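(* Let $n\ge 2$, $s\in(0,1)$, $0<\lambda\le\Lambda<\infty$, let $\Omega\subset\mathbb{R}^n$ be a bounded open set, and let $A_0\in\mathcal M^{\rm sym}(\lambda,\Lambda,\mathbb{R}^n)$. For every $h\in\mathbb N$ let $A_h,A_\infty\in\mathcal M^{\rm sym}(\lambda,\Lambda,\Omega,A_0)$, and let $F_h,F_\infty\colon L^2(\mathbb{R}^n)\to[0,\infty]$ be defined by $F_h(u)=\frac12\int_{\mathbb{R}^n}A_h(x)\nabla^s u(x)\cdot\nabla^s u(x)\,dx$ and $F_\infty(u)=\frac12\int_{\mathbb{R}^n}A_\infty(x)\nabla^s u(x)\cdot\nabla^s u(x)\,dx$ if $u\in H^s_0(\Omega)$, and $F_h(u)=F_\infty(u)=\infty$ if $u\in L^2(\mathbb{R}^n)\setminus H^s_0(\Omega)$. Then $(A_h)_h$ $H$-converges to $A_\infty$ in $H^s_0(\Omega)$ if and only if $(F_h)_h$ $\Gamma$-converges to $F_\infty$ strongly in $L^2(\mathbb{R}^n)$.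
   Context: Fractional gradient: for $\psi\in C_c^\infty(\mathbb{R}^n)$, $\nabla^s\psi(x)=\frac{n-1+s}{\gamma_{1-s}}\int_{\mathbb{R}^n}\frac{(\psi(x)-\psi(y))(x-y)}{|x-y|^{n+s+1}}\,dy$ for all $x\in\mathbb{R}^n$, where $\gamma_\alpha=2^\alpha\pi^{n/2}\,\Gamma(\alpha/2)/\Gamma((n-\alpha)/2)$ for $\alpha\in(0,n)$. Function spaces: for an open set $O\subseteq\mathbb{R}^n$, $H^s_0(O)$ is the Hilbert space obtained as the closure of $C_c^\infty(O)$ with respect to the norm $\|u\|_{H^s(\mathbb{R}^n)}=(\|u\|_{L^2(\mathbb{R}^n)}^2+\|\nabla^s u\|_{L^2(\mathbb{R}^n;\mathbb{R}^n)}^2)^{1/2}$; its elements are functions in $L^2(\mathbb{R}^n)$ (vanishing a.e. outside $O$ when $O=\Omega$), and $\nabla^s$ is extended by continuity to this space. $H^{-s}(O)$ is the dual of $H^s_0(O)$. Matrix classes: for measurable $E\subseteq\mathbb{R}^n$ and $0<\lambda\le\Lambda<\infty$, $\mathcal M(\lambda,\Lambda,E)$ is the set of measurable $A\colon E\to\mathbb{R}^{n\times n}$ such that, for a.e. $x\in E$ and all $\xi\in\mathbb{R}^n$, $A(x)\xi\cdot\xi\ge\lambda|\xi|^2$ and $A(x)\xi\cdot\xi\ge\Lambda^{-1}|A(x)\xi|^2$; $\mathcal M^{\rm sym}(\lambda,\Lambda,E)$ is the subset of those $A$ with $A=A^T$ a.e. in $E$. For $A_0\in\mathcal M^{\rm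 sym}(\lambda,\Lambda,\mathbb{R}^n)$, $\mathcal M^{\rm sym}(\lambda,\Lambda,\Omega,A_0)=\{A\in\mathcal M^{\rm sym}(\lambda,\Lambda,\mathbb{R}^n): A=A_0\text{ a.e. in }\mathbb{R}^n\setminus\Omega\}$. Weak solutions: for $A\in\mathcal M(\lambda,\Lambda,\mathbb{R}^n)$ and $f\in H^{-s}(\Omega)$, the weak solution of $-\mathrm{div}^s(A\nabla^s u)=f$ in $\Omega$, $u=0$ in $\mathbb{R}^n\setminus\Omega$, is the unique $u\in H^s_0(\Omega)$ with $\int_{\mathbb{R}^n}A\nabla^s u\cdot\nabla^s v\,dx=\langle f,v\rangle_{H^{-s}(\Omega)\times H^s_0(\Omega)}$ for all $v\in H^s_0(\Omega)$. Nonlocal $H$-convergence: let $0<\lambda'\le\lambda\le\Lambda\le\Lambda'<\infty$, $(A_h)_h\subset\mathcal M(\lambda,\Lambda,\mathbb{R}^n)$ and $A_\infty\in\mathcal M(\lambda',\Lambda',\mathbb{R}^n)$. One says that $(A_h)_h$ $H$-converges to $A_\infty$ in $H^s_0(\Omega)$ if for all $f\in H^{-s}(\Omega)$, denoting by $u_h$ the weak solution of $-\mathrm{div}^s(A_h\nabla^s u_h)=f$ in $\Omega$, $u_h=0$ in $\mathbb{R}^n\setminus\Omega$, and by $u_\infty$ the weak solution of $-\mathrm{div}^s(A_\infty\nabla^s u_\infty)=f$ in $\Omega$, $u_\infty=0$ in $\mathbb{R}^n\setminus\Omega$, as $h\to\infty$ both $u_h\to u_\infty$ weakly in $H^s_0(\Omega)$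 and $A_h\nabla^s u_h\to A_\infty\nabla^s u_\infty$ weakly in $L^2(\mathbb{R}^n;\mathbb{R}^n)$. $\Gamma$-convergence: for a Banach space $X$ and $E_h,E_\infty\colon X\to[0,\infty]$, $(E_h)_h$ $\Gamma$-converges to $E_\infty$ strongly in $X$ if (i) for every $x\in X$ and every sequence $x_h\to x$ strongly in $X$, $E_\infty(x)\le\liminf_{h\to\infty}E_h(x_h)$; and (ii) for every $x\in X$ there is a sequence $y_h\to x$ strongly in $X$ with $E_\infty(x)\ge\limsup_{h\to\infty}E_h(y_h)$. *)

theory Defs
  imports "HOL-Analysis.Analysis"
begin

text \<open>
  Elements of Lebesgue and Sobolev spaces are represented by functions, without passing to classes
  modulo equality almost everywhere. A space is a set \<open>V\<close> of functions with a seminorm \<open>N\<close>;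
  functions that agree almost everywhere have distance 0. A member of \<open>fdual V N\<close>
  is constrained only on \<open>V\<close>; linearity and boundedness force it to agree on functions of
  \<open>V\<close> at distance 0.
\<close>

definition fconv :: "('a \<Rightarrow> 'b::real_vector) set \<Rightarrow> (('a \<Rightarrow> 'b) \<Rightarrow> real) \<Rightarrow>
    (nat \<Rightarrow> 'a \<Rightarrow> 'b) \<Rightarrow> ('a \<Rightarrow> 'b) \<Rightarrow> bool" where
  "fconv V N u l \<longleftrightarrow> (\<forall>k. u k \<in> V) \<and> l \<in> V \<and> (\<lambda>k. N (\<lambda>x. u k x - l x)) \<longlonglongrightarrow> 0"

definition fdual :: "('a \<Rightarrow> 'b::real_vector) set \<Rightarrow> (('a \<Rightarrow> 'b) \<Rightarrow> real) \<Rightarrow> (('a \<Rightarrow> 'b) \<Rightarrow> real) set" where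
  "fdual V N = {f.
     (\<forall>u\<in>V. \<forall>v\<in>V. f (\<lambda>x. u x + v x) = f u + f v) \<and>
     (\<forall>c. \<forall>u\<in>V. f (\<lambda>x. c *\<^sub>R u x) = c * f u) \<and>
     (\<exists>C. \<forall>u\<in>V. \<bar>f u\<bar> \<le> C * N u)}"

definition fweakconv :: "('a \<Rightarrow> 'b::real_vector) set \<Rightarrow> (('a \<Rightarrow> 'b) \<Rightarrow> real) \<Rightarrow>
    (nat \<Rightarrow> 'a \<Rightarrow> 'b) \<Rightarrow> ('a \<Rightarrow> 'b) \<Rightarrow> bool" where
  "fweakconv V N u l \<longleftrightarrow> (\<forall>k. u k \<in> V) \<and> l \<in> V \<and> (\<forall>f\<in>fdual V N. (\<lambda>k. f (u k)) \<longlonglongrightarrow> f l)"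

definition Gamma_converges :: "('a \<Rightarrow> 'b::real_vector) set \<Rightarrow> (('a \<Rightarrow> 'b) \<Rightarrow> real) \<Rightarrow>
    (nat \<Rightarrow> ('a \<Rightarrow> 'b) \<Rightarrow> ennreal) \<Rightarrow> (('a \<Rightarrow> 'b) \<Rightarrow> ennreal) \<Rightarrow> bool" where
  "Gamma_converges V N E Einf \<longleftrightarrow>
     (\<forall>u\<in>V. \<forall>w. fconv V N w u \<longrightarrow> Einf u \<le> liminf (\<lambda>h. E h (w h))) \<and>
     (\<forall>u\<in>V. \<exists>w. fconv V N w u \<and> limsup (\<lambda>h. E h (w h)) \<le> Einf u)"

definition Ltwo :: "('a::euclidean_space \<Rightarrow> 'b::euclidean_space) set" where
  "Ltwo = {u. u \<in> borel_measurable lebesgue \<and> integrable lebesgue (\<lambda>x. (norm (u x))\<^sup>2)}"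

definition Ltwo_norm :: "('a::euclidean_space \<Rightarrow> 'b::euclidean_space) \<Rightarrow> real" where
  "Ltwo_norm u = sqrt (LINT x|lebesgue. (norm (u x))\<^sup>2)"

primrec Ck :: "nat \<Rightarrow> ('a::euclidean_space \<Rightarrow> real) \<Rightarrow> bool" where
  "Ck 0 f \<longleftrightarrow> continuous_on UNIV f"
| "Ck (Suc k) f \<longleftrightarrow> (\<forall>x. f differentiable (at x)) \<and> (\<forall>v. Ck k (\<lambda>x. frechet_derivative f (at x) v))"

definition Cc_inf :: "'a::euclidean_space set \<Rightarrow> ('a \<Rightarrow> real) set" where
  "Cc_inf U = {f. (\<forall>k. Ck k f) \<and> compact (closure {x. f x \<noteq> 0}) \<and> closure {x. f x \<noteq> 0} \<subseteq> U}"

definition riesz_const :: "real \<Rightarrow> real \<Rightarrow> real" where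
  "riesz_const n \<alpha> = 2 powr \<alpha> * pi powr (n / 2) * Gamma (\<alpha> / 2) / Gamma ((n - \<alpha>) / 2)"

definition frac_grad :: "real \<Rightarrow> (real ^ 'n \<Rightarrow> real) \<Rightarrow> real ^ 'n \<Rightarrow> real ^ 'n" where
  "frac_grad s \<psi> x =
     ((real CARD('n) - 1 + s) / riesz_const (real CARD('n)) (1 - s)) *\<^sub>R
     (LINT y|lebesgue. ((\<psi> x - \<psi> y) / norm (x - y) powr (real CARD('n) + s + 1)) *\<^sub>R (x - y))"

text \<open>
  The closure of \<open>Cc_inf U\<close> in the norm \<open>Hs_norm\<close> below is realised inside \<open>Ltwo\<close>:
  \<open>u\<close> belongs to it, with extended fractional gradient \<open>G\<close>, iff some sequence of
  test functions converges to \<open>u\<close> while their fractional gradients converge to \<open>G\<close>.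
  Such a \<open>G\<close> is determined by \<open>u\<close> up to null sets (the fractional gradient is closable, by
  integration by parts), so the choice in \<open>Hs_grad\<close> is one of a representative.
\<close>

definition has_Hs_grad :: "real \<Rightarrow> (real ^ 'n) set \<Rightarrow> (real ^ 'n \<Rightarrow> real) \<Rightarrow> (real ^ 'n \<Rightarrow> real ^ 'n) \<Rightarrow> bool" where
  "has_Hs_grad s U u G \<longleftrightarrow> (\<exists>\<phi>. (\<forall>k. \<phi> k \<in> Cc_inf U) \<and>
     fconv Ltwo Ltwo_norm \<phi> u \<and> fconv Ltwo Ltwo_norm (\<lambda>k. frac_grad s (\<phi> k)) G)"

definition Hs0 :: "real \<Rightarrow> (real ^ 'n) set \<Rightarrow> (real ^ 'n \<Rightarrow> real) set" where
  "Hs0 s U = {u. \<exists>G. has_Hs_grad s U u G}"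

definition Hs_grad :: "real \<Rightarrow> (real ^ 'n) set \<Rightarrow> (real ^ 'n \<Rightarrow> real) \<Rightarrow> real ^ 'n \<Rightarrow> real ^ 'n" where
  "Hs_grad s U u = (SOME G. has_Hs_grad s U u G)"

definition Hs_norm :: "real \<Rightarrow> (real ^ 'n) set \<Rightarrow> (real ^ 'n \<Rightarrow> real) \<Rightarrow> real" where
  "Hs_norm s U u = sqrt ((Ltwo_norm u)\<^sup>2 + (Ltwo_norm (Hs_grad s U u))\<^sup>2)"

abbreviation Hs_dual :: "real \<Rightarrow> (real ^ 'n) set \<Rightarrow> ((real ^ 'n \<Rightarrow> real) \<Rightarrow> real) set" where
  "Hs_dual s U \<equiv> fdual (Hs0 s U) (Hs_norm s U)"

definition Mclass :: "real \<Rightarrow> real \<Rightarrow> (real ^ 'n) set \<Rightarrow> (real ^ 'n \<Rightarrow> real ^ 'n ^ 'n) set" where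
  "Mclass l L E = {A. A \<in> borel_measurable (lebesgue_on E) \<and>
     (AE x in lebesgue_on E. \<forall>\<xi>. (A x *v \<xi>) \<bullet> \<xi> \<ge> l * (norm \<xi>)\<^sup>2 \<and>
                                (A x *v \<xi>) \<bullet> \<xi> \<ge> inverse L * (norm (A x *v \<xi>))\<^sup>2)}"

definition Msym :: "real \<Rightarrow> real \<Rightarrow> (real ^ 'n) set \<Rightarrow> (real ^ 'n \<Rightarrow> real ^ 'n ^ 'n) set" where
  "Msym l L E = {A \<in> Mclass l L E. AE x in lebesgue_on E. A x = transpose (A x)}"

definition Msym_ext :: "real \<Rightarrow> real \<Rightarrow> (real ^ 'n) set \<Rightarrow> (real ^ 'n \<Rightarrow> real ^ 'n ^ 'n) \<Rightarrow>
    (real ^ 'n \<Rightarrow> real ^ 'n ^ 'n) set" where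
  "Msym_ext l L \<Omega> A0 = {A \<in> Msym l L UNIV. AE x in lebesgue. x \<notin> \<Omega> \<longrightarrow> A x = A0 x}"

definition weak_solution :: "real \<Rightarrow> (real ^ 'n) set \<Rightarrow> (real ^ 'n \<Rightarrow> real ^ 'n ^ 'n) \<Rightarrow>
    ((real ^ 'n \<Rightarrow> real) \<Rightarrow> real) \<Rightarrow> (real ^ 'n \<Rightarrow> real) \<Rightarrow> bool" where
  "weak_solution s \<Omega> A f u \<longleftrightarrow> u \<in> Hs0 s \<Omega> \<and>
     (\<forall>v\<in>Hs0 s \<Omega>. (LINT x|lebesgue. (A x *v Hs_grad s \<Omega> u x) \<bullet> Hs_grad s \<Omega> v x) = f v)"

text \<open>
  For a bounded open \<open>\<Omega>\<close> and coefficients in \<open>Mclass\<close> the weak solution exists and is unique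
  up to null sets (Lax--Milgram), so quantifying over weak solutions amounts to quantifying over
  the representatives of the weak solution.
\<close>

definition H_converges :: "real \<Rightarrow> (real ^ 'n) set \<Rightarrow> (nat \<Rightarrow> real ^ 'n \<Rightarrow> real ^ 'n ^ 'n) \<Rightarrow>
    (real ^ 'n \<Rightarrow> real ^ 'n ^ 'n) \<Rightarrow> bool" where
  "H_converges s \<Omega> A Ainf \<longleftrightarrow>
     (\<forall>f\<in>Hs_dual s \<Omega>. \<forall>u uinf.
        (\<forall>h. weak_solution s \<Omega> (A h) f (u h)) \<and> weak_solution s \<Omega> Ainf f uinf \<longrightarrow>
        fweakconv (Hs0 s \<Omega>) (Hs_norm s \<Omega>) u uinf \<and>
        fweakconv Ltwo Ltwo_norm (\<lambda>h x. A h x *v Hs_grad s \<Omega> (u h) x)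
          (\<lambda>x. Ainf x *v Hs_grad s \<Omega> uinf x))"

definition energy :: "real \<Rightarrow> (real ^ 'n) set \<Rightarrow> (real ^ 'n \<Rightarrow> real ^ 'n ^ 'n) \<Rightarrow>
    (real ^ 'n \<Rightarrow> real) \<Rightarrow> ennreal" where
  "energy s \<Omega> A u =
     (if u \<in> Hs0 s \<Omega>
      then ennreal (1 / 2 * (LINT x|lebesgue. (A x *v Hs_grad s \<Omega> u x) \<bullet> Hs_grad s \<Omega> u x))
      else \<infinity>)"

end

theory Submission imports Defs "HOL-Probability.Probability" "HOL-Library.Diagonal_Subsequence" "HOL-Real_Asymp.Real_Asymp"
begin

text \<open>
  For symmetric coefficients, Gamma-convergence of the energies is equivalent to weak convergence of the
  solutions: a solution minimises the energy minus a linear term, and the fractional Poincare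
  inequality and Rellich compactness supply equicoercivity.

  What remains is that convergence of the solutions forces convergence of the fluxes. Outside \<open>\<Omega>\<close> the
  coefficients do not vary. Inside, let \<open>D\<close> map a field \<open>Y\<close> to the weak limit of its fluxes minus \<open>Ainf Y\<close>.
  A nonlocal div-curl lemma (multiplication by a test function commutes with the gradient up to a compact
  operator) shows that \<open>D\<close> is a local, symmetric, bounded map on all fields obtained from gradients by
  multiplication with smooth functions, while \<open>D\<close> of a gradient is orthogonal to gradients. The gradients of
  \<open>k powr (-s) * \<eta> * sin (k \<xi> \<bullet> x)\<close> and of its cosine companion are, up to \<open>O (k powr (-s))\<close>, plane waves of
  amplitude proportional to \<open>\<eta> \<xi>\<close>, because the symbol of the gradient is homogeneous of degree \<open>s\<close> and parallel to
  \<open>\<xi>\<close>; demodulated, they converge to \<open>\<eta> \<xi>\<close>. Hence the quadratic form of \<open>D\<close> vanishes on \<open>\<eta> \<xi>\<close>,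
  by polarisation \<open>D\<close> vanishes weakly on these fields, and by symmetry everywhere in \<open>\<Omega>\<close>.
\<close>

section \<open>The Hilbert space of square-integrable functions\<close>

text \<open>The obstacle: weak convergence of the solutions fixes the limiting fluxes only against
  gradients, whereas weak convergence in L2 tests against every field. The defect \<open>D\<close>
  is this gap. What closes it is that \<open>D\<close> is local and the gradient is not. Since
  \<open>D\<close> of a gradient is orthogonal to gradients, pairing it with \<open>\<phi>\<close>
  times the gradient of \<open>f\<close> leaves only a commutator, whose size is the L2 norm of
  \<open>f\<close> and not that of its gradient; functions that vanish in L2 while their gradients
  keep a fixed size make this pairing disappear. Such gradients oscillate, so their amplitude has to
  be brought out by multiplication with cosine and sine, which leads outside the gradients. Hence
  defects are followed on the larger class generated by sums and multipliers, as a relation and not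
  as a map: a limiting flux exists at first only along a subsequence, for countably many fields, and
  its uniqueness is what has to be proved. Fourier analysis enters only through squared moduli of
  real integrals weighted by Gaussians, together with a lower bound for the symbol whose sign comes
  from a Laplace transform.\<close>

lemma Ltwo_measurable: "f \<in> Ltwo \<Longrightarrow> f \<in> borel_measurable lebesgue"
  by (simp add: Ltwo_def)

lemma Ltwo_integrable: "f \<in> Ltwo \<Longrightarrow> integrable lebesgue (\<lambda>x. (norm (f x))\<^sup>2)"
  by (simp add: Ltwo_def)

lemma Ltwo_I_bound:
  assumes "f \<in> borel_measurable lebesgue" "integrable lebesgue g" "AE x in lebesgue. (norm (f x))\<^sup>2 \<le> g x"
  shows "f \<in> Ltwo"
  unfolding Ltwo_def
proof (intro CollectI conjI)
  show "integrable lebesgue (\<lambda>x. (norm (f x))\<^sup>2)"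
    by (rule Bochner_Integration.integrable_bound[OF assms(2)]) (use assms in auto)
qed (use assms in auto)

lemma Ltwo_add:
  fixes f g :: "'a::euclidean_space \<Rightarrow> 'b::euclidean_space"
  assumes "f \<in> Ltwo" "g \<in> Ltwo" shows "(\<lambda>x. f x + g x) \<in> Ltwo"
proof (rule Ltwo_I_bound)
  show "integrable lebesgue (\<lambda>x. 2 * (norm (f x))\<^sup>2 + 2 * (norm (g x))\<^sup>2)"
    using assms by (auto simp: Ltwo_def)
  have "(norm (u + v))\<^sup>2 \<le> 2 * (norm u)\<^sup>2 + 2 * (norm v)\<^sup>2" for u v :: 'b
  proof -
    have "0 \<le> (norm (u - v))\<^sup>2" by simp
    thus ?thesis by (simp add: power2_norm_eq_inner inner_simps inner_commute)
  qed
  thus "AE x in lebesgue. (norm (f x + g x))\<^sup>2 \<le> 2 * (norm (f x))\<^sup>2 + 2 * (norm (g x))\<^sup>2" by simp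
qed (use assms in \<open>auto simp: Ltwo_def\<close>)

lemma Ltwo_scaleR: "f \<in> Ltwo \<Longrightarrow> (\<lambda>x. c *\<^sub>R f x) \<in> Ltwo"
  by (auto simp: Ltwo_def power_mult_distrib)

lemma Ltwo_minus: "f \<in> Ltwo \<Longrightarrow> g \<in> Ltwo \<Longrightarrow> (\<lambda>x. f x - g x) \<in> Ltwo"
  using Ltwo_add[of f "\<lambda>x. (-1) *\<^sub>R g x"] Ltwo_scaleR[of g "-1"] by simp

lemma Ltwo_zero: "(\<lambda>x. 0) \<in> Ltwo"
  by (auto simp: Ltwo_def)

lemma Ltwo_inner_integrable:
  assumes "f \<in> Ltwo" "g \<in> Ltwo" shows "integrable lebesgue (\<lambda>x. f x \<bullet> g x)"
proof (rule Bochner_Integration.integrable_bound)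
  show "integrable lebesgue (\<lambda>x. (norm (f x))\<^sup>2 + (norm (g x))\<^sup>2)"
    using assms by (auto simp: Ltwo_def)
  have "\<bar>u \<bullet> v\<bar> \<le> (norm u)\<^sup>2 + (norm v)\<^sup>2" for u v :: 'b
  proof -
    have "2 * (norm u * norm v) \<le> (norm u)\<^sup>2 + (norm v)\<^sup>2"
      using sum_squares_bound[of "norm u" "norm v"] by simp
    thus ?thesis using Cauchy_Schwarz_ineq2[of u v] mult_nonneg_nonneg[of "norm u" "norm v"] by simp
  qed
  thus "AE x in lebesgue. norm (f x \<bullet> g x) \<le> norm ((norm (f x))\<^sup>2 + (norm (g x))\<^sup>2)" by simp
  show "(\<lambda>x. f x \<bullet> g x) \<in> borel_measurable lebesgue"
    using assms by (auto simp: Ltwo_def)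
qed

lemma Ltwo_bounded_scale:
  fixes f :: "'a::euclidean_space \<Rightarrow> 'b::euclidean_space"
  assumes "f \<in> Ltwo" "c \<in> borel_measurable lebesgue" "\<And>x. \<bar>c x\<bar> \<le> B"
  shows "(\<lambda>x. c x *\<^sub>R f x) \<in> Ltwo"
proof (rule Ltwo_I_bound)
  show "integrable lebesgue (\<lambda>x. B\<^sup>2 * (norm (f x))\<^sup>2)" using assms by (auto simp: Ltwo_def)
  have "\<bar>c x\<bar>\<^sup>2 \<le> B\<^sup>2" for x using assms(3)[of x] by (intro power_mono) auto
  thus "AE x in lebesgue. (norm (c x *\<^sub>R f x))\<^sup>2 \<le> B\<^sup>2 * (norm (f x))\<^sup>2"
    by (auto simp: power_mult_distrib intro!: mult_right_mono)
qed (use assms in \<open>auto simp: Ltwo_def\<close>)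

\<comment> \<open>The statement of the theorem uses representatives. A type of classes makes L2 a
  complete inner product space in the sense of the type classes, so that Hilbert space arguments are
  carried out once and serve scalar fields, vector fields and pairs of both.\<close>
quotient_type (overloaded) ('a, 'b) L2 = "'a::euclidean_space \<Rightarrow> 'b::euclidean_space" / partial:
  "\<lambda>f g. f \<in> Ltwo \<and> g \<in> Ltwo \<and> (AE x in lebesgue. f x = g x)"
  morphisms rep_L2 cls
proof (rule part_equivpI)
  show "\<exists>f::'a\<Rightarrow>'b. f \<in> Ltwo \<and> f \<in> Ltwo \<and> (AE x in lebesgue. f x = f x)"
    by (rule exI[of _ "\<lambda>x. 0"]) (simp add: Ltwo_zero)
  show "symp (\<lambda>f g::'a\<Rightarrow>'b. f \<in> Ltwo \<and> g \<in> Ltwo \<and> (AE x in lebesgue. f x = g x))"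
    by (auto intro!: sympI elim: AE_mp)
  show "transp (\<lambda>f g::'a\<Rightarrow>'b. f \<in> Ltwo \<and> g \<in> Ltwo \<and> (AE x in lebesgue. f x = g x))"
    by (intro transpI conjI; (elim conjE)?, auto elim: AE_mp)
qed

lemma cls_eq_iff:
  assumes "f \<in> Ltwo" "g \<in> Ltwo"
  shows "cls f = cls g \<longleftrightarrow> (AE x in lebesgue. f x = g x)"
  using assms Quotient_rel[OF Quotient_L2, of f g] by auto

lemma cls_cases: obtains f where "f \<in> Ltwo" "X = cls f"
proof -
  have "rep_L2 X \<in> Ltwo" using Quotient_rep_reflp[OF Quotient_L2, of X] by simp
  moreover have "cls (rep_L2 X) = X" by (rule Quotient_abs_rep[OF Quotient_L2])
  ultimately show ?thesis using that by metis
qed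

lemma rep_L2_Ltwo: "rep_L2 X \<in> Ltwo"
  using Quotient_rep_reflp[OF Quotient_L2, of X] by simp

lemma cls_rep: "cls (rep_L2 X) = X"
  by (rule Quotient_abs_rep[OF Quotient_L2])

lemma rep_cls_AE: "f \<in> Ltwo \<Longrightarrow> AE x in lebesgue. rep_L2 (cls f) x = f x"
  using cls_eq_iff[of "rep_L2 (cls f)" f] cls_rep rep_L2_Ltwo by blast

instantiation L2 :: (euclidean_space, euclidean_space) real_inner
begin

lift_definition zero_L2 :: "('a,'b) L2" is "\<lambda>x. 0" by (simp add: Ltwo_zero)
lift_definition plus_L2 :: "('a,'b) L2 \<Rightarrow> ('a,'b) L2 \<Rightarrow> ('a,'b) L2" is "\<lambda>f g x. f x + g x"
  by (auto intro: Ltwo_add elim: AE_mp)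
lift_definition minus_L2 :: "('a,'b) L2 \<Rightarrow> ('a,'b) L2 \<Rightarrow> ('a,'b) L2" is "\<lambda>f g x. f x - g x"
  by (auto intro: Ltwo_minus elim: AE_mp)
lift_definition uminus_L2 :: "('a,'b) L2 \<Rightarrow> ('a,'b) L2" is "\<lambda>f x. - f x"
  using Ltwo_scaleR[of _ "-1"] by (fastforce elim: AE_mp)
lift_definition scaleR_L2 :: "real \<Rightarrow> ('a,'b) L2 \<Rightarrow> ('a,'b) L2" is "\<lambda>c f x. c *\<^sub>R f x"
  by (auto intro: Ltwo_scaleR elim: AE_mp)
lift_definition inner_L2 :: "('a,'b) L2 \<Rightarrow> ('a,'b) L2 \<Rightarrow> real" is "\<lambda>f g. LINT x|lebesgue. f x \<bullet> g x"
proof -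
  fix f f' g g' :: "'a \<Rightarrow> 'b"
  assume "f \<in> Ltwo \<and> f' \<in> Ltwo \<and> (AE x in lebesgue. f x = f' x)" "g \<in> Ltwo \<and> g' \<in> Ltwo \<and> (AE x in lebesgue. g x = g' x)"
  thus "(LINT x|lebesgue. f x \<bullet> g x) = (LINT x|lebesgue. f' x \<bullet> g' x)"
    by (intro integral_cong_AE) (auto intro!: borel_measurable_integrable[OF Ltwo_inner_integrable] elim: AE_mp)
qed

definition norm_L2 :: "('a,'b) L2 \<Rightarrow> real" where "norm_L2 X = sqrt (X \<bullet> X)"
definition sgn_L2 :: "('a,'b) L2 \<Rightarrow> ('a,'b) L2" where "sgn_L2 X = inverse (norm X) *\<^sub>R X"
definition dist_L2 :: "('a,'b) L2 \<Rightarrow> ('a,'b) L2 \<Rightarrow> real" where "dist_L2 X Y = norm (X - Y)"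
definition uniformity_L2 :: "(('a,'b) L2 \<times> ('a,'b) L2) filter"
  where "uniformity_L2 = (INF e\<in>{0 <..}. principal {(x, y). dist x y < e})"
definition open_L2 :: "('a,'b) L2 set \<Rightarrow> bool"
  where "open_L2 U = (\<forall>x\<in>U. eventually (\<lambda>(x', y). x' = x \<longrightarrow> y \<in> U) uniformity)"

instance
proof
  fix X Y Z :: "('a,'b) L2" and a b :: real
  show "X + Y + Z = X + (Y + Z)"
    by transfer (auto intro!: Ltwo_add simp: add.assoc)
  show "X + Y = Y + X" by transfer (auto intro!: Ltwo_add simp: add.commute)
  show "0 + X = X" by transfer auto
  show "- X + X = 0" by transfer (auto simp: Ltwo_zero)
  show "X - Y = X + - Y"
    by transfer (auto intro!: Ltwo_minus)
  show "a *\<^sub>R (X + Y) = a *\<^sub>R X + a *\<^sub>R Y"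
    by transfer (auto intro!: Ltwo_add Ltwo_scaleR simp: scaleR_add_right)
  show "(a + b) *\<^sub>R X = a *\<^sub>R X + b *\<^sub>R X"
    by transfer (auto intro!: Ltwo_add Ltwo_scaleR simp: scaleR_add_left)
  show "a *\<^sub>R b *\<^sub>R X = (a * b) *\<^sub>R X"
    by transfer (auto intro!: Ltwo_scaleR)
  show "1 *\<^sub>R X = X" by transfer auto
  show "X \<bullet> Y = Y \<bullet> X" by transfer (simp add: inner_commute)
  show "(X + Y) \<bullet> Z = X \<bullet> Z + Y \<bullet> Z"
    by transfer (simp add: inner_add_left Bochner_Integration.integral_add Ltwo_inner_integrable)
  show "(a *\<^sub>R X) \<bullet> Y = a * (X \<bullet> Y)" by transfer simp
  show "0 \<le> X \<bullet> X" by transfer simp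
  show "(X \<bullet> X = 0) = (X = 0)"
  proof transfer
    fix f :: "'a \<Rightarrow> 'b" assume f: "f \<in> Ltwo \<and> f \<in> Ltwo \<and> (AE x in lebesgue. f x = f x)"
    hence "(LINT x|lebesgue. f x \<bullet> f x) = 0 \<longleftrightarrow> (AE x in lebesgue. f x \<bullet> f x = 0)"
      by (intro integral_nonneg_eq_0_iff_AE) (auto simp: Ltwo_inner_integrable)
    thus "((LINT x|lebesgue. f x \<bullet> f x) = 0) = (f \<in> Ltwo \<and> (\<lambda>x. 0) \<in> Ltwo \<and> (AE x in lebesgue. f x = 0))"
      using f by (simp add: Ltwo_zero)
  qed
  show "norm X = sqrt (X \<bullet> X)" by (rule norm_L2_def)
qed (rule sgn_L2_def dist_L2_def uniformity_L2_def open_L2_def)+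

end

lemma cls_zero: "cls (\<lambda>x. 0) = 0" by (simp add: zero_L2_def)

lemma cls_add:
  assumes "f \<in> Ltwo" "g \<in> Ltwo" shows "cls (\<lambda>x. f x + g x) = cls f + cls g"
  using plus_L2.abs_eq[of f g] assms by simp

lemma cls_minus:
  assumes "f \<in> Ltwo" "g \<in> Ltwo" shows "cls (\<lambda>x. f x - g x) = cls f - cls g"
  using minus_L2.abs_eq[of f g] assms by simp

lemma cls_scaleR:
  assumes "f \<in> Ltwo" shows "cls (\<lambda>x. c *\<^sub>R f x) = c *\<^sub>R cls f"
  using scaleR_L2.abs_eq[of f c] assms by simp

lemma inner_cls:
  assumes "f \<in> Ltwo" "g \<in> Ltwo" shows "cls f \<bullet> cls g = (LINT x|lebesgue. f x \<bullet> g x)"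
  using inner_L2.abs_eq[of f g] assms by simp

lemma norm_cls:
  assumes "f \<in> Ltwo" shows "norm (cls f) = Ltwo_norm f"
  using assms by (simp add: norm_eq_sqrt_inner inner_cls Ltwo_norm_def power2_norm_eq_inner)

lemma norm_cls_sq:
  assumes "f \<in> Ltwo" shows "(norm (cls f))\<^sup>2 = (LINT x|lebesgue. (norm (f x))\<^sup>2)"
  using assms by (simp add: power2_norm_eq_inner inner_cls)

lemma fconv_Ltwo_iff:
  "fconv Ltwo Ltwo_norm u l \<longleftrightarrow> (\<forall>k. u k \<in> Ltwo) \<and> l \<in> Ltwo \<and> (\<lambda>k. cls (u k)) \<longlonglongrightarrow> cls l"
proof -
  have "((\<lambda>k. Ltwo_norm (\<lambda>x. u k x - l x)) \<longlonglongrightarrow> 0) \<longleftrightarrow> (\<lambda>k. cls (u k)) \<longlonglongrightarrow> cls l"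
    if "\<forall>k. u k \<in> Ltwo" "l \<in> Ltwo"
  proof -
    have "Ltwo_norm (\<lambda>x. u k x - l x) = norm (cls (u k) - cls l)" for k
      using that norm_cls[of "\<lambda>x. u k x - l x"] Ltwo_minus[of "u k" l] by (simp add: cls_minus)
    thus ?thesis
      by (simp add: tendsto_norm_zero_iff LIM_zero_iff)
  qed
  thus ?thesis unfolding fconv_def by auto
qed

text \<open>The squared increments have integrals at most \<open>(1/4)^k\<close>, so even with
  weights \<open>2^k\<close> their sum is integrable. Where that sum is finite, the increments are
  dominated by the geometric series \<open>C * (1 / sqrt 2)^k\<close>.\<close>

lemma L2_rapid_Cauchy_converges_AE:
  fixes f :: "nat \<Rightarrow> 'a::euclidean_space \<Rightarrow> 'b::euclidean_space"
  assumes f: "\<And>k. f k \<in> Ltwo" and d: "\<And>k. norm (cls (f (Suc k)) - cls (f k)) \<le> (1/2)^k"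
  shows "AE x in lebesgue. convergent (\<lambda>k. f k x)"
proof -
  have [measurable]: "f k \<in> borel_measurable lebesgue" for k using f Ltwo_measurable by auto
  define a where "a = (\<lambda>k x. (norm (f (Suc k) x - f k x))\<^sup>2)"
  have am [measurable]: "a k \<in> borel_measurable lebesgue" for k
    unfolding a_def by measurable
  have ai: "integrable lebesgue (a k)" for k
    using Ltwo_integrable[OF Ltwo_minus[OF f f]] by (simp add: a_def)
  have "(LINT x|lebesgue. a k x) \<le> (1/4)^k" for k
  proof -
    have "(LINT x|lebesgue. a k x) = (norm (cls (f (Suc k)) - cls (f k)))\<^sup>2"
      using norm_cls_sq[OF Ltwo_minus[OF f[of "Suc k"] f[of k]]] by (simp add: a_def cls_minus f)
    also have "\<dots> \<le> ((1/2)^k)\<^sup>2" using d by (intro power_mono) auto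
    also have "\<dots> = (1/4)^k" by (simp add: power2_eq_square flip: power_mult_distrib)
    finally show ?thesis .
  qed
  hence nn: "(\<integral>\<^sup>+x. ennreal (2^k * a k x) \<partial>lebesgue) \<le> ennreal ((1/2)^k)" for k
  proof -
    have "(\<integral>\<^sup>+x. ennreal (2^k * a k x) \<partial>lebesgue) = ennreal (LINT x|lebesgue. 2^k * a k x)"
    proof (rule nn_integral_eq_integral)
      show "integrable lebesgue (\<lambda>x. 2^k * a k x)" by (intro integrable_mult_right ai)
      show "AE x in lebesgue. 0 \<le> 2^k * a k x" unfolding a_def by (intro always_eventually allI) simp
    qed
    also have "\<dots> \<le> ennreal (2^k * (1/4)^k)"
      using \<open>(LINT x|lebesgue. a k x) \<le> (1/4)^k\<close> by (intro ennreal_leI) simp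
    also have "2^k * (1/4)^k = ((1/2)^k::real)" by (simp flip: power_mult_distrib)
    finally show ?thesis .
  qed
  have "(\<integral>\<^sup>+x. (\<Sum>k. ennreal (2^k * a k x)) \<partial>lebesgue) = (\<Sum>k. \<integral>\<^sup>+x. ennreal (2^k * a k x) \<partial>lebesgue)"
    by (rule nn_integral_suminf) auto
  also have "\<dots> \<le> (\<Sum>k. ennreal ((1/2)^k))"
    by (intro suminf_le nn) auto
  also have "\<dots> < \<infinity>"
    by (simp add: suminf_ennreal2 summable_geometric less_top[symmetric])
  finally have "AE x in lebesgue. (\<Sum>k. ennreal (2^k * a k x)) \<noteq> \<infinity>"
    by (intro nn_integral_PInf_AE) auto
  thus ?thesis
  proof eventually_elim
    case (elim x)
    have sm: "summable (\<lambda>k. 2^k * a k x)"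
      by (rule summable_suminf_not_top) (use elim in \<open>auto simp: a_def\<close>)
    define C where "C = sqrt (\<Sum>k. 2^k * a k x)"
    have "norm (f (Suc k) x - f k x) \<le> C * (1 / sqrt 2)^k" for k
    proof -
      have "2^k * a k x \<le> (\<Sum>k. 2^k * a k x)"
        using sum_le_suminf[OF sm, of "{k}"] by (auto simp: a_def)
      hence "sqrt (2^k * a k x) \<le> C" unfolding C_def by simp
      hence "sqrt 2^k * norm (f (Suc k) x - f k x) \<le> C"
        by (simp add: a_def real_sqrt_mult real_sqrt_power)
      thus ?thesis by (simp add: field_simps)
    qed
    moreover have "summable (\<lambda>k. C * (1 / sqrt 2)^k)"
      by (intro summable_mult summable_geometric) simp
    ultimately have "summable (\<lambda>k. f (Suc k) x - f k x)"
      by (rule summable_comparison_test'[of "\<lambda>k. C * (1 / sqrt 2)^k" 0, rotated])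
    hence "convergent (\<lambda>n. \<Sum>k<n. f (Suc k) x - f k x)"
      by (simp add: summable_iff_convergent)
    hence "convergent (\<lambda>n. f n x - f 0 x)"
      using sum_lessThan_telescope[of "\<lambda>k. f k x"] by simp
    thus "convergent (\<lambda>n. f n x)"
      using convergent_add_const_iff[of "- f 0 x" "\<lambda>n. f n x"] by (simp add: add.commute)
  qed
qed

text \<open>Riesz-Fischer: a rapidly convergent subsequence has an almost everywhere limit, and
  Fatou's lemma turns the Cauchy estimates into distances to it.\<close>

instance L2 :: (euclidean_space, euclidean_space) complete_space
proof
  fix X :: "nat \<Rightarrow> ('a,'b) L2" assume X: "Cauchy X"
  have "\<exists>N. \<forall>m\<ge>N. \<forall>n\<ge>N. norm (X m - X n) < (1/2)^k" for k :: nat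
    using X by (auto simp: Cauchy_def dist_norm)
  then obtain N where N: "\<And>k m n. m \<ge> N k \<Longrightarrow> n \<ge> N k \<Longrightarrow> norm (X m - X n) < (1/2)^k"
    by metis
  \<comment> \<open>The maximum yields \<open>r k >= N k\<close> and \<open>r (Suc k) >= N k\<close>
    together, as the estimate for consecutive members requires.\<close>
  define r where "r = (\<lambda>k. Max (N ` {..k}))"
  have rN: "r k \<ge> N k" for k by (simp add: r_def)
  have rm: "r (Suc k) \<ge> N k" for k by (simp add: r_def Max_ge_iff)
  define f where "f = (\<lambda>n. rep_L2 (X n))"
  have f: "f n \<in> Ltwo" "cls (f n) = X n" for n by (auto simp: f_def rep_L2_Ltwo cls_rep)
  have fm [measurable]: "f n \<in> borel_measurable lebesgue" for n using f Ltwo_measurable by auto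
  have cv: "AE x in lebesgue. convergent (\<lambda>k. f (r k) x)"
  proof (rule L2_rapid_Cauchy_converges_AE)
    show "norm (cls (f (r (Suc k))) - cls (f (r k))) \<le> (1/2)^k" for k
      using N[OF rm[of k] rN[of k]] by (simp add: f)
  qed (simp add: f)
  define g where "g = (\<lambda>x. lim (\<lambda>k. f (r k) x))"
  have gm [measurable]: "g \<in> borel_measurable lebesgue"
    unfolding g_def by (rule borel_measurable_lim_metric) simp
  have fg: "AE x in lebesgue. (\<lambda>k. f (r k) x) \<longlonglongrightarrow> g x"
    using cv by eventually_elim (simp add: g_def convergent_LIMSEQ_iff)
  \<comment> \<open>Fatou along the subsequence bounds the distance of every late \<open>f n\<close>
    to \<open>g\<close>, so the full sequence converges.\<close>
  have fatou: "(\<integral>\<^sup>+x. ennreal ((norm (f n x - g x))\<^sup>2) \<partial>lebesgue) \<le> ennreal (((1/2)^j)\<^sup>2)" if n: "n \<ge> N j" for n j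
  proof -
    have "(\<integral>\<^sup>+x. ennreal ((norm (f n x - g x))\<^sup>2) \<partial>lebesgue)
        = (\<integral>\<^sup>+x. liminf (\<lambda>k. ennreal ((norm (f n x - f (r k) x))\<^sup>2)) \<partial>lebesgue)"
    proof (rule nn_integral_cong_AE)
      show "AE x in lebesgue. ennreal ((norm (f n x - g x))\<^sup>2) = liminf (\<lambda>k. ennreal ((norm (f n x - f (r k) x))\<^sup>2))"
        using fg
      proof eventually_elim
        case (elim x)
        have "(\<lambda>k. ennreal ((norm (f n x - f (r k) x))\<^sup>2)) \<longlonglongrightarrow> ennreal ((norm (f n x - g x))\<^sup>2)"
          by (intro tendsto_intros elim)
        thus ?case by (intro lim_imp_Liminf[symmetric]) auto
      qed
    qed
    also have "\<dots> \<le> liminf (\<lambda>k. \<integral>\<^sup>+x. ennreal ((norm (f n x - f (r k) x))\<^sup>2) \<partial>lebesgue)"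
      by (rule nn_integral_liminf) measurable
    also have "\<dots> \<le> ennreal (((1/2)^j)\<^sup>2)"
    proof (rule Liminf_le, simp)
      have "eventually (\<lambda>k. k \<ge> j) sequentially" by (rule eventually_ge_at_top)
      thus "eventually (\<lambda>k. (\<integral>\<^sup>+x. ennreal ((norm (f n x - f (r k) x))\<^sup>2) \<partial>lebesgue) \<le> ennreal (((1/2)^j)\<^sup>2)) sequentially"
      proof eventually_elim
        case (elim k)
        have "r k \<ge> N j" using elim by (force simp: r_def Max_ge_iff)
        hence *: "norm (X n - X (r k)) < (1/2)^j" using N n by blast
        have "(\<integral>\<^sup>+x. ennreal ((norm (f n x - f (r k) x))\<^sup>2) \<partial>lebesgue) = ennreal (LINT x|lebesgue. (norm (f n x - f (r k) x))\<^sup>2)"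
          by (rule nn_integral_eq_integral) (auto intro!: Ltwo_integrable Ltwo_minus f)
        also have "(LINT x|lebesgue. (norm (f n x - f (r k) x))\<^sup>2) = (norm (X n - X (r k)))\<^sup>2"
          using norm_cls_sq[OF Ltwo_minus[OF f(1)[of n] f(1)[of "r k"]]] by (simp add: cls_minus f)
        also have "\<dots> \<le> ((1/2)^j)\<^sup>2" using * by (intro power_mono) auto
        finally show ?case by (simp add: ennreal_leI)
      qed
    qed
    finally show ?thesis .
  qed
  have diff: "(\<lambda>x. f n x - g x) \<in> Ltwo" if "n \<ge> N j" for n j
    unfolding Ltwo_def
  proof (intro CollectI conjI)
    have "(\<integral>\<^sup>+x. ennreal ((norm (f n x - g x))\<^sup>2) \<partial>lebesgue) < \<infinity>"
      using fatou[OF that] by (rule le_less_trans) (simp add: less_top[symmetric])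
    thus "integrable lebesgue (\<lambda>x. (norm (f n x - g x))\<^sup>2)"
      by (intro integrableI_nonneg) auto
  qed measurable
  have g: "g \<in> Ltwo"
    using Ltwo_minus[OF f(1)[of "N 0"] diff[of 0 "N 0"]] by simp
  have bd: "norm (X n - cls g) \<le> (1/2)^j" if "n \<ge> N j" for n j
  proof -
    have "ennreal ((norm (X n - cls g))\<^sup>2) = ennreal (LINT x|lebesgue. (norm (f n x - g x))\<^sup>2)"
      using norm_cls_sq[OF diff[OF that]] by (simp add: cls_minus f g)
    also have "\<dots> = (\<integral>\<^sup>+x. ennreal ((norm (f n x - g x))\<^sup>2) \<partial>lebesgue)"
      by (rule nn_integral_eq_integral[symmetric]) (auto intro!: Ltwo_integrable diff[OF that])
    also note fatou[OF that]
    finally have "(norm (X n - cls g))\<^sup>2 \<le> ((1/2)^j)\<^sup>2" by simp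
    thus ?thesis by (rule power2_le_imp_le) simp
  qed
  have "X \<longlonglongrightarrow> cls g"
  proof (rule metric_LIMSEQ_I)
    fix e :: real assume "e > 0"
    then obtain j where "(1/2)^j < e" using real_arch_pow_inv[of e "1/2"] by auto
    thus "\<exists>no. \<forall>n\<ge>no. dist (X n) (cls g) < e"
      using bd[of j] by (force simp: dist_norm)
  qed
  thus "convergent X" by (rule convergentI)
qed

section \<open>Weak convergence and Gamma-convergence of quadratic forms\<close>

lemma linear_coefficient_zero:
  fixes b c :: real
  assumes "\<And>t. 0 \<le> t * b + t\<^sup>2 * c"
  shows "b = 0"
proof -
  have c: "c \<ge> 0" using assms[of 1] assms[of "-1"] by simp
  \<comment> \<open>This \<open>t\<close> makes the quadratic equal to minus a square; the summand 1
    keeps the denominator positive when \<open>c = 0\<close>.\<close>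
  have "0 \<le> (- b / (c + 1)) * b + (- b / (c + 1))\<^sup>2 * c" by (rule assms)
  also have "\<dots> = - (b / (c + 1))\<^sup>2"
    using c by (simp add: divide_simps power2_eq_square) (simp add: algebra_simps)
  finally have "b / (c + 1) = 0" by simp
  thus ?thesis using c by auto
qed

text \<open>Direct method: minimise \<open>a v v / 2 - f v\<close> over \<open>K\<close>. The
  parallelogram identity makes a minimising sequence Cauchy, and the vanishing first variation at
  its limit is the claimed equation.\<close>

lemma coercive_form_represents:
  fixes a :: "'h::{real_inner,complete_space} \<Rightarrow> 'h \<Rightarrow> real"
  assumes K: "subspace K" "closed K"
    and a: "bounded_bilinear a" and sym: "\<And>u v. a u v = a v u"
    and l: "l > 0" and co: "\<And>u. u \<in> K \<Longrightarrow> l * (norm u)\<^sup>2 \<le> a u u"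
    and fa: "\<And>u v. u \<in> K \<Longrightarrow> v \<in> K \<Longrightarrow> f (u + v) = f u + f v"
    and fs: "\<And>c u. u \<in> K \<Longrightarrow> f (c *\<^sub>R u) = c * f u"
    and fb: "\<And>u. u \<in> K \<Longrightarrow> \<bar>f u\<bar> \<le> C * norm u"
  shows "\<exists>u\<in>K. \<forall>v\<in>K. a u v = f v"
proof -
  interpret a: bounded_bilinear a by (rule a)
  define J where "J = (\<lambda>v. a v v / 2 - f v)"
  \<comment> \<open>Completing the square in \<open>norm v\<close>.\<close>
  have lower: "J v \<ge> - C\<^sup>2 / (2 * l)" if "v \<in> K" for v
  proof -
    have "J v \<ge> l * (norm v)\<^sup>2 / 2 - C * norm v" using co[OF that] fb[OF that] by (simp add: J_def)
    moreover have "l * (norm v)\<^sup>2 / 2 - C * norm v + C\<^sup>2 / (2 * l) = (l * norm v - C)\<^sup>2 / (2 * l)"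
      using l by (simp add: field_simps power2_eq_square)
    moreover have "(l * norm v - C)\<^sup>2 / (2 * l) \<ge> 0" using l by simp
    ultimately show ?thesis by linarith
  qed
  define m where "m = Inf (J ` K)"
  have bdd: "bdd_below (J ` K)" by (rule bdd_belowI2[of _ "- C\<^sup>2 / (2 * l)"]) (rule lower)
  have K0: "0 \<in> K" by (rule subspace_0[OF K(1)])
  have mle: "m \<le> J v" if "v \<in> K" for v unfolding m_def by (rule cINF_lower[OF bdd that])
  have "\<exists>v\<in>K. J v < m + 1 / Suc n" for n
  proof -
    have "Inf (J ` K) < m + 1 / Suc n" by (simp add: m_def)
    thus ?thesis using K0 by (subst (asm) cINF_less_iff[OF _ bdd]) auto
  qed
  then obtain w where w: "\<And>n. w n \<in> K" "\<And>n. J (w n) < m + 1 / Suc n" by metis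
  have par: "l / 4 * (norm (w i - w j))\<^sup>2 \<le> 1 / Suc i + 1 / Suc j" for i j
  proof -
    define h where "h = (1/2) *\<^sub>R (w i + w j)"
    have h: "h \<in> K" unfolding h_def using w K(1) by (simp add: subspace_add subspace_scale)
    have d: "w i - w j \<in> K" using w K(1) by (simp add: subspace_diff)
    have "f h = (f (w i) + f (w j)) / 2"
      unfolding h_def using w K(1) by (subst fs) (auto simp: fa subspace_add)
    moreover have "a h h = (a (w i) (w i) + 2 * a (w i) (w j) + a (w j) (w j)) / 4"
      unfolding h_def by (simp add: a.scaleR_left a.scaleR_right a.add_left a.add_right sym[of "w j" "w i"] add_divide_distrib)
    moreover have "a (w i - w j) (w i - w j) = a (w i) (w i) - 2 * a (w i) (w j) + a (w j) (w j)"
      by (simp add: a.diff_left a.diff_right sym[of "w j" "w i"])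
    ultimately have "a (w i - w j) (w i - w j) / 4 = J (w i) + J (w j) - 2 * J h"
      by (simp add: J_def field_simps)
    also have "\<dots> \<le> 1 / Suc i + 1 / Suc j" using w(2)[of i] w(2)[of j] mle[OF h] by linarith
    finally show ?thesis using co[OF d] by simp
  qed
  have "Cauchy w"
  proof (rule CauchyI)
    fix e :: real assume e: "e > 0"
    obtain N where N: "8 / (l * e\<^sup>2) < real N" using reals_Archimedean2 by blast
    have "norm (w i - w j) < e" if "i \<ge> N" "j \<ge> N" for i j
    proof (rule power2_less_imp_less)
      have "1 / real (Suc i) \<le> 1 / Suc N" "1 / real (Suc j) \<le> 1 / Suc N" using that by (auto simp: frac_le)
      hence "l / 4 * (norm (w i - w j))\<^sup>2 \<le> 2 / Suc N" using par[of i j] by simp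
      moreover have "2 / Suc N < l * e\<^sup>2 / 4"
      proof -
        have "8 < l * e\<^sup>2 * real N" using N l e by (simp add: field_simps)
        also have "\<dots> \<le> l * e\<^sup>2 * Suc N" using l by (intro mult_left_mono) auto
        finally show ?thesis by (simp add: field_simps)
      qed
      ultimately have "l / 4 * (norm (w i - w j))\<^sup>2 < l / 4 * e\<^sup>2" by simp
      thus "(norm (w i - w j))\<^sup>2 < e\<^sup>2" using l by simp
    qed (use e in simp)
    thus "\<exists>M. \<forall>m\<ge>M. \<forall>n\<ge>M. norm (w m - w n) < e" by blast
  qed
  then obtain u where u: "w \<longlonglongrightarrow> u" using Cauchy_convergent_iff convergent_def by blast
  have uK: "u \<in> K" by (rule closed_sequentially[OF K(2) _ u]) (rule w)
  show ?thesis
  proof (intro bexI[OF _ uK] ballI)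
    fix v assume v: "v \<in> K"
    \<comment> \<open>Inherited from the almost minimality of \<open>w n\<close>, whose error
      \<open>1 / Suc n\<close> disappears in the limit.\<close>
    have "0 \<le> t * (a u v - f v) + t\<^sup>2 * (a v v / 2)" for t
    proof (rule LIMSEQ_le)
      show "(\<lambda>n. - (1 / real (Suc n))) \<longlonglongrightarrow> 0"
        using tendsto_minus[OF LIMSEQ_Suc[OF lim_1_over_n]] by simp
      show "(\<lambda>n. t * (a (w n) v - f v) + t\<^sup>2 * (a v v / 2)) \<longlonglongrightarrow> t * (a u v - f v) + t\<^sup>2 * (a v v / 2)"
        by (intro tendsto_intros a.tendsto u)
      show "\<exists>N. \<forall>n\<ge>N. - (1 / real (Suc n)) \<le> t * (a (w n) v - f v) + t\<^sup>2 * (a v v / 2)"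
      proof (intro exI allI impI)
        fix n
        have "w n + t *\<^sub>R v \<in> K" using w v K(1) by (simp add: subspace_add subspace_scale)
        hence "m \<le> J (w n + t *\<^sub>R v)" by (rule mle)
        also have "J (w n + t *\<^sub>R v) = J (w n) + (t * (a (w n) v - f v) + t\<^sup>2 * (a v v / 2))"
          unfolding J_def using w v K(1)
          by (simp add: fa fs subspace_scale a.add_left a.add_right a.scaleR_left a.scaleR_right sym[of v "w n"]
              field_simps power2_eq_square)
        finally show "- (1 / real (Suc n)) \<le> t * (a (w n) v - f v) + t\<^sup>2 * (a v v / 2)"
          using w(2)[of n] by linarith
      qed
    qed
    thus "a u v = f v" using linear_coefficient_zero by fastforce
  qed
qed

lemma riesz_representation:
  fixes f :: "'h::{real_inner,complete_space} \<Rightarrow> real"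
  assumes "subspace K" "closed K"
    and "\<And>u v. u \<in> K \<Longrightarrow> v \<in> K \<Longrightarrow> f (u + v) = f u + f v"
    and "\<And>c u. u \<in> K \<Longrightarrow> f (c *\<^sub>R u) = c * f u"
    and "\<And>u. u \<in> K \<Longrightarrow> \<bar>f u\<bar> \<le> C * norm u"
  shows "\<exists>u\<in>K. \<forall>v\<in>K. u \<bullet> v = f v"
  by (rule coercive_form_represents[OF assms(1,2) bounded_bilinear_inner inner_commute zero_less_one _ assms(3-5)])
     (auto simp: power2_norm_eq_inner)

lemma closed_subspace_projection:
  fixes K :: "'h::{real_inner,complete_space} set"
  assumes "subspace K" "closed K"
  obtains p where "p \<in> K" "\<And>v. v \<in> K \<Longrightarrow> (x - p) \<bullet> v = 0"
proof -
  have "\<exists>u\<in>K. \<forall>v\<in>K. u \<bullet> v = x \<bullet> v"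
    by (rule riesz_representation[OF assms, of _ "norm x"])
       (auto simp: inner_add_right Cauchy_Schwarz_ineq2)
  thus ?thesis using that by (auto simp: inner_diff_left)
qed

section \<open>Weak convergence and weak compactness in Hilbert space\<close>

definition weakly :: "(nat \<Rightarrow> 'h::real_inner) \<Rightarrow> 'h \<Rightarrow> bool" where
  "weakly x y \<longleftrightarrow> (\<forall>g. (\<lambda>h. x h \<bullet> g) \<longlonglongrightarrow> y \<bullet> g)"

lemma weaklyD: "weakly x y \<Longrightarrow> (\<lambda>h. x h \<bullet> g) \<longlonglongrightarrow> y \<bullet> g"
  by (simp add: weakly_def)

lemma weaklyD': "weakly x y \<Longrightarrow> (\<lambda>h. g \<bullet> x h) \<longlonglongrightarrow> g \<bullet> y"
  by (simp add: weakly_def inner_commute)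

lemma weakly_subseq: "weakly x y \<Longrightarrow> strict_mono r \<Longrightarrow> weakly (\<lambda>h. x (r h)) y"
  unfolding weakly_def using LIMSEQ_subseq_LIMSEQ[of _ _ r] by (fastforce simp: o_def)

lemma weakly_add: "weakly x y \<Longrightarrow> weakly x' y' \<Longrightarrow> weakly (\<lambda>h. x h + x' h) (y + y')"
  unfolding weakly_def by (auto simp: inner_add_left intro: tendsto_add)

lemma weakly_diff: "weakly x y \<Longrightarrow> weakly x' y' \<Longrightarrow> weakly (\<lambda>h. x h - x' h) (y - y')"
  unfolding weakly_def by (auto simp: inner_diff_left intro: tendsto_diff)

lemma tendsto_imp_weakly: "x \<longlonglongrightarrow> y \<Longrightarrow> weakly x y"
  unfolding weakly_def by (auto intro: tendsto_inner)

lemma weakly_unique: "weakly x y \<Longrightarrow> weakly x z \<Longrightarrow> y = z"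
  unfolding weakly_def by (metis LIMSEQ_unique vector_eq_rdot)

text \<open>The component \<open>y - p\<close> orthogonal to \<open>K\<close> annihilates every
  \<open>x h\<close>, hence also their weak limit \<open>y\<close>, and therefore itself.\<close>

lemma weakly_closed_subspace:
  fixes K :: "'h::{real_inner,complete_space} set"
  assumes K: "subspace K" "closed K" and x: "\<And>h. x h \<in> K" and w: "weakly x y"
  shows "y \<in> K"
proof -
  obtain p where p: "p \<in> K" "\<And>v. v \<in> K \<Longrightarrow> (y - p) \<bullet> v = 0" using closed_subspace_projection[OF K] by blast
  have "(\<lambda>h. (y - p) \<bullet> x h) \<longlonglongrightarrow> (y - p) \<bullet> y" by (rule weaklyD'[OF w])
  moreover have "(\<lambda>h. (y - p) \<bullet> x h) = (\<lambda>h. 0)" using p(2) x by auto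
  ultimately have "(y - p) \<bullet> y = 0" by (simp add: LIMSEQ_const_iff)
  hence "(y - p) \<bullet> (y - p) = 0" using p(2)[OF p(1)] by (simp add: inner_diff_right)
  thus ?thesis using p(1) by simp
qed

text \<open>The vector representing \<open>T v \<bullet> g\<close> is the adjoint applied to
  \<open>g\<close>.\<close>

lemma weakly_linear_image:
  fixes T :: "'h::{real_inner,complete_space} \<Rightarrow> 'k::real_inner"
  assumes T: "bounded_linear T" and x: "weakly x y"
  shows "weakly (\<lambda>h. T (x h)) (T y)"
  unfolding weakly_def
proof
  fix g
  interpret bounded_linear T by (rule T)
  obtain B where B: "\<And>x. norm (T x) \<le> norm x * B" using bounded by blast
  have "\<exists>u\<in>UNIV. \<forall>v\<in>UNIV. u \<bullet> v = T v \<bullet> g"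
  proof (rule riesz_representation[where C="B * norm g"])
    fix u show "\<bar>T u \<bullet> g\<bar> \<le> B * norm g * norm u"
      using Cauchy_Schwarz_ineq2[of "T u" g] mult_right_mono[OF B[of u], of "norm g"] by (simp add: mult_ac)
  qed (auto simp: add scale inner_add_left)
  then obtain u where "\<And>v. u \<bullet> v = T v \<bullet> g" by blast
  thus "(\<lambda>h. T (x h) \<bullet> g) \<longlonglongrightarrow> T y \<bullet> g" using weaklyD'[OF x, of u] by simp
qed

text \<open>Separability is bypassed: diagonal extraction only makes the products of members of the
  families converge. The vectors against which all families converge form a closed subspace that
  contains every member, and on its orthogonal complement all products are 0. A single subsequence
  has to serve all \<open>i\<close>, since later countably many fluxes must converge
  simultaneously.\<close>

lemma weakly_compact_family:
  fixes x :: "nat \<Rightarrow> nat \<Rightarrow> 'h::{real_inner,complete_space}"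
  assumes B: "\<And>i h. norm (x i h) \<le> B i"
  obtains r where "strict_mono (r :: nat \<Rightarrow> nat)" "\<And>i. \<exists>y. weakly (\<lambda>h. x i (r h)) y"
proof -
  define P where "P = (\<lambda>n r. case from_nat n :: nat \<times> nat \<times> nat of (i, j, k) \<Rightarrow> convergent (\<lambda>h. x i (r h) \<bullet> x j k))"
  interpret subseqs P
  proof
    fix n and s :: "nat \<Rightarrow> nat" assume s: "strict_mono s"
    obtain i j k where n: "(from_nat n :: nat \<times> nat \<times> nat) = (i, j, k)" using prod_cases3 by blast
    have "bounded (range (\<lambda>h. x i (s h) \<bullet> x j k))"
      unfolding bounded_iff
    proof (intro exI ballI, safe)
      fix h
      have "\<bar>x i (s h) \<bullet> x j k\<bar> \<le> norm (x i (s h)) * norm (x j k)" by (rule Cauchy_Schwarz_ineq2)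
      also have "\<dots> \<le> B i * norm (x j k)" using B by (intro mult_right_mono) auto
      finally show "norm (x i (s h) \<bullet> x j k) \<le> B i * norm (x j k)" by simp
    qed
    then obtain l r where "strict_mono r" "((\<lambda>h. x i (s h) \<bullet> x j k) \<circ> r) \<longlonglongrightarrow> l"
      using bounded_imp_convergent_subsequence by blast
    thus "\<exists>r'. strict_mono r' \<and> P n (s \<circ> r')"
      by (auto simp: P_def n o_def convergent_def)
  qed
  define r where "r = diagseq"
  have r: "strict_mono r" unfolding r_def by (rule subseq_diagseq)
  have c0: "convergent (\<lambda>h. x i (r h) \<bullet> x j k)" for i j k
  proof -
    define n where "n = to_nat (i, j, k)"
    \<comment> \<open>The diagonal sequence refines the \<open>n\<close>-th extraction only after
      index \<open>n\<close>, which is harmless for convergence.\<close>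
    have "P n (diagseq \<circ> ((+) (Suc n)))"
    proof (rule diagseq_holds)
      fix r s :: "nat \<Rightarrow> nat" and n assume "strict_mono r" "P n s"
      thus "P n (s \<circ> r)"
        by (auto simp: P_def split: prod.splits dest: convergent_subseq_convergent simp: o_def)
           (metis (no_types, lifting) LIMSEQ_subseq_LIMSEQ convergent_def comp_def)?
    qed
    hence "convergent (\<lambda>h. x i (diagseq (h + Suc n)) \<bullet> x j k)"
      by (simp add: P_def n_def o_def add.commute)
    thus ?thesis unfolding r_def
      using convergent_ignore_initial_segment[of "\<lambda>h. x i (diagseq h) \<bullet> x j k" "Suc n"] by simp
  qed
  define Y where "Y = {y. \<forall>i. convergent (\<lambda>h. x i (r h) \<bullet> y)}"
  have Ysub: "subspace Y"
    unfolding subspace_def Y_def by (auto simp: inner_add_right convergent_const intro: convergent_add convergent_mult)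
  have Ycl: "closed Y"
    unfolding closed_sequential_limits
  proof safe
    fix w y assume w: "\<forall>n. w n \<in> Y" "w \<longlonglongrightarrow> y"
    show "y \<in> Y" unfolding Y_def
    proof safe
      fix i
      have "Cauchy (\<lambda>h. x i (r h) \<bullet> y)"
      proof (rule CauchyI)
        fix e :: real assume e: "e > 0"
        define b where "b = B i + 1"
        have "0 \<le> B i" by (rule order_trans[OF norm_ge_zero B])
        hence b: "b > 0" by (simp add: b_def)
        have b': "norm (x i h) \<le> b" for h using B[of i h] by (simp add: b_def)
        have "e / (4 * b) > 0" using e b by simp
        then obtain n where n: "norm (w n - y) < e / (4 * b)"
          using LIMSEQ_D[OF w(2)] by blast
        have d: "\<bar>x i (r h) \<bullet> y - x i (r h) \<bullet> w n\<bar> \<le> e / 4" for h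
        proof -
          have "\<bar>x i (r h) \<bullet> (y - w n)\<bar> \<le> norm (x i (r h)) * norm (y - w n)" by (rule Cauchy_Schwarz_ineq2)
          also have "\<dots> \<le> b * (e / (4 * b))"
            using b b' n by (intro mult_mono) (auto simp: norm_minus_commute)
          also have "\<dots> = e / 4" using b by simp
          finally show ?thesis by (simp add: inner_diff_right)
        qed
        have "Cauchy (\<lambda>h. x i (r h) \<bullet> w n)" using w(1) by (auto simp: Y_def Cauchy_convergent_iff)
        then obtain M where M: "\<And>h k. h \<ge> M \<Longrightarrow> k \<ge> M \<Longrightarrow> norm (x i (r h) \<bullet> w n - x i (r k) \<bullet> w n) < e / 2"
          using CauchyD[of _ "e / 2"] e by fastforce
        have "norm (x i (r h) \<bullet> y - x i (r k) \<bullet> y) < e" if "h \<ge> M" "k \<ge> M" for h k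
          using M[OF that] d[of h] d[of k] unfolding real_norm_def by linarith
        thus "\<exists>M. \<forall>m\<ge>M. \<forall>n\<ge>M. norm (x i (r m) \<bullet> y - x i (r n) \<bullet> y) < e" by blast
      qed
      thus "convergent (\<lambda>h. x i (r h) \<bullet> y)" by (simp add: Cauchy_convergent_iff)
    qed
  qed
  have cv: "convergent (\<lambda>h. x i (r h) \<bullet> y)" for i y
  proof -
    obtain p where p: "p \<in> Y" "\<And>v. v \<in> Y \<Longrightarrow> (y - p) \<bullet> v = 0" using closed_subspace_projection[OF Ysub Ycl] by blast
    have "(y - p) \<bullet> x i (r h) = 0" for h by (rule p(2)) (simp add: Y_def c0)
    hence "x i (r h) \<bullet> y = x i (r h) \<bullet> p" for h by (simp add: inner_commute inner_diff_left inner_diff_right)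
    thus ?thesis using p(1) by (simp add: Y_def)
  qed
  have "\<exists>y. weakly (\<lambda>h. x i (r h)) y" for i
  proof -
    define f where "f = (\<lambda>y. lim (\<lambda>h. x i (r h) \<bullet> y))"
    have f: "(\<lambda>h. x i (r h) \<bullet> y) \<longlonglongrightarrow> f y" for y using cv by (simp add: f_def convergent_LIMSEQ_iff)
    have "\<exists>u\<in>UNIV. \<forall>v\<in>UNIV. u \<bullet> v = f v"
    proof (rule riesz_representation[where C="B i"])
      fix u v :: 'h and c :: real
      show "f (u + v) = f u + f v"
        using LIMSEQ_unique[OF f[of "u + v"]] tendsto_add[OF f[of u] f[of v]] by (simp add: inner_add_right)
      show "f (c *\<^sub>R u) = c * f u"
        using LIMSEQ_unique[OF f[of "c *\<^sub>R u"]] tendsto_mult_left[OF f[of u], of c] by simp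
      have "\<bar>x i (r h) \<bullet> u\<bar> \<le> B i * norm u" for h
        using Cauchy_Schwarz_ineq2[of "x i (r h)" u] mult_right_mono[OF B[of i "r h"], of "norm u"] by simp
      thus "\<bar>f u\<bar> \<le> B i * norm u"
        by (intro LIMSEQ_le_const2[OF tendsto_rabs[OF f[of u]]]) auto
    qed auto
    then obtain u where "\<And>v. u \<bullet> v = f v" by blast
    hence "weakly (\<lambda>h. x i (r h)) u" unfolding weakly_def using f by simp
    thus ?thesis by blast
  qed
  thus ?thesis using that r by blast
qed

lemma weakly_compact:
  fixes x :: "nat \<Rightarrow> 'h::{real_inner,complete_space}"
  assumes "\<And>h. norm (x h) \<le> B"
  obtains r y where "strict_mono (r :: nat \<Rightarrow> nat)" "weakly (\<lambda>h. x (r h)) y"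
  using weakly_compact_family[of "\<lambda>_. x" "\<lambda>_. B"] assms by metis

lemma LIMSEQ_by_subsequences:
  fixes f :: "nat \<Rightarrow> 'a::metric_space"
  assumes "\<And>r :: nat \<Rightarrow> nat. strict_mono r \<Longrightarrow> \<exists>q :: nat \<Rightarrow> nat. strict_mono q \<and> (\<lambda>n. f (r (q n))) \<longlonglongrightarrow> l"
  shows "f \<longlonglongrightarrow> l"
proof (rule ccontr)
  assume "\<not> f \<longlonglongrightarrow> l"
  then obtain e where e: "e > 0" "\<And>N. \<exists>n\<ge>N. dist (f n) l \<ge> e"
    unfolding lim_sequentially by (meson not_less)
  hence "infinite {n. dist (f n) l \<ge> e}"
    unfolding infinite_nat_iff_unbounded_le by blast
  then obtain r :: "nat \<Rightarrow> nat" where r: "strict_mono r" "\<And>n. dist (f (r n)) l \<ge> e"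
    using infinite_enumerate[of "{n. dist (f n) l \<ge> e}"] by blast
  obtain q :: "nat \<Rightarrow> nat" where "strict_mono q" "(\<lambda>n. f (r (q n))) \<longlonglongrightarrow> l" using assms[OF r(1)] by blast
  then obtain N where "dist (f (r (q N))) l < e" using e(1) unfolding lim_sequentially by blast
  thus False using r(2)[of "q N"] by simp
qed

section \<open>Abstract energies on a closed graph\<close>

definition elliptic :: "real \<Rightarrow> real \<Rightarrow> ('h::real_inner \<Rightarrow> 'h) \<Rightarrow> bool" where
  "elliptic l L A \<longleftrightarrow> bounded_linear A \<and> (\<forall>u v. A u \<bullet> v = u \<bullet> A v) \<and>
     (\<forall>u. l * (norm u)\<^sup>2 \<le> A u \<bullet> u) \<and> (\<forall>u. norm (A u) \<le> L * norm u)"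

lemma elliptic_linear: "elliptic l L A \<Longrightarrow> bounded_linear A"
  and elliptic_sym: "elliptic l L A \<Longrightarrow> A u \<bullet> v = u \<bullet> A v"
  and elliptic_lower: "elliptic l L A \<Longrightarrow> l * (norm u)\<^sup>2 \<le> A u \<bullet> u"
  and elliptic_upper: "elliptic l L A \<Longrightarrow> norm (A u) \<le> L * norm u"
  unfolding elliptic_def by blast+

text \<open>\<open>G\<close> models the pairs of a function and its extended gradient. A closed
  subspace of a product space carries the domain and the operator together; the assumptions are what
  the concrete gradient supplies, namely the Poincare inequality, closability and Rellich
  compactness.\<close>

locale energy_graph =
  fixes G :: "('x::{real_inner,complete_space} \<times> 'h::{real_inner,complete_space}) set"
    and CP :: real
  assumes subspace_G: "subspace G" and closed_G: "closed G"
    and poincare: "\<And>x U. (x, U) \<in> G \<Longrightarrow> norm x \<le> CP * norm U"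
    and closable: "\<And>U. (0, U) \<in> G \<Longrightarrow> U = 0"
    and compact_G: "\<And>x U B. (\<And>k. (x k, U k) \<in> G) \<Longrightarrow> (\<And>k. norm (U k) \<le> B) \<Longrightarrow> weakly U 0 \<Longrightarrow> x \<longlonglongrightarrow> 0"
begin

text \<open>The space of gradients, in which all variational problems are posed; the functions
  themselves return only in the strong limits.\<close>

definition K where "K = snd ` G"

definition energy_on :: "('h \<Rightarrow> 'h) \<Rightarrow> 'x \<Rightarrow> ennreal" where
  "energy_on A x = (if \<exists>U. (x, U) \<in> G then ennreal (1/2 * (A (THE U. (x, U) \<in> G) \<bullet> (THE U. (x, U) \<in> G))) else \<infinity>)"

lemma G_diff: "(x, U) \<in> G \<Longrightarrow> (y, V) \<in> G \<Longrightarrow> (x - y, U - V) \<in> G"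
  using subspace_diff[OF subspace_G, of "(x, U)" "(y, V)"] by simp

lemma G_functional: "(x, U) \<in> G \<Longrightarrow> (x, V) \<in> G \<Longrightarrow> U = V"
  using closable[of "U - V"] G_diff[of x U x V] by simp

lemma the_G: "(x, U) \<in> G \<Longrightarrow> (THE U. (x, U) \<in> G) = U"
  using G_functional by blast

lemma energy_on_G: "(x, U) \<in> G \<Longrightarrow> energy_on A x = ennreal (1/2 * (A U \<bullet> U))"
  by (auto simp: energy_on_def the_G)

lemma energy_on_finite: "energy_on A x < \<infinity> \<Longrightarrow> \<exists>U. (x, U) \<in> G"
  by (auto simp: energy_on_def split: if_splits)

lemma subspace_K: "subspace K"
proof -
  have "linear (snd :: 'x \<times> 'h \<Rightarrow> 'h)" by (rule bounded_linear.linear[OF bounded_linear_snd])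
  thus ?thesis unfolding K_def by (rule linear_subspace_image) (rule subspace_G)
qed

text \<open>By the Poincare inequality the functions are Cauchy whenever their gradients are, so
  closedness of the graph applies.\<close>

lemma closed_K: "closed K"
  unfolding closed_sequential_limits
proof safe
  fix U V assume U: "\<forall>n. U n \<in> K" "U \<longlonglongrightarrow> V"
  hence "\<forall>n. \<exists>x. (x, U n) \<in> G" by (force simp: K_def)
  then obtain x where x: "\<And>n. (x n, U n) \<in> G" by metis
  have "Cauchy x"
  proof (rule CauchyI)
    fix e :: real assume e: "e > 0"
    define c where "c = \<bar>CP\<bar> + 1"
    have c: "c > 0" "CP \<le> c" by (auto simp: c_def)
    have "Cauchy U" using U(2) by (rule LIMSEQ_imp_Cauchy)
    then obtain M where M: "\<And>m n. m \<ge> M \<Longrightarrow> n \<ge> M \<Longrightarrow> norm (U m - U n) < e / c"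
      using CauchyD[of U "e / c"] e c by auto
    have "norm (x m - x n) < e" if "m \<ge> M" "n \<ge> M" for m n
    proof -
      have "norm (x m - x n) \<le> CP * norm (U m - U n)" by (rule poincare[OF G_diff[OF x x]])
      also have "\<dots> \<le> c * norm (U m - U n)" using c by (intro mult_right_mono) auto
      also have "\<dots> < c * (e / c)" using M[OF that] c by (intro mult_strict_left_mono)
      finally show ?thesis using c by simp
    qed
    thus "\<exists>M. \<forall>m\<ge>M. \<forall>n\<ge>M. norm (x m - x n) < e" by blast
  qed
  then obtain y where "x \<longlonglongrightarrow> y" using Cauchy_convergent_iff convergent_def by blast
  hence "(\<lambda>n. (x n, U n)) \<longlonglongrightarrow> (y, V)" using U(2) by (rule tendsto_Pair)
  hence "(y, V) \<in> G" by (rule closed_sequentially[OF closed_G, rotated]) (rule x)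
  thus "V \<in> K" by (force simp: K_def)
qed

lemma solution_exists:
  assumes A: "elliptic l L A" and l: "l > 0"
    and "\<And>u v. u \<in> K \<Longrightarrow> v \<in> K \<Longrightarrow> f (u + v) = f u + f v"
    and "\<And>c u. u \<in> K \<Longrightarrow> f (c *\<^sub>R u) = c * f u"
    and "\<And>u. u \<in> K \<Longrightarrow> \<bar>f u\<bar> \<le> C * norm u"
  shows "\<exists>U\<in>K. \<forall>V\<in>K. A U \<bullet> V = f V"
proof (rule coercive_form_represents[OF subspace_K closed_K _ _ l _ assms(3-5)])
  interpret bounded_linear A using A by (simp add: elliptic_def)
  show "bounded_bilinear (\<lambda>u. inner (A u))"
    using bounded_bilinear.comp1[OF bounded_bilinear_inner] bounded_linear_axioms by blast
qed (use A in \<open>auto simp: elliptic_def inner_commute\<close>)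

lemma strong_limit:
  assumes "\<And>k. (x k, U k) \<in> G" "\<And>k. norm (U k) \<le> B" "weakly U V" "(y, V) \<in> G"
  shows "x \<longlonglongrightarrow> y"
proof -
  have "(\<lambda>k. x k - y) \<longlonglongrightarrow> 0"
  proof (rule compact_G)
    show "(x k - y, U k - V) \<in> G" for k by (rule G_diff[OF assms(1,4)])
    show "norm (U k - V) \<le> B + norm V" for k
      using norm_triangle_ineq4[of "U k" V] assms(2)[of k] by simp
    show "weakly (\<lambda>k. U k - V) 0" using weakly_diff[OF assms(3) tendsto_imp_weakly[OF tendsto_const[of V]]] by simp
  qed
  thus ?thesis by (simp add: LIM_zero_iff)
qed

lemma weak_limit_in_G:
  assumes "\<And>k. (x k, U k) \<in> G" "\<And>k. norm (U k) \<le> B" "weakly U V"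
  obtains y where "(y, V) \<in> G" "x \<longlonglongrightarrow> y"
proof -
  have "V \<in> K" by (rule weakly_closed_subspace[OF subspace_K closed_K _ assms(3)]) (use assms(1) in \<open>force simp: K_def\<close>)
  then obtain y where "(y, V) \<in> G" by (auto simp: K_def)
  thus ?thesis using that strong_limit[OF assms] by blast
qed

text \<open>For elliptic \<open>Ainf\<close> every bounded functional on \<open>K\<close> has the
  form \<open>Ainf U \<bullet> V\<close>, so parametrising the data by the limit solution
  \<open>U\<close> covers all right-hand sides. This is H-convergence without the condition on the
  fluxes.\<close>

definition resolvents_converge :: "(nat \<Rightarrow> 'h \<Rightarrow> 'h) \<Rightarrow> ('h \<Rightarrow> 'h) \<Rightarrow> bool" where
  "resolvents_converge A Ainf \<longleftrightarrow> (\<forall>U\<in>K. \<forall>W. (\<forall>h. W h \<in> K \<and> (\<forall>V\<in>K. A h (W h) \<bullet> V = Ainf U \<bullet> V)) \<longrightarrow> weakly W U)"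

definition energies_Gamma_converge :: "(nat \<Rightarrow> 'h \<Rightarrow> 'h) \<Rightarrow> ('h \<Rightarrow> 'h) \<Rightarrow> bool" where
  "energies_Gamma_converge A Ainf \<longleftrightarrow>
     (\<forall>x w. w \<longlonglongrightarrow> x \<longrightarrow> energy_on Ainf x \<le> liminf (\<lambda>h. energy_on (A h) (w h))) \<and>
     (\<forall>x. \<exists>w. w \<longlonglongrightarrow> x \<and> limsup (\<lambda>h. energy_on (A h) (w h)) \<le> energy_on Ainf x)"

text \<open>Expand \<open>A (U - W) \<bullet> (U - W) >= 0\<close>. The point is that the left side
  is linear in \<open>U\<close> and in \<open>W\<close> and so passes to weak limits, which the
  energy on the right does not.\<close>

lemma energy_resolvent_le:
  assumes A: "elliptic l L A" and l: "l > 0" and W: "A W \<bullet> U = F \<bullet> U" "A W \<bullet> W = F \<bullet> W"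
  shows "F \<bullet> U - 1/2 * (F \<bullet> W) \<le> 1/2 * (A U \<bullet> U)"
proof -
  interpret bounded_linear A using A by (simp add: elliptic_def)
  have "l * (norm (U - W))\<^sup>2 \<le> A (U - W) \<bullet> (U - W)" by (rule elliptic_lower[OF A])
  moreover have "0 \<le> l * (norm (U - W))\<^sup>2" using l by simp
  moreover have "A U \<bullet> W = A W \<bullet> U" using elliptic_sym[OF A, of U W] by (simp add: inner_commute)
  ultimately show ?thesis using W by (simp add: diff inner_diff_left inner_diff_right)
qed

lemma elliptic_norm_le:
  assumes "elliptic l L A" "l > 0" "1/2 * (A U \<bullet> U) \<le> c"
  shows "norm U \<le> sqrt (2 * c / l)"
proof -
  have "l * (norm U)\<^sup>2 \<le> 2 * c" using assms by (auto simp: elliptic_def intro: order_trans)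
  thus ?thesis using assms(2) by (intro real_le_rsqrt) (simp add: field_simps)
qed

lemma resolvent_bounded:
  assumes A: "elliptic l L A" and B: "elliptic l L B" and l: "l > 0" and W: "A W \<bullet> W = B U \<bullet> W"
  shows "norm W \<le> L / l * norm U"
proof (cases "W = 0")
  case False
  have "l * (norm W)\<^sup>2 \<le> A W \<bullet> W" by (rule elliptic_lower[OF A])
  also have "\<dots> \<le> norm (B U) * norm W" unfolding W by (rule norm_cauchy_schwarz)
  also have "\<dots> \<le> L * norm U * norm W" using B by (intro mult_right_mono) (auto simp: elliptic_def)
  finally have "l * norm W \<le> L * norm U" using False by (simp add: power2_eq_square)
  thus ?thesis using l by (simp add: field_simps)
next
  case True
  have "norm (B U) \<le> L * norm U" using B by (simp add: elliptic_def)
  hence "0 \<le> L * norm U" by (rule order_trans[OF norm_ge_zero])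
  thus ?thesis using True l by simp
qed

lemma resolvent_exists:
  assumes A: "elliptic l L A" and B: "elliptic l L B" and l: "l > 0"
  obtains W where "W \<in> K" "\<And>V. V \<in> K \<Longrightarrow> A W \<bullet> V = B U \<bullet> V"
proof -
  have "\<exists>W\<in>K. \<forall>V\<in>K. A W \<bullet> V = B U \<bullet> V"
    by (rule solution_exists[OF A l, where C="norm (B U)"]) (auto simp: inner_add_right Cauchy_Schwarz_ineq2)
  thus ?thesis using that by blast
qed

text \<open>For the lower bound, bounded energies give weakly convergent gradients, and the linear
  minorant of \<open>energy_resolvent_le\<close>, built from the resolvents of
  \<open>Ainf V\<close>, tends to the energy of \<open>V\<close>. The resolvents of
  \<open>Ainf U\<close> are themselves a recovery sequence, because their energies are
  \<open>1/2 * (Ainf U \<bullet> W h)\<close>.\<close>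

lemma resolvents_converge_imp_Gamma:
  assumes l: "l > 0" and A: "\<And>h. elliptic l L (A h)" and Ai: "elliptic l L Ainf"
    and R: "resolvents_converge A Ainf"
  shows "energies_Gamma_converge A Ainf"
  unfolding energies_Gamma_converge_def
proof (intro conjI allI impI)
  fix x :: 'x and w assume w: "w \<longlonglongrightarrow> x"
  show "energy_on Ainf x \<le> liminf (\<lambda>h. energy_on (A h) (w h))"
  proof (rule ccontr)
    assume "\<not> ?thesis"
    hence "liminf (\<lambda>h. energy_on (A h) (w h)) < energy_on Ainf x" by simp
    then obtain c where c: "liminf (\<lambda>h. energy_on (A h) (w h)) < c" "c < energy_on Ainf x" using dense by blast
    have "\<not> eventually (\<lambda>h. c \<le> energy_on (A h) (w h)) sequentially"
      using Liminf_bounded[of c "\<lambda>h. energy_on (A h) (w h)" sequentially] c(1) by fastforce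
    hence "\<exists>h\<ge>N. energy_on (A h) (w h) < c" for N
      unfolding eventually_sequentially by (meson not_less)
    hence "infinite {h. energy_on (A h) (w h) < c}"
      unfolding infinite_nat_iff_unbounded_le by blast
    then obtain r :: "nat \<Rightarrow> nat" where r: "strict_mono r" "\<And>n. energy_on (A (r n)) (w (r n)) < c"
      using infinite_enumerate[of "{h. energy_on (A h) (w h) < c}"] by blast
    obtain c' where c': "c = ennreal c'" "c' \<ge> 0" using c(2) by (cases c) auto
    have "\<exists>U. (w (r n), U) \<in> G" for n
      using r(2)[of n] by (intro energy_on_finite[of "A (r n)"]) (simp add: order.strict_trans2)
    then obtain U where U: "\<And>n. (w (r n), U n) \<in> G" by metis
    have e: "1/2 * (A (r n) (U n) \<bullet> U n) \<le> c'" for n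
    proof -
      have "ennreal (1/2 * (A (r n) (U n) \<bullet> U n)) \<le> ennreal c'" using r(2)[of n] c'(1) by (simp add: energy_on_G[OF U])
      thus ?thesis using c'(2) by (simp add: ennreal_le_iff)
    qed
    obtain q V where q: "strict_mono (q :: nat \<Rightarrow> nat)" "weakly (\<lambda>n. U (q n)) V"
      using weakly_compact[of U] elliptic_norm_le[OF A l e] by blast
    obtain y where y: "(y, V) \<in> G" "(\<lambda>n. w (r (q n))) \<longlonglongrightarrow> y"
      using weak_limit_in_G[of "\<lambda>n. w (r (q n))" "\<lambda>n. U (q n)", OF U elliptic_norm_le[OF A l e] q(2)] by blast
    have rq: "strict_mono (\<lambda>n. r (q n))" using strict_mono_o[OF r(1) q(1)] by (simp add: o_def)
    have "(\<lambda>n. w (r (q n))) \<longlonglongrightarrow> x" using LIMSEQ_subseq_LIMSEQ[OF w rq] by (simp add: o_def)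
    hence yx: "y = x" using y(2) LIMSEQ_unique by blast
    have VK: "V \<in> K" using y(1) by (force simp: K_def)
    have "\<exists>W. W \<in> K \<and> (\<forall>V'\<in>K. A h W \<bullet> V' = Ainf V \<bullet> V')" for h
      using resolvent_exists[OF A Ai l] by metis
    then obtain W where W: "\<And>h. W h \<in> K \<and> (\<forall>V'\<in>K. A h (W h) \<bullet> V' = Ainf V \<bullet> V')" by metis
    have "weakly W V" using R VK W unfolding resolvents_converge_def by blast
    hence Wq: "weakly (\<lambda>n. W (r (q n))) V" by (rule weakly_subseq[OF _ rq])
    have "1/2 * (Ainf V \<bullet> V) \<le> c'"
    proof (rule LIMSEQ_le_const2)
      have "(\<lambda>n. Ainf V \<bullet> U (q n) - 1/2 * (Ainf V \<bullet> W (r (q n)))) \<longlonglongrightarrow> Ainf V \<bullet> V - 1/2 * (Ainf V \<bullet> V)"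
        by (intro tendsto_diff tendsto_mult_left weaklyD' q(2) Wq)
      thus "(\<lambda>n. Ainf V \<bullet> U (q n) - 1/2 * (Ainf V \<bullet> W (r (q n)))) \<longlonglongrightarrow> 1/2 * (Ainf V \<bullet> V)" by simp
      have "U n \<in> K" for n using U[of n] by (force simp: K_def)
      hence "Ainf V \<bullet> U (q n) - 1/2 * (Ainf V \<bullet> W (r (q n))) \<le> c'" for n
        using energy_resolvent_le[OF A l, of "r (q n)" "W (r (q n))" "U (q n)" "Ainf V"] W e[of "q n"] by fastforce
      thus "\<exists>N. \<forall>n\<ge>N. Ainf V \<bullet> U (q n) - 1/2 * (Ainf V \<bullet> W (r (q n))) \<le> c'" by blast
    qed
    hence "energy_on Ainf x \<le> c" using y(1) yx c' by (simp add: energy_on_G ennreal_leI)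
    thus False using c(2) by simp
  qed
next
  fix x :: 'x
  show "\<exists>w. w \<longlonglongrightarrow> x \<and> limsup (\<lambda>h. energy_on (A h) (w h)) \<le> energy_on Ainf x"
  proof (cases "\<exists>U. (x, U) \<in> G")
    case False
    hence "energy_on Ainf x = \<infinity>" by (simp add: energy_on_def)
    thus ?thesis by (intro exI[of _ "\<lambda>_. x"]) auto
  next
    case True
    then obtain U where U: "(x, U) \<in> G" by blast
    hence UK: "U \<in> K" by (force simp: K_def)
    have "\<exists>W. W \<in> K \<and> (\<forall>V'\<in>K. A h W \<bullet> V' = Ainf U \<bullet> V')" for h
      using resolvent_exists[OF A Ai l] by metis
    then obtain W where W: "\<And>h. W h \<in> K \<and> (\<forall>V'\<in>K. A h (W h) \<bullet> V' = Ainf U \<bullet> V')" by metis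
    have Ww: "weakly W U" using R UK W unfolding resolvents_converge_def by blast
    have "\<exists>y. (y, W h) \<in> G" for h using W[of h] by (force simp: K_def)
    then obtain y where y: "\<And>h. (y h, W h) \<in> G" by metis
    have "y \<longlonglongrightarrow> x"
      by (rule strong_limit[OF y _ Ww U, of "L / l * norm U"]) (rule resolvent_bounded[OF A Ai l], use W in blast)
    moreover have "(\<lambda>h. energy_on (A h) (y h)) \<longlonglongrightarrow> energy_on Ainf x"
    proof -
      have "energy_on (A h) (y h) = ennreal (1/2 * (Ainf U \<bullet> W h))" for h
        using W[of h] by (simp add: energy_on_G[OF y])
      moreover have "(\<lambda>h. ennreal (1/2 * (Ainf U \<bullet> W h))) \<longlonglongrightarrow> ennreal (1/2 * (Ainf U \<bullet> U))"
        by (intro tendsto_ennrealI tendsto_mult_left weaklyD' Ww)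
      ultimately show ?thesis by (simp add: energy_on_G[OF U])
    qed
    hence "limsup (\<lambda>h. energy_on (A h) (y h)) = energy_on Ainf x" by (intro lim_imp_Limsup) auto
    ultimately show ?thesis by (intro exI[of _ y]) auto
  qed
qed

text \<open>The lower bound in Gamma-convergence concerns full sequences; filling the gaps with the
  limit makes it available along a subsequence.\<close>

lemma tendsto_fill_subsequence:
  fixes a :: "nat \<Rightarrow> 'a::topological_space"
  assumes p: "strict_mono (p :: nat \<Rightarrow> nat)" and a: "(\<lambda>n. a (p n)) \<longlonglongrightarrow> y"
  shows "(\<lambda>h. if h \<in> range p then a h else y) \<longlonglongrightarrow> y"
proof (rule topological_tendstoI)
  fix S assume S: "open S" "y \<in> S"
  then obtain N where N: "\<And>n. n \<ge> N \<Longrightarrow> a (p n) \<in> S"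
    using topological_tendstoD[OF a] by (auto simp: eventually_sequentially)
  have "(if h \<in> range p then a h else y) \<in> S" if "h \<ge> p N" for h
    using that S N p by (auto simp: strict_mono_less_eq)
  thus "eventually (\<lambda>h. (if h \<in> range p then a h else y) \<in> S) sequentially"
    unfolding eventually_sequentially by blast
qed

text \<open>Let \<open>V\<close> be a weak cluster point of the resolvents. The lower bound along
  them gives \<open>Ainf V \<bullet> V <= Ainf U \<bullet> V\<close>; a recovery sequence for
  \<open>U\<close>, compared with the resolvents, gives
  \<open>Ainf U \<bullet> U <= Ainf U \<bullet> V\<close>. Adding both makes the energy of
  \<open>U - V\<close> nonpositive.\<close>

lemma Gamma_imp_resolvents_converge:
  assumes l: "l > 0" and A: "\<And>h. elliptic l L (A h)" and Ai: "elliptic l L Ainf"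
    and Gm: "energies_Gamma_converge A Ainf"
  shows "resolvents_converge A Ainf"
  unfolding resolvents_converge_def
proof (intro ballI allI impI)
  fix U W assume UK: "U \<in> K" and W: "\<forall>h. W h \<in> K \<and> (\<forall>V\<in>K. A h (W h) \<bullet> V = Ainf U \<bullet> V)"
  obtain xU where xU: "(xU, U) \<in> G" using UK by (auto simp: K_def)
  have "\<exists>y. (y, W h) \<in> G" for h using W by (force simp: K_def)
  then obtain y where y: "\<And>h. (y h, W h) \<in> G" by metis
  have Wb: "norm (W h) \<le> L / l * norm U" for h by (rule resolvent_bounded[OF A Ai l]) (use W in blast)
  obtain w where w: "w \<longlonglongrightarrow> xU" "limsup (\<lambda>h. energy_on (A h) (w h)) \<le> energy_on Ainf xU"
    using Gm unfolding energies_Gamma_converge_def by blast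
  have "V = U" if p: "strict_mono (p :: nat \<Rightarrow> nat)" and V: "weakly (\<lambda>n. W (p n)) V" for p V
  proof -
    obtain z where z: "(z, V) \<in> G" "(\<lambda>n. y (p n)) \<longlonglongrightarrow> z"
      using weak_limit_in_G[of "\<lambda>n. y (p n)" "\<lambda>n. W (p n)", OF y Wb V] by blast
    define v where "v = (\<lambda>h. if h \<in> range p then y h else z)"
    have "v \<longlonglongrightarrow> z" unfolding v_def by (rule tendsto_fill_subsequence[OF p z(2)])
    hence "energy_on Ainf z \<le> liminf (\<lambda>h. energy_on (A h) (v h))"
      using Gm unfolding energies_Gamma_converge_def by blast
    also have "\<dots> \<le> liminf ((\<lambda>h. energy_on (A h) (v h)) \<circ> p)" by (rule liminf_subseq_mono[OF p])
    also have "((\<lambda>h. energy_on (A h) (v h)) \<circ> p) = (\<lambda>n. ennreal (1/2 * (Ainf U \<bullet> W (p n))))"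
      using W by (auto simp: v_def energy_on_G[OF y])
    also have "liminf \<dots> = ennreal (1/2 * (Ainf U \<bullet> V))"
      by (intro lim_imp_Liminf tendsto_ennrealI tendsto_mult_left weaklyD' V) auto
    finally have "ennreal (1/2 * (Ainf V \<bullet> V)) \<le> ennreal (1/2 * (Ainf U \<bullet> V))" by (simp add: energy_on_G[OF z(1)])
    \<comment> \<open>\<open>ennreal\<close> truncates negative numbers to 0, so the inequality
      between reals follows only once the right side is nonnegative.\<close>
    moreover have "0 \<le> Ainf U \<bullet> V"
    proof (rule LIMSEQ_le_const[OF weaklyD'[OF V, of "Ainf U"]], intro exI allI impI)
      fix n
      have "0 \<le> l * (norm (W (p n)))\<^sup>2" using l by simp
      also have "\<dots> \<le> A (p n) (W (p n)) \<bullet> W (p n)" by (rule elliptic_lower[OF A])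
      finally show "0 \<le> Ainf U \<bullet> W (p n)" using W by simp
    qed
    ultimately have c1: "Ainf V \<bullet> V \<le> Ainf U \<bullet> V" by simp
    \<comment> \<open>The slack \<open>e\<close> turns the limsup bound into a strict bound from
      some index on. The gradients \<open>R\<close> of the recovery sequence must converge weakly to
      \<open>U\<close>, because the functions converge to \<open>xU\<close> and the graph is
      functional.\<close>
    have c2: "1/2 * (Ainf U \<bullet> U) \<le> 1/2 * (Ainf U \<bullet> V)"
    proof (rule field_le_epsilon)
      fix e :: real assume e: "e > 0"
      have nn: "0 \<le> Ainf U \<bullet> U"
        using l by (intro order_trans[OF _ elliptic_lower[OF Ai]]) simp
      define c where "c = 1/2 * (Ainf U \<bullet> U) + e"
      have "energy_on Ainf xU < ennreal c" using e nn by (simp add: energy_on_G[OF xU] c_def ennreal_less_iff)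
      hence "limsup (\<lambda>h. energy_on (A h) (w h)) < ennreal c" using w(2) by (rule le_less_trans[rotated])
      hence "eventually (\<lambda>h. energy_on (A h) (w h) < ennreal c) sequentially" by (rule Limsup_lessD)
      then obtain N where N: "\<And>h. h \<ge> N \<Longrightarrow> energy_on (A h) (w h) < ennreal c"
        by (auto simp: eventually_sequentially)
      define P where "P = (\<lambda>n. p (n + N))"
      have P: "strict_mono P" using p by (auto simp: P_def strict_mono_def)
      have PN: "P n \<ge> N" for n using seq_suble[OF p, of "n + N"] by (simp add: P_def)
      have VP: "weakly (\<lambda>n. W (P n)) V"
        using weakly_subseq[OF V, of "\<lambda>n. n + N"] by (simp add: P_def strict_mono_def)
      have "\<exists>R. (w (P n), R) \<in> G" for n
        using N[OF PN] by (intro energy_on_finite[of "A (P n)"]) (metis ennreal_less_top infinity_ennreal_def order.strict_trans)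
      then obtain R where R: "\<And>n. (w (P n), R n) \<in> G" by metis
      have c0: "c \<ge> 0" using e nn by (simp add: c_def)
      have e': "1/2 * (A (P n) (R n) \<bullet> R n) \<le> c" for n
      proof -
        have "ennreal (1/2 * (A (P n) (R n) \<bullet> R n)) \<le> ennreal c" using N[OF PN, of n] by (simp add: energy_on_G[OF R])
        thus ?thesis using c0 by (simp add: ennreal_le_iff)
      qed
      obtain q R' where q: "strict_mono (q :: nat \<Rightarrow> nat)" "weakly (\<lambda>n. R (q n)) R'"
        using weakly_compact[of R] elliptic_norm_le[OF A l e'] by blast
      obtain x' where x': "(x', R') \<in> G" "(\<lambda>n. w (P (q n))) \<longlonglongrightarrow> x'"
        using weak_limit_in_G[of "\<lambda>n. w (P (q n))" "\<lambda>n. R (q n)", OF R elliptic_norm_le[OF A l e'] q(2)] by blast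
      have "strict_mono (\<lambda>n. P (q n))" using strict_mono_o[OF P q(1)] by (simp add: o_def)
      hence "(\<lambda>n. w (P (q n))) \<longlonglongrightarrow> xU" using LIMSEQ_subseq_LIMSEQ[OF w(1)] by (fastforce simp: o_def)
      hence "x' = xU" using x'(2) LIMSEQ_unique by blast
      hence RU: "R' = U" using x'(1) xU G_functional by blast
      have "Ainf U \<bullet> U - 1/2 * (Ainf U \<bullet> V) \<le> c"
      proof (rule LIMSEQ_le_const2)
        show "(\<lambda>n. Ainf U \<bullet> R (q n) - 1/2 * (Ainf U \<bullet> W (P (q n)))) \<longlonglongrightarrow> Ainf U \<bullet> U - 1/2 * (Ainf U \<bullet> V)"
          using q(2) weakly_subseq[OF VP q(1)] unfolding RU by (intro tendsto_diff tendsto_mult_left weaklyD')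
        have "R n \<in> K" for n using R[of n] by (force simp: K_def)
        hence "Ainf U \<bullet> R (q n) - 1/2 * (Ainf U \<bullet> W (P (q n))) \<le> c" for n
          using energy_resolvent_le[OF A l, of "P (q n)" "W (P (q n))" "R (q n)" "Ainf U"] W e'[of "q n"] by fastforce
        thus "\<exists>N. \<forall>n\<ge>N. Ainf U \<bullet> R (q n) - 1/2 * (Ainf U \<bullet> W (P (q n))) \<le> c" by blast
      qed
      thus "1/2 * (Ainf U \<bullet> U) \<le> 1/2 * (Ainf U \<bullet> V) + e" by (simp add: c_def)
    qed
    interpret bounded_linear Ainf using Ai by (simp add: elliptic_def)
    have "l * (norm (U - V))\<^sup>2 \<le> Ainf (U - V) \<bullet> (U - V)" by (rule elliptic_lower[OF Ai])
    also have "\<dots> = Ainf U \<bullet> U - 2 * (Ainf U \<bullet> V) + Ainf V \<bullet> V"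
      using elliptic_sym[OF Ai, of V U] by (simp add: diff inner_diff_left inner_diff_right inner_commute)
    also have "\<dots> \<le> 0" using c1 c2 by simp
    finally have "(norm (U - V))\<^sup>2 \<le> 0" using l by (simp add: mult_le_0_iff)
    thus "V = U" by simp
  qed note key = this
  show "weakly W U" unfolding weakly_def
  proof
    fix g
    show "(\<lambda>h. W h \<bullet> g) \<longlonglongrightarrow> U \<bullet> g"
    proof (rule LIMSEQ_by_subsequences)
      fix r :: "nat \<Rightarrow> nat" assume r: "strict_mono r"
      obtain q V where q: "strict_mono (q :: nat \<Rightarrow> nat)" "weakly (\<lambda>n. W (r (q n))) V"
        using weakly_compact[of "\<lambda>n. W (r n)"] Wb by blast
      have "V = U" using key[of "\<lambda>n. r (q n)"] strict_mono_o[OF r q(1)] q(2) by (simp add: o_def)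
      thus "\<exists>q::nat\<Rightarrow>nat. strict_mono q \<and> (\<lambda>n. W (r (q n)) \<bullet> g) \<longlonglongrightarrow> U \<bullet> g" using q weaklyD by blast
    qed
  qed
qed

theorem Gamma_iff_resolvents:
  assumes "l > 0" "\<And>h. elliptic l L (A h)" "elliptic l L Ainf"
  shows "energies_Gamma_converge A Ainf \<longleftrightarrow> resolvents_converge A Ainf"
  using Gamma_imp_resolvents_converge[of l L A Ainf] resolvents_converge_imp_Gamma[of l L A Ainf] assms by blast

end

section \<open>The fractional gradient of bounded Lipschitz functions\<close>

lemma lborel_affine_preimage:
  fixes t :: "'a::euclidean_space"
  assumes c: "c \<noteq> 0"
  shows "distr lborel borel (\<lambda>x. t + c *\<^sub>R x) = density lborel (\<lambda>_. ennreal (1 / \<bar>c\<bar> ^ DIM('a)))"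
proof -
  have "density lborel (\<lambda>_. ennreal (1 / \<bar>c\<bar> ^ DIM('a)))
      = density (density (distr lborel borel (\<lambda>x. t + c *\<^sub>R x)) (\<lambda>_. ennreal (\<bar>c\<bar>^DIM('a)))) (\<lambda>_. ennreal (1 / \<bar>c\<bar> ^ DIM('a)))"
    using lborel_affine[OF c, of t] by simp
  also have "\<dots> = distr lborel borel (\<lambda>x. t + c *\<^sub>R x)"
    using c by (subst density_density_eq) (auto simp: density_1 ennreal_mult[symmetric])
  finally show ?thesis by simp
qed

lemma
  fixes f :: "'a::euclidean_space \<Rightarrow> 'b::{banach,second_countable_topology}"
  assumes c: "c \<noteq> 0" and f [measurable]: "f \<in> borel_measurable borel"
  shows integrable_lborel_affine: "integrable lborel (\<lambda>x. f (t + c *\<^sub>R x)) \<longleftrightarrow> integrable lborel f"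
    and integral_lborel_affine: "(LINT x|lborel. f (t + c *\<^sub>R x)) = (1 / \<bar>c\<bar> ^ DIM('a)) *\<^sub>R (LINT x|lborel. f x)"
proof -
  let ?D = "distr lborel borel (\<lambda>x. t + c *\<^sub>R x)"
  have D: "?D = density lborel (\<lambda>_. ennreal (1 / \<bar>c\<bar> ^ DIM('a)))" by (rule lborel_affine_preimage[OF c])
  have "integrable lborel (\<lambda>x. f (t + c *\<^sub>R x)) \<longleftrightarrow> integrable ?D f"
    by (rule integrable_distr_eq[symmetric]) auto
  also have "\<dots> \<longleftrightarrow> integrable lborel (\<lambda>x. (1 / \<bar>c\<bar> ^ DIM('a)) *\<^sub>R f x)"
    unfolding D by (rule integrable_density) auto
  also have "\<dots> \<longleftrightarrow> integrable lborel f"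
    using c integrable_scaleR_right[of "1 / \<bar>c\<bar> ^ DIM('a)" lborel f]
      integrable_scaleR_right[of "\<bar>c\<bar> ^ DIM('a)" lborel "\<lambda>x. (1 / \<bar>c\<bar> ^ DIM('a)) *\<^sub>R f x"] by auto
  finally show "integrable lborel (\<lambda>x. f (t + c *\<^sub>R x)) \<longleftrightarrow> integrable lborel f" .
  have "(LINT x|lborel. f (t + c *\<^sub>R x)) = integral\<^sup>L ?D f"
    by (rule integral_distr[symmetric]) auto
  also have "\<dots> = (LINT x|lborel. (1 / \<bar>c\<bar> ^ DIM('a)) *\<^sub>R f x)"
    unfolding D by (rule integral_density) auto
  also have "\<dots> = (1 / \<bar>c\<bar> ^ DIM('a)) *\<^sub>R (LINT x|lborel. f x)" using c by simp
  finally show "(LINT x|lborel. f (t + c *\<^sub>R x)) = (1 / \<bar>c\<bar> ^ DIM('a)) *\<^sub>R (LINT x|lborel. f x)" .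
qed

lemma nn_integral_lborel_affine:
  fixes f :: "'a::euclidean_space \<Rightarrow> ennreal"
  assumes c: "c \<noteq> 0" and f [measurable]: "f \<in> borel_measurable borel"
  shows "(\<integral>\<^sup>+x. f (t + c *\<^sub>R x) \<partial>lborel) = ennreal (1 / \<bar>c\<bar> ^ DIM('a)) * (\<integral>\<^sup>+x. f x \<partial>lborel)"
proof -
  have "(\<integral>\<^sup>+x. f (t + c *\<^sub>R x) \<partial>lborel) = (\<integral>\<^sup>+x. f x \<partial>distr lborel borel (\<lambda>x. t + c *\<^sub>R x))"
    by (rule nn_integral_distr[symmetric]) auto
  also have "\<dots> = (\<integral>\<^sup>+x. ennreal (1 / \<bar>c\<bar> ^ DIM('a)) * f x \<partial>lborel)"
    unfolding lborel_affine_preimage[OF c] by (rule nn_integral_density) auto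
  also have "\<dots> = ennreal (1 / \<bar>c\<bar> ^ DIM('a)) * (\<integral>\<^sup>+x. f x \<partial>lborel)" by (rule nn_integral_cmult) auto
  finally show ?thesis .
qed

lemmas integral_lborel_translate = integral_lborel_affine[of 1, simplified]
lemmas integrable_lborel_translate = integrable_lborel_affine[of 1, simplified]
lemmas nn_integral_lborel_translate = nn_integral_lborel_affine[of 1, simplified]
lemmas integral_lborel_reflect = integral_lborel_affine[of "-1", simplified]

text \<open>Dyadic shells in place of polar coordinates: by monotonicity the profile on a shell is
  at most its value at the inner radius, and the shell is enclosed in the ball of its outer
  radius.\<close>

lemma nn_integral_radial_dyadic:
  fixes \<phi> :: "real \<Rightarrow> real"
  assumes dec: "\<And>a b. 0 < a \<Longrightarrow> a \<le> b \<Longrightarrow> \<phi> b \<le> \<phi> a" and nn: "\<And>a. 0 \<le> \<phi> a"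
    and s1: "summable (\<lambda>j. \<phi> (2^j) * 2^(j * DIM('a)))"
    and s2: "summable (\<lambda>j. \<phi> (1 / 2^Suc j) * (1 / 2^j) ^ DIM('a))"
    and [measurable]: "\<phi> \<in> borel_measurable borel"
  shows "(\<integral>\<^sup>+z. ennreal (\<phi> (norm (z::'a::euclidean_space))) \<partial>lborel) < \<infinity>"
proof -
  define a where "a = (\<lambda>j z::'a. ennreal (\<phi> (2^j)) * indicator (cball 0 (2 * 2^j)) z)"
  define b where "b = (\<lambda>j z::'a. ennreal (\<phi> (1 / 2^Suc j)) * indicator (cball 0 (1 / 2^j)) z)"
  have [measurable]: "a j \<in> borel_measurable borel" "b j \<in> borel_measurable borel" for j
    unfolding a_def b_def
    by (intro borel_measurable_times_ennreal borel_measurable_indicator borel_closed closed_cball borel_measurable_const)+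
  have pt: "ennreal (\<phi> (norm z)) \<le> (\<Sum>j. a j z) + (\<Sum>j. b j z)" if z: "z \<noteq> 0" for z :: 'a
  proof (cases "norm z \<ge> 1")
    case True
    obtain m where "norm z < 2^m" using real_arch_pow[of 2 "norm z"] by auto
    define m where "m = (LEAST m. norm z < 2^m)"
    have m: "norm z < 2^m" unfolding m_def by (rule LeastI) fact
    have "m \<noteq> 0" using m True by (cases m) auto
    then obtain j where j: "m = Suc j" by (cases m) auto
    have "\<not> norm z < 2^j" using not_less_Least[of j "\<lambda>m. norm z < 2^m"] j by (simp add: m_def)
    hence "\<phi> (norm z) \<le> \<phi> (2^j)" by (intro dec) auto
    moreover have "z \<in> cball 0 (2 * 2^j)" using m j by simp
    ultimately have "ennreal (\<phi> (norm z)) \<le> a j z" by (simp add: a_def ennreal_leI)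
    also have "\<dots> \<le> (\<Sum>j. a j z)" using sum_le_suminf[of "\<lambda>j. a j z" "{j}"] by simp
    finally show ?thesis by (rule order_trans) simp
  next
    case False
    obtain m where "(1/2)^m < norm z" using real_arch_pow_inv[of "norm z" "1/2"] z by auto
    define m where "m = (LEAST m. (1/2)^m < norm z)"
    have m: "(1/2)^m < norm z" unfolding m_def by (rule LeastI) fact
    have "m \<noteq> 0" using m False by (cases m) auto
    then obtain j where j: "m = Suc j" by (cases m) auto
    have "\<not> (1/2)^j < norm z" using not_less_Least[of j "\<lambda>m. (1/2)^m < norm z"] j by (simp add: m_def)
    hence "z \<in> cball 0 (1 / 2^j)" by (simp add: power_one_over)
    moreover have "\<phi> (norm z) \<le> \<phi> (1 / 2^Suc j)" using m j by (intro dec) (auto simp: power_one_over)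
    ultimately have "ennreal (\<phi> (norm z)) \<le> b j z" by (simp add: b_def ennreal_leI)
    also have "\<dots> \<le> (\<Sum>j. b j z)" using sum_le_suminf[of "\<lambda>j. b j z" "{j}"] by simp
    finally show ?thesis by (rule order_trans) simp
  qed
  define v where "v = unit_ball_vol (real DIM('a))"
  have v: "v \<ge> 0" by (simp add: v_def)
  have ia: "(\<integral>\<^sup>+z. a j z \<partial>lborel) = ennreal (v * 2 ^ DIM('a) * (\<phi> (2^j) * 2^(j * DIM('a))))" for j
    unfolding a_def
    by (subst nn_integral_cmult_indicator)
       (auto simp: emeasure_cball v_def nn power_mult_distrib power_mult ennreal_mult'[symmetric] mult_ac)
  have ib: "(\<integral>\<^sup>+z. b j z \<partial>lborel) = ennreal (v * (\<phi> (1 / 2^Suc j) * (1 / 2^j) ^ DIM('a)))" for j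
    unfolding b_def
    by (subst nn_integral_cmult_indicator)
       (auto simp: emeasure_cball v_def nn ennreal_mult'[symmetric] mult_ac simp del: power_Suc)
  have "AE z in lborel. (z::'a) \<noteq> 0" by (intro AE_lborel_singleton)
  hence "(\<integral>\<^sup>+z. ennreal (\<phi> (norm (z::'a))) \<partial>lborel) \<le> (\<integral>\<^sup>+z. (\<Sum>j. a j z) + (\<Sum>j. b j z) \<partial>lborel)"
    using pt by (intro nn_integral_mono_AE) auto
  also have "\<dots> = (\<Sum>j. \<integral>\<^sup>+z. a j z \<partial>lborel) + (\<Sum>j. \<integral>\<^sup>+z. b j z \<partial>lborel)"
    by (simp add: nn_integral_add nn_integral_suminf)
  finally have le: "(\<integral>\<^sup>+z. ennreal (\<phi> (norm (z::'a))) \<partial>lborel) \<le> (\<Sum>j. \<integral>\<^sup>+z. a j z \<partial>lborel) + (\<Sum>j. \<integral>\<^sup>+z. b j z \<partial>lborel)" .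
  have "(\<Sum>j. \<integral>\<^sup>+z. a j z \<partial>lborel) < \<infinity>"
    unfolding ia using v nn s1
    by (subst suminf_ennreal2) (auto intro!: mult_nonneg_nonneg summable_mult)
  moreover have "(\<Sum>j. \<integral>\<^sup>+z. b j z \<partial>lborel) < \<infinity>"
    unfolding ib using v nn s2
    by (subst suminf_ennreal2) (auto intro!: mult_nonneg_nonneg summable_mult simp del: power_Suc)
  ultimately show ?thesis using le by (simp add: order.strict_trans1 ennreal_add_less_top[symmetric])
qed

section \<open>Kernel, increments and integration by parts\<close>

locale fractional_kernel =
  fixes s :: real and dimension :: "'n::finite itself"
  assumes s: "0 < s" "s < 1"
begin

definition kern :: "real ^ 'n \<Rightarrow> real ^ 'n" where
  "kern z = norm z powr (- (CARD('n) + s + 1)) *\<^sub>R z"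

text \<open>Majorises an increment of a bounded Lipschitz function times
  \<open>norm (kern z)\<close>: near 0 the Lipschitz bound gains one power of \<open>norm z\<close>,
  far away boundedness suffices.\<close>

definition kap :: "real ^ 'n \<Rightarrow> real" where
  "kap z = min 1 (norm z) * norm z powr (- (CARD('n) + s))"

lemma norm_kern: "norm (kern z) = norm z powr (- (CARD('n) + s))"
proof (cases "z = 0")
  case False
  have "norm (kern z) = norm z powr (- (CARD('n) + s + 1)) * norm z powr 1" using False by (simp add: kern_def)
  also have "\<dots> = norm z powr (- (CARD('n) + s))" by (subst powr_add[symmetric]) simp
  finally show ?thesis .
qed (simp add: kern_def)

lemma kern_minus: "kern (- z) = - kern z" by (simp add: kern_def)

lemma kern_measurable [measurable]: "kern \<in> borel_measurable borel"
  unfolding kern_def by measurable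

lemma kap_measurable [measurable]: "kap \<in> borel_measurable borel"
  unfolding kap_def by measurable

lemma kap_nonneg: "0 \<le> kap z" by (simp add: kap_def)

lemma kap_minus: "kap (- z) = kap z" by (simp add: kap_def)

text \<open>This is where \<open>0 < s < 1\<close> enters: the dyadic sums are geometric with ratio
  \<open>2 powr (- s)\<close> at infinity and \<open>2 powr (s - 1)\<close> at the origin.\<close>

lemma kap_integrable: "integrable lborel kap"
proof (rule integrableI_nonneg)
  define n where "n = real CARD('n)"
  have n: "n \<ge> 1" unfolding n_def by (simp add: Suc_leI)
  define \<phi> where "\<phi> = (\<lambda>r::real. min 1 r * r powr (- (n + s)))"
  have \<phi>': "\<phi> r = (if r \<le> 1 then r powr (1 - n - s) else r powr (- (n + s)))" if "r > 0" for r
    using that powr_add[of r 1 "- (n + s)"] by (auto simp: \<phi>_def min_def algebra_simps)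
  have "(\<integral>\<^sup>+z. ennreal ((\<lambda>r. if r \<le> 0 then 0 else \<phi> r) (norm (z::real^'n))) \<partial>lborel) < \<infinity>"
  \<comment> \<open>The profile is cut off at \<open>r <= 0\<close> because nonnegativity is asked
    on all reals, while \<open>min 1 r\<close> is negative for negative \<open>r\<close>.\<close>
  proof (rule nn_integral_radial_dyadic)
    fix a b :: real assume ab: "0 < a" "a \<le> b"
    have "\<phi> b \<le> \<phi> a"
    proof (cases "b \<le> 1")
      case True
      have "b powr (1 - n - s) \<le> a powr (1 - n - s)" using ab n s by (intro powr_mono2') auto
      thus ?thesis using ab True by (simp add: \<phi>')
    next
      case False
      have 1: "b powr (- (n + s)) \<le> max a 1 powr (- (n + s))" using ab n s False by (intro powr_mono2') auto
      have 2: "max a 1 powr (- (n + s)) \<le> \<phi> a"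
      proof (cases "a \<le> 1")
        case True
        have "1 powr (1 - n - s) \<le> a powr (1 - n - s)" using ab n s True by (intro powr_mono2') auto
        thus ?thesis using ab True by (simp add: \<phi>')
      qed (use ab in \<open>simp add: \<phi>'\<close>)
      show ?thesis using 1 2 False ab by (simp add: \<phi>')
    qed
    thus "(if b \<le> 0 then 0 else \<phi> b) \<le> (if a \<le> 0 then 0 else \<phi> a)" using ab by simp
  next
    fix a show "0 \<le> (if a \<le> 0 then 0 else \<phi> a)" by (simp add: \<phi>_def)
  next
    show "(\<lambda>r. if r \<le> 0 then 0 else \<phi> r) \<in> borel_measurable borel" unfolding \<phi>_def by measurable
  next
    have "\<phi> (2^j) * 2^(j * CARD('n)) = (2 powr (- s))^j" for j
    proof -
      have "\<phi> (2^j) = (2^j) powr (- (n + s))" by (simp add: \<phi>_def)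
      also have "\<dots> = 2 powr (- (n + s) * j)" by (simp add: powr_powr mult.commute flip: powr_realpow)
      finally have "\<phi> (2^j) * 2^(j * CARD('n)) = 2 powr (- (n + s) * j) * 2 powr (n * j)"
        by (simp add: n_def mult.commute flip: powr_realpow)
      also have "\<dots> = 2 powr (- s * j)" by (simp add: algebra_simps flip: powr_add)
      also have "\<dots> = (2 powr (- s))^j" by (simp add: powr_powr flip: powr_realpow)
      finally show ?thesis .
    qed
    thus "summable (\<lambda>j. (if 2^j \<le> (0::real) then 0 else \<phi> (2^j)) * 2^(j * DIM(real^'n)))"
    proof -
      have "\<not> 2^j \<le> (0::real)" for j :: nat by (simp add: not_le)
      thus ?thesis using s powr_less_mono[of "- s" 0 2] \<open>\<And>j. \<phi> (2^j) * 2^(j * CARD('n)) = (2 powr (- s))^j\<close>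
        by (simp add: summable_geometric)
    qed
  next
    have "\<phi> (1 / 2^Suc j) * (1 / 2^j) ^ CARD('n) = 2 powr (n + s - 1) * (2 powr (s - 1))^j" for j
    proof -
      have "(2::real)^Suc j = 2 powr (real j + 1)" using powr_realpow[of 2 "Suc j"] by (simp add: add.commute del: power_Suc)
      hence eq: "(1 / 2^Suc j :: real) = 2 powr (- (real j + 1))" by (simp only: powr_minus_divide)
      have "0 < (1 / 2^Suc j :: real)" "(1 / 2^Suc j :: real) \<le> 1"
        using one_le_power[of "2::real" "Suc j"] by (simp_all add: divide_le_eq_1 del: power_Suc)
      hence "\<phi> (1 / 2^Suc j) = (1 / 2^Suc j) powr (1 - n - s)" by (simp add: \<phi>' del: power_Suc)
      also have "\<dots> = (2 powr (- (real j + 1))) powr (1 - n - s)" by (simp only: eq)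
      also have "\<dots> = 2 powr ((- (real j + 1)) * (1 - n - s))" by (simp add: powr_powr)
      finally have 1: "\<phi> (1 / 2^Suc j) = 2 powr ((- (real j + 1)) * (1 - n - s))" .
      have 2: "(1 / 2^j :: real) ^ CARD('n) = 2 powr (- (real j * n))"
        by (simp add: n_def powr_minus powr_powr power_one_over power_mult field_simps flip: powr_realpow)
      have "\<phi> (1 / 2^Suc j) * (1 / 2^j) ^ CARD('n) = 2 powr ((- (real j + 1)) * (1 - n - s)) * 2 powr (- (real j * n))"
        by (simp only: 1 2)
      also have "\<dots> = 2 powr (n + s - 1) * 2 powr ((s - 1) * j)"
        by (simp add: algebra_simps flip: powr_add)
      also have "2 powr ((s - 1) * j) = (2 powr (s - 1))^j" by (simp add: powr_powr flip: powr_realpow)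
      finally show ?thesis .
    qed
    moreover have "(if 1 / 2^Suc j \<le> (0::real) then 0 else \<phi> (1 / 2^Suc j)) = \<phi> (1 / 2^Suc j)" for j :: nat
      by (rule if_not_P) (simp add: not_le)
    moreover have "\<bar>2 powr (s - 1)\<bar> < (1::real)" using s powr_less_mono[of "s - 1" 0 2] by simp
    ultimately show "summable (\<lambda>j. (if 1 / 2^Suc j \<le> (0::real) then 0 else \<phi> (1 / 2^Suc j)) * (1 / 2^j)^DIM(real^'n))"
      by (simp only: DIM_cart DIM_real mult_1_right) (intro summable_mult summable_geometric, simp)
  qed
  also have "(\<lambda>z::real^'n. ennreal ((\<lambda>r. if r \<le> 0 then 0 else \<phi> r) (norm z))) = (\<lambda>z. ennreal (kap z))"
    by (auto simp: fun_eq_iff kap_def \<phi>_def n_def)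
  finally show "(\<integral>\<^sup>+z. ennreal (kap z) \<partial>lborel) < \<infinity>" .
qed (auto simp: kap_nonneg)

text \<open>Bounded and Lipschitz with a single constant, in the form matched to \<open>kap\<close>.
  The class contains the test functions and also cosine and sine, so the formulas for the gradient
  and integration by parts extend to plane waves.\<close>

definition osc_bounded :: "real \<Rightarrow> (real ^ 'n \<Rightarrow> real) \<Rightarrow> bool" where
  "osc_bounded M f \<longleftrightarrow> (\<forall>x. \<bar>f x\<bar> \<le> M) \<and> (\<forall>x y. \<bar>f x - f y\<bar> \<le> M * min 1 (norm (x - y)))"

lemma osc_boundedD:
  assumes "osc_bounded M f"
  shows "\<bar>f x\<bar> \<le> M" "\<bar>f x - f y\<bar> \<le> M * min 1 (norm (x - y))"
  using assms by (auto simp: osc_bounded_def)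

lemma osc_bounded_nonneg: "osc_bounded M f \<Longrightarrow> 0 \<le> M"
  using osc_boundedD(1)[of M f 0] by linarith

lemma osc_bounded_continuous: assumes "osc_bounded M f" shows "continuous_on UNIV f"
proof (rule lipschitz_on_continuous_on[of M])
  show "M-lipschitz_on UNIV f"
  proof (rule lipschitz_onI)
    fix x y :: "real ^ 'n"
    have "M * min 1 (norm (x - y)) \<le> M * norm (x - y)"
      using osc_bounded_nonneg[OF assms] by (intro mult_left_mono) auto
    thus "dist (f x) (f y) \<le> M * dist x y"
      using osc_boundedD(2)[OF assms, of x y] by (simp add: dist_norm)
  qed (rule osc_bounded_nonneg[OF assms])
qed

lemma osc_bounded_measurable: "osc_bounded M f \<Longrightarrow> f \<in> borel_measurable borel"
  using osc_bounded_continuous borel_measurable_continuous_onI by blast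

lemma norm_increment_kern_le:
  assumes "osc_bounded M f"
  shows "\<bar>f (x + z) - f x\<bar> * norm (kern z) \<le> M * kap z"
proof -
  have "\<bar>f (x + z) - f x\<bar> * norm (kern z) \<le> (M * min 1 (norm z)) * norm (kern z)"
    using osc_boundedD(2)[OF assms, of "x + z" x] by (intro mult_right_mono) auto
  thus ?thesis by (simp add: norm_kern kap_def mult.assoc)
qed

lemma increment_kern_integrable:
  assumes f: "osc_bounded M f"
  shows "integrable lborel (\<lambda>z. (f (x + z) - f x) *\<^sub>R kern z)"
proof (rule Bochner_Integration.integrable_bound)
  note [measurable] = osc_bounded_measurable[OF f]
  show "integrable lborel (\<lambda>z. M * kap z)" by (intro integrable_mult_right kap_integrable)
  show "(\<lambda>z. (f (x + z) - f x) *\<^sub>R kern z) \<in> borel_measurable lborel" by measurable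
  have "0 \<le> M * kap z" for z using osc_bounded_nonneg[OF f] kap_nonneg by simp
  thus "AE z in lborel. norm ((f (x + z) - f x) *\<^sub>R kern z) \<le> norm (M * kap z)"
    using norm_increment_kern_le[OF f] by (simp add: kap_nonneg)
qed

text \<open>The fractional gradient up to the constant \<open>cst\<close>, rewritten over increments
  and for Borel Lebesgue measure, to which Fubini and the substitution rules apply.\<close>

definition fgrad :: "(real ^ 'n \<Rightarrow> real) \<Rightarrow> real ^ 'n \<Rightarrow> real ^ 'n" where
  "fgrad f x = (LINT z|lborel. (f (x + z) - f x) *\<^sub>R kern z)"

text \<open>A common majorant: it dominates \<open>fgrad f\<close> and, times the supremum of the
  other factor, the commutator of the gradient with \<open>f\<close>.\<close>

definition fosc :: "(real ^ 'n \<Rightarrow> real) \<Rightarrow> real ^ 'n \<Rightarrow> real" where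
  "fosc f x = (LINT z|lborel. \<bar>f (x + z) - f x\<bar> * norm (kern z))"

definition cst :: real where
  "cst = (real CARD('n) - 1 + s) / riesz_const (real CARD('n)) (1 - s)"

lemma cst_pos: "cst > 0"
proof -
  have "real CARD('n) \<ge> 1" by (simp add: Suc_leI)
  hence "0 < real CARD('n) - 1 + s" "1 - s < real CARD('n)" using s by linarith+
  thus ?thesis unfolding cst_def riesz_const_def using s by (auto intro!: divide_pos_pos mult_pos_pos Gamma_real_pos)
qed

lemma fgrad_reflect:
  assumes f: "osc_bounded M f"
  shows "(LINT z|lborel. (f (x - z) - f x) *\<^sub>R kern z) = - fgrad f x"
proof -
  note [measurable] = osc_bounded_measurable[OF f]
  have "(LINT z|lborel. (f (x - z) - f x) *\<^sub>R kern z) = (LINT z|lborel. (\<lambda>z. - ((f (x + z) - f x) *\<^sub>R kern z)) (0 - z))"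
    by (simp add: kern_minus)
  also have "\<dots> = (LINT z|lborel. - ((f (x + z) - f x) *\<^sub>R kern z))"
    by (rule integral_lborel_reflect) measurable
  finally show ?thesis by (simp add: fgrad_def)
qed

lemma frac_grad_eq_fgrad:
  assumes f: "osc_bounded M f"
  shows "frac_grad s f x = cst *\<^sub>R fgrad f x"
proof -
  note [measurable] = osc_bounded_measurable[OF f]
  have "(LINT y|lebesgue. ((f x - f y) / norm (x - y) powr (real CARD('n) + s + 1)) *\<^sub>R (x - y))
      = (LINT y|lebesgue. (f x - f y) *\<^sub>R kern (x - y))"
    unfolding kern_def powr_minus_divide by simp
  also have "\<dots> = (LINT y|lborel. (f x - f y) *\<^sub>R kern (x - y))"
    by (rule integral_completion) measurable
  also have "\<dots> = (LINT z|lborel. (\<lambda>y. (f x - f y) *\<^sub>R kern (x - y)) (x + z))"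
    by (rule integral_lborel_translate[symmetric]) measurable
  also have "\<dots> = fgrad f x"
    unfolding fgrad_def by (rule Bochner_Integration.integral_cong) (auto simp: kern_minus algebra_simps)
  finally show ?thesis by (simp add: frac_grad_def cst_def)
qed

lemma fgrad_measurable [measurable (raw)]:
  assumes [measurable]: "f \<in> borel_measurable borel"
  shows "fgrad f \<in> borel_measurable borel"
proof -
  have "(\<lambda>x. LINT z|lborel. (f (x + z) - f x) *\<^sub>R kern z) \<in> borel_measurable lborel" by measurable
  thus ?thesis by (simp add: fgrad_def[abs_def])
qed

lemma fosc_measurable [measurable (raw)]:
  assumes [measurable]: "f \<in> borel_measurable borel"
  shows "fosc f \<in> borel_measurable borel"
proof -
  have "(\<lambda>x. LINT z|lborel. \<bar>f (x + z) - f x\<bar> * norm (kern z)) \<in> borel_measurable lborel" by measurable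
  thus ?thesis by (simp add: fosc_def[abs_def])
qed

lemma fosc_nonneg: "0 \<le> fosc f x" by (simp add: fosc_def)

lemma norm_fgrad_le_fosc: "norm (fgrad f x) \<le> fosc f x"
  unfolding fgrad_def fosc_def
  using integral_norm_bound[of lborel "\<lambda>z. (f (x + z) - f x) *\<^sub>R kern z"] by simp

definition kap_mass :: real where "kap_mass = (LINT z|lborel. kap z)"

lemma kap_mass_nonneg: "0 \<le> kap_mass" by (simp add: kap_mass_def kap_nonneg)

lemma abs_increment_kern_integrable:
  assumes f: "osc_bounded M f"
  shows "integrable lborel (\<lambda>z. \<bar>f (x + z) - f x\<bar> * norm (kern z))"
  using integrable_norm[OF increment_kern_integrable[OF f, of x]] by simp

lemma fosc_le: assumes f: "osc_bounded M f" shows "fosc f x \<le> M * kap_mass"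
proof -
  have "fosc f x \<le> (LINT z|lborel. M * kap z)"
    unfolding fosc_def by (intro integral_mono abs_increment_kern_integrable[OF f] integrable_mult_right kap_integrable
        norm_increment_kern_le[OF f])
  thus ?thesis by (simp add: kap_mass_def)
qed

text \<open>For fixed \<open>z\<close> the increment vanishes unless \<open>x\<close> or
  \<open>x + z\<close> lies in the support ball, so the integral over \<open>x\<close> costs at most
  twice the volume of that ball.\<close>

lemma increment_kern_integrable_pair:
  assumes f: "osc_bounded M f" and supp: "\<And>x. norm x > R \<Longrightarrow> f x = 0"
  shows "integrable (lborel \<Otimes>\<^sub>M lborel) (\<lambda>(x, z). \<bar>f (x + z) - f x\<bar> * norm (kern z))"
proof (rule integrableI_bounded)
  note [measurable] = osc_bounded_measurable[OF f]
  show "(\<lambda>(x, z). \<bar>f (x + z) - f x\<bar> * norm (kern z)) \<in> borel_measurable (lborel \<Otimes>\<^sub>M lborel)" by measurable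
  define v where "v = measure lborel (cball (0::real^'n) R)"
  have v: "emeasure lborel (cball a R) = ennreal v" for a :: "real^'n"
  proof -
    have "emeasure lborel (cball a R) = ennreal (measure lborel (cball a R))"
      by (intro emeasure_eq_ennreal_measure) (use emeasure_lborel_cball_finite[of a R] in auto)
    also have "measure lborel (cball a R) = v"
      unfolding v_def by (cases "R \<ge> 0") (auto simp: content_cball)
    finally show ?thesis .
  qed
  have M: "0 \<le> M" by (rule osc_bounded_nonneg[OF f])
  have inner: "(\<integral>\<^sup>+x. ennreal (\<bar>f (x + z) - f x\<bar> * norm (kern z)) \<partial>lborel) \<le> ennreal (2 * M * v * kap z)" for z
  proof -
    have "(\<integral>\<^sup>+x. ennreal (\<bar>f (x + z) - f x\<bar> * norm (kern z)) \<partial>lborel)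
       \<le> (\<integral>\<^sup>+x. ennreal (M * kap z) * (indicator (cball 0 R) x + indicator (cball (- z) R) x) \<partial>lborel)"
    proof (rule nn_integral_mono)
      fix x
      show "ennreal (\<bar>f (x + z) - f x\<bar> * norm (kern z)) \<le> ennreal (M * kap z) * (indicator (cball 0 R) x + indicator (cball (- z) R) x)"
      proof (cases "norm x \<le> R \<or> norm (x + z) \<le> R")
        case True
        have "ennreal (\<bar>f (x + z) - f x\<bar> * norm (kern z)) \<le> ennreal (M * kap z) * 1"
          using norm_increment_kern_le[OF f, of x z] by (simp add: ennreal_leI)
        also have "\<dots> \<le> ennreal (M * kap z) * (indicator (cball 0 R) x + indicator (cball (- z) R) x)"
          using True by (intro mult_left_mono) (auto simp: indicator_def dist_norm norm_minus_commute add.commute)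
        finally show ?thesis .
      next
        case False
        thus ?thesis using supp[of x] supp[of "x + z"] by simp
      qed
    qed
    also have "\<dots> = ennreal (M * kap z) * (ennreal v + ennreal v)"
    proof -
      have [measurable]: "cball a R \<in> sets borel" for a :: "real^'n" by (rule borel_closed) simp
      show ?thesis by (subst nn_integral_cmult, measurable, subst nn_integral_add) (auto simp: v)
    qed
    also have "\<dots> = ennreal (2 * M * v * kap z)"
      using M kap_nonneg[of z] by (simp add: v_def ennreal_mult[symmetric] ennreal_plus[symmetric] mult_ac del: ennreal_plus)
    finally show ?thesis .
  qed
  have "(\<integral>\<^sup>+p. ennreal (norm (case p of (x, z) \<Rightarrow> \<bar>f (x + z) - f x\<bar> * norm (kern z))) \<partial>(lborel \<Otimes>\<^sub>M lborel))
      = (\<integral>\<^sup>+z. \<integral>\<^sup>+x. ennreal (\<bar>f (x + z) - f x\<bar> * norm (kern z)) \<partial>lborel \<partial>lborel)"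
    by (subst lborel_pair.nn_integral_snd[symmetric]) (simp_all add: abs_mult)
  also have "\<dots> \<le> (\<integral>\<^sup>+z. ennreal (2 * M * v * kap z) \<partial>lborel)" by (intro nn_integral_mono inner)
  also have "\<dots> = ennreal (LINT z|lborel. 2 * M * v * kap z)"
    by (rule nn_integral_eq_integral) (auto simp: M v_def kap_nonneg intro: kap_integrable integrable_mult_right)
  also have "\<dots> < \<infinity>" by simp
  finally show "(\<integral>\<^sup>+p. ennreal (norm (case p of (x, z) \<Rightarrow> \<bar>f (x + z) - f x\<bar> * norm (kern z))) \<partial>(lborel \<Otimes>\<^sub>M lborel)) < \<infinity>" .
qed

lemma fosc_integrable:
  assumes f: "osc_bounded M f" and supp: "\<And>x. norm x > R \<Longrightarrow> f x = 0"
  shows "integrable lborel (fosc f)"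
  using lborel_pair.integrable_fst[OF increment_kern_integrable_pair[OF f supp]] by (simp add: fosc_def[abs_def])

lemma Ltwo_borelI:
  fixes g :: "'a::euclidean_space \<Rightarrow> 'b::euclidean_space"
  assumes "g \<in> borel_measurable borel" "integrable lborel h" "\<And>x. (norm (g x))\<^sup>2 \<le> h x"
  shows "g \<in> Ltwo"
proof (rule Ltwo_I_bound)
  show "g \<in> borel_measurable lebesgue" using assms(1) by (intro measurable_completion) simp
  show "integrable lebesgue h"
    using assms(2) by (subst integrable_completion) auto
qed (use assms in auto)

text \<open>Integrable and bounded by \<open>M * kap_mass\<close>, hence square-integrable.\<close>

lemma fosc_Ltwo:
  assumes f: "osc_bounded M f" and supp: "\<And>x. norm x > R \<Longrightarrow> f x = 0"
  shows "fosc f \<in> Ltwo"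
proof (rule Ltwo_borelI)
  note [measurable] = osc_bounded_measurable[OF f]
  show "fosc f \<in> borel_measurable borel" by measurable
  show "integrable lborel (\<lambda>x. M * kap_mass * fosc f x)"
    by (intro integrable_mult_right fosc_integrable[OF f supp])
  show "(norm (fosc f x))\<^sup>2 \<le> M * kap_mass * fosc f x" for x
    using mult_right_mono[OF fosc_le[OF f, of x] fosc_nonneg[of f x]] by (simp add: power2_eq_square)
qed

lemma fgrad_Ltwo:
  assumes f: "osc_bounded M f" and supp: "\<And>x. norm x > R \<Longrightarrow> f x = 0"
  shows "fgrad f \<in> Ltwo"
proof (rule Ltwo_I_bound)
  note [measurable] = osc_bounded_measurable[OF f]
  show "fgrad f \<in> borel_measurable lebesgue"
    by (intro measurable_completion) simp
  show "integrable lebesgue (\<lambda>x. (norm (fosc f x))\<^sup>2)" by (rule Ltwo_integrable[OF fosc_Ltwo[OF f supp]])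
  show "AE x in lebesgue. (norm (fgrad f x))\<^sup>2 \<le> (norm (fosc f x))\<^sup>2"
    using norm_fgrad_le_fosc fosc_nonneg by (intro AE_I2 power_mono) auto
qed

lemma fgrad_integrable:
  assumes f: "osc_bounded M f" and supp: "\<And>x. norm x > R \<Longrightarrow> f x = 0"
  shows "integrable lborel (fgrad f)"
proof (rule Bochner_Integration.integrable_bound[OF fosc_integrable[OF f supp]])
  note [measurable] = osc_bounded_measurable[OF f]
  show "fgrad f \<in> borel_measurable lborel" by simp
  show "AE x in lborel. norm (fgrad f x) \<le> norm (fosc f x)"
    using norm_fgrad_le_fosc fosc_nonneg by simp
qed

lemma bounded_support_integrable:
  fixes f :: "real ^ 'n \<Rightarrow> real"
  assumes f: "osc_bounded M f" and supp: "\<And>x. norm x > R \<Longrightarrow> f x = 0"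
  shows "integrable lborel f"
proof (rule Bochner_Integration.integrable_bound)
  show "integrable lborel (\<lambda>x::real^'n. M * indicator (cball 0 R) x :: real)"
    using emeasure_lborel_cball_finite[of "0::real^'n" R] by (intro integrable_mult_right integrable_real_indicator) auto
  show "f \<in> borel_measurable lborel" using osc_bounded_measurable[OF f] by simp
  show "AE x in lborel. norm (f x) \<le> norm (M * indicator (cball 0 R) x)"
    using osc_boundedD(1)[OF f] supp osc_bounded_nonneg[OF f] by (intro AE_I2) (auto simp: indicator_def abs_mult)
qed

text \<open>The increments are moved to the other factor by a translation, for each fixed \<open>z\<close>.\<close>

lemma fgrad_by_parts:
  assumes f: "osc_bounded M f" and supp: "\<And>x. norm x > R \<Longrightarrow> f x = 0" and g: "osc_bounded M' g"
  shows "(LINT x|lborel. g x *\<^sub>R fgrad f x) = - (LINT x|lborel. f x *\<^sub>R fgrad g x)"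
proof -
  note [measurable] = osc_bounded_measurable[OF f] osc_bounded_measurable[OF g]
  have fi: "integrable lborel f" by (rule bounded_support_integrable[OF f supp])
  have I1: "integrable (lborel \<Otimes>\<^sub>M lborel) (\<lambda>(x, z). g x *\<^sub>R (f (x + z) - f x) *\<^sub>R kern z)"
  proof (rule Bochner_Integration.integrable_bound)
    show "integrable (lborel \<Otimes>\<^sub>M lborel) (\<lambda>p. M' * (case p of (x, z) \<Rightarrow> \<bar>f (x + z) - f x\<bar> * norm (kern z)))"
      by (intro integrable_mult_right increment_kern_integrable_pair[OF f supp])
    show "AE p in lborel \<Otimes>\<^sub>M lborel. norm (case p of (x, z) \<Rightarrow> g x *\<^sub>R (f (x + z) - f x) *\<^sub>R kern z)
        \<le> norm (M' * (case p of (x, z) \<Rightarrow> \<bar>f (x + z) - f x\<bar> * norm (kern z)))"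
    proof (rule AE_I2, clarify)
      fix x z
      have "\<bar>g x\<bar> * (\<bar>f (x + z) - f x\<bar> * norm (kern z)) \<le> M' * (\<bar>f (x + z) - f x\<bar> * norm (kern z))"
        using osc_boundedD(1)[OF g] by (intro mult_right_mono) auto
      thus "norm (g x *\<^sub>R (f (x + z) - f x) *\<^sub>R kern z) \<le> norm (M' * (\<bar>f (x + z) - f x\<bar> * norm (kern z)))"
        using osc_bounded_nonneg[OF g] by (simp add: abs_mult)
    qed
  qed measurable
  have I2: "integrable (lborel \<Otimes>\<^sub>M lborel) (\<lambda>(x, z). f x *\<^sub>R (g (x - z) - g x) *\<^sub>R kern z)"
  proof (rule Bochner_Integration.integrable_bound)
    show "integrable (lborel \<Otimes>\<^sub>M lborel) (\<lambda>(x, z). f x * (M' * kap z))"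
    proof (rule lborel_pair.Fubini_integrable)
      show "integrable lborel (\<lambda>x. LINT z|lborel. norm (case (x, z) of (x, z) \<Rightarrow> f x * (M' * kap z)))"
        using osc_bounded_nonneg[OF g] integrable_norm[OF fi] by (simp add: abs_mult kap_nonneg)
    qed (auto simp: kap_integrable)
    have "norm (f x *\<^sub>R (g (x - z) - g x) *\<^sub>R kern z) \<le> norm (f x * (M' * kap z))" for x z
      using mult_left_mono[OF norm_increment_kern_le[OF g, of x "- z"], of "\<bar>f x\<bar>"] osc_bounded_nonneg[OF g] kap_nonneg[of z]
      by (simp add: abs_mult kern_minus kap_minus mult.assoc)
    thus "AE p in lborel \<Otimes>\<^sub>M lborel. norm (case p of (x, z) \<Rightarrow> f x *\<^sub>R (g (x - z) - g x) *\<^sub>R kern z)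
        \<le> norm (case p of (x, z) \<Rightarrow> f x * (M' * kap z))" by auto
  qed measurable
  have gf: "integrable lborel (\<lambda>x. f x * h x)" if "\<And>x. \<bar>h x\<bar> \<le> M'" and [measurable]: "h \<in> borel_measurable borel" for h
    by (rule Bochner_Integration.integrable_bound[of lborel "\<lambda>x. M' * f x"])
       (use that(1) fi osc_bounded_nonneg[OF g] in \<open>auto simp: abs_mult mult.commute intro!: AE_I2 mult_left_mono\<close>,
        metis abs_ge_zero mult.commute mult_left_mono)
  have swap: "(LINT x|lborel. g x *\<^sub>R (f (x + z) - f x) *\<^sub>R kern z) = (LINT x|lborel. f x *\<^sub>R (g (x - z) - g x) *\<^sub>R kern z)" for z
  proof -
    have i1: "integrable lborel (\<lambda>x. f x * g (x - z))" "integrable lborel (\<lambda>x. f x * g x)"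
      using osc_boundedD(1)[OF g] by (auto intro!: gf)
    have i2: "integrable lborel (\<lambda>x. f (x + z) * g x)"
      using integrable_lborel_translate[of "\<lambda>x. f x * g (x - z)" z] i1 by (simp add: add.commute)
    have e: "(LINT x|lborel. f (x + z) * g x) = (LINT x|lborel. f x * g (x - z))"
      using integral_lborel_translate[of "\<lambda>x. f x * g (x - z)" z] by (simp add: add.commute)
    have "(LINT x|lborel. g x *\<^sub>R (f (x + z) - f x) *\<^sub>R kern z) = (LINT x|lborel. (f (x + z) * g x - f x * g x) *\<^sub>R kern z)"
      by (intro Bochner_Integration.integral_cong) (auto simp: algebra_simps)
    also have "\<dots> = (LINT x|lborel. f (x + z) * g x - f x * g x) *\<^sub>R kern z"
      by (intro integral_scaleR_left) (use i1 i2 in auto)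
    also have "(LINT x|lborel. f (x + z) * g x - f x * g x) = (LINT x|lborel. f x * g (x - z) - f x * g x)"
      using i1 i2 e by simp
    also have "\<dots> *\<^sub>R kern z = (LINT x|lborel. (f x * g (x - z) - f x * g x) *\<^sub>R kern z)"
      by (intro integral_scaleR_left[symmetric]) (use i1 in auto)
    also have "\<dots> = (LINT x|lborel. f x *\<^sub>R (g (x - z) - g x) *\<^sub>R kern z)"
      by (intro Bochner_Integration.integral_cong) (auto simp: algebra_simps)
    finally show ?thesis .
  qed
  have "(LINT x|lborel. g x *\<^sub>R fgrad f x) = (LINT x|lborel. LINT z|lborel. g x *\<^sub>R (f (x + z) - f x) *\<^sub>R kern z)"
    by (simp only: fgrad_def integral_scaleR_right)
  also have "\<dots> = (LINT z|lborel. LINT x|lborel. g x *\<^sub>R (f (x + z) - f x) *\<^sub>R kern z)"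
    by (rule lborel_pair.Fubini_integral[OF I1, symmetric])
  also have "\<dots> = (LINT z|lborel. LINT x|lborel. f x *\<^sub>R (g (x - z) - g x) *\<^sub>R kern z)" by (simp only: swap)
  also have "\<dots> = (LINT x|lborel. LINT z|lborel. f x *\<^sub>R (g (x - z) - g x) *\<^sub>R kern z)"
    by (rule lborel_pair.Fubini_integral[OF I2])
  also have "\<dots> = (LINT x|lborel. f x *\<^sub>R (- fgrad g x))"
    by (simp only: integral_scaleR_right fgrad_reflect[OF g])
  finally show ?thesis by simp
qed

section \<open>The commutator of the gradient with a multiplication\<close>

definition commutator :: "(real ^ 'n \<Rightarrow> real) \<Rightarrow> (real ^ 'n \<Rightarrow> real) \<Rightarrow> real ^ 'n \<Rightarrow> real ^ 'n" where
  "commutator \<phi> f x = (LINT z|lborel. ((\<phi> (x + z) - \<phi> x) * f (x + z)) *\<^sub>R kern z)"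

lemma commutator_integrand_integrable:
  assumes p: "osc_bounded M \<phi>" and f: "osc_bounded M' f"
  shows "integrable lborel (\<lambda>z. ((\<phi> (x + z) - \<phi> x) * f (x + z)) *\<^sub>R kern z)"
proof (rule Bochner_Integration.integrable_bound)
  note [measurable] = osc_bounded_measurable[OF f] osc_bounded_measurable[OF p]
  show "(\<lambda>z. ((\<phi> (x + z) - \<phi> x) * f (x + z)) *\<^sub>R kern z) \<in> borel_measurable lborel" by measurable
  show "integrable lborel (\<lambda>z. M' * (\<bar>\<phi> (x + z) - \<phi> x\<bar> * norm (kern z)))"
    by (intro integrable_mult_right abs_increment_kern_integrable[OF p])
  show "AE z in lborel. norm (((\<phi> (x + z) - \<phi> x) * f (x + z)) *\<^sub>R kern z) \<le> norm (M' * (\<bar>\<phi> (x + z) - \<phi> x\<bar> * norm (kern z)))"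
  proof (rule AE_I2)
    fix z
    have "\<bar>f (x + z)\<bar> * (\<bar>\<phi> (x + z) - \<phi> x\<bar> * norm (kern z)) \<le> M' * (\<bar>\<phi> (x + z) - \<phi> x\<bar> * norm (kern z))"
      using osc_boundedD(1)[OF f] by (intro mult_right_mono) auto
    thus "norm (((\<phi> (x + z) - \<phi> x) * f (x + z)) *\<^sub>R kern z) \<le> norm (M' * (\<bar>\<phi> (x + z) - \<phi> x\<bar> * norm (kern z)))"
      using osc_bounded_nonneg[OF f] by (simp add: abs_mult mult_ac)
  qed
qed

text \<open>In the remainder the increment falls on \<open>\<phi>\<close> alone. It tames the
  singularity of the kernel, so the commutator is bounded in terms of \<open>f\<close> without
  derivatives of \<open>f\<close>.\<close>

lemma fgrad_mult:
  assumes p: "osc_bounded M \<phi>" and f: "osc_bounded M' f"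
  shows "fgrad (\<lambda>x. \<phi> x * f x) x = \<phi> x *\<^sub>R fgrad f x + commutator \<phi> f x"
proof -
  have "fgrad (\<lambda>x. \<phi> x * f x) x
      = (LINT z|lborel. \<phi> x *\<^sub>R (f (x + z) - f x) *\<^sub>R kern z + ((\<phi> (x + z) - \<phi> x) * f (x + z)) *\<^sub>R kern z)"
    unfolding fgrad_def by (intro Bochner_Integration.integral_cong) (auto simp: algebra_simps)
  also have "\<dots> = (LINT z|lborel. \<phi> x *\<^sub>R (f (x + z) - f x) *\<^sub>R kern z) + commutator \<phi> f x"
    unfolding commutator_def
    by (intro Bochner_Integration.integral_add integrable_scaleR_right increment_kern_integrable[OF f] commutator_integrand_integrable[OF p f])
  also have "(LINT z|lborel. \<phi> x *\<^sub>R (f (x + z) - f x) *\<^sub>R kern z) = \<phi> x *\<^sub>R fgrad f x"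
    unfolding fgrad_def by (rule integral_scaleR_right)
  finally show ?thesis .
qed

lemma commutator_measurable [measurable (raw)]:
  assumes [measurable]: "\<phi> \<in> borel_measurable borel" "f \<in> borel_measurable borel"
  shows "commutator \<phi> f \<in> borel_measurable borel"
proof -
  have "(\<lambda>x. LINT z|lborel. ((\<phi> (x + z) - \<phi> x) * f (x + z)) *\<^sub>R kern z) \<in> borel_measurable lborel" by measurable
  thus ?thesis by (simp add: commutator_def[abs_def])
qed

text \<open>Meant for plane waves \<open>f\<close>: only the supremum of \<open>f\<close> enters, so
  the bound does not see the frequency.\<close>

lemma norm_commutator_le_sup:
  assumes p: "osc_bounded M \<phi>" and f: "osc_bounded M' f" and B: "\<And>x. \<bar>f x\<bar> \<le> B"
  shows "norm (commutator \<phi> f x) \<le> B * fosc \<phi> x"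
proof -
  have "norm (commutator \<phi> f x) \<le> (LINT z|lborel. norm (((\<phi> (x + z) - \<phi> x) * f (x + z)) *\<^sub>R kern z))"
    unfolding commutator_def by (rule integral_norm_bound)
  also have "\<dots> \<le> (LINT z|lborel. B * (\<bar>\<phi> (x + z) - \<phi> x\<bar> * norm (kern z)))"
  proof (rule integral_mono)
    show "integrable lborel (\<lambda>z. norm (((\<phi> (x + z) - \<phi> x) * f (x + z)) *\<^sub>R kern z))"
      by (rule integrable_norm[OF commutator_integrand_integrable[OF p f]])
    show "integrable lborel (\<lambda>z. B * (\<bar>\<phi> (x + z) - \<phi> x\<bar> * norm (kern z)))"
      by (intro integrable_mult_right abs_increment_kern_integrable[OF p])
    fix z
    have "\<bar>f (x + z)\<bar> * (\<bar>\<phi> (x + z) - \<phi> x\<bar> * norm (kern z)) \<le> B * (\<bar>\<phi> (x + z) - \<phi> x\<bar> * norm (kern z))"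
      using B by (intro mult_right_mono) auto
    thus "norm (((\<phi> (x + z) - \<phi> x) * f (x + z)) *\<^sub>R kern z) \<le> B * (\<bar>\<phi> (x + z) - \<phi> x\<bar> * norm (kern z))"
      by (simp add: abs_mult mult_ac)
  qed
  also have "\<dots> = B * fosc \<phi> x" by (simp add: fosc_def)
  finally show ?thesis .
qed

text \<open>Cauchy--Schwarz applied to the splitting \<open>\<kappa> = \<surd>\<kappa> \<surd>\<kappa>\<close>.\<close>

lemma norm_commutator_sq_le:
  assumes p: "osc_bounded M \<phi>" and f: "osc_bounded M' f"
  shows "(norm (commutator \<phi> f x))\<^sup>2 \<le> M\<^sup>2 * kap_mass * (LINT z|lborel. kap z * (f (x + z))\<^sup>2)"
proof -
  note [measurable] = osc_bounded_measurable[OF f] osc_bounded_measurable[OF p]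
  define a where "a = (\<lambda>z. sqrt (kap z))"
  define b where "b = (\<lambda>z. sqrt (kap z) * \<bar>f (x + z)\<bar>)"
  have ki: "integrable lborel (\<lambda>z. kap z * h z)" if "\<And>z. \<bar>h z\<bar> \<le> C" and [measurable]: "h \<in> borel_measurable borel" for h and C
    by (rule Bochner_Integration.integrable_bound[of lborel "\<lambda>z. C * kap z"])
       (use that(1) order_trans[OF abs_ge_zero that(1)[of 0]] in \<open>auto simp: kap_integrable abs_mult kap_nonneg mult.commute intro!: AE_I2 mult_right_mono\<close>)
  have f2: "\<bar>(f y)\<^sup>2\<bar> \<le> M'\<^sup>2" for y using osc_boundedD(1)[OF f, of y] by (simp add: abs_le_square_iff[symmetric] osc_bounded_nonneg[OF f])
  have i2: "integrable lborel (\<lambda>z. kap z * (f (x + z))\<^sup>2)" by (rule ki[OF f2]) measurable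
  have i1: "integrable lborel (\<lambda>z. kap z * \<bar>f (x + z)\<bar>)" by (rule ki[of _ M']) (use osc_boundedD(1)[OF f] in auto)
  have a: "a \<in> Ltwo" by (rule Ltwo_borelI[OF _ kap_integrable]) (auto simp: a_def kap_nonneg)
  have b: "b \<in> Ltwo"
    by (rule Ltwo_borelI[OF _ i2]) (auto simp: b_def kap_nonneg power_mult_distrib)
  have na: "(norm (cls a))\<^sup>2 = kap_mass"
    unfolding norm_cls_sq[OF a] by (subst integral_completion) (auto simp: a_def kap_nonneg kap_mass_def)
  have nb: "(norm (cls b))\<^sup>2 = (LINT z|lborel. kap z * (f (x + z))\<^sup>2)"
    unfolding norm_cls_sq[OF b] by (subst integral_completion) (auto simp: b_def kap_nonneg power_mult_distrib)
  have nab: "cls a \<bullet> cls b = (LINT z|lborel. kap z * \<bar>f (x + z)\<bar>)"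
    unfolding inner_cls[OF a b] by (subst integral_completion) (auto simp: a_def b_def kap_nonneg mult.assoc[symmetric])
  have "norm (commutator \<phi> f x) \<le> (LINT z|lborel. norm (((\<phi> (x + z) - \<phi> x) * f (x + z)) *\<^sub>R kern z))"
    unfolding commutator_def by (rule integral_norm_bound)
  also have "\<dots> \<le> (LINT z|lborel. M * (kap z * \<bar>f (x + z)\<bar>))"
  proof (rule integral_mono)
    show "integrable lborel (\<lambda>z. norm (((\<phi> (x + z) - \<phi> x) * f (x + z)) *\<^sub>R kern z))"
      by (rule integrable_norm[OF commutator_integrand_integrable[OF p f]])
    show "integrable lborel (\<lambda>z. M * (kap z * \<bar>f (x + z)\<bar>))" by (intro integrable_mult_right i1)
    fix z
    show "norm (((\<phi> (x + z) - \<phi> x) * f (x + z)) *\<^sub>R kern z) \<le> M * (kap z * \<bar>f (x + z)\<bar>)"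
      using mult_right_mono[OF norm_increment_kern_le[OF p, of x z], of "\<bar>f (x + z)\<bar>"]
      by (simp add: abs_mult mult_ac)
  qed
  also have "\<dots> = M * (cls a \<bullet> cls b)" by (simp add: nab)
  also have "\<dots> \<le> M * (norm (cls a) * norm (cls b))"
    by (intro mult_left_mono norm_cauchy_schwarz osc_bounded_nonneg[OF p])
  finally have "(norm (commutator \<phi> f x))\<^sup>2 \<le> (M * (norm (cls a) * norm (cls b)))\<^sup>2" by (intro power_mono) auto
  thus ?thesis by (simp add: power_mult_distrib na nb mult.assoc)
qed

text \<open>A Schur-type estimate: integrate the pointwise bound over \<open>x\<close>, exchange the
  order, and use that translations preserve the L2 norm; this produces the second factor
  \<open>kap_mass\<close>.\<close>

lemma
  assumes p: "osc_bounded M \<phi>" and f: "osc_bounded M' f" and f2: "f \<in> Ltwo"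
  shows commutator_Ltwo: "commutator \<phi> f \<in> Ltwo"
    and norm_commutator_le: "norm (cls (commutator \<phi> f)) \<le> M * kap_mass * norm (cls f)"
proof -
  note [measurable] = osc_bounded_measurable[OF f] osc_bounded_measurable[OF p]
  have M: "M \<ge> 0" by (rule osc_bounded_nonneg[OF p])
  have fi: "integrable lborel (\<lambda>x. (f x)\<^sup>2)"
    using Ltwo_integrable[OF f2] by (subst (asm) integrable_completion) auto
  have f0: "(norm (cls f))\<^sup>2 = (LINT x|lborel. (f x)\<^sup>2)"
    unfolding norm_cls_sq[OF f2] by (subst integral_completion) auto
  have "(\<integral>\<^sup>+x. ennreal ((norm (commutator \<phi> f x))\<^sup>2) \<partial>lborel)
      \<le> (\<integral>\<^sup>+x. ennreal (M\<^sup>2 * kap_mass) * (\<integral>\<^sup>+z. ennreal (kap z) * ennreal ((f (x + z))\<^sup>2) \<partial>lborel) \<partial>lborel)"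
  proof (rule nn_integral_mono)
    fix x
    have "integrable lborel (\<lambda>z. kap z * (f (x + z))\<^sup>2)"
    proof (rule Bochner_Integration.integrable_bound)
      show "integrable lborel (\<lambda>z. M'\<^sup>2 * kap z)" by (intro integrable_mult_right kap_integrable)
      have "(f y)\<^sup>2 \<le> M'\<^sup>2" for y using osc_boundedD(1)[OF f, of y] by (simp add: abs_le_square_iff[symmetric] osc_bounded_nonneg[OF f])
      thus "AE z in lborel. norm (kap z * (f (x + z))\<^sup>2) \<le> norm (M'\<^sup>2 * kap z)"
        by (auto simp: abs_mult kap_nonneg mult.commute intro!: mult_left_mono)
    qed measurable
    hence "(\<integral>\<^sup>+z. ennreal (kap z) * ennreal ((f (x + z))\<^sup>2) \<partial>lborel) = ennreal (LINT z|lborel. kap z * (f (x + z))\<^sup>2)"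
      by (subst nn_integral_eq_integral[symmetric]) (auto simp: kap_nonneg ennreal_mult)
    thus "ennreal ((norm (commutator \<phi> f x))\<^sup>2)
      \<le> ennreal (M\<^sup>2 * kap_mass) * (\<integral>\<^sup>+z. ennreal (kap z) * ennreal ((f (x + z))\<^sup>2) \<partial>lborel)"
      using norm_commutator_sq_le[OF p f, of x] kap_mass_nonneg
      by (simp add: ennreal_mult'[symmetric] ennreal_leI)
  qed
  also have "\<dots> = ennreal (M\<^sup>2 * kap_mass) * (\<integral>\<^sup>+x. \<integral>\<^sup>+z. ennreal (kap z) * ennreal ((f (x + z))\<^sup>2) \<partial>lborel \<partial>lborel)"
    by (rule nn_integral_cmult) measurable
  also have "(\<integral>\<^sup>+x. \<integral>\<^sup>+z. ennreal (kap z) * ennreal ((f (x + z))\<^sup>2) \<partial>lborel \<partial>lborel)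
      = (\<integral>\<^sup>+z. \<integral>\<^sup>+x. ennreal (kap z) * ennreal ((f (x + z))\<^sup>2) \<partial>lborel \<partial>lborel)"
    by (rule lborel_pair.Fubini'[symmetric]) measurable
  also have "\<dots> = (\<integral>\<^sup>+z. ennreal (kap z) * (\<integral>\<^sup>+x. ennreal ((f x)\<^sup>2) \<partial>lborel) \<partial>lborel)"
  proof (rule nn_integral_cong)
    fix z
    have "(\<integral>\<^sup>+x. ennreal (kap z) * ennreal ((f (x + z))\<^sup>2) \<partial>lborel) = ennreal (kap z) * (\<integral>\<^sup>+x. ennreal ((f (z + x))\<^sup>2) \<partial>lborel)"
      by (subst nn_integral_cmult) (auto simp: add.commute)
    also have "(\<integral>\<^sup>+x. ennreal ((f (z + x))\<^sup>2) \<partial>lborel) = (\<integral>\<^sup>+x. ennreal ((f x)\<^sup>2) \<partial>lborel)"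
      using nn_integral_lborel_translate[of "\<lambda>x. ennreal ((f x)\<^sup>2)" z] by simp
    finally show "(\<integral>\<^sup>+x. ennreal (kap z) * ennreal ((f (x + z))\<^sup>2) \<partial>lborel) = ennreal (kap z) * (\<integral>\<^sup>+x. ennreal ((f x)\<^sup>2) \<partial>lborel)" .
  qed
  also have "\<dots> = (\<integral>\<^sup>+z. ennreal (kap z) \<partial>lborel) * (\<integral>\<^sup>+x. ennreal ((f x)\<^sup>2) \<partial>lborel)"
    by (rule nn_integral_multc) measurable
  also have "(\<integral>\<^sup>+z. ennreal (kap z) \<partial>lborel) = ennreal kap_mass"
    unfolding kap_mass_def by (rule nn_integral_eq_integral[OF kap_integrable]) (simp add: kap_nonneg)
  also have "(\<integral>\<^sup>+x. ennreal ((f x)\<^sup>2) \<partial>lborel) = ennreal ((norm (cls f))\<^sup>2)"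
    unfolding f0 by (rule nn_integral_eq_integral[OF fi]) simp
  also have "ennreal (M\<^sup>2 * kap_mass) * (ennreal kap_mass * ennreal ((norm (cls f))\<^sup>2)) = ennreal ((M * kap_mass * norm (cls f))\<^sup>2)"
    using kap_mass_nonneg M by (simp add: ennreal_mult[symmetric] power_mult_distrib power2_eq_square mult_ac)
  finally have bd: "(\<integral>\<^sup>+x. ennreal ((norm (commutator \<phi> f x))\<^sup>2) \<partial>lborel) \<le> ennreal ((M * kap_mass * norm (cls f))\<^sup>2)" .
  have i: "integrable lborel (\<lambda>x. (norm (commutator \<phi> f x))\<^sup>2)"
  proof (rule integrableI_nonneg)
    show "(\<integral>\<^sup>+x. ennreal ((norm (commutator \<phi> f x))\<^sup>2) \<partial>lborel) < \<infinity>" using bd by (rule le_less_trans) simp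
  qed auto
  show C: "commutator \<phi> f \<in> Ltwo" by (rule Ltwo_borelI[OF _ i]) auto
  have "ennreal ((norm (cls (commutator \<phi> f)))\<^sup>2) = (\<integral>\<^sup>+x. ennreal ((norm (commutator \<phi> f x))\<^sup>2) \<partial>lborel)"
    unfolding norm_cls_sq[OF C] by (subst integral_completion) (auto simp: nn_integral_eq_integral[OF i])
  hence "ennreal ((norm (cls (commutator \<phi> f)))\<^sup>2) \<le> ennreal ((M * kap_mass * norm (cls f))\<^sup>2)" using bd by (simp only:)
  hence "(norm (cls (commutator \<phi> f)))\<^sup>2 \<le> (M * kap_mass * norm (cls f))\<^sup>2" by (subst (asm) ennreal_le_iff) auto
  thus "norm (cls (commutator \<phi> f)) \<le> M * kap_mass * norm (cls f)"
    by (rule power2_le_imp_le) (intro mult_nonneg_nonneg M kap_mass_nonneg norm_ge_zero)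
qed

end

section \<open>The symbol of the fractional gradient\<close>

lemma prod_Basis_cart: "(\<Prod>b\<in>Basis. f b) = (\<Prod>i\<in>UNIV. f (axis i 1 :: real ^ 'n))"
proof -
  have B: "(Basis :: (real ^ 'n) set) = range (\<lambda>i. axis i 1)" by (auto simp: Basis_vec_def)
  have "inj (\<lambda>i::'n. axis i (1::real))" by (auto simp: inj_on_def axis_eq_axis)
  thus ?thesis unfolding B by (simp add: prod.reindex o_def)
qed

text \<open>Lebesgue measure is determined on boxes, which permutations and reflections of the
  coordinates map to boxes. These symmetries take the place of rotation invariance when the
  direction of the symbol is computed.\<close>

lemma lborel_distr_eqI_cart:
  fixes g :: "real ^ 'n \<Rightarrow> real ^ 'n"
  assumes [measurable]: "g \<in> borel_measurable borel"
    and pre: "\<And>l u. \<forall>i. l $ i \<le> u $ i \<Longrightarrow> \<exists>l' u'. g -` box l u = box l' u' \<and> (\<forall>i. l' $ i \<le> u' $ i) \<and> (\<Prod>i\<in>UNIV. u' $ i - l' $ i) = (\<Prod>i\<in>UNIV. u $ i - l $ i)"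
  shows "distr lborel borel g = lborel"
proof (rule lborel_eqI[symmetric])
  fix l u :: "real ^ 'n" assume "\<And>b. b \<in> Basis \<Longrightarrow> l \<bullet> b \<le> u \<bullet> b"
  hence "\<forall>i. l $ i \<le> u $ i" by (force simp: Basis_vec_def inner_axis)
  then obtain l' u' where lu: "g -` box l u = box l' u'" "\<forall>i. l' $ i \<le> u' $ i"
    "(\<Prod>i\<in>UNIV. u' $ i - l' $ i) = (\<Prod>i\<in>UNIV. u $ i - l $ i)" using pre by blast
  have "emeasure (distr lborel borel g) (box l u) = emeasure lborel (box l' u')"
    by (subst emeasure_distr) (auto simp: lu)
  also have "\<dots> = (\<Prod>b\<in>Basis. (u' - l') \<bullet> b)"
    using lu(2) by (subst emeasure_lborel_box_eq) (auto simp: Basis_vec_def inner_axis)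
  also have "\<dots> = (\<Prod>b\<in>Basis. (u - l) \<bullet> b)"
    unfolding prod_Basis_cart using lu(3) by (simp add: inner_axis)
  finally show "emeasure (distr lborel borel g) (box l u) = (\<Prod>b\<in>Basis. (u - l) \<bullet> b)" .
qed simp

lemma lborel_distr_permute_cart:
  fixes p :: "'n::finite \<Rightarrow> 'n"
  assumes "bij p"
  shows "distr lborel borel (\<lambda>z::real^'n. \<chi> j. z $ p j) = lborel"
proof (rule lborel_distr_eqI_cart)
  fix l u :: "real ^ 'n" assume lu: "\<forall>i. l $ i \<le> u $ i"
  have ip: "bij (inv p)" using assms by (rule bij_imp_bij_inv)
  have "(\<lambda>z::real^'n. \<chi> j. z $ p j) -` box l u = box (\<chi> j. l $ inv p j) (\<chi> j. u $ inv p j)"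
    using assms by (auto simp: mem_box_cart) (metis bij_inv_eq_iff)+
  moreover have "(\<Prod>i\<in>UNIV. u $ inv p i - l $ inv p i) = (\<Prod>i\<in>UNIV. u $ i - l $ i)"
    by (rule prod.reindex_bij_betw[OF ip, of "\<lambda>i. u $ i - l $ i"])
  ultimately show "\<exists>l' u'. (\<lambda>z::real^'n. \<chi> j. z $ p j) -` box l u = box l' u' \<and> (\<forall>i. l' $ i \<le> u' $ i) \<and>
      (\<Prod>i\<in>UNIV. u' $ i - l' $ i) = (\<Prod>i\<in>UNIV. u $ i - l $ i)"
    using lu by (intro exI[of _ "\<chi> j. l $ inv p j"] exI[of _ "\<chi> j. u $ inv p j"]) auto
qed (intro borel_measurable_continuous_onI continuous_on_vec_lambda continuous_intros)

definition flip_coord :: "'n \<Rightarrow> real ^ 'n \<Rightarrow> real ^ 'n" where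
  "flip_coord i z = (\<chi> j. if j = i then - z $ j else z $ j)"

lemma flip_coord_measurable [measurable]: "flip_coord i \<in> borel_measurable borel"
proof -
  have "continuous_on UNIV (\<lambda>z. flip_coord i z $ j)" for j
    by (cases "j = i") (auto simp: flip_coord_def intro!: continuous_intros)
  hence "continuous_on UNIV (\<lambda>z. \<chi> j. flip_coord i z $ j)" by (rule continuous_on_vec_lambda)
  thus ?thesis by (intro borel_measurable_continuous_onI) simp
qed

lemma lborel_distr_flip_coord: "distr lborel borel (flip_coord i) = lborel"
proof (rule lborel_distr_eqI_cart)
  fix l u :: "real ^ 'a" assume lu: "\<forall>i. l $ i \<le> u $ i"
  define l' where "l' = (\<chi> j. if j = i then - u $ j else l $ j)"
  define u' where "u' = (\<chi> j. if j = i then - l $ j else u $ j)"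
  have "flip_coord i -` box l u = box l' u'"
    by (auto simp: flip_coord_def mem_box_cart l'_def u'_def split: if_splits) (metis minus_less_iff less_minus_iff)+
  moreover have "(\<Prod>j\<in>UNIV. u' $ j - l' $ j) = (\<Prod>j\<in>UNIV. u $ j - l $ j)"
    by (rule prod.cong) (auto simp: l'_def u'_def)
  moreover have "\<forall>j. l' $ j \<le> u' $ j" using lu by (auto simp: l'_def u'_def)
  ultimately show "\<exists>l' u'. flip_coord i -` box l u = box l' u' \<and> (\<forall>i. l' $ i \<le> u' $ i) \<and>
      (\<Prod>i\<in>UNIV. u' $ i - l' $ i) = (\<Prod>i\<in>UNIV. u $ i - l $ i)" by blast
qed measurable

lemma norm_flip_coord: "norm (flip_coord i z) = norm z"
  unfolding norm_vec_def L2_set_def flip_coord_def by (auto intro!: arg_cong[where f=sqrt] sum.cong)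

lemma norm_permute_cart:
  fixes p :: "'n::finite \<Rightarrow> 'n" and z :: "real ^ 'n"
  assumes "bij p" shows "norm (\<chi> j. z $ p j) = norm z"
  unfolding norm_vec_def L2_set_def
  using sum.reindex_bij_betw[OF assms, of "\<lambda>j. (norm (z $ j))\<^sup>2"] by simp

text \<open>The Laplace transform of the sine has the sign of \<open>a\<close>. It turns the
  oscillating integral of the symbol into one with an integrand of constant sign.\<close>

lemma integral_exp_sin:
  fixes a :: real
  shows "set_integrable lborel {0<..} (\<lambda>t. exp (- t) * sin (t * a))"
    and "(LINT t:{0<..}|lborel. exp (- t) * sin (t * a)) = a / (1 + a\<^sup>2)"
proof -
  have e: "set_integrable lborel {0<..} (\<lambda>t::real. exp (- t))"
    using integrable_I0i_exp_mscale[of 1] by (simp add: interval_integrable_to_infinity_eq zero_ereal_def)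
  show i: "set_integrable lborel {0<..} (\<lambda>t. exp (- t) * sin (t * a))"
    by (rule set_integrable_bound[OF e])
       (auto simp: set_borel_measurable_def abs_mult abs_sin_le_one mult_left_le)
  define F where "F = (\<lambda>t. - exp (- t) * (sin (t * a) + a * cos (t * a)) / (1 + a\<^sup>2))"
  have pos: "1 + a\<^sup>2 > 0" by (intro add_pos_nonneg) auto
  have "(LBINT t=0..\<infinity>. exp (- t) * sin (t * a)) = 0 - F 0"
  proof (rule interval_integral_FTC_integrable)
    fix t
    have "(F has_real_derivative (exp (- t) * sin (t * a))) (at t)"
      unfolding F_def using pos
      by (auto intro!: derivative_eq_intros simp: divide_simps) (simp add: algebra_simps power2_eq_square)
    thus "(F has_vector_derivative exp (- t) * sin (t * a)) (at t)"
      by (simp add: has_real_derivative_iff_has_vector_derivative)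
    show "isCont (\<lambda>t. exp (- t) * sin (t * a)) t" by (intro continuous_intros)
  next
    show "set_integrable lborel (einterval 0 \<infinity>) (\<lambda>t. exp (- t) * sin (t * a))"
      using i by (simp add: zero_ereal_def einterval_def greaterThan_def)
    have "isCont F 0" unfolding F_def using pos by (intro continuous_intros) auto
    hence "(F \<longlongrightarrow> F 0) (at_right 0)" unfolding isCont_def by (rule tendsto_mono[OF at_le, rotated]) simp
    thus "((F \<circ> real_of_ereal) \<longlongrightarrow> F 0) (at_right 0)"
      using ereal_tendsto_simps1(2)[of F "F 0" 0] by (simp add: zero_ereal_def)
    have "(F \<longlongrightarrow> 0) at_top"
    proof (rule tendsto_0_le[where K="(1 + \<bar>a\<bar>) / (1 + a\<^sup>2)"])
      show "((\<lambda>t::real. exp (- t)) \<longlongrightarrow> 0) at_top" by (intro filterlim_compose[OF exp_at_bot] filterlim_uminus_at_bot_at_top)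
      show "\<forall>\<^sub>F t in at_top. norm (F t) \<le> norm (exp (- t)) * ((1 + \<bar>a\<bar>) / (1 + a\<^sup>2))"
      proof (intro always_eventually allI)
        fix t
        have "\<bar>sin (t * a) + a * cos (t * a)\<bar> \<le> 1 + \<bar>a\<bar>"
        proof -
          have "\<bar>a * cos (t * a)\<bar> \<le> \<bar>a\<bar>" using mult_left_mono[OF abs_cos_le_one[of "t * a"], of "\<bar>a\<bar>"] by (simp add: abs_mult)
          thus ?thesis using abs_sin_le_one[of "t * a"] by linarith
        qed
        thus "norm (F t) \<le> norm (exp (- t)) * ((1 + \<bar>a\<bar>) / (1 + a\<^sup>2))"
          unfolding F_def using pos by (simp add: abs_mult divide_right_mono)
      qed
    qed
    thus "((F \<circ> real_of_ereal) \<longlongrightarrow> 0) (at_left \<infinity>)" by (simp add: ereal_tendsto_simps1)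
  qed simp
  also have "0 - F 0 = a / (1 + a\<^sup>2)" by (simp add: F_def)
  finally show "(LINT t:{0<..}|lborel. exp (- t) * sin (t * a)) = a / (1 + a\<^sup>2)"
    by (simp add: interval_integral_to_infinity_eq zero_ereal_def)
qed

section \<open>Homogeneity, positivity and direction of the symbol\<close>

context fractional_kernel
begin

text \<open>Up to \<open>cst\<close> and a factor i, the Fourier multiplier of the gradient, as
  \<open>fgrad_cos\<close> and \<open>fgrad_sin\<close> show. Only the sine appears because
  \<open>kern\<close> is odd.\<close>

definition symb :: "real ^ 'n \<Rightarrow> real ^ 'n" where
  "symb \<xi> = (LINT z|lborel. sin (\<xi> \<bullet> z) *\<^sub>R kern z)"

lemma abs_sin_kern_le: "\<bar>sin (\<xi> \<bullet> z)\<bar> * norm (kern z) \<le> (1 + norm \<xi>) * kap z"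
proof -
  have "\<bar>sin (\<xi> \<bullet> z)\<bar> \<le> norm \<xi> * norm z"
    using abs_sin_x_le_abs_x[of "\<xi> \<bullet> z"] Cauchy_Schwarz_ineq2[of \<xi> z] by linarith
  moreover have "norm \<xi> * norm z \<le> (1 + norm \<xi>) * norm z" by (intro mult_right_mono) auto
  moreover have "\<bar>sin (\<xi> \<bullet> z)\<bar> \<le> 1 + norm \<xi>" using abs_sin_le_one[of "\<xi> \<bullet> z"] norm_ge_zero[of \<xi>] by linarith
  ultimately have "\<bar>sin (\<xi> \<bullet> z)\<bar> \<le> (1 + norm \<xi>) * min 1 (norm z)" by (auto simp: min_def)
  hence "\<bar>sin (\<xi> \<bullet> z)\<bar> * norm (kern z) \<le> (1 + norm \<xi>) * min 1 (norm z) * norm (kern z)" by (intro mult_right_mono) auto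
  thus ?thesis by (simp add: kap_def norm_kern mult.assoc)
qed

lemma sin_kern_integrable: "integrable lborel (\<lambda>z. sin (\<xi> \<bullet> z) *\<^sub>R kern z)"
proof (rule Bochner_Integration.integrable_bound)
  show "integrable lborel (\<lambda>z. (1 + norm \<xi>) * kap z)" by (intro integrable_mult_right kap_integrable)
  show "AE z in lborel. norm (sin (\<xi> \<bullet> z) *\<^sub>R kern z) \<le> norm ((1 + norm \<xi>) * kap z)"
    using abs_sin_kern_le[of \<xi>] by (intro AE_I2) (simp add: abs_mult kap_nonneg add_nonneg_nonneg)
qed measurable

lemma symb_inner: "symb \<xi> \<bullet> v = (LINT z|lborel. sin (\<xi> \<bullet> z) * (kern z \<bullet> v))"
  unfolding symb_def by (subst integral_inner_left[symmetric]) (auto intro: sin_kern_integrable)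

lemma kern_scale: assumes "r > 0" shows "kern (r *\<^sub>R z) = r powr (- (CARD('n) + s)) *\<^sub>R kern z"
proof -
  have "r powr (- (CARD('n) + s + 1)) * r = r powr (- (CARD('n) + s))"
    using assms powr_add[of r "- (CARD('n) + s + 1)" 1] by simp
  thus ?thesis using assms by (simp add: kern_def powr_mult mult.commute mult.left_commute)
qed

text \<open>Substitute \<open>r *\<^sub>R z\<close>: the kernel is homogeneous of degree
  \<open>-(n + s)\<close> and the volume element contributes \<open>n\<close>.\<close>

lemma symb_scale: assumes r: "r > 0" shows "symb (r *\<^sub>R \<xi>) = r powr s *\<^sub>R symb \<xi>"
proof -
  have "(LINT z|lborel. (\<lambda>y. sin (\<xi> \<bullet> y) *\<^sub>R kern y) (0 + r *\<^sub>R z)) = (1 / \<bar>r\<bar> ^ DIM(real^'n)) *\<^sub>R symb \<xi>"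
    unfolding symb_def by (rule integral_lborel_affine) (use r in auto)
  moreover have "(LINT z|lborel. (\<lambda>y. sin (\<xi> \<bullet> y) *\<^sub>R kern y) (0 + r *\<^sub>R z)) = r powr (- (CARD('n) + s)) *\<^sub>R symb (r *\<^sub>R \<xi>)"
    using r unfolding symb_def by (simp add: kern_scale mult.commute flip: integral_scaleR_right)
  ultimately have "r powr (- (CARD('n) + s)) *\<^sub>R symb (r *\<^sub>R \<xi>) = r powr (- CARD('n)) *\<^sub>R symb \<xi>"
    using r by (simp add: powr_minus_divide powr_realpow)
  hence "r powr (CARD('n) + s) *\<^sub>R r powr (- (CARD('n) + s)) *\<^sub>R symb (r *\<^sub>R \<xi>) = r powr (CARD('n) + s) *\<^sub>R r powr (- CARD('n)) *\<^sub>R symb \<xi>"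
    by simp
  thus ?thesis using r by (simp flip: powr_add)
qed

text \<open>The defining integrand changes sign. Averaging
  \<open>symb (t *\<^sub>R \<xi>) \<bullet> \<xi>\<close> over \<open>t\<close> with weight
  \<open>exp (- t)\<close> gives, by homogeneity, a nonnegative multiple of
  \<open>symb \<xi> \<bullet> \<xi>\<close>. Integrating over \<open>t\<close> before
  \<open>z\<close> instead gives the sine's Laplace transform, and the result is a nonnegative
  integrand that vanishes only where \<open>\<xi> \<bullet> z = 0\<close>.\<close>

lemma symb_inner_pos: assumes "\<xi> \<noteq> 0" shows "symb \<xi> \<bullet> \<xi> > 0"
proof -
  define q where "q = (\<lambda>z. \<xi> \<bullet> z)"
  define F where "F = (\<lambda>t z. indicator {0<..} t *\<^sub>R (exp (- t) * sin (t * q z)) * (kern z \<bullet> \<xi>))"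
  have [measurable]: "q \<in> borel_measurable borel" unfolding q_def by measurable
  have bd: "\<bar>F t z\<bar> \<le> indicator {0<..} t * (exp (- t) * (1 + t * norm \<xi>)) * (norm \<xi> * kap z)" for t z
  proof (cases "t > 0")
    case True
    have "\<bar>sin ((t *\<^sub>R \<xi>) \<bullet> z)\<bar> * norm (kern z) \<le> (1 + t * norm \<xi>) * kap z"
      using abs_sin_kern_le[of "t *\<^sub>R \<xi>" z] True by simp
    hence "\<bar>sin (t * q z)\<bar> * norm (kern z) \<le> (1 + t * norm \<xi>) * kap z" by (simp add: q_def)
    hence "\<bar>sin (t * q z)\<bar> * norm (kern z) * norm \<xi> \<le> (1 + t * norm \<xi>) * kap z * norm \<xi>" by (intro mult_right_mono) auto
    moreover have "\<bar>sin (t * q z)\<bar> * \<bar>kern z \<bullet> \<xi>\<bar> \<le> \<bar>sin (t * q z)\<bar> * (norm (kern z) * norm \<xi>)"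
      by (intro mult_left_mono Cauchy_Schwarz_ineq2) auto
    ultimately have "\<bar>sin (t * q z)\<bar> * \<bar>kern z \<bullet> \<xi>\<bar> \<le> (1 + t * norm \<xi>) * kap z * norm \<xi>" by (simp add: mult.assoc)
    hence "exp (- t) * (\<bar>sin (t * q z)\<bar> * \<bar>kern z \<bullet> \<xi>\<bar>) \<le> exp (- t) * ((1 + t * norm \<xi>) * kap z * norm \<xi>)" by (intro mult_left_mono) auto
    thus ?thesis using True by (simp add: F_def abs_mult mult_ac)
  qed (simp add: F_def)
  have ei: "integrable lborel (\<lambda>t. indicator {0<..} t * (exp (- t) * (1 + t * norm \<xi>)) :: real)"
  proof -
    have "set_integrable lborel {0<..} (\<lambda>t::real. exp (- t))"
      using integrable_I0i_exp_mscale[of 1] by (simp add: interval_integrable_to_infinity_eq zero_ereal_def)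
    hence 1: "integrable lborel (\<lambda>t. indicator {0<..} t * exp (- t) :: real)" by (simp add: set_integrable_def)
    have 2: "integrable lborel (\<lambda>x::real. exp (- x) * x * indicator {0..} x)"
      using has_bochner_integral_I0i_power_exp_m'[of 1] by (simp add: has_bochner_integral_iff mult.commute)
    have "integrable lborel (\<lambda>t. indicator {0<..} t * exp (- t) + norm \<xi> * (exp (- t) * t * indicator {0..} t))"
      by (intro Bochner_Integration.integrable_add 1 integrable_mult_right 2)
    also have "(\<lambda>t. indicator {0<..} t * exp (- t) + norm \<xi> * (exp (- t) * t * indicator {0..} t))
        = (\<lambda>t::real. indicator {0<..} t * (exp (- t) * (1 + t * norm \<xi>)))"
      by (auto simp: fun_eq_iff indicator_def algebra_simps)
    finally show ?thesis .
  qed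
  have Fi: "integrable (lborel \<Otimes>\<^sub>M lborel) (\<lambda>(t, z). F t z)"
  proof (rule Bochner_Integration.integrable_bound)
    show "integrable (lborel \<Otimes>\<^sub>M lborel) (\<lambda>(t, z). indicator {0<..} t * (exp (- t) * (1 + t * norm \<xi>)) * (norm \<xi> * kap z) :: real)"
    proof (rule lborel_pair.Fubini_integrable)
      have "(\<lambda>t. LINT z|lborel. norm (indicator {0<..} t * (exp (- t) * (1 + t * norm \<xi>)) * (norm \<xi> * kap z)))
         = (\<lambda>t. indicator {0<..} t * (exp (- t) * (1 + t * norm \<xi>)) * (norm \<xi> * kap_mass))"
        by (auto simp: fun_eq_iff indicator_def abs_mult kap_nonneg kap_mass_def add_nonneg_nonneg)
      thus "integrable lborel (\<lambda>t::real. LINT z|lborel. norm (case (t, z) of (t, z) \<Rightarrow> indicator {0<..} t * (exp (- t) * (1 + t * norm \<xi>)) * (norm \<xi> * kap z)))"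
        using ei by simp
    qed (auto simp: kap_integrable)
    show "(\<lambda>(t, z). F t z) \<in> borel_measurable (lborel \<Otimes>\<^sub>M lborel)" unfolding F_def by measurable
    show "AE p in lborel \<Otimes>\<^sub>M lborel. norm (case p of (t, z) \<Rightarrow> F t z)
        \<le> norm (case p of (t, z) \<Rightarrow> indicator {0<..} t * (exp (- t) * (1 + t * norm \<xi>)) * (norm \<xi> * kap z))"
      using bd by (intro AE_I2) (auto intro: order_trans[OF _ abs_ge_self])
  qed
  have t1: "(LINT z|lborel. F t z) = indicator {0<..} t * (exp (- t) * t powr s) * (symb \<xi> \<bullet> \<xi>)" for t
  proof (cases "t > 0")
    case True
    have "(LINT z|lborel. F t z) = exp (- t) * (symb (t *\<^sub>R \<xi>) \<bullet> \<xi>)"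
      using True by (simp add: F_def q_def symb_inner mult.assoc flip: integral_mult_right_zero)
    thus ?thesis using True by (simp add: symb_scale)
  qed (simp add: F_def)
  have t2: "(LINT t|lborel. F t z) = q z / (1 + (q z)\<^sup>2) * (kern z \<bullet> \<xi>)" for z
    using integral_exp_sin(2)[of "q z"] by (simp add: F_def set_lebesgue_integral_def)
  have t3: "q z / (1 + (q z)\<^sup>2) * (kern z \<bullet> \<xi>) \<ge> 0" for z
  proof -
    have "q z * (kern z \<bullet> \<xi>) = norm z powr (- (CARD('n) + s + 1)) * (q z)\<^sup>2"
      by (simp add: kern_def q_def inner_commute power2_eq_square mult_ac)
    hence "0 \<le> q z * (kern z \<bullet> \<xi>)" by simp
    hence "0 \<le> q z * (kern z \<bullet> \<xi>) / (1 + (q z)\<^sup>2)" by (intro divide_nonneg_nonneg add_nonneg_nonneg) auto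
    thus ?thesis by simp
  qed
  have eq: "(LINT t|lborel. LINT z|lborel. F t z) = (LINT z|lborel. LINT t|lborel. F t z)"
    by (rule lborel_pair.Fubini_integral[OF Fi, symmetric])
  have "integrable lborel (\<lambda>z. LINT t|lborel. F t z)" by (rule lborel_pair.integrable_snd[OF Fi])
  hence i: "integrable lborel (\<lambda>z. q z / (1 + (q z)\<^sup>2) * (kern z \<bullet> \<xi>))" by (simp only: t2)
  have "(LINT z|lborel. q z / (1 + (q z)\<^sup>2) * (kern z \<bullet> \<xi>)) \<noteq> 0"
  proof
    \<comment> \<open>Otherwise the integrand would vanish almost everywhere and the open half-space
      \<open>\<xi> \<bullet> z > 0\<close> would be negligible.\<close>
    assume "(LINT z|lborel. q z / (1 + (q z)\<^sup>2) * (kern z \<bullet> \<xi>)) = 0"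
    hence "AE z in lborel. q z / (1 + (q z)\<^sup>2) * (kern z \<bullet> \<xi>) = 0"
      using integral_nonneg_eq_0_iff_AE[OF i] t3 by simp
    hence "AE z in lborel. \<xi> \<bullet> z = 0"
    proof eventually_elim
      case (elim z)
      have "1 + (q z)\<^sup>2 > 0" by (intro add_pos_nonneg) auto
      thus ?case using elim by (auto simp: q_def kern_def inner_commute)
    qed
    moreover have "open {z. \<xi> \<bullet> z > 0}" by (rule open_halfspace_gt)
    moreover have "\<xi> \<in> {z. \<xi> \<bullet> z > 0}" using assms by simp
    moreover have "\<exists>N\<in>null_sets lborel. {z. \<not> \<xi> \<bullet> z = 0} \<subseteq> N"
      using calculation(1) by (auto elim!: AE_E simp: null_sets_def)
    then obtain N where "N \<in> null_sets lborel" "{z. \<xi> \<bullet> z > 0} \<subseteq> N" by force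
    hence "negligible {z. \<xi> \<bullet> z > 0}"
      by (meson negligible_subset negligible_iff_null_sets null_sets_completionI)
    ultimately show False using open_not_negligible by blast
  qed
  moreover have "(LINT z|lborel. q z / (1 + (q z)\<^sup>2) * (kern z \<bullet> \<xi>)) \<ge> 0" using t3 by simp
  ultimately have "0 < (LINT z|lborel. q z / (1 + (q z)\<^sup>2) * (kern z \<bullet> \<xi>))" by linarith
  hence "0 < (LINT t|lborel. indicator {0<..} t * (exp (- t) * t powr s) * (symb \<xi> \<bullet> \<xi>))"
    using eq by (simp only: t1 t2)
  also have "\<dots> = (LINT t|lborel. indicator {0<..} t * (exp (- t) * t powr s)) * (symb \<xi> \<bullet> \<xi>)" by simp
  finally have "0 < (LINT t|lborel. indicator {0<..} t * (exp (- t) * t powr s)) * (symb \<xi> \<bullet> \<xi>)" .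
  moreover have "0 \<le> (LINT t::real|lborel. indicator {0<..} t * (exp (- t) * t powr s))" by simp
  ultimately show ?thesis by (simp add: zero_less_mult_iff)
qed

text \<open>The 2 accounts for the total oscillation, \<open>norm \<xi>\<close> for the Lipschitz
  constant.\<close>

lemma osc_bounded_cos: "osc_bounded (2 + norm \<xi>) (\<lambda>x. cos (\<xi> \<bullet> x))"
  and osc_bounded_sin: "osc_bounded (2 + norm \<xi>) (\<lambda>x. sin (\<xi> \<bullet> x))"
proof -
  have lip: "\<bar>\<xi> \<bullet> x - \<xi> \<bullet> y\<bar> \<le> norm \<xi> * norm (x - y)" for x y
    using Cauchy_Schwarz_ineq2[of \<xi> "x - y"] by (simp add: inner_diff_right)
  have fin: "d \<le> (2 + norm \<xi>) * min 1 (norm (x - y))" if "d \<le> 2" "d \<le> \<bar>\<xi> \<bullet> x - \<xi> \<bullet> y\<bar>" for d and x y :: "real^'n"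
  proof -
    have "d \<le> norm \<xi> * norm (x - y)" using that(2) lip by (rule order_trans)
    also have "\<dots> \<le> (2 + norm \<xi>) * norm (x - y)" by (intro mult_right_mono) auto
    finally have "d \<le> (2 + norm \<xi>) * norm (x - y)" .
    moreover have "d \<le> 2 + norm \<xi>" using that(1) norm_ge_zero[of \<xi>] by linarith
    ultimately show ?thesis by (auto simp: min_def)
  qed
  have "\<bar>cos a - cos b\<bar> \<le> \<bar>a - b\<bar>" "\<bar>sin a - sin b\<bar> \<le> \<bar>a - b\<bar>" for a b :: real
  proof -
    have h: "\<bar>sin ((a - b) / 2)\<bar> \<le> \<bar>a - b\<bar> / 2" using abs_sin_x_le_abs_x[of "(a - b) / 2"] by simp
    have h': "\<bar>sin ((b - a) / 2)\<bar> \<le> \<bar>a - b\<bar> / 2" using abs_sin_x_le_abs_x[of "(b - a) / 2"] by simp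
    have "\<bar>cos a - cos b\<bar> = 2 * (\<bar>sin ((a + b) / 2)\<bar> * \<bar>sin ((b - a) / 2)\<bar>)"
      unfolding cos_diff_cos abs_mult by simp
    also have "\<dots> \<le> 2 * (1 * (\<bar>a - b\<bar> / 2))" using h' by (intro mult_left_mono mult_mono abs_sin_le_one) auto
    finally show "\<bar>cos a - cos b\<bar> \<le> \<bar>a - b\<bar>" by simp
    have "\<bar>sin a - sin b\<bar> = 2 * (\<bar>sin ((a - b) / 2)\<bar> * \<bar>cos ((a + b) / 2)\<bar>)"
      unfolding sin_diff_sin abs_mult by simp
    also have "\<dots> \<le> 2 * ((\<bar>a - b\<bar> / 2) * 1)" using h by (intro mult_left_mono mult_mono abs_cos_le_one) auto
    finally show "\<bar>sin a - sin b\<bar> \<le> \<bar>a - b\<bar>" by simp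
  qed note lip1 = this
  have two: "\<bar>cos a - cos b\<bar> \<le> 2" "\<bar>sin a - sin b\<bar> \<le> 2" for a b :: real
    using abs_cos_le_one[of a] abs_cos_le_one[of b] abs_sin_le_one[of a] abs_sin_le_one[of b] by linarith+
  have one: "\<bar>cos a\<bar> \<le> 2 + norm \<xi>" "\<bar>sin a\<bar> \<le> 2 + norm \<xi>" for a
    using abs_cos_le_one[of a] abs_sin_le_one[of a] norm_ge_zero[of \<xi>] by linarith+
  show "osc_bounded (2 + norm \<xi>) (\<lambda>x. cos (\<xi> \<bullet> x))" "osc_bounded (2 + norm \<xi>) (\<lambda>x. sin (\<xi> \<bullet> x))"
    unfolding osc_bounded_def using one by (auto intro!: fin two lip1)
qed

text \<open>An even function is integrated against an odd kernel.\<close>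

lemma cos_kern_integral:
  "integrable lborel (\<lambda>z. (cos (\<xi> \<bullet> z) - 1) *\<^sub>R kern z)" "(LINT z|lborel. (cos (\<xi> \<bullet> z) - 1) *\<^sub>R kern z) = 0"
proof -
  show "integrable lborel (\<lambda>z. (cos (\<xi> \<bullet> z) - 1) *\<^sub>R kern z)"
    using increment_kern_integrable[OF osc_bounded_cos, of \<xi> 0] by simp
  define J where "J = (LINT z|lborel. (cos (\<xi> \<bullet> z) - 1) *\<^sub>R kern z)"
  have "J = - J"
    using fgrad_reflect[OF osc_bounded_cos, of \<xi> 0] by (simp add: fgrad_def J_def)
  hence "(2::real) *\<^sub>R J = 0" by (simp add: scaleR_2)
  hence "J = 0" by (subst (asm) scaleR_eq_0_iff) simp
  thus "(LINT z|lborel. (cos (\<xi> \<bullet> z) - 1) *\<^sub>R kern z) = 0" by (simp add: J_def)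
qed

lemma fgrad_cos: "fgrad (\<lambda>x. cos (\<xi> \<bullet> x)) x = - sin (\<xi> \<bullet> x) *\<^sub>R symb \<xi>"
proof -
  have "(cos (\<xi> \<bullet> (x + z)) - cos (\<xi> \<bullet> x)) *\<^sub>R kern z
      = cos (\<xi> \<bullet> x) *\<^sub>R ((cos (\<xi> \<bullet> z) - 1) *\<^sub>R kern z) - sin (\<xi> \<bullet> x) *\<^sub>R (sin (\<xi> \<bullet> z) *\<^sub>R kern z)" for z
    by (simp add: inner_add_right cos_add scaleR_left_diff_distrib scaleR_right_diff_distrib right_diff_distrib)
  hence "fgrad (\<lambda>x. cos (\<xi> \<bullet> x)) x
      = (LINT z|lborel. cos (\<xi> \<bullet> x) *\<^sub>R ((cos (\<xi> \<bullet> z) - 1) *\<^sub>R kern z) - sin (\<xi> \<bullet> x) *\<^sub>R (sin (\<xi> \<bullet> z) *\<^sub>R kern z))"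
    by (simp only: fgrad_def)
  also have "\<dots> = (LINT z|lborel. cos (\<xi> \<bullet> x) *\<^sub>R ((cos (\<xi> \<bullet> z) - 1) *\<^sub>R kern z)) - (LINT z|lborel. sin (\<xi> \<bullet> x) *\<^sub>R (sin (\<xi> \<bullet> z) *\<^sub>R kern z))"
    by (intro Bochner_Integration.integral_diff integrable_scaleR_right cos_kern_integral(1) sin_kern_integrable)
  also have "\<dots> = - sin (\<xi> \<bullet> x) *\<^sub>R symb \<xi>"
    by (simp only: integral_scaleR_right cos_kern_integral(2) symb_def) simp
  finally show ?thesis .
qed

lemma fgrad_sin: "fgrad (\<lambda>x. sin (\<xi> \<bullet> x)) x = cos (\<xi> \<bullet> x) *\<^sub>R symb \<xi>"
proof -
  have "(sin (\<xi> \<bullet> (x + z)) - sin (\<xi> \<bullet> x)) *\<^sub>R kern z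
      = sin (\<xi> \<bullet> x) *\<^sub>R ((cos (\<xi> \<bullet> z) - 1) *\<^sub>R kern z) + cos (\<xi> \<bullet> x) *\<^sub>R (sin (\<xi> \<bullet> z) *\<^sub>R kern z)" for z
    by (simp add: inner_add_right sin_add scaleR_left_diff_distrib scaleR_left_distrib scaleR_right_diff_distrib right_diff_distrib)
  hence "fgrad (\<lambda>x. sin (\<xi> \<bullet> x)) x
      = (LINT z|lborel. sin (\<xi> \<bullet> x) *\<^sub>R ((cos (\<xi> \<bullet> z) - 1) *\<^sub>R kern z) + cos (\<xi> \<bullet> x) *\<^sub>R (sin (\<xi> \<bullet> z) *\<^sub>R kern z))"
    by (simp only: fgrad_def)
  also have "\<dots> = (LINT z|lborel. sin (\<xi> \<bullet> x) *\<^sub>R ((cos (\<xi> \<bullet> z) - 1) *\<^sub>R kern z)) + (LINT z|lborel. cos (\<xi> \<bullet> x) *\<^sub>R (sin (\<xi> \<bullet> z) *\<^sub>R kern z))"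
    by (intro Bochner_Integration.integral_add integrable_scaleR_right cos_kern_integral(1) sin_kern_integrable)
  also have "\<dots> = cos (\<xi> \<bullet> x) *\<^sub>R symb \<xi>"
    by (simp only: integral_scaleR_right cos_kern_integral(2) symb_def) simp
  finally show ?thesis .
qed

lemma kern_nth_measurable [measurable]: "(\<lambda>z. kern z $ j) \<in> borel_measurable borel"
proof -
  have "(\<lambda>z. kern z \<bullet> axis j 1) \<in> borel_measurable borel" by measurable
  thus ?thesis by (simp add: inner_axis)
qed

lemma symb_nth: "symb \<xi> $ j = (LINT z|lborel. sin (\<xi> \<bullet> z) * kern z $ j)"
  using symb_inner[of \<xi> "axis j 1"] by (simp add: inner_axis)

lemma integral_lborel_invariant:
  fixes f :: "real ^ 'n \<Rightarrow> real"
  assumes "distr lborel borel g = (lborel :: (real^'n) measure)" and [measurable]: "g \<in> borel_measurable borel" "f \<in> borel_measurable borel"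
  shows "(LINT z|lborel. f (g z)) = (LINT z|lborel. f z)"
  using integral_distr[of g lborel borel f] assms(1) by simp

text \<open>Flipping coordinate \<open>j\<close> preserves \<open>\<xi> \<bullet> z\<close> and
  reverses the sign of \<open>kern z $ j\<close>.\<close>

lemma symb_nth_zero:
  assumes "\<xi> $ j = 0" shows "symb \<xi> $ j = 0"
proof -
  have f: "\<xi> \<bullet> flip_coord j z = \<xi> \<bullet> z" for z
    unfolding inner_vec_def by (rule sum.cong) (auto simp: flip_coord_def assms)
  have "kern (flip_coord j z) $ j = - kern z $ j" for z
    by (simp add: kern_def norm_flip_coord) (simp add: flip_coord_def)
  hence "(LINT z|lborel. sin (\<xi> \<bullet> flip_coord j z) * kern (flip_coord j z) $ j) = - (LINT z|lborel. sin (\<xi> \<bullet> z) * kern z $ j)"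
    by (simp add: f)
  moreover have "(LINT z|lborel. sin (\<xi> \<bullet> flip_coord j z) * kern (flip_coord j z) $ j) = (LINT z|lborel. sin (\<xi> \<bullet> z) * kern z $ j)"
    by (rule integral_lborel_invariant[OF lborel_distr_flip_coord])
       (auto intro!: borel_measurable_times kern_nth_measurable)
  ultimately show ?thesis by (simp add: symb_nth equal_neg_zero)
qed

text \<open>Exchanging coordinates \<open>i\<close> and \<open>j\<close> preserves
  \<open>\<xi> \<bullet> z\<close> and exchanges the two components of the kernel.\<close>

lemma symb_nth_swap:
  assumes "\<xi> $ i = \<xi> $ j" shows "symb \<xi> $ i = symb \<xi> $ j"
proof -
  define p where "p = Transposition.transpose i j"
  have p: "bij p" by (simp add: p_def)
  define g where "g = (\<lambda>z::real^'n. \<chi> k. z $ p k)"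
  have [measurable]: "g \<in> borel_measurable borel"
    unfolding g_def by (intro borel_measurable_continuous_onI continuous_on_vec_lambda continuous_intros)
  have xp: "\<xi> $ p k = \<xi> $ k" for k using assms by (auto simp: p_def Transposition.transpose_def)
  have f: "\<xi> \<bullet> g z = \<xi> \<bullet> z" for z
  proof -
    have "\<xi> \<bullet> g z = (\<Sum>k\<in>UNIV. \<xi> $ p k \<bullet> z $ p k)" by (simp add: inner_vec_def g_def xp)
    also have "\<dots> = \<xi> \<bullet> z" using sum.reindex_bij_betw[OF p, of "\<lambda>k. \<xi> $ k \<bullet> z $ k"] by (simp add: inner_vec_def)
    finally show ?thesis .
  qed
  have "kern (g z) $ i = kern z $ j" for z
    unfolding kern_def g_def norm_permute_cart[OF p] by (simp add: p_def)
  hence "(LINT z|lborel. sin (\<xi> \<bullet> g z) * kern (g z) $ i) = (LINT z|lborel. sin (\<xi> \<bullet> z) * kern z $ j)"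
    by (simp add: f)
  moreover have "(LINT z|lborel. sin (\<xi> \<bullet> g z) * kern (g z) $ i) = (LINT z|lborel. sin (\<xi> \<bullet> z) * kern z $ i)"
    by (rule integral_lborel_invariant)
       (use lborel_distr_permute_cart[OF p] in \<open>auto simp: g_def[symmetric] intro!: borel_measurable_times kern_nth_measurable\<close>)
  ultimately show ?thesis by (simp add: symb_nth)
qed

text \<open>For these special directions flips and swaps already force parallelism: vanishing
  coordinates of \<open>\<xi>\<close> give vanishing components of the symbol, and equal ones give
  equal components. These directions are also exactly those that polarisation will use.\<close>

lemma symb_parallel:
  assumes "\<xi> = axis i 1 \<or> (i \<noteq> j \<and> \<xi> = axis i 1 + axis j 1)"
  obtains w where "w > 0" "symb \<xi> = w *\<^sub>R \<xi>"
proof -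
  define w where "w = symb \<xi> $ i"
  have nz: "\<xi> \<noteq> 0"
  proof
    assume "\<xi> = 0"
    hence "\<xi> $ i = 0" by simp
    thus False using assms by (auto simp: axis_def)
  qed
  have eq: "symb \<xi> = w *\<^sub>R \<xi>"
  proof (rule vec_eq_iff[THEN iffD2], rule allI)
    fix k
    show "symb \<xi> $ k = (w *\<^sub>R \<xi>) $ k"
    proof (cases "\<xi> $ k = 0")
      case False
      hence "\<xi> $ k = 1" "\<xi> $ i = 1" using assms by (auto simp: axis_def split: if_splits)
      thus ?thesis using symb_nth_swap[of \<xi> k i] by (simp add: w_def)
    qed (simp add: symb_nth_zero)
  qed
  have "0 < w * (\<xi> \<bullet> \<xi>)" using symb_inner_pos[OF nz] by (simp add: eq)
  moreover have "\<xi> \<bullet> \<xi> > 0" using nz by simp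
  ultimately have "w > 0" by (simp only: zero_less_mult_iff) linarith
  thus ?thesis using that eq by blast
qed

lemma symb_continuous: "continuous_on UNIV symb"
proof (rule continuous_on_sequentiallyI)
  fix u :: "nat \<Rightarrow> real ^ 'n" and a assume u: "u \<longlonglongrightarrow> a"
  hence "Bseq u" using convergentI convergent_imp_Bseq by blast
  then obtain B where B: "\<And>k. norm (u k) \<le> B" by (auto simp: Bseq_def)
  show "(\<lambda>k. symb (u k)) \<longlonglongrightarrow> symb a"
    unfolding symb_def
  proof (rule integral_dominated_convergence)
    show "integrable lborel (\<lambda>z. (1 + B) * kap z)" by (intro integrable_mult_right kap_integrable)
    show "AE z in lborel. (\<lambda>k. sin (u k \<bullet> z) *\<^sub>R kern z) \<longlonglongrightarrow> sin (a \<bullet> z) *\<^sub>R kern z"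
      by (intro AE_I2 tendsto_intros u)
    show "AE z in lborel. norm (sin (u k \<bullet> z) *\<^sub>R kern z) \<le> (1 + B) * kap z" for k
    proof (rule AE_I2)
      fix z
      have "(1 + norm (u k)) * kap z \<le> (1 + B) * kap z" using B[of k] by (intro mult_right_mono) (auto simp: kap_nonneg)
      thus "norm (sin (u k \<bullet> z) *\<^sub>R kern z) \<le> (1 + B) * kap z" using abs_sin_kern_le[of "u k" z] by simp
    qed
  qed measurable
qed

text \<open>\<open>w\<close> is the minimum over the unit sphere, positive by
  \<open>symb_inner_pos\<close>; homogeneity does the rest.\<close>

lemma symb_lower_bound: obtains w where "w > 0" "\<And>\<xi>. w * norm \<xi> powr s \<le> norm (symb \<xi>)"
proof -
  have c: "continuous_on (sphere 0 1) (\<lambda>\<xi>. norm (symb \<xi>))"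
    by (intro continuous_on_norm continuous_on_subset[OF symb_continuous]) auto
  have "\<exists>e\<in>sphere 0 1. \<forall>\<xi>\<in>sphere 0 1. norm (symb e) \<le> norm (symb \<xi>)"
    by (rule continuous_attains_inf[OF _ _ c]) auto
  then obtain e where e: "e \<in> sphere 0 1" "\<And>\<xi>. \<xi> \<in> sphere 0 1 \<Longrightarrow> norm (symb e) \<le> norm (symb \<xi>)"
    by blast
  have "e \<noteq> 0" using e(1) by auto
  hence "symb e \<noteq> 0" using symb_inner_pos[of e] by auto
  moreover have "norm (symb e) * norm \<xi> powr s \<le> norm (symb \<xi>)" for \<xi>
  proof (cases "\<xi> = 0")
    case False
    have "symb \<xi> = norm \<xi> powr s *\<^sub>R symb (inverse (norm \<xi>) *\<^sub>R \<xi>)"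
      using symb_scale[of "norm \<xi>" "inverse (norm \<xi>) *\<^sub>R \<xi>"] False by simp
    moreover have "norm (symb e) \<le> norm (symb (inverse (norm \<xi>) *\<^sub>R \<xi>))" using False by (intro e(2)) simp
    hence "norm \<xi> powr s * norm (symb e) \<le> norm \<xi> powr s * norm (symb (inverse (norm \<xi>) *\<^sub>R \<xi>))" by (intro mult_left_mono) auto
    ultimately show ?thesis by (simp add: mult.commute)
  qed simp
  ultimately show ?thesis using that[of "norm (symb e)"] by simp
qed

end

section \<open>Fractional Poincare inequality and compactness\<close>

definition gauss :: "'a::euclidean_space \<Rightarrow> real" where "gauss x = exp (- (norm x)\<^sup>2 / 2)"

lemma gauss_bounds: "0 < gauss x" "gauss x \<le> 1" by (auto simp: gauss_def)

lemma abs_gauss: "\<bar>gauss x\<bar> = gauss x" using gauss_bounds(1)[of x] by simp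

lemma gauss_measurable [measurable]: "gauss \<in> borel_measurable borel"
  unfolding gauss_def by measurable

definition gauss_mass :: "'a::euclidean_space itself \<Rightarrow> real" where
  "gauss_mass _ = sqrt (2 * pi) ^ DIM('a)"

lemma gauss_mass_pos: "0 < gauss_mass TYPE('a::euclidean_space)" by (simp add: gauss_mass_def)

text \<open>The product over the coordinates of the characteristic function of the standard normal
  distribution, with the normalisation removed.\<close>

lemma gauss_cis:
  fixes w :: "'a::euclidean_space"
  shows "integrable lborel (\<lambda>x. gauss x *\<^sub>R cis (w \<bullet> x))"
    and "(LINT x|lborel. gauss x *\<^sub>R cis (w \<bullet> x)) = of_real (gauss_mass TYPE('a) * gauss w)"
proof -
  have [measurable]: "cis \<in> borel_measurable borel"
    by (intro borel_measurable_continuous_onI continuous_intros)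
  define f where "f = (\<lambda>(b::'a) (t::real). (std_normal_density t *\<^sub>R cis ((w \<bullet> b) * t) :: complex))"
  have fi: "integrable lborel (f b)" for b
  proof (rule Bochner_Integration.integrable_bound)
    show "integrable lborel std_normal_density" using integrable_std_normal_moment[of 0] by simp
    show "AE t in lborel. norm (f b t) \<le> norm (std_normal_density t)" by (simp add: f_def)
  qed (simp add: f_def)
  have f1: "integral\<^sup>L lborel (f b) = of_real (exp (- (w \<bullet> b)\<^sup>2 / 2))" for b
  proof -
    have "char std_normal_distribution (w \<bullet> b) = integral\<^sup>L lborel (f b)"
      unfolding char_def f_def by (subst integral_density) (auto simp: cis_conv_exp mult.commute)
    thus ?thesis by (simp add: char_std_normal_distribution)
  qed
  have prod: "(\<Prod>b\<in>Basis. f b (x \<bullet> b)) = (1 / gauss_mass TYPE('a)) *\<^sub>R (gauss x *\<^sub>R cis (w \<bullet> x))" for x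
  proof -
    have "(\<Prod>b\<in>Basis. f b (x \<bullet> b)) = of_real (\<Prod>b\<in>Basis. std_normal_density (x \<bullet> b)) * (\<Prod>b\<in>Basis. cis ((w \<bullet> b) * (x \<bullet> b)))"
      by (simp add: f_def scaleR_conv_of_real prod.distrib)
    also have "(\<Prod>b\<in>Basis. cis ((w \<bullet> b) * (x \<bullet> b))) = cis (w \<bullet> x)"
      unfolding cis_conv_exp euclidean_inner[of w x] by (simp add: exp_sum[symmetric] sum_distrib_left[symmetric])
    also have "(\<Prod>b\<in>Basis. std_normal_density (x \<bullet> b)) = (1 / gauss_mass TYPE('a)) * gauss x"
    proof -
      have "(\<Prod>b\<in>Basis. std_normal_density (x \<bullet> b)) = (\<Prod>b\<in>Basis. (1 / sqrt (2 * pi)) * exp (- (x \<bullet> b)\<^sup>2 / 2))"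
        by (simp add: std_normal_density_def)
      also have "\<dots> = (1 / sqrt (2 * pi)) ^ DIM('a) * exp (\<Sum>b\<in>Basis. - (x \<bullet> b)\<^sup>2 / 2)"
        by (simp only: prod.distrib exp_sum[OF finite_Basis] prod_constant)
      also have "(\<Sum>b\<in>Basis. - (x \<bullet> b)\<^sup>2 / 2) = - (norm x)\<^sup>2 / 2"
        by (simp add: norm_eq_sqrt_inner euclidean_inner[of x x] power2_eq_square sum_negf sum_divide_distrib sum_nonneg)
      finally show ?thesis by (simp add: gauss_mass_def gauss_def power_one_over)
    qed
    finally show ?thesis by (simp add: scaleR_conv_of_real flip: of_real_prod)
  qed
  interpret product_sigma_finite "\<lambda>_::'a. lborel :: real measure" by standard
  have mp: "(\<lambda>x. \<Prod>b\<in>Basis. f b (x \<bullet> b)) \<in> borel_measurable borel"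
    unfolding prod by measurable
  have pm: "(\<lambda>g::'a\<Rightarrow>real. \<Sum>b\<in>Basis. g b *\<^sub>R b) \<in> measurable (\<Pi>\<^sub>M b\<in>Basis. lborel) borel" by measurable
  have coord: "(\<Sum>c\<in>Basis. g c *\<^sub>R c) \<bullet> b = g b" if "b \<in> Basis" for g :: "'a \<Rightarrow> real" and b
    using that by (simp add: inner_sum_left inner_Basis if_distrib sum.delta cong: if_cong)
  have ie: "integrable lborel (\<lambda>x. \<Prod>b\<in>Basis. f b (x \<bullet> b)) \<longleftrightarrow> integrable (\<Pi>\<^sub>M b\<in>(Basis::'a set). lborel) (\<lambda>g. \<Prod>b\<in>Basis. f b (g b))"
    by (subst lborel_eq, subst integrable_distr_eq[OF pm mp]) (simp add: coord cong: prod.cong)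
  have ii: "(LINT x|lborel. (\<Prod>b\<in>Basis. f b (x \<bullet> b))) = (LINT g|(\<Pi>\<^sub>M b\<in>(Basis::'a set). lborel). (\<Prod>b\<in>Basis. f b (g b)))"
    by (subst lborel_eq, subst integral_distr[OF pm mp]) (simp add: coord cong: prod.cong)
  have "integrable lborel (\<lambda>x. \<Prod>b\<in>Basis. f b (x \<bullet> b))"
    unfolding ie by (rule product_integrable_prod) (auto intro: fi)
  hence 1: "integrable lborel (\<lambda>x. (1 / gauss_mass TYPE('a)) *\<^sub>R (gauss x *\<^sub>R cis (w \<bullet> x)))" by (simp only: prod)
  have "integrable lborel (\<lambda>x. gauss_mass TYPE('a) *\<^sub>R (1 / gauss_mass TYPE('a)) *\<^sub>R (gauss x *\<^sub>R cis (w \<bullet> x)))"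
    by (rule integrable_scaleR_right[OF 1])
  thus "integrable lborel (\<lambda>x. gauss x *\<^sub>R cis (w \<bullet> x))" using gauss_mass_pos[where 'a='a] by simp
  have "(LINT x|lborel. (\<Prod>b\<in>Basis. f b (x \<bullet> b))) = (\<Prod>b\<in>Basis. integral\<^sup>L lborel (f b))"
    unfolding ii by (rule product_integral_prod) (auto intro: fi)
  also have "\<dots> = of_real (gauss w)"
  proof -
    have "(\<Prod>b\<in>Basis. integral\<^sup>L lborel (f b)) = of_real (exp (\<Sum>b\<in>Basis. - (w \<bullet> b)\<^sup>2 / 2))"
      by (simp add: f1 exp_sum)
    also have "(\<Sum>b\<in>Basis. - (w \<bullet> b)\<^sup>2 / 2) = - (norm w)\<^sup>2 / 2"
      by (simp add: norm_eq_sqrt_inner euclidean_inner[of w w] power2_eq_square sum_negf sum_divide_distrib sum_nonneg)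
    finally show ?thesis by (simp add: gauss_def)
  qed
  finally have "(1 / gauss_mass TYPE('a)) *\<^sub>R (LINT x|lborel. gauss x *\<^sub>R cis (w \<bullet> x)) = of_real (gauss w)"
    by (simp only: prod integral_scaleR_right)
  hence "gauss_mass TYPE('a) *\<^sub>R (1 / gauss_mass TYPE('a)) *\<^sub>R (LINT x|lborel. gauss x *\<^sub>R cis (w \<bullet> x)) = gauss_mass TYPE('a) *\<^sub>R of_real (gauss w)"
    by simp
  thus "(LINT x|lborel. gauss x *\<^sub>R cis (w \<bullet> x)) = of_real (gauss_mass TYPE('a) * gauss w)"
    using gauss_mass_pos[where 'a='a] by (simp add: scaleR_conv_of_real)
qed

lemma gauss_cos:
  fixes w :: "'a::euclidean_space"
  shows "integrable lborel (\<lambda>x. gauss x * cos (w \<bullet> x))"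
    and "(LINT x|lborel. gauss x * cos (w \<bullet> x)) = gauss_mass TYPE('a) * gauss w"
proof -
  have "integrable lborel (\<lambda>x. Re (gauss x *\<^sub>R cis (w \<bullet> x)))" by (rule integrable_Re[OF gauss_cis(1)])
  thus "integrable lborel (\<lambda>x. gauss x * cos (w \<bullet> x))" by simp
  have "(LINT x|lborel. Re (gauss x *\<^sub>R cis (w \<bullet> x))) = Re (LINT x|lborel. gauss x *\<^sub>R cis (w \<bullet> x))"
    by (rule integral_Re[OF gauss_cis(1)])
  thus "(LINT x|lborel. gauss x * cos (w \<bullet> x)) = gauss_mass TYPE('a) * gauss w" by (simp add: gauss_cis(2))
qed

lemma gauss_integral:
  shows "integrable lborel (gauss :: 'a::euclidean_space \<Rightarrow> real)"
    and "(LINT x|lborel. gauss (x::'a)) = gauss_mass TYPE('a)"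
  using gauss_cos[of "0::'a"] by (simp_all add: gauss_def[of "0::'a"])

lemma gauss_scaled_cos:
  fixes w :: "'a::euclidean_space"
  assumes e: "e > 0"
  shows "integrable lborel (\<lambda>x. gauss (e *\<^sub>R x) * cos (w \<bullet> x))"
    and "(LINT x|lborel. gauss (e *\<^sub>R x) * cos (w \<bullet> x)) = gauss_mass TYPE('a) * gauss ((1 / e) *\<^sub>R w) / e ^ DIM('a)"
proof -
  have eq: "gauss (e *\<^sub>R x) * cos (w \<bullet> x) = (\<lambda>y. gauss y * cos (((1 / e) *\<^sub>R w) \<bullet> y)) (0 + e *\<^sub>R x)" for x
    using e by simp
  show "integrable lborel (\<lambda>x. gauss (e *\<^sub>R x) * cos (w \<bullet> x))"
    unfolding eq by (subst integrable_lborel_affine) (use e gauss_cos(1)[of "(1 / e) *\<^sub>R w"] in auto)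
  show "(LINT x|lborel. gauss (e *\<^sub>R x) * cos (w \<bullet> x)) = gauss_mass TYPE('a) * gauss ((1 / e) *\<^sub>R w) / e ^ DIM('a)"
    unfolding eq by (subst integral_lborel_affine) (use e gauss_cos(2)[of "(1 / e) *\<^sub>R w"] in auto)
qed

text \<open>The squared modulus of the Fourier transform of a real function, in real integrals.
  Weighted by a Gaussian it can be integrated for any integrable \<open>f\<close>, so no extension
  of the transform to L2 has to be built.\<close>

definition power_spectrum :: "('a::euclidean_space \<Rightarrow> real) \<Rightarrow> 'a \<Rightarrow> real" where
  "power_spectrum f \<xi> = (LINT x|lborel. f x * cos (\<xi> \<bullet> x))\<^sup>2 + (LINT x|lborel. f x * sin (\<xi> \<bullet> x))\<^sup>2"

lemma power_spectrum_nonneg: "0 \<le> power_spectrum f \<xi>" by (simp add: power_spectrum_def)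

lemma power_spectrum_measurable [measurable (raw)]:
  assumes [measurable]: "f \<in> borel_measurable borel"
  shows "power_spectrum f \<in> borel_measurable borel"
proof -
  have "(\<lambda>\<xi>. (LINT x|lborel. f x * cos (\<xi> \<bullet> x))\<^sup>2 + (LINT x|lborel. f x * sin (\<xi> \<bullet> x))\<^sup>2) \<in> borel_measurable lborel"
    by measurable
  thus ?thesis by (simp add: power_spectrum_def[abs_def])
qed

lemma integrable_mult_bounded:
  fixes f h :: "'a::euclidean_space \<Rightarrow> real"
  assumes "integrable lborel f" "h \<in> borel_measurable borel" "\<And>x. \<bar>h x\<bar> \<le> C"
  shows "integrable lborel (\<lambda>x. f x * h x)"
proof (rule Bochner_Integration.integrable_bound)
  show "integrable lborel (\<lambda>x. C * \<bar>f x\<bar>)" using assms(1) by (intro integrable_mult_right integrable_abs)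
  have "0 \<le> C" using assms(3)[of 0] by linarith
  thus "AE x in lborel. norm (f x * h x) \<le> norm (C * \<bar>f x\<bar>)"
  proof (intro AE_I2)
    fix x
    show "norm (f x * h x) \<le> norm (C * \<bar>f x\<bar>)"
      using mult_left_mono[OF assms(3)[of x] abs_ge_zero[of "f x"]] \<open>0 \<le> C\<close> by (simp add: abs_mult mult.commute)
  qed
qed (use assms in auto)

lemma power_spectrum_le:
  assumes f: "integrable lborel f"
  shows "power_spectrum f \<xi> \<le> 2 * (LINT x|lborel. \<bar>f x\<bar>)\<^sup>2"
proof -
  have b: "\<bar>LINT x|lborel. f x * h x\<bar> \<le> (LINT x|lborel. \<bar>f x\<bar>)"
    if h: "h \<in> borel_measurable borel" "\<And>x. \<bar>h x\<bar> \<le> 1" for h :: "'a \<Rightarrow> real"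
  proof -
    have "\<bar>LINT x|lborel. f x * h x\<bar> \<le> (LINT x|lborel. \<bar>f x * h x\<bar>)" by (rule integral_abs_bound)
    also have "\<dots> \<le> (LINT x|lborel. \<bar>f x\<bar>)"
      by (intro integral_mono integrable_abs integrable_mult_bounded[OF f h] f) (auto simp: abs_mult mult_left_le h)
    finally show ?thesis .
  qed
  have "(LINT x|lborel. f x * cos (\<xi> \<bullet> x))\<^sup>2 \<le> (LINT x|lborel. \<bar>f x\<bar>)\<^sup>2"
    by (subst power2_abs[symmetric], intro power_mono b) auto
  moreover have "(LINT x|lborel. f x * sin (\<xi> \<bullet> x))\<^sup>2 \<le> (LINT x|lborel. \<bar>f x\<bar>)\<^sup>2"
    by (subst power2_abs[symmetric], intro power_mono b) auto
  ultimately show ?thesis by (simp add: power_spectrum_def)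
qed

definition autocorrelation :: "('a::euclidean_space \<Rightarrow> real) \<Rightarrow> 'a \<Rightarrow> real" where
  "autocorrelation f w = (LINT x|lborel. f x * f (x + w))"

lemma product_pair_integrable:
  fixes f :: "'a::euclidean_space \<Rightarrow> real" and g :: "'b::euclidean_space \<Rightarrow> real"
  assumes f: "integrable lborel f" and g: "integrable lborel g"
  shows "integrable (lborel \<Otimes>\<^sub>M lborel) (\<lambda>(x, y). f x * g y)"
proof (rule lborel_pair.Fubini_integrable)
  show "(\<lambda>(x, y). f x * g y) \<in> borel_measurable (lborel \<Otimes>\<^sub>M lborel)"
    using borel_measurable_integrable[OF f] borel_measurable_integrable[OF g] by measurable
  show "integrable lborel (\<lambda>x. LINT y|lborel. norm (case (x, y) of (x, y) \<Rightarrow> f x * g y))"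
    using integrable_abs[OF f] by (simp add: abs_mult)
qed (use g in auto)

lemma integral_product_pair:
  fixes f :: "'a::euclidean_space \<Rightarrow> real" and g :: "'b::euclidean_space \<Rightarrow> real"
  assumes f: "integrable lborel f" and g: "integrable lborel g"
  shows "(LINT p|(lborel \<Otimes>\<^sub>M lborel). f (fst p) * g (snd p)) = (LINT x|lborel. f x) * (LINT y|lborel. g y)"
  using lborel_pair.integral_fst[OF product_pair_integrable[OF f g]] by (simp add: case_prod_beta')

text \<open>The squared Fourier integrals form a double integral of
  \<open>f x * f y * cos (\<xi> \<bullet> (x - y))\<close>. Integrating the wide Gaussian over
  \<open>\<xi>\<close> leaves a narrow one in \<open>y - x\<close>, and
  \<open>y = x + e *\<^sub>R w\<close> exposes the autocorrelation.\<close>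

lemma
  fixes f :: "'a::euclidean_space \<Rightarrow> real"
  assumes f: "integrable lborel f" and [measurable]: "f \<in> borel_measurable borel" and e: "e > 0"
  shows gauss_spectrum_integrable: "integrable lborel (\<lambda>\<xi>. gauss (e *\<^sub>R \<xi>) * power_spectrum f \<xi>)"
    and gauss_spectrum_eq: "integrable lborel (\<lambda>x. (f x)\<^sup>2) \<Longrightarrow>
      (LINT \<xi>|lborel. gauss (e *\<^sub>R \<xi>) * power_spectrum f \<xi>) = gauss_mass TYPE('a) * (LINT w|lborel. gauss w * autocorrelation f (e *\<^sub>R w))"
proof -
  have ge: "integrable lborel (\<lambda>\<xi>::'a. gauss (e *\<^sub>R \<xi>))" using gauss_scaled_cos(1)[OF e, of "0::'a"] by simp
  show "integrable lborel (\<lambda>\<xi>. gauss (e *\<^sub>R \<xi>) * power_spectrum f \<xi>)"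
    by (rule integrable_mult_bounded[OF ge, of _ "2 * (LINT x|lborel. \<bar>f x\<bar>)\<^sup>2"])
       (use power_spectrum_le[OF f] in \<open>auto simp: power_spectrum_nonneg\<close>)
  assume f2: "integrable lborel (\<lambda>x. (f x)\<^sup>2)"
  have fc: "integrable lborel (\<lambda>x. f x * cos (\<xi> \<bullet> x))" "integrable lborel (\<lambda>x. f x * sin (\<xi> \<bullet> x))" for \<xi>
    by (rule integrable_mult_bounded[OF f, of _ 1]; simp)+
  have ps: "power_spectrum f \<xi> = (LINT p|(lborel \<Otimes>\<^sub>M lborel). f (fst p) * f (snd p) * cos (\<xi> \<bullet> (fst p - snd p)))" for \<xi>
  proof -
    have i1: "integrable (lborel \<Otimes>\<^sub>M lborel) (\<lambda>p. (f (fst p) * cos (\<xi> \<bullet> fst p)) * (f (snd p) * cos (\<xi> \<bullet> snd p)))"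
      using product_pair_integrable[OF fc(1) fc(1), of \<xi> \<xi>] by (simp add: case_prod_beta')
    have i2: "integrable (lborel \<Otimes>\<^sub>M lborel) (\<lambda>p. (f (fst p) * sin (\<xi> \<bullet> fst p)) * (f (snd p) * sin (\<xi> \<bullet> snd p)))"
      using product_pair_integrable[OF fc(2) fc(2), of \<xi> \<xi>] by (simp add: case_prod_beta')
    have "(LINT p|(lborel \<Otimes>\<^sub>M lborel). f (fst p) * f (snd p) * cos (\<xi> \<bullet> (fst p - snd p)))
      = (LINT p|(lborel \<Otimes>\<^sub>M lborel). (f (fst p) * cos (\<xi> \<bullet> fst p)) * (f (snd p) * cos (\<xi> \<bullet> snd p))
           + (f (fst p) * sin (\<xi> \<bullet> fst p)) * (f (snd p) * sin (\<xi> \<bullet> snd p)))"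
      by (intro Bochner_Integration.integral_cong) (auto simp: inner_diff_right cos_diff algebra_simps)
    also have "\<dots> = power_spectrum f \<xi>"
      by (simp only: Bochner_Integration.integral_add[OF i1 i2] integral_product_pair[OF fc(1) fc(1)] integral_product_pair[OF fc(2) fc(2)]
          power_spectrum_def power2_eq_square)
    finally show ?thesis by simp
  qed
  interpret P2: pair_sigma_finite "lborel :: 'a measure" "lborel \<Otimes>\<^sub>M lborel :: ('a \<times> 'a) measure"
    by (simp add: pair_sigma_finite_def lborel.sigma_finite_measure_axioms sigma_finite_pair_measure sigma_finite_lborel)
  have ff: "integrable (lborel \<Otimes>\<^sub>M lborel) (\<lambda>p. f (fst p) * f (snd p))"
    using product_pair_integrable[OF f f] by (simp add: case_prod_beta')
  have trip: "integrable (lborel \<Otimes>\<^sub>M (lborel \<Otimes>\<^sub>M lborel)) (\<lambda>(\<xi>, p). gauss (e *\<^sub>R \<xi>) * (f (fst p) * f (snd p) * cos (\<xi> \<bullet> (fst p - snd p))))"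
  proof (rule Bochner_Integration.integrable_bound)
    show "integrable (lborel \<Otimes>\<^sub>M (lborel \<Otimes>\<^sub>M lborel)) (\<lambda>(\<xi>::'a, p). gauss (e *\<^sub>R \<xi>) * (f (fst p) * f (snd p)))"
    proof (rule P2.Fubini_integrable)
      show "integrable lborel (\<lambda>\<xi>::'a. LINT p|(lborel \<Otimes>\<^sub>M lborel). norm (case (\<xi>, p) of (\<xi>, p) \<Rightarrow> gauss (e *\<^sub>R \<xi>) * (f (fst p) * f (snd p))))"
        using ge gauss_bounds(1) by (simp add: abs_mult abs_gauss)
    qed (use ff in auto)
    show "AE p in lborel \<Otimes>\<^sub>M (lborel \<Otimes>\<^sub>M lborel). norm (case p of (\<xi>, p) \<Rightarrow> gauss (e *\<^sub>R \<xi>) * (f (fst p) * f (snd p) * cos (\<xi> \<bullet> (fst p - snd p))))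
        \<le> norm (case p of (\<xi>, p) \<Rightarrow> gauss (e *\<^sub>R \<xi>) * (f (fst p) * f (snd p)))"
    proof (rule AE_I2, clarify)
      fix \<xi> x y :: 'a
      have "\<bar>gauss (e *\<^sub>R \<xi>) * (f x * f y)\<bar> * \<bar>cos (\<xi> \<bullet> (x - y))\<bar> \<le> \<bar>gauss (e *\<^sub>R \<xi>) * (f x * f y)\<bar> * 1"
        by (intro mult_left_mono) auto
      thus "norm (gauss (e *\<^sub>R \<xi>) * (f (fst (x, y)) * f (snd (x, y)) * cos (\<xi> \<bullet> (fst (x, y) - snd (x, y))))) \<le> norm (gauss (e *\<^sub>R \<xi>) * (f (fst (x, y)) * f (snd (x, y))))"
        by (simp add: abs_mult mult.assoc)
    qed
  qed measurable
  define c where "c = gauss_mass TYPE('a) / e ^ DIM('a)"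
  have inner: "(LINT \<xi>|lborel. gauss (e *\<^sub>R \<xi>) * (f (fst p) * f (snd p) * cos (\<xi> \<bullet> (fst p - snd p))))
      = c * (f (fst p) * f (snd p) * gauss ((1 / e) *\<^sub>R (snd p - fst p)))" for p :: "'a \<times> 'a"
  proof -
    have "(LINT \<xi>|lborel. gauss (e *\<^sub>R \<xi>) * (f (fst p) * f (snd p) * cos (\<xi> \<bullet> (fst p - snd p))))
       = (LINT \<xi>|lborel. (f (fst p) * f (snd p)) * (gauss (e *\<^sub>R \<xi>) * cos ((fst p - snd p) \<bullet> \<xi>)))"
      by (intro Bochner_Integration.integral_cong) (auto simp: inner_commute)
    also have "\<dots> = (f (fst p) * f (snd p)) * (gauss_mass TYPE('a) * gauss ((1 / e) *\<^sub>R (fst p - snd p)) / e ^ DIM('a))"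
      by (simp only: integral_mult_right_zero gauss_scaled_cos(2)[OF e])
    also have "gauss ((1 / e) *\<^sub>R (fst p - snd p)) = gauss ((1 / e) *\<^sub>R (snd p - fst p))"
      by (simp add: gauss_def norm_minus_commute)
    finally show ?thesis by (simp add: c_def)
  qed
  have "(LINT \<xi>|lborel. gauss (e *\<^sub>R \<xi>) * power_spectrum f \<xi>)
      = (LINT \<xi>|lborel. LINT p|(lborel \<Otimes>\<^sub>M lborel). gauss (e *\<^sub>R \<xi>) * (f (fst p) * f (snd p) * cos (\<xi> \<bullet> (fst p - snd p))))"
    by (simp add: ps)
  also have "\<dots> = (LINT p|(lborel \<Otimes>\<^sub>M lborel). LINT \<xi>|lborel. gauss (e *\<^sub>R \<xi>) * (f (fst p) * f (snd p) * cos (\<xi> \<bullet> (fst p - snd p))))"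
    by (rule P2.Fubini_integral[OF trip, symmetric])
  also have "\<dots> = c * (LINT p|(lborel \<Otimes>\<^sub>M lborel). f (fst p) * f (snd p) * gauss ((1 / e) *\<^sub>R (snd p - fst p)))"
    by (simp only: inner integral_mult_right_zero)
  also have "(LINT p|(lborel \<Otimes>\<^sub>M lborel). f (fst p) * f (snd p) * gauss ((1 / e) *\<^sub>R (snd p - fst p)))
      = (LINT x|lborel. LINT y|lborel. f x * f y * gauss ((1 / e) *\<^sub>R (y - x)))"
  proof -
    have "integrable (lborel \<Otimes>\<^sub>M lborel) (\<lambda>(x, y). f x * f y * gauss ((1 / e) *\<^sub>R (y - x)))"
    proof (rule Bochner_Integration.integrable_bound[OF ff])
      have "\<bar>f x * f y\<bar> * gauss ((1 / e) *\<^sub>R (y - x)) \<le> \<bar>f x * f y\<bar> * 1" for x y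
        by (intro mult_left_mono gauss_bounds) auto
      thus "AE p in lborel \<Otimes>\<^sub>M lborel. norm (case p of (x, y) \<Rightarrow> f x * f y * gauss ((1 / e) *\<^sub>R (y - x))) \<le> norm (f (fst p) * f (snd p))"
        by (intro AE_I2) (auto simp: abs_mult abs_gauss)
    qed measurable
    from lborel_pair.integral_fst[OF this] show ?thesis by (simp add: case_prod_beta')
  qed
  also have "\<dots> = (LINT x|lborel. e ^ DIM('a) * (LINT w|lborel. f x * f (x + e *\<^sub>R w) * gauss w))"
  proof (rule Bochner_Integration.integral_cong, simp)
    fix x
    have "(LINT w|lborel. (\<lambda>y. f x * f y * gauss ((1 / e) *\<^sub>R (y - x))) (x + e *\<^sub>R w))
       = (1 / \<bar>e\<bar> ^ DIM('a)) *\<^sub>R (LINT y|lborel. f x * f y * gauss ((1 / e) *\<^sub>R (y - x)))"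
      by (rule integral_lborel_affine) (use e in auto)
    thus "(LINT y|lborel. f x * f y * gauss ((1 / e) *\<^sub>R (y - x))) = e ^ DIM('a) * (LINT w|lborel. f x * f (x + e *\<^sub>R w) * gauss w)"
      using e by simp
  qed
  \<comment> \<open>The Jacobian of \<open>y = x + e *\<^sub>R w\<close> cancels the power of
    \<open>e\<close> in \<open>c\<close>.\<close>
  also have "c * \<dots> = gauss_mass TYPE('a) * (LINT x|lborel. LINT w|lborel. f x * f (x + e *\<^sub>R w) * gauss w)"
    using e by (simp add: c_def)
  also have "(LINT x|lborel. LINT w|lborel. f x * f (x + e *\<^sub>R w) * gauss w) = (LINT w|lborel. LINT x|lborel. f x * f (x + e *\<^sub>R w) * gauss w)"
  proof (rule lborel_pair.Fubini_integral[symmetric])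
    show "integrable (lborel \<Otimes>\<^sub>M lborel) (\<lambda>(x, w). f x * f (x + e *\<^sub>R w) * gauss w)"
    proof (rule Bochner_Integration.integrable_bound)
      have g2: "integrable (lborel \<Otimes>\<^sub>M lborel) (\<lambda>(x, w). (f x)\<^sup>2 * gauss (w::'a))"
        by (rule product_pair_integrable[OF f2 gauss_integral(1)])
      have g3: "integrable (lborel \<Otimes>\<^sub>M lborel) (\<lambda>(x, w). (f (x + e *\<^sub>R w))\<^sup>2 * gauss w)"
      proof (subst lborel_pair.integrable_product_swap_iff[symmetric], rule lborel_pair.Fubini_integrable)
        have "(LINT x|lborel. (f (x + e *\<^sub>R w))\<^sup>2) = (LINT x|lborel. (f x)\<^sup>2)" for w
          using integral_lborel_translate[of "\<lambda>x. (f x)\<^sup>2" "e *\<^sub>R w"] by (simp add: add.commute)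
        thus "integrable lborel (\<lambda>w. LINT x|lborel. norm (case (w, x) of (x, y) \<Rightarrow> case (y, x) of (x, w) \<Rightarrow> (f (x + e *\<^sub>R w))\<^sup>2 * gauss w))"
          using gauss_integral(1)[where 'a='a] by (simp add: abs_mult abs_gauss)
        have "integrable lborel (\<lambda>x. (f (x + e *\<^sub>R w))\<^sup>2)" for w
          using integrable_lborel_translate[of "\<lambda>x. (f x)\<^sup>2" "e *\<^sub>R w"] f2 by (simp add: add.commute)
        thus "AE w in lborel. integrable lborel (\<lambda>x. case (w, x) of (x, y) \<Rightarrow> case (y, x) of (x, w) \<Rightarrow> (f (x + e *\<^sub>R w))\<^sup>2 * gauss w)"
          by simp
      qed measurable
      show "integrable (lborel \<Otimes>\<^sub>M lborel) (\<lambda>p. (case p of (x, w) \<Rightarrow> (f x)\<^sup>2 * gauss w) + (case p of (x, w) \<Rightarrow> (f (x + e *\<^sub>R w))\<^sup>2 * gauss w))"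
        by (rule Bochner_Integration.integrable_add[OF g2 g3])
      have "\<bar>a * b\<bar> * g \<le> a\<^sup>2 * g + b\<^sup>2 * g" if "g \<ge> 0" for a b g :: real
      proof -
        have "\<bar>a * b\<bar> \<le> a\<^sup>2 + b\<^sup>2"
          using sum_squares_bound[of "\<bar>a\<bar>" "\<bar>b\<bar>"] abs_ge_zero[of "a * b"] unfolding power2_abs abs_mult by linarith
        from mult_right_mono[OF this that] show ?thesis by (simp add: algebra_simps)
      qed
      thus "AE p in lborel \<Otimes>\<^sub>M lborel. norm (case p of (x, w) \<Rightarrow> f x * f (x + e *\<^sub>R w) * gauss w)
          \<le> norm ((case p of (x, w) \<Rightarrow> (f x)\<^sup>2 * gauss w) + (case p of (x, w) \<Rightarrow> (f (x + e *\<^sub>R w))\<^sup>2 * gauss w))"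
        by (intro AE_I2) (auto simp: abs_mult abs_gauss less_imp_le[OF gauss_bounds(1)] intro!: order_trans[OF _ abs_ge_self])
    qed measurable
  qed
  also have "\<dots> = (LINT w|lborel. gauss w * autocorrelation f (e *\<^sub>R w))"
    by (simp add: autocorrelation_def mult.commute)
  finally show "(LINT \<xi>|lborel. gauss (e *\<^sub>R \<xi>) * power_spectrum f \<xi>) = gauss_mass TYPE('a) * (LINT w|lborel. gauss w * autocorrelation f (e *\<^sub>R w))" .
qed

lemma autocorrelation_le:
  fixes f :: "'a::euclidean_space \<Rightarrow> real"
  assumes [measurable]: "f \<in> borel_measurable borel" and f2: "integrable lborel (\<lambda>x. (f x)\<^sup>2)"
  shows "\<bar>autocorrelation f w\<bar> \<le> (LINT x|lborel. (f x)\<^sup>2)"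
proof -
  have t: "integrable lborel (\<lambda>x. (f (x + w))\<^sup>2)" "(LINT x|lborel. (f (x + w))\<^sup>2) = (LINT x|lborel. (f x)\<^sup>2)"
    using integrable_lborel_translate[of "\<lambda>x. (f x)\<^sup>2" w] f2 integral_lborel_translate[of "\<lambda>x. (f x)\<^sup>2" w]
    by (simp_all add: add.commute)
  have am: "\<bar>f x * f (x + w)\<bar> \<le> ((f x)\<^sup>2 + (f (x + w))\<^sup>2) / 2" for x
    using sum_squares_bound[of "\<bar>f x\<bar>" "\<bar>f (x + w)\<bar>"] by (simp add: abs_mult)
  have i: "integrable lborel (\<lambda>x. ((f x)\<^sup>2 + (f (x + w))\<^sup>2) / 2)" using f2 t(1) by simp
  have "\<bar>autocorrelation f w\<bar> \<le> (LINT x|lborel. \<bar>f x * f (x + w)\<bar>)"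
    unfolding autocorrelation_def by (rule integral_abs_bound)
  also have "\<dots> \<le> (LINT x|lborel. ((f x)\<^sup>2 + (f (x + w))\<^sup>2) / 2)"
  proof (rule integral_mono[OF _ i am])
    show "integrable lborel (\<lambda>x. \<bar>f x * f (x + w)\<bar>)"
      by (rule Bochner_Integration.integrable_bound[OF i]) (use am in \<open>auto intro!: AE_I2 order_trans[OF _ abs_ge_self]\<close>)
  qed
  also have "\<dots> = (LINT x|lborel. (f x)\<^sup>2)" using f2 t by simp
  finally show ?thesis .
qed

lemma autocorrelation_measurable [measurable (raw)]:
  assumes [measurable]: "f \<in> borel_measurable borel"
  shows "autocorrelation f \<in> borel_measurable borel"
proof -
  have "(\<lambda>w. LINT x|lborel. f x * f (x + w)) \<in> borel_measurable lborel" by measurable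
  thus ?thesis by (simp add: autocorrelation_def[abs_def])
qed

text \<open>One half of Plancherel, uniform in \<open>e\<close>. It will be applied to the
  components of gradients, for which no Lipschitz bound is at hand.\<close>

lemma gauss_spectrum_le:
  fixes f :: "'a::euclidean_space \<Rightarrow> real"
  assumes f: "integrable lborel f" and fm [measurable]: "f \<in> borel_measurable borel" and e: "e > 0"
    and f2: "integrable lborel (\<lambda>x. (f x)\<^sup>2)"
  shows "(LINT \<xi>|lborel. gauss (e *\<^sub>R \<xi>) * power_spectrum f \<xi>) \<le> (gauss_mass TYPE('a))\<^sup>2 * (LINT x|lborel. (f x)\<^sup>2)"
proof -
  define B where "B = (LINT x|lborel. (f x)\<^sup>2)"
  note [measurable] = autocorrelation_measurable[OF fm]
  have ac: "\<bar>autocorrelation f w\<bar> \<le> B" for w unfolding B_def by (rule autocorrelation_le[OF fm f2])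
  have "(LINT w|lborel. gauss w * autocorrelation f (e *\<^sub>R w)) \<le> (LINT w|lborel. gauss (w::'a) * B)"
  proof (rule integral_mono)
    show "integrable lborel (\<lambda>w. gauss w * autocorrelation f (e *\<^sub>R w))"
      by (rule integrable_mult_bounded[OF gauss_integral(1) _ ac]) measurable
    show "integrable lborel (\<lambda>w::'a. gauss w * B)" using gauss_integral(1)[where 'a='a] by simp
    show "gauss w * autocorrelation f (e *\<^sub>R w) \<le> gauss w * B" for w
      using ac[of "e *\<^sub>R w"] by (intro mult_left_mono less_imp_le[OF gauss_bounds(1)]) simp
  qed
  also have "\<dots> = gauss_mass TYPE('a) * B" by (simp add: gauss_integral(2))
  finally have "gauss_mass TYPE('a) * (LINT w|lborel. gauss w * autocorrelation f (e *\<^sub>R w)) \<le> gauss_mass TYPE('a) * (gauss_mass TYPE('a) * B)"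
    by (intro mult_left_mono less_imp_le[OF gauss_mass_pos])
  thus ?thesis unfolding gauss_spectrum_eq[OF f fm e f2] by (simp add: B_def power2_eq_square mult.assoc)
qed

text \<open>The exact limit for Lipschitz functions: the autocorrelation at \<open>w\<close> differs
  from its value at 0, the squared norm, by at most \<open>M * norm w\<close> times the L1
  norm.\<close>

lemma gauss_spectrum_tendsto:
  fixes f :: "'a::euclidean_space \<Rightarrow> real"
  assumes f: "integrable lborel f" and fm [measurable]: "f \<in> borel_measurable borel"
    and f2: "integrable lborel (\<lambda>x. (f x)\<^sup>2)"
    and lip: "\<And>x y. \<bar>f x - f y\<bar> \<le> M * norm (x - y)"
  shows "(\<lambda>k. LINT \<xi>|lborel. gauss ((1 / Suc k) *\<^sub>R \<xi>) * power_spectrum f \<xi>) \<longlonglongrightarrow> (gauss_mass TYPE('a))\<^sup>2 * (LINT x|lborel. (f x)\<^sup>2)"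
proof -
  define B where "B = (LINT x|lborel. (f x)\<^sup>2)"
  note [measurable] = autocorrelation_measurable[OF fm]
  have ac: "\<bar>autocorrelation f w\<bar> \<le> B" for w unfolding B_def by (rule autocorrelation_le[OF fm f2])
  have near: "\<bar>autocorrelation f w - B\<bar> \<le> M * norm w * (LINT x|lborel. \<bar>f x\<bar>)" for w
  proof -
    have t: "integrable lborel (\<lambda>x. (f (x + w))\<^sup>2)"
      using integrable_lborel_translate[of "\<lambda>x. (f x)\<^sup>2" w] f2 by (simp add: add.commute)
    have i1: "integrable lborel (\<lambda>x. f x * f (x + w))"
    proof (rule Bochner_Integration.integrable_bound)
      show "integrable lborel (\<lambda>x. ((f x)\<^sup>2 + (f (x + w))\<^sup>2) / 2)" using f2 t by simp
      have "\<bar>f x * f (x + w)\<bar> \<le> ((f x)\<^sup>2 + (f (x + w))\<^sup>2) / 2" for x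
        using sum_squares_bound[of "\<bar>f x\<bar>" "\<bar>f (x + w)\<bar>"] by (simp add: abs_mult)
      thus "AE x in lborel. norm (f x * f (x + w)) \<le> norm (((f x)\<^sup>2 + (f (x + w))\<^sup>2) / 2)"
        by (intro AE_I2) (auto intro!: order_trans[OF _ abs_ge_self])
    qed measurable
    have "autocorrelation f w - B = (LINT x|lborel. f x * (f (x + w) - f x))"
      unfolding autocorrelation_def B_def using i1 f2
      by (subst Bochner_Integration.integral_diff[symmetric]) (auto simp: algebra_simps power2_eq_square)
    also have "\<bar>\<dots>\<bar> \<le> (LINT x|lborel. \<bar>f x * (f (x + w) - f x)\<bar>)" by (rule integral_abs_bound)
    also have "\<dots> \<le> (LINT x|lborel. \<bar>f x\<bar> * (M * norm w))"
    proof (rule integral_mono)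
      have "integrable lborel (\<lambda>x. f x * f (x + w) - (f x)\<^sup>2)" using i1 f2 by simp
      also have "(\<lambda>x. f x * f (x + w) - (f x)\<^sup>2) = (\<lambda>x. f x * (f (x + w) - f x))" by (auto simp: algebra_simps power2_eq_square)
      finally show "integrable lborel (\<lambda>x. \<bar>f x * (f (x + w) - f x)\<bar>)" by (rule integrable_abs)
      show "integrable lborel (\<lambda>x. \<bar>f x\<bar> * (M * norm w))" using f by simp
      show "\<bar>f x * (f (x + w) - f x)\<bar> \<le> \<bar>f x\<bar> * (M * norm w)" for x
        using lip[of "x + w" x] by (simp add: abs_mult mult_left_mono)
    qed
    also have "\<dots> = M * norm w * (LINT x|lborel. \<bar>f x\<bar>)" by simp
    finally show ?thesis .
  qed
  have "(\<lambda>k. LINT w|lborel. gauss w * autocorrelation f ((1 / Suc k) *\<^sub>R w)) \<longlonglongrightarrow> (LINT w|lborel. gauss (w::'a) * B)"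
  proof (rule integral_dominated_convergence)
    show "integrable lborel (\<lambda>w::'a. gauss w * B)" using gauss_integral(1)[where 'a='a] by simp
    show "AE w in lborel. (\<lambda>k. gauss w * autocorrelation f ((1 / Suc k) *\<^sub>R w)) \<longlonglongrightarrow> gauss w * B"
    proof (intro AE_I2 tendsto_mult_left)
      fix w
      have "(\<lambda>k. autocorrelation f ((1 / Suc k) *\<^sub>R w) - B) \<longlonglongrightarrow> 0"
      proof (rule tendsto_0_le[where K="M * norm w * (LINT x|lborel. \<bar>f x\<bar>)"])
        show "(\<lambda>k. 1 / real (Suc k)) \<longlonglongrightarrow> 0" by (rule LIMSEQ_Suc[OF lim_1_over_n])
        show "\<forall>\<^sub>F k in sequentially. norm (autocorrelation f ((1 / Suc k) *\<^sub>R w) - B) \<le> norm (1 / real (Suc k)) * (M * norm w * (LINT x|lborel. \<bar>f x\<bar>))"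
          using near[of "(1 / Suc _) *\<^sub>R w"] by (intro always_eventually allI) (simp add: mult_ac)
      qed
      thus "(\<lambda>k. autocorrelation f ((1 / Suc k) *\<^sub>R w)) \<longlonglongrightarrow> B" by (simp add: LIM_zero_iff)
    qed
    show "AE w in lborel. norm (gauss w * autocorrelation f ((1 / Suc k) *\<^sub>R w)) \<le> gauss w * B" for k
      using ac by (intro AE_I2) (simp add: abs_mult abs_gauss mult_left_mono less_imp_le[OF gauss_bounds(1)])
  qed measurable
  hence "(\<lambda>k. gauss_mass TYPE('a) * (LINT w|lborel. gauss w * autocorrelation f ((1 / Suc k) *\<^sub>R w))) \<longlonglongrightarrow> gauss_mass TYPE('a) * (gauss_mass TYPE('a) * B)"
    by (intro tendsto_mult_left) (simp add: gauss_integral(2))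
  moreover have "(LINT \<xi>|lborel. gauss ((1 / Suc k) *\<^sub>R \<xi>) * power_spectrum f \<xi>)
      = gauss_mass TYPE('a) * (LINT w|lborel. gauss w * autocorrelation f ((1 / Suc k) *\<^sub>R w))" for k
    by (rule gauss_spectrum_eq[OF f fm _ f2]) simp
  ultimately show ?thesis by (simp add: B_def power2_eq_square mult.assoc)
qed

section \<open>Spectral estimates for test functions\<close>

context fractional_kernel
begin

text \<open>Integrate by parts against plane waves, whose gradients carry the factor
  \<open>symb \<xi>\<close>; only \<open>f\<close> has to have bounded support.\<close>

lemma fgrad_spectrum:
  assumes f: "osc_bounded M f" and supp: "\<And>x. norm x > R \<Longrightarrow> f x = 0"
  shows "(\<Sum>j\<in>UNIV. power_spectrum (\<lambda>x. fgrad f x $ j) \<xi>) = (norm (symb \<xi>))\<^sup>2 * power_spectrum f \<xi>"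
proof -
  note [measurable] = osc_bounded_measurable[OF f]
  have fi: "integrable lborel f" by (rule bounded_support_integrable[OF f supp])
  have i: "integrable lborel (\<lambda>x. g x *\<^sub>R fgrad f x)" if g: "osc_bounded M' g" for g M'
  proof (rule Bochner_Integration.integrable_bound)
    note [measurable] = osc_bounded_measurable[OF g]
    show "integrable lborel (\<lambda>x. M' * norm (fgrad f x))" by (intro integrable_mult_right integrable_norm fgrad_integrable[OF f supp])
    show "AE x in lborel. norm (g x *\<^sub>R fgrad f x) \<le> norm (M' * norm (fgrad f x))"
      using osc_boundedD(1)[OF g] osc_bounded_nonneg[OF g] by (intro AE_I2) (simp add: mult_right_mono)
    note [measurable] = fgrad_measurable[OF osc_bounded_measurable[OF f]]
    show "(\<lambda>x. g x *\<^sub>R fgrad f x) \<in> borel_measurable lborel" by measurable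
  qed
  have c: "(LINT x|lborel. fgrad f x $ j * cos (\<xi> \<bullet> x)) = symb \<xi> $ j * (LINT x|lborel. f x * sin (\<xi> \<bullet> x))" for j
  proof -
    have "(LINT x|lborel. fgrad f x $ j * cos (\<xi> \<bullet> x)) = (LINT x|lborel. (cos (\<xi> \<bullet> x) *\<^sub>R fgrad f x) \<bullet> axis j 1)"
      by (simp add: inner_axis mult.commute)
    also have "\<dots> = (LINT x|lborel. cos (\<xi> \<bullet> x) *\<^sub>R fgrad f x) \<bullet> axis j 1" by (rule integral_inner_left[OF i[OF osc_bounded_cos]])
    also have "(LINT x|lborel. cos (\<xi> \<bullet> x) *\<^sub>R fgrad f x) = (LINT x|lborel. (f x * sin (\<xi> \<bullet> x)) *\<^sub>R symb \<xi>)"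
      using fgrad_by_parts[OF f supp osc_bounded_cos[of \<xi>]] by (simp add: fgrad_cos)
    also have "\<dots> = (LINT x|lborel. f x * sin (\<xi> \<bullet> x)) *\<^sub>R symb \<xi>"
      by (rule integral_scaleR_left) (rule integrable_mult_bounded[OF fi, of _ 1]; simp)
    finally show ?thesis by (simp add: inner_axis mult.commute)
  qed
  have s: "(LINT x|lborel. fgrad f x $ j * sin (\<xi> \<bullet> x)) = - (symb \<xi> $ j * (LINT x|lborel. f x * cos (\<xi> \<bullet> x)))" for j
  proof -
    have "(LINT x|lborel. fgrad f x $ j * sin (\<xi> \<bullet> x)) = (LINT x|lborel. (sin (\<xi> \<bullet> x) *\<^sub>R fgrad f x) \<bullet> axis j 1)"
      by (simp add: inner_axis mult.commute)
    also have "\<dots> = (LINT x|lborel. sin (\<xi> \<bullet> x) *\<^sub>R fgrad f x) \<bullet> axis j 1" by (rule integral_inner_left[OF i[OF osc_bounded_sin]])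
    also have "(LINT x|lborel. sin (\<xi> \<bullet> x) *\<^sub>R fgrad f x) = - (LINT x|lborel. (f x * cos (\<xi> \<bullet> x)) *\<^sub>R symb \<xi>)"
      using fgrad_by_parts[OF f supp osc_bounded_sin[of \<xi>]] by (simp add: fgrad_sin)
    also have "(LINT x|lborel. (f x * cos (\<xi> \<bullet> x)) *\<^sub>R symb \<xi>) = (LINT x|lborel. f x * cos (\<xi> \<bullet> x)) *\<^sub>R symb \<xi>"
      by (rule integral_scaleR_left) (rule integrable_mult_bounded[OF fi, of _ 1]; simp)
    finally show ?thesis by (simp add: inner_axis mult.commute)
  qed
  have "(\<Sum>j\<in>UNIV. power_spectrum (\<lambda>x. fgrad f x $ j) \<xi>) = (\<Sum>j\<in>UNIV. (symb \<xi> $ j)\<^sup>2 * power_spectrum f \<xi>)"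
    unfolding power_spectrum_def c s by (simp add: power_mult_distrib algebra_simps)
  also have "\<dots> = (norm (symb \<xi>))\<^sup>2 * power_spectrum f \<xi>"
    unfolding power2_norm_eq_inner inner_vec_def by (simp add: power2_eq_square sum_distrib_right)
  finally show ?thesis .
qed

text \<open>By Plancherel against a widening Gaussian; frequencies above \<open>r\<close> are absorbed by the gradient because the symbol grows like \<open>r powr s\<close>.\<close>

lemma low_frequency_bound:
  assumes f: "osc_bounded M f" and supp: "\<And>x. norm x > R \<Longrightarrow> f x = 0"
    and w: "w > 0" "\<And>\<xi>. w * norm \<xi> powr s \<le> norm (symb \<xi>)" and r: "r > 0"
  shows "(gauss_mass TYPE(real^'n))\<^sup>2 * (norm (cls f))\<^sup>2
    \<le> (LINT \<xi>|lborel. indicator (cball 0 r) \<xi> * power_spectrum f \<xi>)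
      + (gauss_mass TYPE(real^'n))\<^sup>2 * (norm (cls (fgrad f)))\<^sup>2 / (w * r powr s)\<^sup>2"
proof -
  note fm [measurable] = osc_bounded_measurable[OF f]
  have fi: "integrable lborel f" by (rule bounded_support_integrable[OF f supp])
  have f2: "integrable lborel (\<lambda>x. (f x)\<^sup>2)"
    using integrable_mult_bounded[OF fi fm osc_boundedD(1)[OF f]] by (simp add: power2_eq_square)
  have fL: "f \<in> Ltwo" by (rule Ltwo_borelI[OF fm f2]) simp
  have gL: "fgrad f \<in> Ltwo" by (rule fgrad_Ltwo[OF f supp])
  define F where "F = (\<lambda>j x. fgrad f x $ j)"
  have Fm [measurable]: "F j \<in> borel_measurable borel" for j
  proof -
    have "(\<lambda>x. fgrad f x \<bullet> axis j 1) \<in> borel_measurable borel" by measurable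
    thus ?thesis by (simp add: F_def inner_axis)
  qed
  have Fi: "integrable lborel (F j)" for j
    by (rule Bochner_Integration.integrable_bound[OF fgrad_integrable[OF f supp]])
       (auto intro!: AE_I2 simp: F_def component_le_norm_cart Fm[unfolded F_def])
  have g2: "integrable lborel (\<lambda>x. (norm (fgrad f x))\<^sup>2)"
    using Ltwo_integrable[OF gL] by (subst (asm) integrable_completion) auto
  have F2: "integrable lborel (\<lambda>x. (F j x)\<^sup>2)" for j
    by (rule Bochner_Integration.integrable_bound[OF g2])
       (auto intro!: AE_I2 power_mono borel_measurable_power Fm[unfolded F_def] simp: F_def abs_le_square_iff[symmetric] component_le_norm_cart)
  have nf: "(norm (cls f))\<^sup>2 = (LINT x|lborel. (f x)\<^sup>2)"
    unfolding norm_cls_sq[OF fL] by (subst integral_completion) auto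
  have ng: "(norm (cls (fgrad f)))\<^sup>2 = (\<Sum>j\<in>UNIV. LINT x|lborel. (F j x)\<^sup>2)"
  proof -
    have "(norm (cls (fgrad f)))\<^sup>2 = (LINT x|lborel. (norm (fgrad f x))\<^sup>2)"
      unfolding norm_cls_sq[OF gL] by (subst integral_completion) auto
    also have "\<dots> = (LINT x|lborel. (\<Sum>j\<in>UNIV. (F j x)\<^sup>2))"
      unfolding F_def power2_norm_eq_inner inner_vec_def by (simp add: power2_eq_square)
    also have "\<dots> = (\<Sum>j\<in>UNIV. LINT x|lborel. (F j x)\<^sup>2)" by (rule Bochner_Integration.integral_sum) (rule F2)
    finally show ?thesis .
  qed
  define gm where "gm = gauss_mass TYPE(real^'n)"
  define c where "c = (w * r powr s)\<^sup>2"
  have c: "c > 0" using w r by (simp add: c_def)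
  have pm: "integrable lborel (\<lambda>\<xi>. indicator (cball 0 r) \<xi> * power_spectrum f \<xi>)"
    by (rule integrable_mult_bounded[where C="2 * (LINT x|lborel. \<bar>f x\<bar>)\<^sup>2"])
       (use power_spectrum_le[OF fi] emeasure_lborel_cball_finite[of "0::real^'n" r] in \<open>auto simp: power_spectrum_nonneg less_top intro!: integrable_real_indicator\<close>)
  have bound: "(LINT \<xi>|lborel. gauss ((1 / Suc k) *\<^sub>R \<xi>) * power_spectrum f \<xi>)
      \<le> (LINT \<xi>|lborel. indicator (cball 0 r) \<xi> * power_spectrum f \<xi>) + gm\<^sup>2 * (norm (cls (fgrad f)))\<^sup>2 / c" for k
  proof -
    define e where "e = 1 / real (Suc k)"
    have e: "e > 0" by (simp add: e_def)
    have gi: "integrable lborel (\<lambda>\<xi>. gauss (e *\<^sub>R \<xi>) * power_spectrum (F j) \<xi>)" for j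
      by (rule gauss_spectrum_integrable[OF Fi Fm e])
    have "(LINT \<xi>|lborel. gauss (e *\<^sub>R \<xi>) * power_spectrum f \<xi>)
       \<le> (LINT \<xi>|lborel. indicator (cball 0 r) \<xi> * power_spectrum f \<xi> + (\<Sum>j\<in>UNIV. gauss (e *\<^sub>R \<xi>) * power_spectrum (F j) \<xi>) / c)"
    proof (rule integral_mono)
      show "integrable lborel (\<lambda>\<xi>. gauss (e *\<^sub>R \<xi>) * power_spectrum f \<xi>)" by (rule gauss_spectrum_integrable[OF fi fm e])
      show "integrable lborel (\<lambda>\<xi>. indicator (cball 0 r) \<xi> * power_spectrum f \<xi> + (\<Sum>j\<in>UNIV. gauss (e *\<^sub>R \<xi>) * power_spectrum (F j) \<xi>) / c)"
        by (intro Bochner_Integration.integrable_add pm integrable_divide Bochner_Integration.integrable_sum gi)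
      fix \<xi> :: "real^'n"
      have S: "(\<Sum>j\<in>UNIV. gauss (e *\<^sub>R \<xi>) * power_spectrum (F j) \<xi>) = gauss (e *\<^sub>R \<xi>) * ((norm (symb \<xi>))\<^sup>2 * power_spectrum f \<xi>)"
        using fgrad_spectrum[where R=R and \<xi>=\<xi>, OF f supp] by (simp add: F_def flip: sum_distrib_left)
      have g0: "0 \<le> gauss (e *\<^sub>R \<xi>)" using gauss_bounds(1) by (rule less_imp_le)
      show "gauss (e *\<^sub>R \<xi>) * power_spectrum f \<xi> \<le> indicator (cball 0 r) \<xi> * power_spectrum f \<xi> + (\<Sum>j\<in>UNIV. gauss (e *\<^sub>R \<xi>) * power_spectrum (F j) \<xi>) / c"
      proof (cases "norm \<xi> \<le> r")
        case True
        have "gauss (e *\<^sub>R \<xi>) * power_spectrum f \<xi> \<le> 1 * power_spectrum f \<xi>" by (intro mult_right_mono gauss_bounds power_spectrum_nonneg)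
        moreover have "0 \<le> (\<Sum>j\<in>UNIV. gauss (e *\<^sub>R \<xi>) * power_spectrum (F j) \<xi>) / c"
          unfolding S using c g0 by (intro divide_nonneg_pos mult_nonneg_nonneg power_spectrum_nonneg) auto
        ultimately show ?thesis using True by simp
      next
        case False
        have "w * r powr s \<le> norm (symb \<xi>)"
          using w(2)[of \<xi>] mult_left_mono[OF powr_mono2[of s r "norm \<xi>"], of w] w(1) s r False by linarith
        hence "c \<le> (norm (symb \<xi>))\<^sup>2" unfolding c_def using w r by (intro power_mono) auto
        hence "gauss (e *\<^sub>R \<xi>) * (c * power_spectrum f \<xi>) \<le> gauss (e *\<^sub>R \<xi>) * ((norm (symb \<xi>))\<^sup>2 * power_spectrum f \<xi>)"
          by (intro mult_left_mono mult_right_mono g0 power_spectrum_nonneg)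
        thus ?thesis unfolding S using False c by (simp add: field_simps)
      qed
    qed
    also have "\<dots> = (LINT \<xi>|lborel. indicator (cball 0 r) \<xi> * power_spectrum f \<xi>) + (\<Sum>j\<in>UNIV. LINT \<xi>|lborel. gauss (e *\<^sub>R \<xi>) * power_spectrum (F j) \<xi>) / c"
      using gi pm by (subst Bochner_Integration.integral_add) (auto simp: Bochner_Integration.integral_sum)
    also have "(\<Sum>j\<in>UNIV. LINT \<xi>|lborel. gauss (e *\<^sub>R \<xi>) * power_spectrum (F j) \<xi>) \<le> (\<Sum>j\<in>UNIV. gm\<^sup>2 * (LINT x|lborel. (F j x)\<^sup>2))"
      unfolding gm_def by (intro sum_mono gauss_spectrum_le Fi Fm e F2)
    also have "\<dots> = gm\<^sup>2 * (norm (cls (fgrad f)))\<^sup>2" by (simp add: ng sum_distrib_left)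
    finally show ?thesis using c by (simp add: e_def divide_right_mono)
  qed
  have lip: "\<bar>f x - f y\<bar> \<le> M * norm (x - y)" for x y
    using osc_boundedD(2)[OF f, of x y] mult_left_mono[of "min 1 (norm (x - y))" "norm (x - y)" M] osc_bounded_nonneg[OF f] by linarith
  have "gm\<^sup>2 * (LINT x|lborel. (f x)\<^sup>2) \<le> (LINT \<xi>|lborel. indicator (cball 0 r) \<xi> * power_spectrum f \<xi>) + gm\<^sup>2 * (norm (cls (fgrad f)))\<^sup>2 / c"
    by (rule LIMSEQ_le_const2[OF gauss_spectrum_tendsto[OF fi fm f2 lip, folded gm_def]]) (use bound in blast)
  thus ?thesis by (simp add: nf gm_def c_def)
qed

lemma bounded_support_Ltwo:
  fixes f :: "real ^ 'n \<Rightarrow> real"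
  assumes f: "osc_bounded M f" and supp: "\<And>x. norm x > R \<Longrightarrow> f x = 0"
  shows "f \<in> Ltwo"
proof (rule Ltwo_borelI[OF osc_bounded_measurable[OF f]])
  show "integrable lborel (\<lambda>x. f x * f x)"
    by (rule integrable_mult_bounded[OF bounded_support_integrable[OF f supp] osc_bounded_measurable[OF f] osc_boundedD(1)[OF f]])
qed (simp add: power2_eq_square)

lemma L1_norm_sq_le:
  fixes f :: "real ^ 'n \<Rightarrow> real"
  assumes f: "osc_bounded M f" and supp: "\<And>x. norm x > R \<Longrightarrow> f x = 0"
  shows "(LINT x|lborel. \<bar>f x\<bar>)\<^sup>2 \<le> measure lborel (cball (0::real^'n) R) * (norm (cls f))\<^sup>2"
proof -
  note [measurable] = osc_bounded_measurable[OF f]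
  define g :: "real^'n \<Rightarrow> real" where "g = indicator (cball 0 R)"
  have gi: "integrable lborel g"
    unfolding g_def using emeasure_lborel_cball_finite[of "0::real^'n" R] by (intro integrable_real_indicator) auto
  have gm [measurable]: "g \<in> borel_measurable borel" unfolding g_def by (intro borel_measurable_indicator borel_closed) simp
  have g: "g \<in> Ltwo" by (rule Ltwo_borelI[OF gm gi]) (simp add: g_def indicator_def)
  have fL: "f \<in> Ltwo" by (rule bounded_support_Ltwo[OF f supp])
  have f': "(\<lambda>x. \<bar>f x\<bar>) \<in> Ltwo" using fL by (auto simp: Ltwo_def)
  have "(LINT x|lborel. \<bar>f x\<bar>) = (LINT x|lborel. g x * \<bar>f x\<bar>)"
    using supp by (intro Bochner_Integration.integral_cong) (auto simp: g_def indicator_def not_le)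
  also have "\<dots> = cls g \<bullet> cls (\<lambda>x. \<bar>f x\<bar>)"
    unfolding inner_cls[OF g f'] by (subst integral_completion) auto
  finally have "(LINT x|lborel. \<bar>f x\<bar>)\<^sup>2 \<le> (norm (cls g))\<^sup>2 * (norm (cls (\<lambda>x. \<bar>f x\<bar>)))\<^sup>2"
    using Cauchy_Schwarz_ineq[of "cls g" "cls (\<lambda>x. \<bar>f x\<bar>)"] by (simp add: power2_norm_eq_inner)
  also have "(norm (cls (\<lambda>x. \<bar>f x\<bar>)))\<^sup>2 = (norm (cls f))\<^sup>2" by (simp add: norm_cls_sq fL f')
  also have "(norm (cls g))\<^sup>2 = (LINT x|lborel. g x)"
  proof -
    have "(norm (g x))\<^sup>2 = g x" for x by (simp add: g_def indicator_def)
    thus ?thesis unfolding norm_cls_sq[OF g] by (subst integral_completion) auto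
  qed
  also have "\<dots> = measure lborel (cball (0::real^'n) R)" by (simp add: g_def)
  finally show ?thesis .
qed

lemma cball_spectrum_integrable:
  assumes f: "integrable lborel f" and [measurable]: "f \<in> borel_measurable borel"
  shows "integrable lborel (\<lambda>\<xi>::real^'n. indicator (cball 0 r) \<xi> * power_spectrum f \<xi>)"
  by (rule integrable_mult_bounded[where C="2 * (LINT x|lborel. \<bar>f x\<bar>)\<^sup>2"])
     (use power_spectrum_le[OF f] emeasure_lborel_cball_finite[of "0::real^'n" r] in \<open>auto simp: power_spectrum_nonneg less_top intro!: integrable_real_indicator\<close>)

text \<open>Low frequencies are controlled by the L1 norm, hence on a bounded support by a small
  multiple of the squared L2 norm, which is absorbed on the left; the remaining ones are controlled
  by the gradient.\<close>

lemma test_poincare: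
  obtains C where "C \<ge> 0" "\<And>M f. osc_bounded M f \<Longrightarrow> (\<And>x. norm x > R \<Longrightarrow> f x = 0) \<Longrightarrow> norm (cls f) \<le> C * norm (cls (fgrad f))"
proof -
  obtain w where w: "w > 0" "\<And>\<xi>. w * norm \<xi> powr s \<le> norm (symb \<xi>)" by (rule symb_lower_bound) blast
  define v where "v = measure lborel (cball (0::real^'n) R)"
  define u where "u = unit_ball_vol (real CARD('n))"
  define gm where "gm = gauss_mass TYPE(real^'n)"
  have gm: "gm > 0" by (simp add: gm_def gauss_mass_pos)
  have uv: "u \<ge> 0" "v \<ge> 0" by (auto simp: u_def v_def)
  \<comment> \<open>Chosen so that \<open>4 * (u * r) * v\<close> is at most \<open>gm\<close>
    squared, which bounds the low frequencies by half of the left side; \<open>r <= 1\<close> allows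
    replacing the volume factor \<open>r ^ CARD('n)\<close> by \<open>r\<close>.\<close>
  define r where "r = min 1 (gm\<^sup>2 / (4 * ((u + 1) * (v + 1))))"
  have r: "r > 0" "r \<le> 1" using gm uv by (auto simp: r_def)
  have "r * (4 * ((u + 1) * (v + 1))) \<le> gm\<^sup>2"
  proof -
    have "r \<le> gm\<^sup>2 / (4 * ((u + 1) * (v + 1)))" by (simp add: r_def)
    moreover have "4 * ((u + 1) * (v + 1)) > 0" using uv by simp
    ultimately show ?thesis by (simp add: pos_le_divide_eq)
  qed
  moreover have "r * (4 * (u * v)) \<le> r * (4 * ((u + 1) * (v + 1)))"
    using uv r by (intro mult_left_mono mult_mono) auto
  ultimately have small: "4 * (u * r) * v \<le> gm\<^sup>2" by (simp add: mult_ac)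
  define C where "C = sqrt 2 / (w * r powr s)"
  have "norm (cls f) \<le> C * norm (cls (fgrad f))" if f: "osc_bounded M f" and supp: "\<And>x. norm x > R \<Longrightarrow> f x = 0" for M f
  proof -
    note [measurable] = osc_bounded_measurable[OF f]
    have fi: "integrable lborel f" by (rule bounded_support_integrable[OF f supp])
    define a where "a = (norm (cls f))\<^sup>2"
    define b where "b = (norm (cls (fgrad f)))\<^sup>2 / (w * r powr s)\<^sup>2"
    have "(LINT \<xi>|lborel. indicator (cball (0::real^'n) r) \<xi> * power_spectrum f \<xi>) \<le> (LINT \<xi>|lborel. indicator (cball (0::real^'n) r) \<xi> * (2 * (v * a)))"
    proof (rule integral_mono)
      show "integrable lborel (\<lambda>\<xi>. indicator (cball (0::real^'n) r) \<xi> * power_spectrum f \<xi>)"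
        by (rule cball_spectrum_integrable[OF fi]) measurable
      show "integrable lborel (\<lambda>\<xi>. indicator (cball (0::real^'n) r) \<xi> * (2 * (v * a)))"
        using emeasure_lborel_cball_finite[of "0::real^'n" r] by (intro integrable_mult_left integrable_real_indicator) auto
      show "indicator (cball (0::real^'n) r) \<xi> * power_spectrum f \<xi> \<le> indicator (cball (0::real^'n) r) \<xi> * (2 * (v * a))" for \<xi>
        using power_spectrum_le[OF fi, of \<xi>] L1_norm_sq_le[where R=R, OF f supp]
        by (intro mult_left_mono) (auto simp: v_def a_def)
    qed
    also have "\<dots> = (u * r ^ CARD('n)) * (2 * (v * a))"
      using r by (simp add: content_cball u_def)
    also have "\<dots> \<le> (u * r) * (2 * (v * a))"
    proof -
      have "r ^ CARD('n) \<le> r ^ 1" using r by (intro power_decreasing) (auto simp: Suc_leI)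
      thus ?thesis using uv by (intro mult_right_mono mult_left_mono) (auto simp: a_def)
    qed
    also have "\<dots> \<le> gm\<^sup>2 / 2 * a" using mult_right_mono[OF small, of a] by (simp add: a_def mult_ac)
    finally have "gm\<^sup>2 * a \<le> gm\<^sup>2 / 2 * a + gm\<^sup>2 * b"
      using low_frequency_bound[where R=R, OF f supp w r(1)] by (simp add: a_def b_def gm_def)
    hence "gm\<^sup>2 * a \<le> gm\<^sup>2 * (2 * b)" by (simp add: algebra_simps)
    hence "a \<le> 2 * b" using gm by simp
    also have "\<dots> = (C * norm (cls (fgrad f)))\<^sup>2" by (simp add: b_def C_def power_mult_distrib power_divide)
    finally show ?thesis unfolding a_def
      by (rule power2_le_imp_le) (use w r in \<open>auto simp: C_def\<close>)
  qed
  moreover have "C \<ge> 0" using w r by (simp add: C_def)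
  ultimately show ?thesis using that by blast
qed

text \<open>At a fixed frequency the Fourier integrals are inner products with plane waves cut off
  outside the common support ball, so they vanish by weak convergence. Dominated convergence handles
  a ball of frequencies, and the gradient bound makes the rest small uniformly in
  \<open>k\<close>.\<close>

lemma test_rellich:
  assumes f: "\<And>k. osc_bounded (M k) (f k)" and supp: "\<And>k x. norm x > R \<Longrightarrow> f k x = 0"
    and B: "\<And>k. norm (cls (fgrad (f k))) \<le> B" and wk: "weakly (\<lambda>k. cls (f k)) 0"
  shows "(\<lambda>k. cls (f k)) \<longlonglongrightarrow> 0"
proof -
  obtain w where w: "w > 0" "\<And>\<xi>. w * norm \<xi> powr s \<le> norm (symb \<xi>)" by (rule symb_lower_bound) blast
  obtain C where C: "C \<ge> 0" "\<And>M f. osc_bounded M f \<Longrightarrow> (\<And>x. norm x > R \<Longrightarrow> f x = 0) \<Longrightarrow> norm (cls f) \<le> C * norm (cls (fgrad f))"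
    using test_poincare by metis
  have B0: "B \<ge> 0" using order_trans[OF norm_ge_zero B[of 0]] .
  have nb: "norm (cls (f k)) \<le> C * B" for k
    using C(2)[OF f supp, of k] mult_left_mono[OF B[of k] C(1)] by simp
  define v where "v = measure lborel (cball (0::real^'n) R)"
  define gm where "gm = gauss_mass TYPE(real^'n)"
  have gm: "gm > 0" by (simp add: gm_def gauss_mass_pos)
  note fm [measurable] = osc_bounded_measurable[OF f]
  have fi: "integrable lborel (f k)" for k by (rule bounded_support_integrable[OF f supp])
  have fL: "f k \<in> Ltwo" for k by (rule bounded_support_Ltwo[OF f supp])
  have psb: "power_spectrum (f k) \<xi> \<le> 2 * (v * (C * B)\<^sup>2)" for k \<xi>
  proof -
    have "(LINT x|lborel. \<bar>f k x\<bar>)\<^sup>2 \<le> v * (norm (cls (f k)))\<^sup>2" unfolding v_def by (rule L1_norm_sq_le[OF f supp])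
    also have "\<dots> \<le> v * (C * B)\<^sup>2" using nb[of k] by (intro mult_left_mono power_mono) (auto simp: v_def)
    finally show ?thesis using power_spectrum_le[OF fi, of k \<xi>] by simp
  qed
  have coef: "(\<lambda>k. LINT x|lborel. f k x * h x) \<longlonglongrightarrow> 0" if h: "h \<in> borel_measurable borel" "\<And>x. \<bar>h x\<bar> \<le> 1" for h
  proof -
    note [measurable] = h(1)
    define g where "g = (\<lambda>x::real^'n. indicator (cball 0 R) x * h x)"
    have gm' [measurable]: "g \<in> borel_measurable borel"
      unfolding g_def by (intro borel_measurable_times borel_measurable_indicator borel_closed) (auto simp: h)
    have ii: "integrable lborel (\<lambda>x::real^'n. indicator (cball 0 R) x :: real)"
      using emeasure_lborel_cball_finite[of "0::real^'n" R] by (intro integrable_real_indicator) auto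
    have "g \<in> Ltwo"
      by (rule Ltwo_borelI[OF gm' ii]) (use h(2) in \<open>auto simp: g_def indicator_def abs_square_le_1\<close>)
    hence "cls (f k) \<bullet> cls g = (LINT x|lborel. f k x * g x)" for k
      by (subst inner_cls[OF fL]) (auto intro!: integral_completion)
    moreover have "(LINT x|lborel. f k x * g x) = (LINT x|lborel. f k x * h x)" for k
      using supp by (intro Bochner_Integration.integral_cong) (auto simp: g_def indicator_def not_le)
    ultimately show ?thesis using weaklyD[OF wk, of "cls g"] by simp
  qed
  have ps0: "(\<lambda>k. power_spectrum (f k) \<xi>) \<longlonglongrightarrow> 0" for \<xi>
  proof -
    have "(\<lambda>k. (LINT x|lborel. f k x * cos (\<xi> \<bullet> x))\<^sup>2 + (LINT x|lborel. f k x * sin (\<xi> \<bullet> x))\<^sup>2) \<longlonglongrightarrow> 0\<^sup>2 + 0\<^sup>2"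
      by (intro tendsto_add tendsto_power coef) auto
    thus ?thesis by (simp add: power_spectrum_def)
  qed
  have low: "(\<lambda>k. LINT \<xi>|lborel. indicator (cball (0::real^'n) r) \<xi> * power_spectrum (f k) \<xi>) \<longlonglongrightarrow> 0" for r
  proof -
    have "(\<lambda>k. LINT \<xi>|lborel. indicator (cball (0::real^'n) r) \<xi> * power_spectrum (f k) \<xi>) \<longlonglongrightarrow> (LINT \<xi>::real^'n|lborel. 0)"
    proof (rule integral_dominated_convergence)
      show "integrable lborel (\<lambda>\<xi>. indicator (cball (0::real^'n) r) \<xi> * (2 * (v * (C * B)\<^sup>2)))"
        using emeasure_lborel_cball_finite[of "0::real^'n" r] by (intro integrable_mult_left integrable_real_indicator) auto
      show "AE \<xi> in lborel. (\<lambda>k. indicator (cball (0::real^'n) r) \<xi> * power_spectrum (f k) \<xi>) \<longlonglongrightarrow> 0"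
        using tendsto_mult_left[OF ps0] by (intro AE_I2) fastforce
      show "AE \<xi> in lborel. norm (indicator (cball (0::real^'n) r) \<xi> * power_spectrum (f k) \<xi>) \<le> indicator (cball 0 r) \<xi> * (2 * (v * (C * B)\<^sup>2))" for k
        using psb by (intro AE_I2) (auto simp: indicator_def power_spectrum_nonneg)
      show "(\<lambda>\<xi>. indicator (cball (0::real^'n) r) \<xi> * power_spectrum (f k) \<xi>) \<in> borel_measurable lborel" for k
        by (rule borel_measurable_integrable[OF cball_spectrum_integrable[OF fi fm]])
    qed simp
    thus ?thesis by simp
  qed
  have "(\<lambda>k. (norm (cls (f k)))\<^sup>2) \<longlonglongrightarrow> 0"
  proof (rule LIMSEQ_I)
    fix e :: real assume e: "e > 0"
    have "((\<lambda>r. B\<^sup>2 / (w * r powr s)\<^sup>2) \<longlongrightarrow> 0) at_top"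
      using w(1) s by real_asymp
    hence "eventually (\<lambda>r. B\<^sup>2 / (w * r powr s)\<^sup>2 < e / 2) at_top" using e by (intro order_tendstoD) auto
    hence "eventually (\<lambda>r. B\<^sup>2 / (w * r powr s)\<^sup>2 < e / 2 \<and> r > 0) at_top"
      by (intro eventually_conj eventually_gt_at_top)
    then obtain r where r: "B\<^sup>2 / (w * r powr s)\<^sup>2 < e / 2" "r > 0" by (auto simp: eventually_at_top_linorder)
    define l where "l = (\<lambda>k. LINT \<xi>|lborel. indicator (cball (0::real^'n) r) \<xi> * power_spectrum (f k) \<xi>)"
    have "gm\<^sup>2 * (e / 2) > 0" using gm e by simp
    then obtain N where N: "\<And>k. k \<ge> N \<Longrightarrow> \<bar>l k\<bar> < gm\<^sup>2 * (e / 2)"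
      using LIMSEQ_D[OF low[of r]] unfolding l_def by fastforce
    have "norm ((norm (cls (f k)))\<^sup>2 - 0) < e" if "k \<ge> N" for k
    proof -
      have "gm\<^sup>2 * (norm (cls (f k)))\<^sup>2 \<le> l k + gm\<^sup>2 * (norm (cls (fgrad (f k))))\<^sup>2 / (w * r powr s)\<^sup>2"
        using low_frequency_bound[where R=R, OF f[of k] supp w r(2)] by (simp add: l_def gm_def)
      also have "\<dots> \<le> l k + gm\<^sup>2 * (B\<^sup>2 / (w * r powr s)\<^sup>2)"
        using B[of k] by (auto intro!: divide_right_mono mult_left_mono power_mono)
      also have "\<dots> < gm\<^sup>2 * (e / 2) + gm\<^sup>2 * (e / 2)"
      proof -
        have "gm\<^sup>2 * (B\<^sup>2 / (w * r powr s)\<^sup>2) < gm\<^sup>2 * (e / 2)" using r(1) gm by (intro mult_strict_left_mono) auto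
        thus ?thesis using N[OF that] by linarith
      qed
      finally have "gm\<^sup>2 * (norm (cls (f k)))\<^sup>2 < gm\<^sup>2 * e" by (simp add: algebra_simps)
      thus ?thesis using gm by simp
    qed
    thus "\<exists>N. \<forall>k\<ge>N. norm ((norm (cls (f k)))\<^sup>2 - 0) < e" by blast
  qed
  hence "(\<lambda>k. sqrt ((norm (cls (f k)))\<^sup>2)) \<longlonglongrightarrow> sqrt 0" by (rule tendsto_real_sqrt)
  thus ?thesis by (simp add: tendsto_norm_zero_iff)
qed

end

section \<open>Test functions\<close>

definition smooth :: "('a::euclidean_space \<Rightarrow> real) \<Rightarrow> bool" where
  "smooth f \<longleftrightarrow> (\<forall>k. Ck k f)"

lemma Ck_Suc_I:
  assumes "\<And>x. (f has_derivative f' x) (at x)" "\<And>v. Ck k (\<lambda>x. f' x v)"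
  shows "Ck (Suc k) f"
proof -
  have "frechet_derivative f (at x) = f' x" for x using frechet_derivative_at[OF assms(1)[of x]] by simp
  thus ?thesis using assms by (auto simp: differentiable_def)
qed

lemma Ck_Suc_D:
  assumes "Ck (Suc k) f"
  shows "(f has_derivative frechet_derivative f (at x)) (at x)" "Ck k (\<lambda>x. frechet_derivative f (at x) v)"
  using assms by (auto simp: frechet_derivative_works[symmetric])

lemma Ck_Suc_imp: "Ck (Suc k) f \<Longrightarrow> Ck k f"
proof (induction k arbitrary: f)
  case 0
  thus ?case
    by (auto simp: continuous_on_eq_continuous_at intro!: differentiable_imp_continuous_within)
next
  case (Suc k)
  show ?case
    by (rule Ck_Suc_I[OF Ck_Suc_D(1)[OF Suc.prems]]) (rule Suc.IH[OF Ck_Suc_D(2)[OF Suc.prems]])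
qed

lemma Ck_const: "Ck k (\<lambda>x. c)"
proof (induction k arbitrary: c)
  case (Suc k)
  show ?case by (rule Ck_Suc_I[where f'="\<lambda>_ _. 0"]) (auto intro: Suc)
qed auto

lemma Ck_add: "Ck k f \<Longrightarrow> Ck k g \<Longrightarrow> Ck k (\<lambda>x. f x + g x)"
proof (induction k arbitrary: f g)
  case (Suc k)
  show ?case
  proof (rule Ck_Suc_I)
    show "((\<lambda>x. f x + g x) has_derivative (\<lambda>v. frechet_derivative f (at x) v + frechet_derivative g (at x) v)) (at x)" for x
      by (intro has_derivative_add Ck_Suc_D(1)[OF Suc.prems(1)] Ck_Suc_D(1)[OF Suc.prems(2)])
    show "Ck k (\<lambda>x. frechet_derivative f (at x) v + frechet_derivative g (at x) v)" for v
      by (intro Suc.IH Ck_Suc_D(2) Suc.prems)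
  qed
qed (auto intro: continuous_intros)

lemma Ck_mult: "Ck k f \<Longrightarrow> Ck k g \<Longrightarrow> Ck k (\<lambda>x. f x * g x)"
proof (induction k arbitrary: f g)
  case (Suc k)
  show ?case
  proof (rule Ck_Suc_I)
    show "((\<lambda>x. f x * g x) has_derivative (\<lambda>v. f x * frechet_derivative g (at x) v + frechet_derivative f (at x) v * g x)) (at x)" for x
      by (intro has_derivative_mult Ck_Suc_D(1)[OF Suc.prems(1)] Ck_Suc_D(1)[OF Suc.prems(2)])
    show "Ck k (\<lambda>x. f x * frechet_derivative g (at x) v + frechet_derivative f (at x) v * g x)" for v
      by (intro Ck_add Suc.IH Ck_Suc_D(2) Suc.prems Ck_Suc_imp[OF Suc.prems(1)] Ck_Suc_imp[OF Suc.prems(2)])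
  qed
qed (auto intro: continuous_intros)

text \<open>The outer function comes with all its derivatives as a family \<open>h\<close>, so the
  induction on \<open>k\<close> can pass from \<open>h j\<close> to
  \<open>h (Suc j)\<close>.\<close>

lemma Ck_compose:
  assumes h: "\<And>j t. (h j has_real_derivative h (Suc j) t) (at t)" and q: "smooth q"
  shows "Ck k (\<lambda>x. h j (q x))"
proof (induction k arbitrary: j)
  case 0
  have "continuous_on UNIV (h j)" for j
    by (intro continuous_at_imp_continuous_on ballI DERIV_isCont[OF h])
  moreover have "continuous_on UNIV q" using q by (auto simp: smooth_def dest: spec[of _ 0])
  ultimately show ?case by (auto intro: continuous_on_compose2)
next
  case (Suc k)
  have qS: "Ck (Suc k) q" using q by (simp add: smooth_def)
  show ?case
  proof (rule Ck_Suc_I)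
    show "((\<lambda>x. h j (q x)) has_derivative (\<lambda>v. h (Suc j) (q x) * frechet_derivative q (at x) v)) (at x)" for x
      using has_derivative_compose[OF Ck_Suc_D(1)[OF qS, of x] h[of j "q x", unfolded has_field_derivative_def]] by simp
    show "Ck k (\<lambda>x. h (Suc j) (q x) * frechet_derivative q (at x) v)" for v
      by (intro Ck_mult Suc.IH Ck_Suc_D(2)[OF qS])
  qed
qed

lemma smooth_const: "smooth (\<lambda>x. c)"
  and smooth_add: "smooth f \<Longrightarrow> smooth g \<Longrightarrow> smooth (\<lambda>x. f x + g x)"
  and smooth_mult: "smooth f \<Longrightarrow> smooth g \<Longrightarrow> smooth (\<lambda>x. f x * g x)"
  by (auto simp: smooth_def intro: Ck_const Ck_add Ck_mult)

lemma smooth_compose: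
  assumes "\<And>j t. (h j has_real_derivative h (Suc j) t) (at t)" "smooth q"
  shows "smooth (\<lambda>x. h j (q x))"
  unfolding smooth_def by (intro allI Ck_compose assms)

lemma smooth_inner: "smooth (\<lambda>x. v \<bullet> x)"
  unfolding smooth_def
proof
  fix k show "Ck k (\<lambda>x. v \<bullet> x)"
  proof (cases k)
    case (Suc j)
    show ?thesis unfolding Suc
      by (rule Ck_Suc_I[where f'="\<lambda>_ w. v \<bullet> w"]) (auto intro!: derivative_eq_intros Ck_const)
  qed (auto intro: continuous_intros)
qed

lemma smooth_prod: "finite I \<Longrightarrow> (\<And>i. i \<in> I \<Longrightarrow> smooth (f i)) \<Longrightarrow> smooth (\<lambda>x. \<Prod>i\<in>I. f i x)"
  by (induction I rule: finite_induct) (auto intro: smooth_const smooth_mult)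

lemma smooth_cos: "smooth (\<lambda>x. cos (v \<bullet> x))" and smooth_sin: "smooth (\<lambda>x. sin (v \<bullet> x))"
proof -
  \<comment> \<open>Every derivative is a shift by a quarter period, which gives a family of the
    shape \<open>smooth_compose\<close> expects.\<close>
  have "((\<lambda>t. cos (t + real j * (pi / 2))) has_real_derivative cos (t + real (Suc j) * (pi / 2))) (at t)" for j t
  proof -
    have "cos (t + real (Suc j) * (pi / 2)) = cos ((t + real j * (pi / 2)) + pi / 2)" by (simp add: algebra_simps add_divide_distrib)
    also have "\<dots> = - sin (t + real j * (pi / 2))" by (subst cos_add) simp
    finally show ?thesis by (auto intro!: derivative_eq_intros)
  qed
  from smooth_compose[of "\<lambda>j t. cos (t + real j * (pi / 2))", OF this smooth_inner, of v 0]
  show "smooth (\<lambda>x. cos (v \<bullet> x))" by simp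
  have "((\<lambda>t. sin (t + real j * (pi / 2))) has_real_derivative sin (t + real (Suc j) * (pi / 2))) (at t)" for j t
  proof -
    have "sin (t + real (Suc j) * (pi / 2)) = sin ((t + real j * (pi / 2)) + pi / 2)" by (simp add: algebra_simps add_divide_distrib)
    also have "\<dots> = cos (t + real j * (pi / 2))" by (subst sin_add) simp
    finally show ?thesis by (auto intro!: derivative_eq_intros)
  qed
  from smooth_compose[of "\<lambda>j t. sin (t + real j * (pi / 2))", OF this smooth_inner, of v 0]
  show "smooth (\<lambda>x. sin (v \<bullet> x))" by simp
qed

lemma smooth_continuous: "smooth f \<Longrightarrow> continuous_on UNIV f"
  by (auto simp: smooth_def dest: spec[of _ 0])

text \<open>\<open>flat_exp j\<close> is the \<open>j\<close>-th derivative of \<open>exp (- 1 / t)\<close>, extended by 0 to \<open>t \<le> 0\<close>.\<close>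

primrec flat_poly :: "nat \<Rightarrow> real poly" where
  "flat_poly 0 = 1"
| "flat_poly (Suc j) = [:0, 0, 1:] * (flat_poly j - pderiv (flat_poly j))"

definition flat_exp :: "nat \<Rightarrow> real \<Rightarrow> real" where
  "flat_exp j t = (if t > 0 then poly (flat_poly j) (1 / t) * exp (- (1 / t)) else 0)"

lemma poly_times_exp_minus_tendsto: "((\<lambda>y::real. poly p y * exp (- y)) \<longlongrightarrow> 0) at_top"
proof -
  have "((\<lambda>y. \<Sum>i\<le>degree p. coeff p i * (y ^ i / exp y)) \<longlongrightarrow> (\<Sum>i\<le>degree p. coeff p i * 0)) at_top"
    by (intro tendsto_sum tendsto_mult_left tendsto_power_div_exp_0)
  thus ?thesis by (simp add: poly_altdef sum_distrib_right exp_minus divide_inverse mult.assoc)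
qed

text \<open>For positive \<open>t\<close> this is the recursion of \<open>flat_poly\<close>. At 0
  from the right, with \<open>y = 1 / u\<close>, the difference quotient is a polynomial in
  \<open>y\<close> times \<open>exp (- y)\<close>; dividing by \<open>u\<close> raises the
  polynomial by one degree, whence the factor \<open>[:0, 1:]\<close>.\<close>

lemma flat_exp_deriv: "(flat_exp j has_real_derivative flat_exp (Suc j) t) (at t)"
proof -
  consider "t > 0" | "t < 0" | "t = 0" by linarith
  thus ?thesis
  proof cases
    case 1
    have "((\<lambda>t. poly (flat_poly j) (1 / t) * exp (- (1 / t))) has_real_derivative flat_exp (Suc j) t) (at t)"
      using 1 by (auto intro!: derivative_eq_intros simp: flat_exp_def divide_simps power2_eq_square)
        (simp add: algebra_simps)
    moreover have "eventually (\<lambda>u. u > 0) (nhds t)" using 1 by (intro eventually_nhds_in_open[of "{0<..}", simplified]) auto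
    hence "eventually (\<lambda>u. poly (flat_poly j) (1 / u) * exp (- (1 / u)) = flat_exp j u) (nhds t)"
      by eventually_elim (simp add: flat_exp_def)
    ultimately show ?thesis by (simp add: DERIV_cong_ev)
  next
    case 2
    have "((\<lambda>t. 0) has_real_derivative 0) (at t)" by simp
    moreover have "eventually (\<lambda>u. u < 0) (nhds t)" using 2 by (intro eventually_nhds_in_open[of "{..<0}", simplified]) auto
    hence "eventually (\<lambda>u. 0 = flat_exp j u) (nhds t)" by eventually_elim (simp add: flat_exp_def)
    moreover have "flat_exp (Suc j) t = 0" using 2 by (simp add: flat_exp_def)
    ultimately show ?thesis using DERIV_cong_ev[of t t "\<lambda>u. 0" "flat_exp j" 0 0] by simp
  next
    case 3
    have "((\<lambda>u. (flat_exp j u - flat_exp j 0) / (u - 0)) \<longlongrightarrow> 0) (at 0)"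
    proof (rule filterlim_split_at)
      have "eventually (\<lambda>u::real. u < 0) (at_left 0)" by (simp add: eventually_at_filter)
      hence "eventually (\<lambda>u. (flat_exp j u - flat_exp j 0) / (u - 0) = 0) (at_left 0)"
        by eventually_elim (simp add: flat_exp_def)
      thus "((\<lambda>u. (flat_exp j u - flat_exp j 0) / (u - 0)) \<longlongrightarrow> 0) (at_left 0)" by (rule tendsto_eventually)
      have "((\<lambda>u. poly ([:0, 1:] * flat_poly j) (inverse u) * exp (- inverse u)) \<longlongrightarrow> 0) (at_right (0::real))"
        by (rule filterlim_compose[OF poly_times_exp_minus_tendsto filterlim_inverse_at_top_right])
      moreover have "eventually (\<lambda>u::real. u > 0) (at_right 0)" by (simp add: eventually_at_filter)
      hence "eventually (\<lambda>u. poly ([:0, 1:] * flat_poly j) (inverse u) * exp (- inverse u) = (flat_exp j u - flat_exp j 0) / (u - 0)) (at_right 0)"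
        by eventually_elim (simp add: flat_exp_def inverse_eq_divide)
      ultimately show "((\<lambda>u. (flat_exp j u - flat_exp j 0) / (u - 0)) \<longlongrightarrow> 0) (at_right 0)"
        by (rule Lim_transform_eventually)
    qed
    thus ?thesis using 3 by (simp add: has_field_derivative_iff flat_exp_def)
  qed
qed

text \<open>Positive precisely on the open box. As \<open>m\<close> grows it tends to the indicator
  of the box because \<open>flat_exp 0\<close> tends to 1 at infinity; boxes fit Lebesgue
  differentiation on cubes.\<close>

definition box_bump :: "real \<Rightarrow> real ^ 'n \<Rightarrow> real ^ 'n \<Rightarrow> real ^ 'n \<Rightarrow> real" where
  "box_bump m a b x = (\<Prod>i\<in>UNIV. flat_exp 0 (m * ((x $ i - a $ i) * (b $ i - x $ i))))"

lemma smooth_box_bump: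
  fixes a b :: "real ^ 'n" shows "smooth (box_bump m a b)"
proof -
  have c: "smooth (\<lambda>x::real^'n. x $ i)" for i
    using smooth_inner[of "axis i 1 :: real^'n"] by (simp add: inner_axis inner_commute)
  have "smooth (\<lambda>x::real^'n. m * ((x $ i + - a $ i) * (b $ i + (-1) * x $ i)))" for i
    by (intro smooth_mult smooth_add smooth_const c)
  hence "smooth (\<lambda>x. flat_exp 0 (m * ((x $ i - a $ i) * (b $ i - x $ i))))" for i
    by (intro smooth_compose[of flat_exp, OF flat_exp_deriv]) simp
  thus ?thesis unfolding box_bump_def[abs_def] by (intro smooth_prod) auto
qed

lemma flat_exp_0_bounds: "0 \<le> flat_exp 0 t" "flat_exp 0 t \<le> 1" by (auto simp: flat_exp_def)

lemma box_bump_bounds: "0 \<le> box_bump m a b x" "box_bump m a b x \<le> 1"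
  unfolding box_bump_def by (auto intro!: prod_nonneg prod_le_1 flat_exp_0_bounds)

lemma box_bump_pos:
  assumes ab: "\<And>i. a $ i < b $ i" and m: "m > 0"
  shows "box_bump m a b x > 0 \<longleftrightarrow> x \<in> box a b"
proof -
  have eq: "(u - a $ i) * (b $ i - u) > 0 \<longleftrightarrow> a $ i < u \<and> u < b $ i" for i u
    using ab[of i] by (auto simp: zero_less_mult_iff)
  have "flat_exp 0 t > 0 \<longleftrightarrow> t > 0" for t by (auto simp: flat_exp_def)
  hence f: "flat_exp 0 (m * ((x $ i - a $ i) * (b $ i - x $ i))) > 0 \<longleftrightarrow> a $ i < x $ i \<and> x $ i < b $ i" for i
    using m eq[of "x $ i" i] by (simp add: zero_less_mult_iff)
  show ?thesis
  proof
    assume "x \<in> box a b"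
    thus "box_bump m a b x > 0" unfolding box_bump_def by (intro prod_pos) (auto simp: f mem_box_cart)
  next
    assume p: "box_bump m a b x > 0"
    have "flat_exp 0 (m * ((x $ i - a $ i) * (b $ i - x $ i))) \<noteq> 0" for i
    proof
      assume "flat_exp 0 (m * ((x $ i - a $ i) * (b $ i - x $ i))) = 0"
      hence "box_bump m a b x = 0" unfolding box_bump_def by (subst prod_zero_iff) auto
      thus False using p by simp
    qed
    hence "flat_exp 0 (m * ((x $ i - a $ i) * (b $ i - x $ i))) > 0" for i
      using flat_exp_0_bounds(1) by (simp add: less_le)
    thus "x \<in> box a b" by (simp add: f mem_box_cart)
  qed
qed

lemma box_bump_tendsto:
  fixes a b x :: "real ^ 'n"
  assumes ab: "\<And>i. a $ i < b $ i"
  shows "(\<lambda>k. box_bump (Suc k) a b x) \<longlonglongrightarrow> indicator (box a b) x"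
proof (cases "x \<in> box a b")
  case True
  have "(\<lambda>k. flat_exp 0 (real (Suc k) * c)) \<longlonglongrightarrow> 1" if "c > 0" for c
  proof -
    have "(\<lambda>k. exp (- (1 / real (Suc k) * (1 / c)))) \<longlonglongrightarrow> exp (- (0 * (1 / c)))"
      by (intro tendsto_intros LIMSEQ_Suc[OF lim_1_over_n])
    thus ?thesis using that by (simp add: flat_exp_def)
  qed
  moreover have "(x $ i - a $ i) * (b $ i - x $ i) > 0" for i using True by (simp add: mem_box_cart)
  ultimately have "(\<lambda>k. box_bump (Suc k) a b x) \<longlonglongrightarrow> (\<Prod>i\<in>(UNIV::'n set). 1)"
    unfolding box_bump_def by (intro tendsto_prod) blast
  thus ?thesis using True by simp
next
  case False
  hence "box_bump (Suc k) a b x = 0" for k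
  proof -
    have "\<not> 0 < box_bump (Suc k) a b x" using box_bump_pos[OF ab, of "real (Suc k)" x] False by simp
    thus ?thesis using box_bump_bounds(1)[of "Suc k" a b x] by linarith
  qed
  thus ?thesis using False by simp
qed

section \<open>Compactly supported test functions\<close>

lemma Cc_inf_I:
  assumes "smooth f" "compact S" "S \<subseteq> U" "\<And>x. x \<notin> S \<Longrightarrow> f x = 0"
  shows "f \<in> Cc_inf U"
proof -
  have sub: "closure {x. f x \<noteq> 0} \<subseteq> S"
    using assms(2,4) by (intro closure_minimal compact_imp_closed) auto
  have "bounded (closure {x. f x \<noteq> 0})"
    by (rule bounded_subset[OF compact_imp_bounded[OF assms(2)] sub])
  hence "compact (closure {x. f x \<noteq> 0})" by (simp add: compact_eq_bounded_closed)
  moreover have "closure {x. f x \<noteq> 0} \<subseteq> U" using sub assms(3) by (rule order_trans)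
  ultimately show ?thesis using assms(1) unfolding Cc_inf_def smooth_def by (intro CollectI conjI)
qed

lemma Cc_inf_D:
  assumes "f \<in> Cc_inf U"
  obtains S where "smooth f" "compact S" "S \<subseteq> U" "\<And>x. x \<notin> S \<Longrightarrow> f x = 0"
proof (rule that[of "closure {x. f x \<noteq> 0}"])
  show "f x = 0" if "x \<notin> closure {x. f x \<noteq> 0}" for x
    using that closure_subset[of "{x. f x \<noteq> 0}"] by auto
qed (use assms in \<open>unfold Cc_inf_def smooth_def mem_Collect_eq, blast+\<close>)

lemma Cc_inf_smooth: "f \<in> Cc_inf U \<Longrightarrow> smooth f" unfolding Cc_inf_def smooth_def by blast

lemma Cc_inf_mult_smooth:
  assumes f: "f \<in> Cc_inf U" and g: "smooth g" shows "(\<lambda>x. g x * f x) \<in> Cc_inf U"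
proof -
  obtain S where "smooth f" "compact S" "S \<subseteq> U" "\<And>x. x \<notin> S \<Longrightarrow> f x = 0" using Cc_inf_D[OF f] by blast
  thus ?thesis by (intro Cc_inf_I[of _ S] smooth_mult g) auto
qed

lemma Cc_inf_scale: "f \<in> Cc_inf U \<Longrightarrow> (\<lambda>x. c * f x) \<in> Cc_inf U"
  by (intro Cc_inf_mult_smooth smooth_const)

lemma Cc_inf_add:
  assumes f: "f \<in> Cc_inf U" and g: "g \<in> Cc_inf U" shows "(\<lambda>x. f x + g x) \<in> Cc_inf U"
proof -
  obtain S where S: "smooth f" "compact S" "S \<subseteq> U" "\<And>x. x \<notin> S \<Longrightarrow> f x = 0" using Cc_inf_D[OF f] by blast
  obtain T where T: "smooth g" "compact T" "T \<subseteq> U" "\<And>x. x \<notin> T \<Longrightarrow> g x = 0" using Cc_inf_D[OF g] by blast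
  show ?thesis using S T by (intro Cc_inf_I[of _ "S \<union> T"] smooth_add) auto
qed

lemma Cc_inf_zero: "(\<lambda>x. 0) \<in> Cc_inf U"
  by (rule Cc_inf_I[of _ "{}"]) (auto intro: smooth_const)

lemma box_bump_Cc_inf:
  assumes "\<And>i. a $ i < b $ i" "m > 0" "cbox a b \<subseteq> U" shows "box_bump m a b \<in> Cc_inf U"
proof (rule Cc_inf_I[OF smooth_box_bump, of "cbox a b"])
  show "box_bump m a b x = 0" if "x \<notin> cbox a b" for x
    using box_bump_pos[OF assms(1,2), of x] box_bump_bounds(1)[of m a b x] that box_subset_cbox[of a b] by fastforce
qed (use assms in auto)

text \<open>The directional derivatives are continuous and vanish off the support, hence are
  bounded; summing over the basis bounds the operator norm of the derivative.\<close>

lemma Cc_inf_lipschitz: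
  assumes f: "f \<in> Cc_inf U"
  obtains B L where "\<And>x. \<bar>f x\<bar> \<le> B" "L \<ge> 0" "\<And>x y. \<bar>f x - f y\<bar> \<le> L * norm (x - y)"
proof -
  obtain S where S: "smooth f" "compact S" "\<And>x. x \<notin> S \<Longrightarrow> f x = 0" using Cc_inf_D[OF f] by metis
  have bdd: "\<exists>B\<ge>0. \<forall>x. \<bar>g x\<bar> \<le> B" if "continuous_on UNIV g" "\<And>x. x \<notin> S \<Longrightarrow> g x = 0" for g :: "'a \<Rightarrow> real"
  proof -
    have "compact (g ` S)" by (intro compact_continuous_image S continuous_on_subset[OF that(1)]) auto
    then obtain B where "\<And>x. x \<in> S \<Longrightarrow> \<bar>g x\<bar> \<le> B" using compact_imp_bounded[of "g ` S"] by (auto simp: bounded_iff)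
    hence "\<bar>g x\<bar> \<le> max 0 B" for x using that(2)[of x] by (cases "x \<in> S") (auto intro: max.coboundedI2)
    thus ?thesis by (intro exI[of _ "max 0 B"]) auto
  qed
  obtain B where B: "\<And>x. \<bar>f x\<bar> \<le> B" using bdd[OF smooth_continuous[OF S(1)] S(3)] by blast
  define D where "D = (\<lambda>x. frechet_derivative f (at x))"
  have f1: "Ck (Suc 0) f" using S(1) by (simp add: smooth_def)
  have D: "(f has_derivative D x) (at x)" for x unfolding D_def by (rule Ck_Suc_D(1)[OF f1])
  have Dz: "D x v = 0" if "x \<notin> S" for x v
  proof -
    have "open (- S)" using S(2) by (simp add: compact_imp_closed open_Compl)
    have "((\<lambda>x. 0) has_derivative D x) (at x)"
      by (rule has_derivative_transform_within_open[OF D[of x] \<open>open (- S)\<close>]) (use that S(3) in auto)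
    moreover have "((\<lambda>x. 0) has_derivative (\<lambda>v. 0)) (at x)" by simp
    ultimately have "D x = (\<lambda>v. 0)" by (rule has_derivative_unique)
    thus ?thesis by simp
  qed
  have "\<exists>B\<ge>0. \<forall>x. \<bar>D x v\<bar> \<le> B" for v
    by (rule bdd) (use f1 Dz in \<open>auto simp: D_def\<close>)
  then obtain C where C: "\<And>v. C v \<ge> 0" "\<And>v x. \<bar>D x v\<bar> \<le> C v" by metis
  define L where "L = (\<Sum>b\<in>(Basis::'a set). C b)"
  have L: "L \<ge> 0" unfolding L_def by (intro sum_nonneg C)
  have on: "onorm (D x) \<le> L" for x
  proof (rule onorm_bound[OF L])
    fix v
    interpret bounded_linear "D x" using D[of x] by (rule has_derivative_bounded_linear)
    have "D x v = D x (\<Sum>b\<in>Basis. (v \<bullet> b) *\<^sub>R b)" by (simp add: euclidean_representation)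
    also have "\<dots> = (\<Sum>b\<in>Basis. (v \<bullet> b) * D x b)" by (simp add: sum scale)
    also have "norm \<dots> \<le> (\<Sum>b\<in>Basis. norm v * C b)"
      using C(2) by (intro sum_norm_le) (auto simp: abs_mult Basis_le_norm intro!: mult_mono)
    finally show "norm (D x v) \<le> L * norm v" unfolding L_def sum_distrib_right by (simp add: mult.commute)
  qed
  have "\<bar>f x - f y\<bar> \<le> L * norm (x - y)" for x y
    using differentiable_bound[of UNIV f D L x y] D on by (auto simp: has_derivative_at_withinI)
  thus ?thesis using that B L by blast
qed

context fractional_kernel
begin

text \<open>\<open>L\<close> serves points at distance at most 1, and \<open>2 * B\<close> all
  others.\<close>

lemma osc_bounded_I:
  assumes "\<And>x. \<bar>f x\<bar> \<le> B" "L \<ge> 0" "\<And>x y. \<bar>f x - f y\<bar> \<le> L * norm (x - y)"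
  shows "osc_bounded (2 * B + L) f"
proof -
  have B: "B \<ge> 0" using assms(1)[of 0] by linarith
  have "\<bar>f x - f y\<bar> \<le> (2 * B + L) * min 1 (norm (x - y))" for x y
  proof (cases "norm (x - y) \<le> 1")
    case True
    have "L * norm (x - y) \<le> (2 * B + L) * norm (x - y)" using B by (intro mult_right_mono) auto
    thus ?thesis using True assms(3)[of x y] by simp
  next
    case False
    thus ?thesis using assms(1)[of x] assms(1)[of y] assms(2) by simp
  qed
  moreover have "\<bar>f x\<bar> \<le> 2 * B + L" for x using assms(1)[of x] assms(2) B by linarith
  ultimately show ?thesis by (simp add: osc_bounded_def)
qed

lemma Cc_inf_osc_bounded:
  assumes "f \<in> Cc_inf U" obtains M where "osc_bounded M f"
proof -
  obtain B L where "\<And>x. \<bar>f x\<bar> \<le> B" "L \<ge> 0" "\<And>x y. \<bar>f x - f y\<bar> \<le> L * norm (x - y)" using Cc_inf_lipschitz[OF assms] by blast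
  thus ?thesis using that osc_bounded_I by blast
qed

end

lemma Cc_inf_support_radius:
  fixes f :: "'a::euclidean_space \<Rightarrow> real"
  assumes "f \<in> Cc_inf U" obtains R where "\<And>x. norm x > R \<Longrightarrow> f x = 0"
proof -
  obtain S where S: "compact S" "\<And>x. x \<notin> S \<Longrightarrow> f x = 0" using Cc_inf_D[OF assms] by metis
  obtain R where "\<And>x. x \<in> S \<Longrightarrow> norm x \<le> R" using compact_imp_bounded[OF S(1)] by (auto simp: bounded_iff)
  thus ?thesis using that[of R] S(2) by (metis not_le)
qed

text \<open>By Lebesgue differentiation on cubes, whose indicators are limits of bumps.\<close>

lemma Cc_inf_orthogonal_imp_zero:
  fixes g :: "real ^ 'n \<Rightarrow> real"
  assumes g: "g \<in> Ltwo" and U: "open U"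
    and orth: "\<And>\<phi>. \<phi> \<in> Cc_inf U \<Longrightarrow> (LINT x|lebesgue. \<phi> x * g x) = 0"
  shows "AE x in lebesgue. x \<in> U \<longrightarrow> g x = 0"
proof -
  note gm [measurable] = Ltwo_measurable[OF g]
  have g2: "integrable lebesgue (\<lambda>x. (g x)\<^sup>2)" using Ltwo_integrable[OF g] by simp
  have bm: "box_bump m a b \<in> borel_measurable lebesgue" for m and a b :: "real^'n"
    using borel_measurable_continuous_onI[OF smooth_continuous[OF smooth_box_bump[of m a b]]]
    by (intro measurable_completion) simp
  have loc: "integrable lebesgue (\<lambda>x. indicator (cbox a b) x * g x)" for a b :: "real^'n"
  proof (rule Bochner_Integration.integrable_bound)
    show "integrable lebesgue (\<lambda>x. indicator (cbox a b) x + (g x)\<^sup>2)"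
      using g2 emeasure_lborel_cbox_finite[of a b] by (intro Bochner_Integration.integrable_add integrable_real_indicator) auto
    have "\<bar>t\<bar> \<le> 1 + t\<^sup>2" for t :: real
      using sum_squares_bound[of 1 "\<bar>t\<bar>"] by simp
    thus "AE x in lebesgue. norm (indicator (cbox a b) x * g x) \<le> norm (indicator (cbox a b) x + (g x)\<^sup>2)"
      by (intro AE_I2) (auto simp: indicator_def)
  qed (auto intro!: borel_measurable_times borel_measurable_indicator)
  have si: "set_integrable lebesgue (cbox a b) g" for a b :: "real^'n" using loc by (simp add: set_integrable_def)
  have zero: "integral (cbox a b) g = 0" if ab: "\<And>i. a $ i < b $ i" and sub: "cbox a b \<subseteq> U" for a b
  proof -
    have "(\<lambda>k. LINT x|lebesgue. box_bump (Suc k) a b x * g x) \<longlonglongrightarrow> (LINT x|lebesgue. indicator (box a b) x * g x)"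
    proof (rule integral_dominated_convergence)
      show "integrable lebesgue (\<lambda>x. \<bar>indicator (cbox a b) x * g x\<bar>)" by (intro integrable_abs loc)
      show "AE x in lebesgue. (\<lambda>k. box_bump (Suc k) a b x * g x) \<longlonglongrightarrow> indicator (box a b) x * g x"
        by (intro AE_I2 tendsto_mult_right box_bump_tendsto ab)
      show "AE x in lebesgue. norm (box_bump (Suc k) a b x * g x) \<le> \<bar>indicator (cbox a b) x * g x\<bar>" for k
      proof (rule AE_I2)
        fix x
        have "box_bump (Suc k) a b x \<le> indicator (cbox a b) x"
          using box_bump_pos[OF ab, of "Suc k" x] box_bump_bounds[of "Suc k" a b x] box_subset_cbox[of a b]
          by (cases "x \<in> box a b") (auto simp: indicator_def not_less less_le)
        hence "\<bar>box_bump (Suc k) a b x\<bar> \<le> indicator (cbox a b) x" using box_bump_bounds(1)[of "Suc k" a b x] by simp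
        thus "norm (box_bump (Suc k) a b x * g x) \<le> \<bar>indicator (cbox a b) x * g x\<bar>"
          by (simp add: abs_mult mult_right_mono)
      qed
    qed (auto intro!: borel_measurable_times borel_measurable_indicator bm)
    moreover have "(LINT x|lebesgue. box_bump (Suc k) a b x * g x) = 0" for k
      by (rule orth) (use ab sub in \<open>auto intro!: box_bump_Cc_inf\<close>)
    ultimately have "(LINT x|lebesgue. indicator (box a b) x * g x) = 0"
      using LIMSEQ_unique by (simp add: LIMSEQ_const_iff)
    moreover have "(LINT x|lebesgue. indicator (box a b) x * g x) = (LINT x|lebesgue. indicator (cbox a b) x * g x)"
    proof (rule integral_cong_AE)
      have "AE x in lebesgue. x \<notin> cbox a b - box a b"
        by (rule AE_not_in) (use negligible_frontier_interval[of a b] in \<open>simp add: negligible_iff_null_sets\<close>)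
      thus "AE x in lebesgue. indicator (box a b) x * g x = indicator (cbox a b) x * g x"
        by eventually_elim (use box_subset_cbox[of a b] in \<open>auto simp: indicator_def\<close>)
    qed (auto intro!: borel_measurable_times borel_measurable_indicator)
    ultimately show ?thesis
      using set_lebesgue_integral_eq_integral(2)[OF si, of a b] by (simp add: set_lebesgue_integral_def)
  qed
  have "g integrable_on cbox a b" for a b by (rule set_lebesgue_integral_eq_integral(1)[OF si])
  then obtain N where N: "negligible N"
    "\<And>x e. x \<notin> N \<Longrightarrow> 0 < e \<Longrightarrow> \<exists>d>0. \<forall>h. 0 < h \<and> h < d \<longrightarrow> norm (integral (cbox x (x + h *\<^sub>R One)) g /\<^sub>R h ^ DIM(real^'n) - g x) < e"
    using integrable_ccontinuous_explicit[of g] by blast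
  have One: "(One :: real^'n) $ i = 1" for i
  proof -
    have b: "(axis i 1 :: real^'n) \<in> Basis" by (auto simp: Basis_vec_def)
    have "(One :: real^'n) $ i = One \<bullet> (axis i 1 :: real^'n)" by (simp add: inner_axis)
    also have "\<dots> = (\<Sum>c\<in>Basis. if c = (axis i 1 :: real^'n) then 1 else 0)"
      unfolding inner_sum_left using b by (intro sum.cong) (auto simp: inner_Basis)
    also have "\<dots> = 1" using b by simp
    finally show ?thesis .
  qed
  have "g x = 0" if x: "x \<in> U" "x \<notin> N" for x
  proof (rule ccontr)
    assume nz: "g x \<noteq> 0"
    obtain d where d: "d > 0" "\<And>h. 0 < h \<Longrightarrow> h < d \<Longrightarrow> norm (integral (cbox x (x + h *\<^sub>R One)) g /\<^sub>R h ^ DIM(real^'n) - g x) < norm (g x)"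
      using N(2)[OF x(2), of "norm (g x)"] nz by auto
    obtain r where r: "r > 0" "cball x r \<subseteq> U" using U x(1) open_contains_cball by blast
    \<comment> \<open>Small enough both for the differentiation bound and for the cube to stay
      inside \<open>cball x r\<close>.\<close>
    define h where "h = min (d / 2) (r / norm (One :: real^'n))"
    have n1: "norm (One :: real^'n) > 0" using One by (metis one_neq_zero zero_index zero_less_norm_iff)
    have h: "h > 0" "h < d" using d r n1 by (auto simp: h_def)
    have "norm (One :: real^'n) * h \<le> r" using n1 by (simp add: h_def min_def field_simps)
    have "cbox x (x + h *\<^sub>R One) \<subseteq> cball x r"
    proof
      fix y assume y: "y \<in> cbox x (x + h *\<^sub>R One)"
      have "\<bar>(y - x) $ i\<bar> \<le> \<bar>(h *\<^sub>R One :: real^'n) $ i\<bar>" for i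
      proof -
        have "x $ i \<le> y $ i" "y $ i \<le> x $ i + h * (One :: real^'n) $ i" using y by (simp_all add: mem_box_cart)
        thus ?thesis using h One[of i] by (simp only: vector_minus_component vector_scaleR_component real_scaleR_def)
      qed
      hence "norm (y - x) \<le> norm (h *\<^sub>R One :: real^'n)" by (intro norm_le_componentwise_cart) (simp only: real_norm_def)
      thus "y \<in> cball x r" using h \<open>norm One * h \<le> r\<close> by (simp add: dist_norm norm_minus_commute mult.commute)
    qed
    hence "integral (cbox x (x + h *\<^sub>R One)) g = 0"
      using r h One by (intro zero) auto
    thus False using d(2)[OF h] by simp
  qed
  moreover have "AE x in lebesgue. x \<notin> N" by (rule AE_not_in) (use N(1) in \<open>simp add: negligible_iff_null_sets\<close>)
  ultimately show ?thesis by (auto elim: eventually_mono)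
qed

section \<open>Multiplication operators and the graph of the gradient\<close>

definition bounded_multiplier :: "('a::euclidean_space \<Rightarrow> real) \<Rightarrow> bool" where
  "bounded_multiplier \<phi> \<longleftrightarrow> \<phi> \<in> borel_measurable lebesgue \<and> (\<exists>B. \<forall>x. \<bar>\<phi> x\<bar> \<le> B)"

definition mul :: "('a::euclidean_space \<Rightarrow> real) \<Rightarrow> ('a, 'b::euclidean_space) L2 \<Rightarrow> ('a, 'b) L2" where
  "mul \<phi> X = cls (\<lambda>x. \<phi> x *\<^sub>R rep_L2 X x)"

lemma bounded_multiplier_Ltwo: "bounded_multiplier \<phi> \<Longrightarrow> f \<in> Ltwo \<Longrightarrow> (\<lambda>x. \<phi> x *\<^sub>R f x) \<in> Ltwo"
  unfolding bounded_multiplier_def using Ltwo_bounded_scale by blast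

lemma cls_eqI: "f \<in> Ltwo \<Longrightarrow> g \<in> Ltwo \<Longrightarrow> (AE x in lebesgue. f x = g x) \<Longrightarrow> cls f = cls g"
  by (simp add: cls_eq_iff)

lemma mul_cls:
  assumes "bounded_multiplier \<phi>" "f \<in> Ltwo" shows "mul \<phi> (cls f) = cls (\<lambda>x. \<phi> x *\<^sub>R f x)"
  unfolding mul_def
proof (rule cls_eqI)
  show "AE x in lebesgue. \<phi> x *\<^sub>R rep_L2 (cls f) x = \<phi> x *\<^sub>R f x"
    using rep_cls_AE[OF assms(2)] by eventually_elim simp
qed (intro bounded_multiplier_Ltwo assms rep_L2_Ltwo)+

lemma mul_add: assumes p: "bounded_multiplier \<phi>" shows "mul \<phi> (X + Y) = mul \<phi> X + mul \<phi> Y"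
proof -
  obtain f g where fg: "f \<in> Ltwo" "X = cls f" "g \<in> Ltwo" "Y = cls g" using cls_cases by metis
  have "mul \<phi> (X + Y) = cls (\<lambda>x. \<phi> x *\<^sub>R (f x + g x))" using fg p by (simp add: mul_cls Ltwo_add flip: cls_add)
  also have "\<dots> = mul \<phi> X + mul \<phi> Y" using fg p by (simp add: mul_cls scaleR_add_right cls_add bounded_multiplier_Ltwo)
  finally show ?thesis .
qed

lemma mul_scaleR: assumes p: "bounded_multiplier \<phi>" shows "mul \<phi> (c *\<^sub>R X) = c *\<^sub>R mul \<phi> X"
proof -
  obtain f where f: "f \<in> Ltwo" "X = cls f" using cls_cases by metis
  have "mul \<phi> (c *\<^sub>R X) = cls (\<lambda>x. \<phi> x *\<^sub>R (c *\<^sub>R f x))" using f p by (simp only: mul_cls Ltwo_scaleR flip: cls_scaleR)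
  also have "(\<lambda>x. \<phi> x *\<^sub>R (c *\<^sub>R f x)) = (\<lambda>x. c *\<^sub>R (\<phi> x *\<^sub>R f x))" by (simp add: mult.commute)
  also have "cls \<dots> = c *\<^sub>R mul \<phi> X" using f p by (simp only: mul_cls cls_scaleR bounded_multiplier_Ltwo)
  finally show ?thesis .
qed

lemma mul_norm_le:
  assumes p: "bounded_multiplier \<phi>" and B: "\<And>x. \<bar>\<phi> x\<bar> \<le> B"
  shows "norm (mul \<phi> X) \<le> B * norm X"
proof -
  obtain f where f: "f \<in> Ltwo" "X = cls f" using cls_cases by metis
  have B0: "B \<ge> 0" using order_trans[OF abs_ge_zero B] .
  have "(norm (mul \<phi> X))\<^sup>2 = (LINT x|lebesgue. (norm (\<phi> x *\<^sub>R f x))\<^sup>2)"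
    using f p by (simp only: mul_cls norm_cls_sq bounded_multiplier_Ltwo)
  also have "\<dots> \<le> (LINT x|lebesgue. B\<^sup>2 * (norm (f x))\<^sup>2)"
  proof (rule integral_mono)
    show "integrable lebesgue (\<lambda>x. (norm (\<phi> x *\<^sub>R f x))\<^sup>2)" by (rule Ltwo_integrable[OF bounded_multiplier_Ltwo[OF p f(1)]])
    show "integrable lebesgue (\<lambda>x. B\<^sup>2 * (norm (f x))\<^sup>2)" by (intro integrable_mult_right Ltwo_integrable f)
    show "(norm (\<phi> x *\<^sub>R f x))\<^sup>2 \<le> B\<^sup>2 * (norm (f x))\<^sup>2" for x
      using power_mono[OF B[of x] abs_ge_zero, of 2] by (auto simp: power_mult_distrib intro!: mult_right_mono)
  qed
  also have "\<dots> = (B * norm X)\<^sup>2" by (simp add: f norm_cls_sq power_mult_distrib)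
  finally show ?thesis by (rule power2_le_imp_le) (simp add: B0)
qed

lemma bounded_linear_mul: assumes p: "bounded_multiplier \<phi>" shows "bounded_linear (mul \<phi>)"
proof -
  obtain B where "\<And>x. \<bar>\<phi> x\<bar> \<le> B" using p by (auto simp: bounded_multiplier_def)
  thus ?thesis using mul_norm_le[OF p, of B] by (intro bounded_linear_intro[of _ B]) (auto simp: mul_add mul_scaleR p mult.commute)
qed

lemma mul_inner: assumes p: "bounded_multiplier \<phi>" shows "mul \<phi> X \<bullet> Y = X \<bullet> mul \<phi> Y"
proof -
  obtain f g where fg: "f \<in> Ltwo" "X = cls f" "g \<in> Ltwo" "Y = cls g" using cls_cases by metis
  show ?thesis using fg p by (simp add: mul_cls inner_cls bounded_multiplier_Ltwo)
qed

lemma mul_mul: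
  assumes p: "bounded_multiplier \<phi>" "bounded_multiplier \<psi>"
  shows "mul \<phi> (mul \<psi> X) = mul (\<lambda>x. \<phi> x * \<psi> x) X" "bounded_multiplier (\<lambda>x. \<phi> x * \<psi> x)"
proof -
  obtain B B' where B: "\<And>x. \<bar>\<phi> x\<bar> \<le> B" "\<And>x. \<bar>\<psi> x\<bar> \<le> B'" using p by (auto simp: bounded_multiplier_def)
  have "\<bar>\<phi> x * \<psi> x\<bar> \<le> B * B'" for x
    using B order_trans[OF abs_ge_zero B(1)] by (simp add: abs_mult mult_mono)
  thus pp: "bounded_multiplier (\<lambda>x. \<phi> x * \<psi> x)" using p unfolding bounded_multiplier_def by (auto intro: borel_measurable_times)
  obtain f where f: "f \<in> Ltwo" "X = cls f" using cls_cases by metis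
  show "mul \<phi> (mul \<psi> X) = mul (\<lambda>x. \<phi> x * \<psi> x) X" using f p pp by (simp add: mul_cls bounded_multiplier_Ltwo)
qed

lemma bounded_multiplier_add:
  assumes p: "bounded_multiplier \<phi>" "bounded_multiplier \<psi>"
  shows "bounded_multiplier (\<lambda>x. \<phi> x + \<psi> x)"
proof -
  obtain B B' where B: "\<And>x. \<bar>\<phi> x\<bar> \<le> B" "\<And>x. \<bar>\<psi> x\<bar> \<le> B'" using p by (auto simp: bounded_multiplier_def)
  have "\<bar>\<phi> x + \<psi> x\<bar> \<le> B + B'" for x using B(1)[of x] B(2)[of x] by linarith
  thus ?thesis using p unfolding bounded_multiplier_def by (auto intro: borel_measurable_add)
qed

lemma mul_add_left:
  assumes p: "bounded_multiplier \<phi>" "bounded_multiplier \<psi>"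
  shows "mul (\<lambda>x. \<phi> x + \<psi> x) X = mul \<phi> X + mul \<psi> X"
proof -
  obtain f where f: "f \<in> Ltwo" "X = cls f" using cls_cases by metis
  thus ?thesis using f p bounded_multiplier_add[OF p] by (simp add: mul_cls cls_add bounded_multiplier_Ltwo scaleR_add_left)
qed

section \<open>Coefficient matrices as operators on L2\<close>

definition matop :: "(real ^ 'n \<Rightarrow> real ^ 'n ^ 'n) \<Rightarrow> (real ^ 'n, real ^ 'n) L2 \<Rightarrow> (real ^ 'n, real ^ 'n) L2" where
  "matop A X = cls (\<lambda>x. A x *v rep_L2 X x)"

lemma Mclass_AE:
  assumes A: "A \<in> Mclass l L UNIV" and L: "L > 0"
  shows "A \<in> borel_measurable lebesgue"
    and "AE x in lebesgue. \<forall>\<xi>. l * (norm \<xi>)\<^sup>2 \<le> (A x *v \<xi>) \<bullet> \<xi>"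
    and "AE x in lebesgue. \<forall>\<xi>. (norm (A x *v \<xi>))\<^sup>2 \<le> L * ((A x *v \<xi>) \<bullet> \<xi>)"
    and "AE x in lebesgue. \<forall>\<xi>. norm (A x *v \<xi>) \<le> L * norm \<xi>"
proof -
  show "A \<in> borel_measurable lebesgue" using A by (simp add: Mclass_def lebesgue_on_UNIV_eq)
  have ae: "AE x in lebesgue. \<forall>\<xi>. l * (norm \<xi>)\<^sup>2 \<le> (A x *v \<xi>) \<bullet> \<xi> \<and> inverse L * (norm (A x *v \<xi>))\<^sup>2 \<le> (A x *v \<xi>) \<bullet> \<xi>"
    using A unfolding Mclass_def lebesgue_on_UNIV_eq by blast
  show "AE x in lebesgue. \<forall>\<xi>. l * (norm \<xi>)\<^sup>2 \<le> (A x *v \<xi>) \<bullet> \<xi>" using ae by eventually_elim simp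
  show 2: "AE x in lebesgue. \<forall>\<xi>. (norm (A x *v \<xi>))\<^sup>2 \<le> L * ((A x *v \<xi>) \<bullet> \<xi>)"
    using ae by eventually_elim (use L in \<open>simp add: field_simps\<close>)
  show "AE x in lebesgue. \<forall>\<xi>. norm (A x *v \<xi>) \<le> L * norm \<xi>"
    using 2
  proof eventually_elim
    case (elim x)
    show ?case
    proof
      fix \<xi>
      have "(norm (A x *v \<xi>))\<^sup>2 \<le> L * ((A x *v \<xi>) \<bullet> \<xi>)" using elim by blast
      also have "\<dots> \<le> L * (norm (A x *v \<xi>) * norm \<xi>)" using L by (intro mult_left_mono norm_cauchy_schwarz) auto
      finally have "norm (A x *v \<xi>) * norm (A x *v \<xi>) \<le> norm (A x *v \<xi>) * (L * norm \<xi>)"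
        by (simp add: power2_eq_square mult_ac)
      thus "norm (A x *v \<xi>) \<le> L * norm \<xi>"
        using L by (cases "A x *v \<xi> = 0") auto
    qed
  qed
qed

lemma matrix_vector_mult_measurable:
  fixes A :: "'a \<Rightarrow> real ^ 'n ^ 'n"
  assumes "A \<in> borel_measurable M" "f \<in> borel_measurable M"
  shows "(\<lambda>x. A x *v f x) \<in> borel_measurable M"
proof (rule borel_measurable_continuous_Pair[OF assms])
  show "continuous_on UNIV (\<lambda>p::(real^'n^'n) \<times> (real^'n). fst p *v snd p)"
    unfolding matrix_vector_mult_def by (intro continuous_on_vec_lambda continuous_intros)
qed

lemma matop_Ltwo:
  assumes A: "A \<in> Mclass l L UNIV" and L: "L > 0" and f: "f \<in> Ltwo"
  shows "(\<lambda>x. A x *v f x) \<in> Ltwo"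
proof (rule Ltwo_I_bound)
  show "(\<lambda>x. A x *v f x) \<in> borel_measurable lebesgue"
    by (intro matrix_vector_mult_measurable Mclass_AE(1)[OF A L] Ltwo_measurable f)
  show "integrable lebesgue (\<lambda>x. L\<^sup>2 * (norm (f x))\<^sup>2)" by (intro integrable_mult_right Ltwo_integrable f)
  show "AE x in lebesgue. (norm (A x *v f x))\<^sup>2 \<le> L\<^sup>2 * (norm (f x))\<^sup>2"
    using Mclass_AE(4)[OF A L]
  proof eventually_elim
    case (elim x)
    have "(norm (A x *v f x))\<^sup>2 \<le> (L * norm (f x))\<^sup>2" using elim by (intro power_mono) auto
    thus ?case by (simp add: power_mult_distrib)
  qed
qed

lemma matop_cls:
  assumes A: "A \<in> Mclass l L UNIV" and L: "L > 0" and f: "f \<in> Ltwo"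
  shows "matop A (cls f) = cls (\<lambda>x. A x *v f x)"
  unfolding matop_def
proof (rule cls_eqI)
  show "AE x in lebesgue. A x *v rep_L2 (cls f) x = A x *v f x"
    using rep_cls_AE[OF f] by eventually_elim simp
qed (intro matop_Ltwo[OF A L] f rep_L2_Ltwo)+

lemma matop_elliptic:
  assumes A: "A \<in> Msym l L UNIV" and L: "L > 0"
  shows "elliptic l L (matop A)"
proof -
  have A': "A \<in> Mclass l L UNIV" and sym: "AE x in lebesgue. A x = transpose (A x)"
    using A unfolding Msym_def lebesgue_on_UNIV_eq by blast+
  note c = matop_cls[OF A' L] and T = matop_Ltwo[OF A' L]
  have lower: "l * (norm X)\<^sup>2 \<le> matop A X \<bullet> X" for X
  proof -
    obtain f where f: "f \<in> Ltwo" "X = cls f" using cls_cases by metis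
    have "l * (norm X)\<^sup>2 = (LINT x|lebesgue. l * (norm (f x))\<^sup>2)" by (simp add: f norm_cls_sq)
    also have "\<dots> \<le> (LINT x|lebesgue. (A x *v f x) \<bullet> f x)"
    proof (rule integral_mono_AE)
      show "integrable lebesgue (\<lambda>x. l * (norm (f x))\<^sup>2)" by (intro integrable_mult_right Ltwo_integrable f)
      show "integrable lebesgue (\<lambda>x. (A x *v f x) \<bullet> f x)" by (intro Ltwo_inner_integrable T f)
      show "AE x in lebesgue. l * (norm (f x))\<^sup>2 \<le> (A x *v f x) \<bullet> f x" using Mclass_AE(2)[OF A' L] by eventually_elim simp
    qed
    finally show ?thesis by (simp add: f c T inner_cls)
  qed
  have upper: "norm (matop A X) \<le> L * norm X" for X
  proof -
    obtain f where f: "f \<in> Ltwo" "X = cls f" using cls_cases by metis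
    have "(norm (matop A X))\<^sup>2 = (LINT x|lebesgue. (norm (A x *v f x))\<^sup>2)" by (simp add: f c T norm_cls_sq)
    also have "\<dots> \<le> (LINT x|lebesgue. L\<^sup>2 * (norm (f x))\<^sup>2)"
    proof (rule integral_mono_AE)
      show "integrable lebesgue (\<lambda>x. (norm (A x *v f x))\<^sup>2)" by (intro Ltwo_integrable T f)
      show "integrable lebesgue (\<lambda>x. L\<^sup>2 * (norm (f x))\<^sup>2)" by (intro integrable_mult_right Ltwo_integrable f)
      show "AE x in lebesgue. (norm (A x *v f x))\<^sup>2 \<le> L\<^sup>2 * (norm (f x))\<^sup>2"
        using Mclass_AE(4)[OF A' L]
      proof eventually_elim
        case (elim x)
        have "(norm (A x *v f x))\<^sup>2 \<le> (L * norm (f x))\<^sup>2" using elim by (intro power_mono) auto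
        thus ?case by (simp add: power_mult_distrib)
      qed
    qed
    also have "\<dots> = (L * norm X)\<^sup>2" by (simp add: f norm_cls_sq power_mult_distrib)
    finally show ?thesis by (rule power2_le_imp_le) (use L in simp)
  qed
  have add: "matop A (X + Y) = matop A X + matop A Y" for X Y
  proof -
    obtain f g where fg: "f \<in> Ltwo" "X = cls f" "g \<in> Ltwo" "Y = cls g" using cls_cases by metis
    have "matop A (X + Y) = cls (\<lambda>x. A x *v (f x + g x))" using fg by (simp add: c Ltwo_add flip: cls_add)
    thus ?thesis using fg by (simp add: c T matrix_vector_right_distrib cls_add)
  qed
  have scale: "matop A (r *\<^sub>R X) = r *\<^sub>R matop A X" for r X
  proof -
    obtain f where f: "f \<in> Ltwo" "X = cls f" using cls_cases by metis
    have "matop A (r *\<^sub>R X) = cls (\<lambda>x. A x *v (r *\<^sub>R f x))" using f by (simp add: c Ltwo_scaleR flip: cls_scaleR)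
    thus ?thesis using f by (simp add: c T matrix_vector_mult_scaleR cls_scaleR)
  qed
  have "matop A X \<bullet> Y = X \<bullet> matop A Y" for X Y
  proof -
    obtain f g where fg: "f \<in> Ltwo" "X = cls f" "g \<in> Ltwo" "Y = cls g" using cls_cases by metis
    have "(LINT x|lebesgue. (A x *v f x) \<bullet> g x) = (LINT x|lebesgue. f x \<bullet> (A x *v g x))"
    proof (rule integral_cong_AE)
      show "AE x in lebesgue. (A x *v f x) \<bullet> g x = f x \<bullet> (A x *v g x)"
        using sym
      proof eventually_elim
        case (elim x)
        have "A x *v f x = f x v* A x" using elim transpose_matrix_vector[of "A x" "f x"] by simp
        thus ?case by (simp add: dot_lmul_matrix)
      qed
    qed (intro borel_measurable_integrable Ltwo_inner_integrable T fg)+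
    thus ?thesis using fg by (simp add: c T inner_cls)
  qed
  moreover have "bounded_linear (matop A)"
    by (rule bounded_linear_intro[of _ L]) (use add scale upper in \<open>auto simp: mult.commute\<close>)
  ultimately show ?thesis using lower upper unfolding elliptic_def by blast
qed

lemma matop_mul:
  assumes A: "A \<in> Mclass l L UNIV" and L: "L > 0" and p: "bounded_multiplier \<phi>"
  shows "matop A (mul \<phi> X) = mul \<phi> (matop A X)"
proof -
  obtain f where f: "f \<in> Ltwo" "X = cls f" using cls_cases by metis
  thus ?thesis using p by (simp add: mul_cls matop_cls[OF A L] matop_Ltwo[OF A L] bounded_multiplier_Ltwo matrix_vector_mult_scaleR)
qed

section \<open>The closed graph of the fractional gradient\<close>

context fractional_kernel
begin

text \<open>In contrast to \<open>bounded_multiplier\<close>, these map test functions to test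
  functions and have a bounded commutator with the gradient. Compact support is not imposed, so that
  constants, cosines and sines belong to the class.\<close>

definition multiplier :: "(real ^ 'n \<Rightarrow> real) \<Rightarrow> bool" where
  "multiplier \<phi> \<longleftrightarrow> smooth \<phi> \<and> (\<exists>M. osc_bounded M \<phi>)"

lemma multiplier_bounded: assumes "multiplier \<phi>" shows "bounded_multiplier \<phi>"
proof -
  obtain M where M: "osc_bounded M \<phi>" using assms by (auto simp: multiplier_def)
  have "\<phi> \<in> borel_measurable lebesgue" using osc_bounded_measurable[OF M] by (intro measurable_completion) simp
  thus ?thesis using osc_boundedD(1)[OF M] unfolding bounded_multiplier_def by blast
qed

lemma multiplier_Cc_inf: "\<phi> \<in> Cc_inf U \<Longrightarrow> multiplier \<phi>"
  unfolding multiplier_def using Cc_inf_smooth Cc_inf_osc_bounded by blast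

lemma multiplier_cos: "multiplier (\<lambda>x. cos (v \<bullet> x))" and multiplier_sin: "multiplier (\<lambda>x. sin (v \<bullet> x))"
  unfolding multiplier_def using smooth_cos smooth_sin osc_bounded_cos osc_bounded_sin by blast+

lemma multiplier_const: "multiplier (\<lambda>x. c)"
proof -
  have "osc_bounded \<bar>c\<bar> (\<lambda>x. c)" by (simp add: osc_bounded_def)
  thus ?thesis using smooth_const unfolding multiplier_def by blast
qed

lemma multiplier_mult_Cc_inf: "multiplier \<psi> \<Longrightarrow> \<phi> \<in> Cc_inf U \<Longrightarrow> (\<lambda>x. \<psi> x * \<phi> x) \<in> Cc_inf U"
  unfolding multiplier_def using Cc_inf_mult_smooth by blast

lemma frac_grad_Cc_inf:
  assumes "\<phi> \<in> Cc_inf U"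
  shows "frac_grad s \<phi> = (\<lambda>x. cst *\<^sub>R fgrad \<phi> x)" "fgrad \<phi> \<in> Ltwo" "\<phi> \<in> Ltwo" "frac_grad s \<phi> \<in> Ltwo"
    "cls (frac_grad s \<phi>) = cst *\<^sub>R cls (fgrad \<phi>)"
proof -
  obtain M where M: "osc_bounded M \<phi>" using Cc_inf_osc_bounded[OF assms] by blast
  obtain R where R: "\<And>x. norm x > R \<Longrightarrow> \<phi> x = 0" using Cc_inf_support_radius[OF assms] by blast
  show eq: "frac_grad s \<phi> = (\<lambda>x. cst *\<^sub>R fgrad \<phi> x)" by (rule ext) (rule frac_grad_eq_fgrad[OF M])
  show F: "fgrad \<phi> \<in> Ltwo" by (rule fgrad_Ltwo[OF M R])
  show "\<phi> \<in> Ltwo" by (rule bounded_support_Ltwo[OF M R])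
  show "frac_grad s \<phi> \<in> Ltwo" unfolding eq by (rule Ltwo_scaleR[OF F])
  show "cls (frac_grad s \<phi>) = cst *\<^sub>R cls (fgrad \<phi>)" unfolding eq by (rule cls_scaleR[OF F])
qed

lemma frac_grad_add:
  fixes f g :: "real ^ 'n \<Rightarrow> real"
  assumes f: "f \<in> Cc_inf U" and g: "g \<in> Cc_inf U"
  shows "frac_grad s (\<lambda>x. f x + g x) = (\<lambda>x. frac_grad s f x + frac_grad s g x)"
proof -
  obtain M N where M: "osc_bounded M f" and N: "osc_bounded N g" using Cc_inf_osc_bounded[OF f] Cc_inf_osc_bounded[OF g] by metis
  have "fgrad (\<lambda>x. f x + g x) x = fgrad f x + fgrad g x" for x
  proof -
    have "fgrad (\<lambda>x. f x + g x) x = (LINT z|lborel. (f (x + z) - f x) *\<^sub>R kern z + (g (x + z) - g x) *\<^sub>R kern z)"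
      unfolding fgrad_def by (intro Bochner_Integration.integral_cong) (auto simp: algebra_simps)
    also have "\<dots> = fgrad f x + fgrad g x"
      unfolding fgrad_def by (intro Bochner_Integration.integral_add increment_kern_integrable[OF M] increment_kern_integrable[OF N])
    finally show ?thesis .
  qed
  thus ?thesis by (simp only: frac_grad_Cc_inf(1)[OF f] frac_grad_Cc_inf(1)[OF g] frac_grad_Cc_inf(1)[OF Cc_inf_add[OF f g]] scaleR_add_right)
qed

lemma frac_grad_scale:
  fixes f :: "real ^ 'n \<Rightarrow> real"
  assumes f: "f \<in> Cc_inf U"
  shows "frac_grad s (\<lambda>x. c * f x) = (\<lambda>x. c *\<^sub>R frac_grad s f x)"
proof -
  have "fgrad (\<lambda>x. c * f x) x = c *\<^sub>R fgrad f x" for x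
  proof -
    have "fgrad (\<lambda>x. c * f x) x = (LINT z|lborel. c *\<^sub>R ((f (x + z) - f x) *\<^sub>R kern z))"
      unfolding fgrad_def by (intro Bochner_Integration.integral_cong) (auto simp: algebra_simps)
    also have "\<dots> = c *\<^sub>R fgrad f x" unfolding fgrad_def by (rule integral_scaleR_right)
    finally show ?thesis .
  qed
  thus ?thesis by (simp add: frac_grad_Cc_inf(1)[OF f] frac_grad_Cc_inf(1)[OF Cc_inf_scale[OF f]] mult.commute)
qed

definition test_graph :: "(real ^ 'n) set \<Rightarrow> ((real ^ 'n, real) L2 \<times> (real ^ 'n, real ^ 'n) L2) set" where
  "test_graph U = (\<lambda>\<phi>. (cls \<phi>, cls (frac_grad s \<phi>))) ` Cc_inf U"

text \<open>The extended gradient as a closed subspace of a product of Hilbert spaces;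
  \<open>has_Hs_grad_iff\<close> matches it with the sequential definition on
  representatives.\<close>

definition grad_graph :: "(real ^ 'n) set \<Rightarrow> ((real ^ 'n, real) L2 \<times> (real ^ 'n, real ^ 'n) L2) set" where
  "grad_graph U = closure (test_graph U)"

lemma grad_graph_sequence:
  assumes "(x, G) \<in> grad_graph U"
  obtains \<phi> where "\<And>k. \<phi> k \<in> Cc_inf U" "(\<lambda>k. cls (\<phi> k)) \<longlonglongrightarrow> x" "(\<lambda>k. cls (frac_grad s (\<phi> k))) \<longlonglongrightarrow> G"
proof -
  obtain p where p: "\<And>k. p k \<in> test_graph U" "p \<longlonglongrightarrow> (x, G)"
    using assms unfolding grad_graph_def closure_sequential by blast
  have "\<forall>k. \<exists>\<phi>. \<phi> \<in> Cc_inf U \<and> p k = (cls \<phi>, cls (frac_grad s \<phi>))" using p(1) unfolding test_graph_def by blast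
  then obtain \<phi> where \<phi>: "\<And>k. \<phi> k \<in> Cc_inf U" "\<And>k. p k = (cls (\<phi> k), cls (frac_grad s (\<phi> k)))" by metis
  show ?thesis
    using that[of \<phi>] \<phi> tendsto_fst[OF p(2)] tendsto_snd[OF p(2)] by simp
qed

lemma grad_graph_I:
  assumes "\<And>k. \<phi> k \<in> Cc_inf U" "(\<lambda>k. cls (\<phi> k)) \<longlonglongrightarrow> x" "(\<lambda>k. cls (frac_grad s (\<phi> k))) \<longlonglongrightarrow> G"
  shows "(x, G) \<in> grad_graph U"
  unfolding grad_graph_def closure_sequential
  by (rule exI[of _ "\<lambda>k. (cls (\<phi> k), cls (frac_grad s (\<phi> k)))"])
     (use assms in \<open>auto simp: test_graph_def intro: tendsto_Pair\<close>)

lemma has_Hs_grad_iff: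
  "has_Hs_grad s U u G \<longleftrightarrow> u \<in> Ltwo \<and> G \<in> Ltwo \<and> (cls u, cls G) \<in> grad_graph U"
proof
  assume "has_Hs_grad s U u G"
  thus "u \<in> Ltwo \<and> G \<in> Ltwo \<and> (cls u, cls G) \<in> grad_graph U"
    unfolding has_Hs_grad_def fconv_Ltwo_iff by (auto intro: grad_graph_I)
next
  assume a: "u \<in> Ltwo \<and> G \<in> Ltwo \<and> (cls u, cls G) \<in> grad_graph U"
  then obtain \<phi> where "\<And>k. \<phi> k \<in> Cc_inf U" "(\<lambda>k. cls (\<phi> k)) \<longlonglongrightarrow> cls u" "(\<lambda>k. cls (frac_grad s (\<phi> k))) \<longlonglongrightarrow> cls G"
    using grad_graph_sequence[of "cls u" "cls G" U] by blast
  thus "has_Hs_grad s U u G" using a unfolding has_Hs_grad_def fconv_Ltwo_iff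
    by (intro exI[of _ \<phi>]) (auto intro: frac_grad_Cc_inf)
qed

lemma subspace_grad_graph: "subspace (grad_graph U)"
proof (rule subspaceI)
  show "0 \<in> grad_graph U"
  proof -
    have "frac_grad s (\<lambda>x::real^'n. 0) = (\<lambda>x. 0)" by (simp add: frac_grad_def fun_eq_iff)
    hence "((0, 0) :: (real ^ 'n, real) L2 \<times> (real ^ 'n, real ^ 'n) L2) \<in> grad_graph U"
      by (intro grad_graph_I[of "\<lambda>k x. 0"]) (auto simp: Cc_inf_zero cls_zero)
    thus ?thesis by (simp add: zero_prod_def)
  qed
next
  fix p q assume pq: "p \<in> grad_graph U" "q \<in> grad_graph U"
  obtain \<phi> where \<phi>: "\<And>k. \<phi> k \<in> Cc_inf U" "(\<lambda>k. cls (\<phi> k)) \<longlonglongrightarrow> fst p" "(\<lambda>k. cls (frac_grad s (\<phi> k))) \<longlonglongrightarrow> snd p"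
    using pq(1) grad_graph_sequence[of "fst p" "snd p"] by (metis prod.collapse)
  obtain \<psi> where \<psi>: "\<And>k. \<psi> k \<in> Cc_inf U" "(\<lambda>k. cls (\<psi> k)) \<longlonglongrightarrow> fst q" "(\<lambda>k. cls (frac_grad s (\<psi> k))) \<longlonglongrightarrow> snd q"
    using pq(2) grad_graph_sequence[of "fst q" "snd q"] by (metis prod.collapse)
  have "(fst p + fst q, snd p + snd q) \<in> grad_graph U"
  proof (rule grad_graph_I[of "\<lambda>k x. \<phi> k x + \<psi> k x"])
    show "(\<lambda>x. \<phi> k x + \<psi> k x) \<in> Cc_inf U" for k by (rule Cc_inf_add[OF \<phi>(1) \<psi>(1)])
    show "(\<lambda>k. cls (\<lambda>x. \<phi> k x + \<psi> k x)) \<longlonglongrightarrow> fst p + fst q"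
      using tendsto_add[OF \<phi>(2) \<psi>(2)] by (simp add: cls_add frac_grad_Cc_inf(3)[OF \<phi>(1)] frac_grad_Cc_inf(3)[OF \<psi>(1)])
    show "(\<lambda>k. cls (frac_grad s (\<lambda>x. \<phi> k x + \<psi> k x))) \<longlonglongrightarrow> snd p + snd q"
      using tendsto_add[OF \<phi>(3) \<psi>(3)]
      by (simp add: cls_add frac_grad_add[OF \<phi>(1) \<psi>(1)] frac_grad_Cc_inf(4)[OF \<phi>(1)] frac_grad_Cc_inf(4)[OF \<psi>(1)])
  qed
  thus "p + q \<in> grad_graph U" by (simp add: plus_prod_def)
next
  fix c p assume p: "p \<in> grad_graph U"
  obtain \<phi> where \<phi>: "\<And>k. \<phi> k \<in> Cc_inf U" "(\<lambda>k. cls (\<phi> k)) \<longlonglongrightarrow> fst p" "(\<lambda>k. cls (frac_grad s (\<phi> k))) \<longlonglongrightarrow> snd p"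
    using p grad_graph_sequence[of "fst p" "snd p"] by (metis prod.collapse)
  have "(c *\<^sub>R fst p, c *\<^sub>R snd p) \<in> grad_graph U"
  proof (rule grad_graph_I[of "\<lambda>k x. c * \<phi> k x"])
    show "(\<lambda>x. c * \<phi> k x) \<in> Cc_inf U" for k by (rule Cc_inf_scale[OF \<phi>(1)])
    show "(\<lambda>k. cls (\<lambda>x. c * \<phi> k x)) \<longlonglongrightarrow> c *\<^sub>R fst p"
      using tendsto_scaleR[OF tendsto_const \<phi>(2), of c] cls_scaleR[OF frac_grad_Cc_inf(3)[OF \<phi>(1)], of c] by simp
    show "(\<lambda>k. cls (frac_grad s (\<lambda>x. c * \<phi> k x))) \<longlonglongrightarrow> c *\<^sub>R snd p"
      using tendsto_scaleR[OF tendsto_const \<phi>(3), of c]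
      by (simp add: cls_scaleR frac_grad_scale[OF \<phi>(1)] frac_grad_Cc_inf(4)[OF \<phi>(1)])
  qed
  thus "c *\<^sub>R p \<in> grad_graph U" by (simp add: scaleR_prod_def)
qed

lemma closed_grad_graph: "closed (grad_graph U)" by (simp add: grad_graph_def)

end

context fractional_kernel
begin

lemma frac_grad_by_parts:
  fixes f g :: "real ^ 'n \<Rightarrow> real" and v :: "real ^ 'n"
  assumes f: "f \<in> Cc_inf U" and g: "g \<in> Cc_inf V"
  shows "cls (frac_grad s f) \<bullet> cls (\<lambda>x. g x *\<^sub>R v) = - (cls f \<bullet> cls (\<lambda>x. frac_grad s g x \<bullet> v))"
proof -
  obtain M where M: "osc_bounded M f" using Cc_inf_osc_bounded[OF f] by blast
  obtain R where R: "\<And>x. norm x > R \<Longrightarrow> f x = 0" using Cc_inf_support_radius[OF f] by blast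
  obtain N where N: "osc_bounded N g" using Cc_inf_osc_bounded[OF g] by blast
  note [measurable] = osc_bounded_measurable[OF M] osc_bounded_measurable[OF N]
    fgrad_measurable[OF osc_bounded_measurable[OF M]] fgrad_measurable[OF osc_bounded_measurable[OF N]]
  note F = frac_grad_Cc_inf[OF f] and G = frac_grad_Cc_inf[OF g]
  have i1: "integrable lborel (\<lambda>x. g x *\<^sub>R fgrad f x)"
  proof (rule Bochner_Integration.integrable_bound)
    show "integrable lborel (\<lambda>x. N * norm (fgrad f x))" by (intro integrable_mult_right integrable_norm fgrad_integrable[OF M R])
    show "AE x in lborel. norm (g x *\<^sub>R fgrad f x) \<le> norm (N * norm (fgrad f x))"
      using osc_boundedD(1)[OF N] osc_bounded_nonneg[OF N] by (intro AE_I2) (simp add: mult_right_mono)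
  qed measurable
  have i2: "integrable lborel (\<lambda>x. f x *\<^sub>R fgrad g x)"
  proof (rule Bochner_Integration.integrable_bound)
    show "integrable lborel (\<lambda>x. N * kap_mass * f x)" by (intro integrable_mult_right bounded_support_integrable[OF M R])
    have "norm (fgrad g x) \<le> N * kap_mass" for x using norm_fgrad_le_fosc fosc_le[OF N] by (rule order_trans)
    thus "AE x in lborel. norm (f x *\<^sub>R fgrad g x) \<le> norm (N * kap_mass * f x)"
      using osc_bounded_nonneg[OF N] kap_mass_nonneg by (intro AE_I2) (simp add: abs_mult mult.commute mult_left_mono)
  qed measurable
  have gv: "(\<lambda>x. g x *\<^sub>R v) \<in> Ltwo"
  proof (rule Ltwo_I_bound)
    show "(\<lambda>x. g x *\<^sub>R v) \<in> borel_measurable lebesgue" by (rule measurable_completion) measurable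
    show "integrable lebesgue (\<lambda>x. (norm v)\<^sup>2 * (norm (g x))\<^sup>2)" by (intro integrable_mult_right Ltwo_integrable G)
  qed (simp add: power_mult_distrib mult.commute)
  have Gv: "(\<lambda>x. frac_grad s g x \<bullet> v) \<in> Ltwo"
  proof (rule Ltwo_I_bound)
    show "(\<lambda>x. frac_grad s g x \<bullet> v) \<in> borel_measurable lebesgue" unfolding G(1) by (rule measurable_completion) measurable
    show "integrable lebesgue (\<lambda>x. (norm v)\<^sup>2 * (norm (frac_grad s g x))\<^sup>2)" by (intro integrable_mult_right Ltwo_integrable G)
    have "(w \<bullet> v)\<^sup>2 \<le> (norm v)\<^sup>2 * (norm w)\<^sup>2" for w :: "real^'n"
      using Cauchy_Schwarz_ineq[of w v] by (simp add: power2_norm_eq_inner mult.commute)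
    thus "AE x in lebesgue. (norm (frac_grad s g x \<bullet> v))\<^sup>2 \<le> (norm v)\<^sup>2 * (norm (frac_grad s g x))\<^sup>2" by simp
  qed
  have "cls (frac_grad s f) \<bullet> cls (\<lambda>x. g x *\<^sub>R v) = (LINT x|lebesgue. frac_grad s f x \<bullet> (g x *\<^sub>R v))"
    by (rule inner_cls[OF F(4) gv])
  also have "\<dots> = (LINT x|lborel. cst * ((g x *\<^sub>R fgrad f x) \<bullet> v))"
    unfolding F(1) by (subst integral_completion) (auto simp: mult_ac)
  also have "\<dots> = cst * ((LINT x|lborel. g x *\<^sub>R fgrad f x) \<bullet> v)"
    by (simp only: integral_mult_right_zero integral_inner_left[OF i1])
  also have "\<dots> = - (cst * ((LINT x|lborel. f x *\<^sub>R fgrad g x) \<bullet> v))"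
    using fgrad_by_parts[where R=R, OF M R N] by simp
  also have "cst * ((LINT x|lborel. f x *\<^sub>R fgrad g x) \<bullet> v) = (LINT x|lborel. cst * ((f x *\<^sub>R fgrad g x) \<bullet> v))"
    by (simp only: integral_mult_right_zero integral_inner_left[OF i2])
  also have "\<dots> = (LINT x|lebesgue. f x \<bullet> (frac_grad s g x \<bullet> v))"
    unfolding G(1) by (subst integral_completion) (auto simp: mult_ac)
  also have "\<dots> = cls f \<bullet> cls (\<lambda>x. frac_grad s g x \<bullet> v)" by (rule inner_cls[OF F(3) Gv, symmetric])
  finally show ?thesis .
qed

lemma Ltwo_inner_const:
  fixes G :: "real^'n \<Rightarrow> real^'n"
  assumes "G \<in> Ltwo" shows "(\<lambda>x. G x \<bullet> v) \<in> Ltwo"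
proof (rule Ltwo_I_bound)
  show "(\<lambda>x. G x \<bullet> v) \<in> borel_measurable lebesgue" using Ltwo_measurable[OF assms] by (intro borel_measurable_inner) auto
  show "integrable lebesgue (\<lambda>x. (norm v)\<^sup>2 * (norm (G x))\<^sup>2)" by (intro integrable_mult_right Ltwo_integrable assms)
  have "(w \<bullet> v)\<^sup>2 \<le> (norm v)\<^sup>2 * (norm w)\<^sup>2" for w :: "real^'n"
    using Cauchy_Schwarz_ineq[of w v] by (simp add: power2_norm_eq_inner mult.commute)
  thus "AE x in lebesgue. (norm (G x \<bullet> v))\<^sup>2 \<le> (norm v)\<^sup>2 * (norm (G x))\<^sup>2" by simp
qed

lemma Ltwo_scale_const:
  fixes g :: "real^'n \<Rightarrow> real" and v :: "real^'n"
  assumes "g \<in> Ltwo" shows "(\<lambda>x. g x *\<^sub>R v) \<in> Ltwo"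
proof (rule Ltwo_I_bound)
  show "(\<lambda>x. g x *\<^sub>R v) \<in> borel_measurable lebesgue" using Ltwo_measurable[OF assms] by (intro borel_measurable_scaleR) auto
  show "integrable lebesgue (\<lambda>x. (norm v)\<^sup>2 * (norm (g x))\<^sup>2)" by (intro integrable_mult_right Ltwo_integrable assms)
qed (simp add: power_mult_distrib mult.commute)

lemma vector_zero_of_components:
  fixes G :: "real^'n \<Rightarrow> real^'n"
  assumes "\<And>j. AE x in lebesgue. x \<in> U \<longrightarrow> G x \<bullet> axis j 1 = 0"
  shows "AE x in lebesgue. x \<in> U \<longrightarrow> G x = 0"
proof -
  have "AE x in lebesgue. \<forall>j\<in>UNIV. x \<in> U \<longrightarrow> G x \<bullet> axis j 1 = 0"
    using assms by (intro AE_finite_allI) auto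
  thus ?thesis by eventually_elim (auto simp: vec_eq_iff inner_axis)
qed

text \<open>Integration by parts moves the gradient to a test function; since the functions tend to
  0, the limit \<open>Y\<close> is orthogonal to all test fields.\<close>

lemma grad_graph_closable:
  assumes "(0, Y) \<in> grad_graph U" shows "Y = 0"
proof -
  obtain G where G: "G \<in> Ltwo" "Y = cls G" using cls_cases by metis
  obtain \<phi> where \<phi>: "\<And>k. \<phi> k \<in> Cc_inf U" "(\<lambda>k. cls (\<phi> k)) \<longlonglongrightarrow> 0" "(\<lambda>k. cls (frac_grad s (\<phi> k))) \<longlonglongrightarrow> Y"
    using grad_graph_sequence[OF assms] by blast
  have "AE x in lebesgue. x \<in> UNIV \<longrightarrow> G x \<bullet> axis j 1 = 0" for j
  proof (rule Cc_inf_orthogonal_imp_zero[OF Ltwo_inner_const[OF G(1)] open_UNIV])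
    fix \<psi> :: "real^'n \<Rightarrow> real" assume \<psi>: "\<psi> \<in> Cc_inf UNIV"
    define v :: "real^'n" where "v = axis j 1"
    have "(\<lambda>k. cls (frac_grad s (\<phi> k)) \<bullet> cls (\<lambda>x. \<psi> x *\<^sub>R v)) \<longlonglongrightarrow> Y \<bullet> cls (\<lambda>x. \<psi> x *\<^sub>R v)"
      by (intro tendsto_inner \<phi> tendsto_const)
    moreover have "(\<lambda>k. cls (frac_grad s (\<phi> k)) \<bullet> cls (\<lambda>x. \<psi> x *\<^sub>R v)) \<longlonglongrightarrow> - (0 \<bullet> cls (\<lambda>x. frac_grad s \<psi> x \<bullet> v))"
      unfolding frac_grad_by_parts[OF \<phi>(1) \<psi>] by (intro tendsto_minus tendsto_inner \<phi> tendsto_const)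
    ultimately have "Y \<bullet> cls (\<lambda>x. \<psi> x *\<^sub>R v) = 0" using LIMSEQ_unique by fastforce
    thus "(LINT x|lebesgue. \<psi> x * (G x \<bullet> axis j 1)) = 0"
      unfolding G(2) inner_cls[OF G(1) Ltwo_scale_const[OF frac_grad_Cc_inf(3)[OF \<psi>]]] by (simp add: v_def)
  qed
  hence "AE x in lebesgue. x \<in> UNIV \<longrightarrow> G x = 0" by (rule vector_zero_of_components)
  thus ?thesis unfolding G(2) cls_zero[symmetric] by (intro cls_eqI G Ltwo_zero) simp
qed

text \<open>On test functions the deviation \<open>\<tau>\<close> from the product rule is a
  commutator, bounded by the L2 norm of the function alone. It is therefore Cauchy along
  approximating sequences, and the bound extends to the closure. \<open>C\<close> depends on
  \<open>\<phi>\<close> only, so a strong L2 limit of the functions makes the error vanish.\<close>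

lemma grad_graph_mult:
  assumes p: "multiplier \<phi>"
  obtains C where "C \<ge> 0" "\<And>x Y U. (x, Y) \<in> grad_graph U \<Longrightarrow> \<exists>Z. (mul \<phi> x, Z) \<in> grad_graph U \<and> norm (Z - mul \<phi> Y) \<le> C * norm x"
proof -
  obtain M where M: "osc_bounded M \<phi>" using p by (auto simp: multiplier_def)
  have bp: "bounded_multiplier \<phi>" by (rule multiplier_bounded[OF p])
  define C where "C = cst * (M * kap_mass)"
  have C: "C \<ge> 0" unfolding C_def using cst_pos osc_bounded_nonneg[OF M] kap_mass_nonneg by simp
  define \<tau> where "\<tau> = (\<lambda>f. cls (frac_grad s (\<lambda>x. \<phi> x * f x)) - mul \<phi> (cls (frac_grad s f)))"
  have tau: "norm (\<tau> f) \<le> C * norm (cls f)" if f: "f \<in> Cc_inf U" for f U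
  proof -
    obtain N where N: "osc_bounded N f" using Cc_inf_osc_bounded[OF f] by blast
    have pf: "(\<lambda>x. \<phi> x * f x) \<in> Cc_inf U" by (rule multiplier_mult_Cc_inf[OF p f])
    note F = frac_grad_Cc_inf[OF f] and P = frac_grad_Cc_inf[OF pf]
    have co: "commutator \<phi> f \<in> Ltwo" by (rule commutator_Ltwo[OF M N F(3)])
    have "fgrad (\<lambda>x. \<phi> x * f x) = (\<lambda>x. \<phi> x *\<^sub>R fgrad f x + commutator \<phi> f x)" by (rule ext) (rule fgrad_mult[OF M N])
    hence "cls (fgrad (\<lambda>x. \<phi> x * f x)) = mul \<phi> (cls (fgrad f)) + cls (commutator \<phi> f)"
      by (simp add: cls_add mul_cls[OF bp F(2)] bounded_multiplier_Ltwo[OF bp F(2)] co)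
    hence "\<tau> f = cst *\<^sub>R cls (commutator \<phi> f)"
      by (simp add: \<tau>_def F(5) P(5) mul_scaleR[OF bp] scaleR_add_right)
    hence "norm (\<tau> f) = cst * norm (cls (commutator \<phi> f))" using cst_pos by simp
    also have "\<dots> \<le> cst * (M * kap_mass * norm (cls f))" using cst_pos by (intro mult_left_mono norm_commutator_le[OF M N F(3)]) auto
    finally show ?thesis by (simp add: C_def mult.assoc)
  qed
  have tau_diff: "\<tau> (\<lambda>x. f x + (-1) * g x) = \<tau> f - \<tau> g" if f: "f \<in> Cc_inf U" and g: "g \<in> Cc_inf U" for f g U
  proof -
    have g': "(\<lambda>x. (-1) * g x) \<in> Cc_inf U" by (rule Cc_inf_scale[OF g])
    have pf: "(\<lambda>x. \<phi> x * f x) \<in> Cc_inf U" "(\<lambda>x. \<phi> x * g x) \<in> Cc_inf U" by (intro multiplier_mult_Cc_inf[OF p] f g)+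
    have pg': "(\<lambda>x. (-1) * (\<phi> x * g x)) \<in> Cc_inf U" by (rule Cc_inf_scale[OF pf(2)])
    have 1: "cls (frac_grad s (\<lambda>x. f x + (-1) * g x)) = cls (frac_grad s f) + (-1) *\<^sub>R cls (frac_grad s g)"
      by (simp only: frac_grad_add[OF f g'] frac_grad_scale[OF g] cls_scaleR[OF frac_grad_Cc_inf(4)[OF g]]
          cls_add[OF frac_grad_Cc_inf(4)[OF f] Ltwo_scaleR[OF frac_grad_Cc_inf(4)[OF g]]])
    have "(\<lambda>x. \<phi> x * (f x + (-1) * g x)) = (\<lambda>x. \<phi> x * f x + (-1) * (\<phi> x * g x))" by (simp add: algebra_simps)
    hence 2: "cls (frac_grad s (\<lambda>x. \<phi> x * (f x + (-1) * g x))) = cls (frac_grad s (\<lambda>x. \<phi> x * f x)) + (-1) *\<^sub>R cls (frac_grad s (\<lambda>x. \<phi> x * g x))"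
      by (simp only: frac_grad_add[OF pf(1) pg'] frac_grad_scale[OF pf(2)] cls_scaleR[OF frac_grad_Cc_inf(4)[OF pf(2)]]
          cls_add[OF frac_grad_Cc_inf(4)[OF pf(1)] Ltwo_scaleR[OF frac_grad_Cc_inf(4)[OF pf(2)]]])
    show ?thesis unfolding \<tau>_def 1 2 mul_add[OF bp] mul_scaleR[OF bp] by simp
  qed
  have "\<exists>Z. (mul \<phi> x, Z) \<in> grad_graph U \<and> norm (Z - mul \<phi> Y) \<le> C * norm x" if xY: "(x, Y) \<in> grad_graph U" for x Y U
  proof -
    obtain f where f: "\<And>k. f k \<in> Cc_inf U" "(\<lambda>k. cls (f k)) \<longlonglongrightarrow> x" "(\<lambda>k. cls (frac_grad s (f k))) \<longlonglongrightarrow> Y"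
      using grad_graph_sequence[OF xY] by blast
    interpret mp: bounded_linear "mul \<phi> :: (real^'n, real^'n) L2 \<Rightarrow> _" by (rule bounded_linear_mul[OF bp])
    interpret mq: bounded_linear "mul \<phi> :: (real^'n, real) L2 \<Rightarrow> _" by (rule bounded_linear_mul[OF bp])
    have "Cauchy (\<lambda>k. \<tau> (f k))"
    proof (rule CauchyI)
      fix e :: real assume e: "e > 0"
      have "Cauchy (\<lambda>k. cls (f k))" using f(2) by (rule LIMSEQ_imp_Cauchy)
      then obtain N where N: "\<And>m n. m \<ge> N \<Longrightarrow> n \<ge> N \<Longrightarrow> norm (cls (f m) - cls (f n)) < e / (C + 1)"
        using CauchyD[of "\<lambda>k. cls (f k)" "e / (C + 1)"] e C by auto
      have "norm (\<tau> (f m) - \<tau> (f n)) < e" if mn: "m \<ge> N" "n \<ge> N" for m n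
      proof -
        have d: "(\<lambda>x. f m x + (-1) * f n x) \<in> Cc_inf U" by (intro Cc_inf_add Cc_inf_scale f)
        have "cls (\<lambda>x. f m x + (-1) * f n x) = cls (f m) - cls (f n)"
          using cls_minus[OF frac_grad_Cc_inf(3)[OF f(1)[of m]] frac_grad_Cc_inf(3)[OF f(1)[of n]]] by simp
        hence "norm (\<tau> (f m) - \<tau> (f n)) \<le> C * norm (cls (f m) - cls (f n))"
          using tau[OF d] tau_diff[OF f(1) f(1), of m n] by simp
        also have "\<dots> \<le> (C + 1) * norm (cls (f m) - cls (f n))" by (intro mult_right_mono) auto
        also have "\<dots> < (C + 1) * (e / (C + 1))" using N[OF mn] C by (intro mult_strict_left_mono) auto
        finally show ?thesis using C by simp
      qed
      thus "\<exists>M. \<forall>m\<ge>M. \<forall>n\<ge>M. norm (\<tau> (f m) - \<tau> (f n)) < e" by blast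
    qed
    then obtain T where T: "(\<lambda>k. \<tau> (f k)) \<longlonglongrightarrow> T" using Cauchy_convergent_iff convergent_def by blast
    have pf: "(\<lambda>x. \<phi> x * f k x) \<in> Cc_inf U" for k by (rule multiplier_mult_Cc_inf[OF p f(1)])
    have "(mul \<phi> x, mul \<phi> Y + T) \<in> grad_graph U"
    proof (rule grad_graph_I[OF pf])
      show "(\<lambda>k. cls (\<lambda>x. \<phi> x * f k x)) \<longlonglongrightarrow> mul \<phi> x"
        using mq.tendsto[OF f(2)] by (simp add: mul_cls[OF bp frac_grad_Cc_inf(3)[OF f(1)]])
      show "(\<lambda>k. cls (frac_grad s (\<lambda>x. \<phi> x * f k x))) \<longlonglongrightarrow> mul \<phi> Y + T"
        using tendsto_add[OF mp.tendsto[OF f(3)] T] by (simp add: \<tau>_def)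
    qed
    moreover have "norm T \<le> C * norm x"
      by (rule LIMSEQ_le[OF tendsto_norm[OF T] tendsto_mult_left[OF tendsto_norm[OF f(2)]]]) (use tau[OF f(1)] in blast)
    ultimately show ?thesis by (intro exI[of _ "mul \<phi> Y + T"]) simp
  qed
  thus ?thesis using that C by blast
qed

lemma grad_graph_poincare:
  assumes "bounded U"
  obtains C where "C \<ge> 0" "\<And>x Y. (x, Y) \<in> grad_graph U \<Longrightarrow> norm x \<le> C * norm Y"
proof -
  obtain R where R: "\<And>x. x \<in> U \<Longrightarrow> norm x \<le> R" using assms by (auto simp: bounded_iff)
  obtain C where C: "C \<ge> 0" "\<And>M f. osc_bounded M f \<Longrightarrow> (\<And>x. norm x > R \<Longrightarrow> f x = 0) \<Longrightarrow> norm (cls f) \<le> C * norm (cls (fgrad f))"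
    using test_poincare by metis
  have t: "norm (cls f) \<le> C / cst * norm (cls (frac_grad s f))" if f: "f \<in> Cc_inf U" for f
  proof -
    obtain M where M: "osc_bounded M f" using Cc_inf_osc_bounded[OF f] by blast
    have "f x = 0" if "norm x > R" for x
      using Cc_inf_D[OF f] R that by (metis not_le subsetD)
    hence "norm (cls f) \<le> C * norm (cls (fgrad f))" by (rule C(2)[OF M])
    thus ?thesis using cst_pos by (simp add: frac_grad_Cc_inf(5)[OF f])
  qed
  have "norm x \<le> C / cst * norm Y" if xY: "(x, Y) \<in> grad_graph U" for x Y
  proof -
    obtain f where f: "\<And>k. f k \<in> Cc_inf U" "(\<lambda>k. cls (f k)) \<longlonglongrightarrow> x" "(\<lambda>k. cls (frac_grad s (f k))) \<longlonglongrightarrow> Y"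
      using grad_graph_sequence[OF xY] by blast
    show ?thesis
      by (rule LIMSEQ_le[OF tendsto_norm[OF f(2)] tendsto_mult_left[OF tendsto_norm[OF f(3)]]]) (use t[OF f(1)] in blast)
  qed
  moreover have "C / cst \<ge> 0" using C cst_pos by simp
  ultimately show ?thesis using that by blast
qed

text \<open>A weak cluster point of the pairs lies in the graph and has gradient 0, so by Poincare
  its function is 0; hence \<open>x\<close> tends weakly to 0. Replacing each pair by a test
  function at distance below \<open>1 / Suc k\<close> reduces the strong convergence to
  \<open>test_rellich\<close>.\<close>

lemma grad_graph_compact:
  assumes U: "bounded U" and G: "\<And>k. (x k, Y k) \<in> grad_graph U" and B: "\<And>k. norm (Y k) \<le> B" and w: "weakly Y 0"
  shows "x \<longlonglongrightarrow> 0"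
proof -
  obtain C where C: "C \<ge> 0" "\<And>x Y. (x, Y) \<in> grad_graph U \<Longrightarrow> norm x \<le> C * norm Y" using grad_graph_poincare[OF U] by blast
  have xb: "norm (x k) \<le> C * B" for k using C(2)[OF G[of k]] mult_left_mono[OF B[of k] C(1)] by linarith
  have wx: "weakly x 0"
    unfolding weakly_def
  proof
    fix g
    show "(\<lambda>h. x h \<bullet> g) \<longlonglongrightarrow> 0 \<bullet> g"
    proof (rule LIMSEQ_by_subsequences)
      fix r :: "nat \<Rightarrow> nat" assume r: "strict_mono r"
      have "norm (x (r h), Y (r h)) \<le> C * B + B" for h
        using norm_Pair_le[of "x (r h)" "Y (r h)"] xb[of "r h"] B[of "r h"] by linarith
      then obtain q z where q: "strict_mono (q :: nat \<Rightarrow> nat)" "weakly (\<lambda>h. (x (r (q h)), Y (r (q h)))) z"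
        using weakly_compact[of "\<lambda>h. (x (r h), Y (r h))"] by blast
      have z: "z \<in> grad_graph U"
        by (rule weakly_closed_subspace[OF subspace_grad_graph closed_grad_graph G q(2)])
      have w1: "weakly (\<lambda>h. x (r (q h))) (fst z)"
        unfolding weakly_def using weaklyD[OF q(2), of "(_, 0)"] by (auto simp: inner_prod_def)
      have w2: "weakly (\<lambda>h. Y (r (q h))) (snd z)"
        unfolding weakly_def using weaklyD[OF q(2), of "(0, _)"] by (auto simp: inner_prod_def)
      have "weakly (\<lambda>h. Y (r (q h))) 0" using weakly_subseq[OF w strict_mono_o[OF r q(1)]] by (simp add: o_def)
      hence "snd z = 0" using w2 weakly_unique by blast
      hence "fst z = 0" using C(2)[of "fst z" "snd z"] z by (cases z) simp
      thus "\<exists>q::nat\<Rightarrow>nat. strict_mono q \<and> (\<lambda>n. x (r (q n)) \<bullet> g) \<longlonglongrightarrow> 0 \<bullet> g" using q(1) weaklyD[OF w1] by auto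
    qed
  qed
  have "\<exists>f. f \<in> Cc_inf U \<and> norm (cls f - x k) < 1 / Suc k \<and> norm (cls (frac_grad s f) - Y k) < 1 / Suc k" for k
  proof -
    obtain f where f: "\<And>k. f k \<in> Cc_inf U" "(\<lambda>j. cls (f j)) \<longlonglongrightarrow> x k" "(\<lambda>j. cls (frac_grad s (f j))) \<longlonglongrightarrow> Y k"
      using grad_graph_sequence[OF G[of k]] by blast
    have p: "1 / real (Suc k) > 0" by simp
    have "eventually (\<lambda>j. dist (cls (f j)) (x k) < 1 / Suc k \<and> dist (cls (frac_grad s (f j))) (Y k) < 1 / Suc k) sequentially"
      by (intro eventually_conj tendstoD[OF f(2) p] tendstoD[OF f(3) p])
    then obtain j where "dist (cls (f j)) (x k) < 1 / Suc k \<and> dist (cls (frac_grad s (f j))) (Y k) < 1 / Suc k"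
      using eventually_happens'[OF sequentially_bot] by blast
    thus ?thesis using f(1) by (auto simp: dist_norm)
  qed
  then obtain f where f: "\<And>k. f k \<in> Cc_inf U" "\<And>k. norm (cls (f k) - x k) < 1 / Suc k" "\<And>k. norm (cls (frac_grad s (f k)) - Y k) < 1 / Suc k"
    by metis
  have fx: "(\<lambda>k. cls (f k) - x k) \<longlonglongrightarrow> 0"
    by (rule tendsto_norm_zero_cancel, rule tendsto_sandwich[OF _ _ tendsto_const LIMSEQ_Suc[OF lim_1_over_n]])
       (use f(2) in \<open>auto intro!: always_eventually less_imp_le\<close>)
  have "\<forall>k. \<exists>M. osc_bounded M (f k)" using Cc_inf_osc_bounded[OF f(1)] by blast
  then obtain M where M: "\<And>k. osc_bounded (M k) (f k)" by metis
  obtain R where R: "\<And>x. x \<in> U \<Longrightarrow> norm x \<le> R" using U by (auto simp: bounded_iff)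
  have supp: "f k x = 0" if "norm x > R" for k x
    using Cc_inf_D[OF f(1)[of k]] R that by (metis not_le subsetD)
  have fb: "norm (cls (fgrad (f k))) \<le> (B + 1) / cst" for k
  proof -
    have "1 / real (Suc k) \<le> 1" by simp
    hence "norm (cls (frac_grad s (f k)) - Y k) \<le> 1" using f(3)[of k] by linarith
    hence "norm (cls (frac_grad s (f k))) \<le> B + 1"
      using B[of k] norm_triangle_ineq[of "cls (frac_grad s (f k)) - Y k" "Y k"] by simp
    thus ?thesis using cst_pos by (simp add: frac_grad_Cc_inf(5)[OF f(1)] field_simps)
  qed
  have "weakly (\<lambda>k. cls (f k)) 0"
    using weakly_add[OF tendsto_imp_weakly[OF fx] wx] by simp
  hence "(\<lambda>k. cls (f k)) \<longlonglongrightarrow> 0" using M supp fb by (intro test_rellich[where M=M and f=f and R=R and B="(B + 1) / cst"])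
  from tendsto_diff[OF this fx] show ?thesis by simp
qed

lemma energy_graph_grad_graph:
  assumes "bounded U" obtains C where "energy_graph (grad_graph U) C"
proof -
  obtain C where C: "C \<ge> 0" "\<And>x Y. (x, Y) \<in> grad_graph U \<Longrightarrow> norm x \<le> C * norm Y" using grad_graph_poincare[OF assms] by blast
  have "energy_graph (grad_graph U) C"
    by standard (auto intro: subspace_grad_graph closed_grad_graph C(2) grad_graph_closable grad_graph_compact[OF assms])
  thus ?thesis using that by blast
qed

end

section \<open>Oscillating test fields\<close>

lemma norm_cls_mono:
  assumes "f \<in> Ltwo" "g \<in> Ltwo" "\<And>x. norm (f x) \<le> norm (g x)"
  shows "norm (cls f) \<le> norm (cls g)"
proof (rule power2_le_imp_le)
  show "(norm (cls f))\<^sup>2 \<le> (norm (cls g))\<^sup>2"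
    unfolding norm_cls_sq[OF assms(1)] norm_cls_sq[OF assms(2)]
    by (intro integral_mono Ltwo_integrable assms power_mono norm_ge_zero)
qed simp

lemma mul_commute:
  assumes "bounded_multiplier \<phi>" "bounded_multiplier \<psi>"
  shows "mul \<phi> (mul \<psi> X) = mul \<psi> (mul \<phi> X)"
  unfolding mul_mul(1)[OF assms] mul_mul(1)[OF assms(2,1)] by (simp add: mult.commute)

lemma LIMSEQ_zero_bound:
  fixes e :: "nat \<Rightarrow> 'a::real_normed_vector"
  assumes "\<And>k. norm (e k) \<le> g k" "g \<longlonglongrightarrow> 0" shows "e \<longlonglongrightarrow> 0"
  using assms by (intro Lim_null_comparison[OF _ assms(2)]) auto

lemma inner_tendsto_zero:
  fixes x e :: "nat \<Rightarrow> 'h::real_inner"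
  assumes "\<And>k. norm (x k) \<le> B" "e \<longlonglongrightarrow> 0" shows "(\<lambda>k. x k \<bullet> e k) \<longlonglongrightarrow> 0"
proof (rule LIMSEQ_zero_bound)
  show "norm (x k \<bullet> e k) \<le> B * norm (e k)" for k
    unfolding real_norm_def by (rule order_trans[OF Cauchy_Schwarz_ineq2 mult_right_mono[OF assms(1) norm_ge_zero]])
  show "(\<lambda>k. B * norm (e k)) \<longlonglongrightarrow> 0" using tendsto_mult_right_zero[OF tendsto_norm_zero[OF assms(2)]] .
qed

text \<open>For a bounded sequence, convergence to 0 can thus be tested by projecting onto the
  successful test vectors and examining the remainder.\<close>

lemma weak_null_subspace:
  fixes x :: "nat \<Rightarrow> 'h::real_inner"
  assumes B: "\<And>k. norm (x k) \<le> B"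
  shows "subspace {g. (\<lambda>k. x k \<bullet> g) \<longlonglongrightarrow> 0}" "closed {g. (\<lambda>k. x k \<bullet> g) \<longlonglongrightarrow> 0}"
proof -
  show "subspace {g. (\<lambda>k. x k \<bullet> g) \<longlonglongrightarrow> 0}"
    by (rule subspaceI) (auto simp: inner_add_right intro: tendsto_add_zero tendsto_mult_right_zero)
  have B0: "B \<ge> 0" using order_trans[OF norm_ge_zero B[of 0]] .
  show "closed {g. (\<lambda>k. x k \<bullet> g) \<longlonglongrightarrow> 0}"
    unfolding closed_sequential_limits
  proof (intro allI impI, elim conjE)
    fix g l assume g: "\<forall>n. g n \<in> {g. (\<lambda>k. x k \<bullet> g) \<longlonglongrightarrow> 0}" "g \<longlonglongrightarrow> l"
    have "(\<lambda>k. x k \<bullet> l) \<longlonglongrightarrow> 0"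
    proof (rule LIMSEQ_I)
      fix e :: real assume e: "e > 0"
      define d where "d = e / (2 * (B + 1))"
      have d: "d > 0" using e B0 by (simp add: d_def)
      obtain n where n: "norm (g n - l) < d" using LIMSEQ_D[OF g(2) d] by blast
      have "(\<lambda>k. x k \<bullet> g n) \<longlonglongrightarrow> 0" using g(1) by blast
      then obtain K where K: "\<And>k. k \<ge> K \<Longrightarrow> norm (x k \<bullet> g n - 0) < e / 2" using LIMSEQ_D[of "\<lambda>k. x k \<bullet> g n" 0 "e/2"] e by auto
      have "norm (x k \<bullet> l - 0) < e" if k: "k \<ge> K" for k
      proof -
        have "\<bar>x k \<bullet> (g n - l)\<bar> \<le> norm (x k) * norm (g n - l)" by (rule Cauchy_Schwarz_ineq2)
        also have "\<dots> \<le> (B + 1) * d" using B[of k] n B0 by (intro mult_mono) auto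
        also have "\<dots> = e / 2" using B0 by (simp add: d_def field_simps)
        finally have "\<bar>x k \<bullet> (g n - l)\<bar> \<le> e / 2" .
        thus ?thesis using K[OF k] by (simp add: inner_diff_right abs_if split: if_splits)
      qed
      thus "\<exists>no. \<forall>k\<ge>no. norm (x k \<bullet> l - 0) < e" by blast
    qed
    thus "l \<in> {g. (\<lambda>k. x k \<bullet> g) \<longlonglongrightarrow> 0}" by simp
  qed
qed

section \<open>Oscillating functions and their gradients\<close>

context fractional_kernel
begin

text \<open>In the product rule \<open>\<eta>\<close> takes the part of the multiplier and the plane
  wave \<open>f\<close> that of the function. The error is then the commutator of
  \<open>\<eta>\<close> with a function bounded by 1, at most \<open>fosc \<eta>\<close> at every
  frequency, so a vanishing prefactor \<open>c\<close> removes it.\<close>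

lemma frac_grad_modulated:
  fixes \<eta> f :: "real ^ 'n \<Rightarrow> real" and V :: "real ^ 'n"
  assumes \<eta>: "\<eta> \<in> Cc_inf U" and f: "multiplier f" "\<And>x. \<bar>f x\<bar> \<le> 1"
    and g: "\<And>x. fgrad f x = g x *\<^sub>R V" "bounded_multiplier g"
  shows "norm (cls (frac_grad s (\<lambda>x. c * (f x * \<eta> x))) - (c * cst) *\<^sub>R mul g (cls (\<lambda>x. \<eta> x *\<^sub>R V)))
     \<le> \<bar>c\<bar> * (cst * norm (cls (fosc \<eta>)))"
proof -
  obtain M where M: "osc_bounded M \<eta>" using Cc_inf_osc_bounded[OF \<eta>] by blast
  obtain R where R: "\<And>x. norm x > R \<Longrightarrow> \<eta> x = 0" using Cc_inf_support_radius[OF \<eta>] by blast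
  obtain N where N: "osc_bounded N f" using f(1) by (auto simp: multiplier_def)
  have h: "(\<lambda>x. f x * \<eta> x) \<in> Cc_inf U" by (rule multiplier_mult_Cc_inf[OF f(1) \<eta>])
  have eV: "(\<lambda>x. \<eta> x *\<^sub>R V) \<in> Ltwo" by (rule Ltwo_scale_const[OF frac_grad_Cc_inf(3)[OF \<eta>]])
  define co where "co = (\<lambda>x. fgrad (\<lambda>x. f x * \<eta> x) x - g x *\<^sub>R (\<eta> x *\<^sub>R V))"
  have ge: "(\<lambda>x. g x *\<^sub>R (\<eta> x *\<^sub>R V)) \<in> Ltwo" by (rule bounded_multiplier_Ltwo[OF g(2) eV])
  have co: "co \<in> Ltwo" unfolding co_def by (intro Ltwo_minus ge frac_grad_Cc_inf(2)[OF h])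
  have fo: "fosc \<eta> \<in> Ltwo" by (rule fosc_Ltwo[where R=R, OF M R])
  have "fgrad (\<lambda>x. f x * \<eta> x) x = \<eta> x *\<^sub>R fgrad f x + commutator \<eta> f x" for x
    using fgrad_mult[OF M N, of x] by (simp add: mult.commute)
  hence "co x = commutator \<eta> f x" for x by (simp add: co_def g(1) mult.commute)
  hence "norm (co x) \<le> norm (fosc \<eta> x)" for x
    using norm_commutator_le_sup[OF M N f(2), of x] fosc_nonneg[of \<eta> x] by simp
  hence le: "norm (cls co) \<le> norm (cls (fosc \<eta>))" by (rule norm_cls_mono[OF co fo])
  have eq: "cls co = cls (fgrad (\<lambda>x. f x * \<eta> x)) - mul g (cls (\<lambda>x. \<eta> x *\<^sub>R V))"
    unfolding co_def mul_cls[OF g(2) eV] by (rule cls_minus[OF frac_grad_Cc_inf(2)[OF h] ge])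
  have "cls (frac_grad s (\<lambda>x. c * (f x * \<eta> x))) = c *\<^sub>R cls (frac_grad s (\<lambda>x. f x * \<eta> x))"
    unfolding frac_grad_scale[OF h] by (rule cls_scaleR[OF frac_grad_Cc_inf(4)[OF h]])
  hence "cls (frac_grad s (\<lambda>x. c * (f x * \<eta> x))) - (c * cst) *\<^sub>R mul g (cls (\<lambda>x. \<eta> x *\<^sub>R V)) = (c * cst) *\<^sub>R cls co"
    unfolding eq frac_grad_Cc_inf(5)[OF h] by (simp add: scaleR_diff_right)
  thus ?thesis using le cst_pos by (simp add: abs_mult mult_left_mono mult.assoc)
qed

text \<open>The directions to which \<open>symb_parallel\<close> applies; they determine a symmetric
  bilinear form by polarisation.\<close>

definition directions :: "(real ^ 'n) set" where
  "directions = {\<xi>. \<exists>i j. \<xi> = axis i 1 \<or> (i \<noteq> j \<and> \<xi> = axis i 1 + axis j 1)}"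

text \<open>\<open>Suc k\<close> keeps the frequency away from 0. With this amplitude the functions
  tend to 0 in L2 while their gradients keep a fixed size.\<close>

definition osc_cos :: "(real ^ 'n \<Rightarrow> real) \<Rightarrow> real ^ 'n \<Rightarrow> nat \<Rightarrow> real ^ 'n \<Rightarrow> real" where
  "osc_cos \<eta> \<xi> k = (\<lambda>x. real (Suc k) powr (- s) * (cos ((real (Suc k) *\<^sub>R \<xi>) \<bullet> x) * \<eta> x))"

definition osc_sin :: "(real ^ 'n \<Rightarrow> real) \<Rightarrow> real ^ 'n \<Rightarrow> nat \<Rightarrow> real ^ 'n \<Rightarrow> real" where
  "osc_sin \<eta> \<xi> k = (\<lambda>x. real (Suc k) powr (- s) * (sin ((real (Suc k) *\<^sub>R \<xi>) \<bullet> x) * \<eta> x))"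

text \<open>Countable, so that one diagonal extraction provides limiting fluxes for all of
  them.\<close>

definition oscillations :: "(real ^ 'n \<Rightarrow> real) \<Rightarrow> (real ^ 'n \<Rightarrow> real) set" where
  "oscillations \<eta> = (\<Union>\<xi>\<in>directions. range (osc_cos \<eta> \<xi>) \<union> range (osc_sin \<eta> \<xi>))"

lemma finite_directions: "finite directions"
proof -
  have "directions \<subseteq> range (\<lambda>i. axis i 1) \<union> (\<lambda>(i, j). axis i 1 + axis j 1) ` UNIV" by (auto simp: directions_def)
  thus ?thesis by (rule finite_subset) auto
qed

lemma countable_oscillations: "countable (oscillations \<eta>)"
  unfolding oscillations_def by (intro countable_UN countable_finite[OF finite_directions] countable_Un countable_image) auto

lemma oscillation_limits:
  assumes \<eta>: "\<eta> \<in> Cc_inf U" and \<xi>: "\<xi> \<in> directions"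
  obtains w eS eC where "w > 0"
    "\<And>k. cls (frac_grad s (osc_sin \<eta> \<xi> k)) = w *\<^sub>R mul (\<lambda>x. cos ((real (Suc k) *\<^sub>R \<xi>) \<bullet> x)) (cls (\<lambda>x. \<eta> x *\<^sub>R \<xi>)) + eS k"
    "\<And>k. cls (frac_grad s (osc_cos \<eta> \<xi> k)) = - w *\<^sub>R mul (\<lambda>x. sin ((real (Suc k) *\<^sub>R \<xi>) \<bullet> x)) (cls (\<lambda>x. \<eta> x *\<^sub>R \<xi>)) + eC k"
    "eS \<longlonglongrightarrow> 0" "eC \<longlonglongrightarrow> 0"
    "(\<lambda>k. norm (cls (osc_sin \<eta> \<xi> k))) \<longlonglongrightarrow> 0" "(\<lambda>k. norm (cls (osc_cos \<eta> \<xi> k))) \<longlonglongrightarrow> 0"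
    "\<And>k. osc_sin \<eta> \<xi> k \<in> Cc_inf U" "\<And>k. osc_cos \<eta> \<xi> k \<in> Cc_inf U"
proof -
  obtain w where w: "w > 0" "symb \<xi> = w *\<^sub>R \<xi>" using \<xi> symb_parallel unfolding directions_def by blast
  define p where "p = (\<lambda>k. real (Suc k) powr (- s))"
  have p: "p \<longlonglongrightarrow> 0" unfolding p_def using s by real_asymp
  have p0: "p k \<ge> 0" for k by (simp add: p_def)
  define v where "v = (\<lambda>k. real (Suc k) *\<^sub>R \<xi>)"
  have sv: "symb (v k) = real (Suc k) powr s *\<^sub>R w *\<^sub>R \<xi>" for k unfolding v_def using symb_scale[of "real (Suc k)" \<xi>] w by simp
  have ps: "p k * real (Suc k) powr s = 1" for k unfolding p_def by (simp flip: powr_add)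
  have e: "\<eta> \<in> Ltwo" by (rule frac_grad_Cc_inf(3)[OF \<eta>])
  define E where "E = cls (\<lambda>x. \<eta> x *\<^sub>R \<xi>)"
  have EV: "cls (\<lambda>x. \<eta> x *\<^sub>R symb (v k)) = (real (Suc k) powr s * w) *\<^sub>R E" for k
    unfolding E_def sv using cls_scaleR[OF Ltwo_scale_const[OF e], of "real (Suc k) powr s * w" \<xi>] by (simp add: mult_ac)
  have bc: "bounded_multiplier (\<lambda>x. cos (v k \<bullet> x))" and bs: "bounded_multiplier (\<lambda>x. sin (v k \<bullet> x))" for k
    by (intro multiplier_bounded multiplier_cos multiplier_sin)+
  have bms: "bounded_multiplier (\<lambda>x. - sin (v k \<bullet> x))" for k
    using mul_mul(2)[OF multiplier_bounded[OF multiplier_const[of "-1"]] bs[of k]] by simp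
  have cP: "osc_cos \<eta> \<xi> k \<in> Cc_inf U" and sP: "osc_sin \<eta> \<xi> k \<in> Cc_inf U" for k
    unfolding osc_cos_def osc_sin_def by (intro Cc_inf_scale multiplier_mult_Cc_inf multiplier_cos multiplier_sin \<eta>)+
  have sv': "osc_sin \<eta> \<xi> k = (\<lambda>x. p k * (sin (v k \<bullet> x) * \<eta> x))" and cv': "osc_cos \<eta> \<xi> k = (\<lambda>x. p k * (cos (v k \<bullet> x) * \<eta> x))" for k
    by (simp_all add: osc_sin_def osc_cos_def p_def v_def)
  \<comment> \<open>The amplitude cancels the homogeneity of the symbol, and a factor independent of
    \<open>k\<close> remains.\<close>
  have cw: "p k * cst * (real (Suc k) powr s * w) = cst * w" for k
    using ps[of k] by (metis mult.assoc mult.commute mult.right_neutral)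
  define eS where "eS = (\<lambda>k. cls (frac_grad s (osc_sin \<eta> \<xi> k)) - (cst * w) *\<^sub>R mul (\<lambda>x. cos (v k \<bullet> x)) E)"
  define eC where "eC = (\<lambda>k. cls (frac_grad s (osc_cos \<eta> \<xi> k)) + (cst * w) *\<^sub>R mul (\<lambda>x. sin (v k \<bullet> x)) E)"
  define q where "q = cst * norm (cls (fosc \<eta>))"
  have mneg: "mul (\<lambda>x. - sin (v k \<bullet> x)) X = - mul (\<lambda>x. sin (v k \<bullet> x)) X" for k and X :: "(real^'n, real^'n) L2"
    using mul_add_left[OF bs[of k] bms[of k], of X] mul_cls[OF multiplier_bounded[OF multiplier_const[of 0]] rep_L2_Ltwo[of X]]
    by (simp add: cls_rep cls_zero eq_neg_iff_add_eq_0 add.commute)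
  have "norm (eS k) \<le> p k * q" for k
    using frac_grad_modulated[OF \<eta> multiplier_sin[of "v k"] abs_sin_le_one fgrad_sin[of "v k"] bc[of k], where c="p k"]
    by (simp only: EV mul_scaleR[OF bc[of k]] p0[THEN abs_of_nonneg] q_def eS_def sv' scaleR_scaleR cw)
  hence "eS \<longlonglongrightarrow> 0" by (rule LIMSEQ_zero_bound[OF _ tendsto_mult_left_zero[OF p]])
  moreover have "norm (eC k) \<le> p k * q" for k
    using frac_grad_modulated[OF \<eta> multiplier_cos[of "v k"] abs_cos_le_one fgrad_cos[of "v k"] bms[of k], where c="p k"]
    by (simp only: EV mul_scaleR[OF bs[of k]] p0[THEN abs_of_nonneg] q_def eC_def cv' scaleR_scaleR cw mneg
        scaleR_minus_right diff_minus_eq_add)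
  hence "eC \<longlonglongrightarrow> 0" by (rule LIMSEQ_zero_bound[OF _ tendsto_mult_left_zero[OF p]])
  moreover have "norm (cls (\<lambda>x. p k * (f x * \<eta> x))) \<le> p k * norm (cls \<eta>)"
    if f: "multiplier f" "\<And>x. \<bar>f x\<bar> \<le> 1" for f k
  proof -
    have "cls (\<lambda>x. p k * (f x * \<eta> x)) = p k *\<^sub>R mul f (cls \<eta>)"
      using cls_scaleR[OF bounded_multiplier_Ltwo[OF multiplier_bounded[OF f(1)] e], of "p k"]
      by (simp add: mul_cls[OF multiplier_bounded[OF f(1)] e])
    thus ?thesis using mul_norm_le[OF multiplier_bounded[OF f(1)] f(2), of "cls \<eta>"] p0[of k] by (simp add: mult_left_mono)
  qed
  hence "norm (cls (osc_sin \<eta> \<xi> k)) \<le> p k * norm (cls \<eta>)" "norm (cls (osc_cos \<eta> \<xi> k)) \<le> p k * norm (cls \<eta>)" for k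
    unfolding sv' cv' by (simp_all add: multiplier_sin multiplier_cos)
  hence "(\<lambda>k. cls (osc_sin \<eta> \<xi> k)) \<longlonglongrightarrow> 0" "(\<lambda>k. cls (osc_cos \<eta> \<xi> k)) \<longlonglongrightarrow> 0"
    by (blast intro: LIMSEQ_zero_bound[OF _ tendsto_mult_left_zero[OF p, of "norm (cls \<eta>)"]])+
  moreover have "cst * w > 0" using cst_pos w by simp
  moreover have "cls (frac_grad s (osc_sin \<eta> \<xi> k)) = (cst * w) *\<^sub>R mul (\<lambda>x. cos ((real (Suc k) *\<^sub>R \<xi>) \<bullet> x)) (cls (\<lambda>x. \<eta> x *\<^sub>R \<xi>)) + eS k"
     "cls (frac_grad s (osc_cos \<eta> \<xi> k)) = - (cst * w) *\<^sub>R mul (\<lambda>x. sin ((real (Suc k) *\<^sub>R \<xi>) \<bullet> x)) (cls (\<lambda>x. \<eta> x *\<^sub>R \<xi>)) + eC k" for k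
    by (simp_all add: eS_def eC_def E_def v_def)
  ultimately show ?thesis using that[of "cst * w" eS eC] cP sP tendsto_norm_zero by blast
qed

lemma mul_const: "mul (\<lambda>x. c) X = c *\<^sub>R X" for X :: "(real ^ 'n, real ^ 'n) L2"
  using mul_cls[OF multiplier_bounded[OF multiplier_const[of c]] rep_L2_Ltwo[of X]] cls_scaleR[OF rep_L2_Ltwo[of X], of c]
  by (simp add: cls_rep)

end

text \<open>\<open>R Y D\<close> stands for: the fluxes of some fields converging weakly to \<open>Y\<close> converge weakly to \<open>Ainf Y + D\<close>.\<close>

locale flux_relation = fractional_kernel s dimension
  for s :: real and dimension :: "'n::finite itself" +
  fixes Om :: "(real ^ 'n) set" and \<eta> :: "real ^ 'n \<Rightarrow> real"
    and R :: "(real ^ 'n, real ^ 'n) L2 \<Rightarrow> (real ^ 'n, real ^ 'n) L2 \<Rightarrow> bool" and Lam :: real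
  assumes open_Om: "open Om" and eta: "\<eta> \<in> Cc_inf Om"
    and R_add: "\<And>Y D Z E. R Y D \<Longrightarrow> R Z E \<Longrightarrow> R (Y + Z) (D + E)"
    and R_mul: "\<And>\<phi> Y D. multiplier \<phi> \<Longrightarrow> R Y D \<Longrightarrow> R (mul \<phi> Y) (mul \<phi> D)"
    and R_sym: "\<And>\<phi> Y D Z E. \<phi> \<in> Cc_inf Om \<Longrightarrow> R Y D \<Longrightarrow> R Z E \<Longrightarrow> mul \<phi> D \<bullet> Z = mul \<phi> Y \<bullet> E"
    and R_lip: "\<And>\<phi> Y D. \<phi> \<in> Cc_inf Om \<Longrightarrow> R Y D \<Longrightarrow> norm (mul \<phi> D) \<le> Lam * norm (mul \<phi> Y)"
    and R_osc: "\<And>f. f \<in> oscillations \<eta> \<Longrightarrow> \<exists>D. R (cls (frac_grad s f)) D \<and>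
        (\<forall>V \<in> snd ` grad_graph Om. D \<bullet> V = 0) \<and> norm D \<le> Lam * norm (cls (frac_grad s f))"
begin

lemma R_scaleR: "R Y D \<Longrightarrow> R (c *\<^sub>R Y) (c *\<^sub>R D)"
  using R_mul[OF multiplier_const[of c]] by (simp add: mul_const)

lemma R_diff: "R Y D \<Longrightarrow> R Z E \<Longrightarrow> R (Y - Z) (D - E)"
  using R_add[of Y D "(-1) *\<^sub>R Z" "(-1) *\<^sub>R E"] R_scaleR[of Z E "-1"] by simp

text \<open>Since the defects are orthogonal to gradients, only the commutator of \<open>\<phi>\<close> with the gradient contributes.\<close>

lemma defect_energy_tendsto_zero:
  assumes f: "\<And>k. f k \<in> Cc_inf Om" "(\<lambda>k. norm (cls (f k))) \<longlonglongrightarrow> 0"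
    and D: "\<And>k V. V \<in> snd ` grad_graph Om \<Longrightarrow> D k \<bullet> V = 0" "\<And>k. norm (D k) \<le> B"
    and p: "multiplier \<phi>"
  shows "(\<lambda>k. mul \<phi> (D k) \<bullet> cls (frac_grad s (f k))) \<longlonglongrightarrow> 0"
proof -
  obtain C where C: "C \<ge> 0" "\<And>x Y U. (x, Y) \<in> grad_graph U \<Longrightarrow> \<exists>Z. (mul \<phi> x, Z) \<in> grad_graph U \<and> norm (Z - mul \<phi> Y) \<le> C * norm x"
    using grad_graph_mult[OF p] by metis
  have bp: "bounded_multiplier \<phi>" by (rule multiplier_bounded[OF p])
  have B0: "B \<ge> 0" using order_trans[OF norm_ge_zero D(2)[of 0]] .
  have "\<bar>mul \<phi> (D k) \<bullet> cls (frac_grad s (f k))\<bar> \<le> B * (C * norm (cls (f k)))" for k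
  proof -
    define Y where "Y = cls (frac_grad s (f k))"
    have "(cls (f k), Y) \<in> grad_graph Om" unfolding Y_def by (rule grad_graph_I[of "\<lambda>_. f k"]) (use f(1) in auto)
    then obtain Z where Z: "(mul \<phi> (cls (f k)), Z) \<in> grad_graph Om" "norm (Z - mul \<phi> Y) \<le> C * norm (cls (f k))" using C(2) by blast
    have "Z \<in> snd ` grad_graph Om" using Z(1) by force
    hence "mul \<phi> (D k) \<bullet> Y = - (D k \<bullet> (Z - mul \<phi> Y))" using D(1) by (simp add: mul_inner[OF bp] inner_diff_right)
    hence "\<bar>mul \<phi> (D k) \<bullet> Y\<bar> \<le> norm (D k) * norm (Z - mul \<phi> Y)" using Cauchy_Schwarz_ineq2[of "D k" "Z - mul \<phi> Y"] by simp
    also have "\<dots> \<le> B * (C * norm (cls (f k)))" using Z(2) D(2) B0 by (intro mult_mono) auto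
    finally show ?thesis by (simp add: Y_def)
  qed
  hence "norm (mul \<phi> (D k) \<bullet> cls (frac_grad s (f k))) \<le> B * (C * norm (cls (f k)))" for k by simp
  thus ?thesis by (rule LIMSEQ_zero_bound[OF _ tendsto_mult_right_zero[OF tendsto_mult_right_zero[OF f(2)]]])
qed

definition profile :: "real ^ 'n \<Rightarrow> (real ^ 'n, real ^ 'n) L2" where
  "profile \<xi> = cls (\<lambda>x. \<eta> x *\<^sub>R \<xi>)"

lemma profile_add: "profile (\<xi> + \<zeta>) = profile \<xi> + profile \<zeta>"
  unfolding profile_def scaleR_add_right by (intro cls_add Ltwo_scale_const frac_grad_Cc_inf(3)[OF eta])

text \<open>Demodulating the gradients of the sine and cosine oscillations yields fields that converge
  strongly to a constant direction times \<open>\<eta>\<close>.\<close>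

lemma oscillating_profile:
  assumes \<xi>: "\<xi> \<in> directions"
  shows "\<exists>P N B. (\<forall>k. R (P k) (N k)) \<and> P \<longlonglongrightarrow> profile \<xi> \<and> (\<forall>k. norm (N k) \<le> B) \<and>
     (\<forall>\<phi>\<in>Cc_inf Om. (\<lambda>k. mul \<phi> (N k) \<bullet> profile \<xi>) \<longlonglongrightarrow> 0)"
proof -
  obtain w eS eC where w: "w > 0"
    and S: "\<And>k. cls (frac_grad s (osc_sin \<eta> \<xi> k)) = w *\<^sub>R mul (\<lambda>x. cos ((real (Suc k) *\<^sub>R \<xi>) \<bullet> x)) (profile \<xi>) + eS k"
    and C: "\<And>k. cls (frac_grad s (osc_cos \<eta> \<xi> k)) = - w *\<^sub>R mul (\<lambda>x. sin ((real (Suc k) *\<^sub>R \<xi>) \<bullet> x)) (profile \<xi>) + eC k"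
    and e: "eS \<longlonglongrightarrow> 0" "eC \<longlonglongrightarrow> 0"
    and n: "(\<lambda>k. norm (cls (osc_sin \<eta> \<xi> k))) \<longlonglongrightarrow> 0" "(\<lambda>k. norm (cls (osc_cos \<eta> \<xi> k))) \<longlonglongrightarrow> 0"
    and t: "\<And>k. osc_sin \<eta> \<xi> k \<in> Cc_inf Om" "\<And>k. osc_cos \<eta> \<xi> k \<in> Cc_inf Om"
    using oscillation_limits[OF eta \<xi>] unfolding profile_def by metis
  define E where "E = profile \<xi>"
  define SS where "SS = (\<lambda>k. cls (frac_grad s (osc_sin \<eta> \<xi> k)))"
  define CC where "CC = (\<lambda>k. cls (frac_grad s (osc_cos \<eta> \<xi> k)))"
  define co where "co = (\<lambda>k x. cos ((real (Suc k) *\<^sub>R \<xi>) \<bullet> x))"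
  define si where "si = (\<lambda>k x. sin ((real (Suc k) *\<^sub>R \<xi>) \<bullet> x))"
  have mc: "multiplier (co k)" and ms: "multiplier (si k)" for k unfolding co_def si_def by (rule multiplier_cos multiplier_sin)+
  note bc = multiplier_bounded[OF mc] and bs = multiplier_bounded[OF ms]
  have nc: "norm (mul (co k) X) \<le> norm X" and ns: "norm (mul (si k) X) \<le> norm X" for k and X :: "(real ^ 'n, real ^ 'n) L2"
    using mul_norm_le[OF bc, of k 1 X] mul_norm_le[OF bs, of k 1 X] by (simp_all add: co_def si_def)
  have S': "SS k = w *\<^sub>R mul (co k) E + eS k" and C': "CC k = - w *\<^sub>R mul (si k) E + eC k" for k
    using S C by (simp_all add: SS_def CC_def E_def co_def si_def)
  have "osc_sin \<eta> \<xi> k \<in> oscillations \<eta>" "osc_cos \<eta> \<xi> k \<in> oscillations \<eta>" for k using \<xi> by (auto simp: oscillations_def)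
  hence "\<forall>k. \<exists>D. R (SS k) D \<and> (\<forall>V \<in> snd ` grad_graph Om. D \<bullet> V = 0) \<and> norm D \<le> Lam * norm (SS k)"
    "\<forall>k. \<exists>D. R (CC k) D \<and> (\<forall>V \<in> snd ` grad_graph Om. D \<bullet> V = 0) \<and> norm D \<le> Lam * norm (CC k)"
    using R_osc unfolding SS_def CC_def by blast+
  then obtain DS DC where DS: "\<And>k. R (SS k) (DS k)" "\<And>k V. V \<in> snd ` grad_graph Om \<Longrightarrow> DS k \<bullet> V = 0" "\<And>k. norm (DS k) \<le> Lam * norm (SS k)"
    and DC: "\<And>k. R (CC k) (DC k)" "\<And>k V. V \<in> snd ` grad_graph Om \<Longrightarrow> DC k \<bullet> V = 0" "\<And>k. norm (DC k) \<le> Lam * norm (CC k)" by metis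
  have "\<exists>B. \<forall>k. norm (DS k) \<le> B \<and> norm (DC k) \<le> B"
  proof -
    obtain b where b: "\<And>k. norm (eS k) \<le> b" using convergent_imp_bounded[OF e(1)] by (auto simp: bounded_iff)
    obtain b' where b': "\<And>k. norm (eC k) \<le> b'" using convergent_imp_bounded[OF e(2)] by (auto simp: bounded_iff)
    have "norm (SS k) \<le> w * norm E + (\<bar>b\<bar> + \<bar>b'\<bar>)" "norm (CC k) \<le> w * norm E + (\<bar>b\<bar> + \<bar>b'\<bar>)" for k
    proof -
      have "norm (w *\<^sub>R mul (co k) E) \<le> w * norm E" "norm (- w *\<^sub>R mul (si k) E) \<le> w * norm E" using nc ns w by (simp_all add: mult_left_mono)
      thus "norm (SS k) \<le> w * norm E + (\<bar>b\<bar> + \<bar>b'\<bar>)" "norm (CC k) \<le> w * norm E + (\<bar>b\<bar> + \<bar>b'\<bar>)"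
        unfolding S' C' using b[of k] b'[of k] by (intro norm_triangle_le; linarith)+
    qed
    hence "Lam * norm (SS k) \<le> \<bar>Lam\<bar> * (w * norm E + (\<bar>b\<bar> + \<bar>b'\<bar>))" "Lam * norm (CC k) \<le> \<bar>Lam\<bar> * (w * norm E + (\<bar>b\<bar> + \<bar>b'\<bar>))" for k
      by (intro mult_mono; simp)+
    thus ?thesis using DS(3) DC(3) order_trans by blast
  qed
  then obtain B where B: "\<And>k. norm (DS k) \<le> B" "\<And>k. norm (DC k) \<le> B" by blast
  \<comment> \<open>\<open>CC\<close> carries the factor minus sine, so the difference is
    \<open>w\<close> times \<open>cos^2 + sin^2\<close> applied to \<open>E\<close>, up to terms
    that tend to 0.\<close>
  define P where "P = (\<lambda>k. (1 / w) *\<^sub>R (mul (co k) (SS k) - mul (si k) (CC k)))"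
  define N where "N = (\<lambda>k. (1 / w) *\<^sub>R (mul (co k) (DS k) - mul (si k) (DC k)))"
  have "R (P k) (N k)" for k unfolding P_def N_def by (intro R_scaleR R_diff R_mul mc ms DS DC)
  moreover have "P \<longlonglongrightarrow> E"
  proof -
    have Peq: "P k = E + (1 / w) *\<^sub>R (mul (co k) (eS k) - mul (si k) (eC k))" for k
    proof -
      have "mul (co k) (mul (co k) E) + mul (si k) (mul (si k) E) = mul (\<lambda>x. co k x * co k x + si k x * si k x) E"
        by (simp only: mul_mul(1)[OF bc bc] mul_mul(1)[OF bs bs] mul_add_left[OF mul_mul(2)[OF bc bc] mul_mul(2)[OF bs bs]])
      also have "(\<lambda>x. co k x * co k x + si k x * si k x) = (\<lambda>x. 1)" by (simp add: co_def si_def flip: power2_eq_square)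
      finally have one: "mul (co k) (mul (co k) E) + mul (si k) (mul (si k) E) = E" by (simp add: mul_const)
      have "mul (co k) (SS k) - mul (si k) (CC k)
          = w *\<^sub>R (mul (co k) (mul (co k) E) + mul (si k) (mul (si k) E)) + (mul (co k) (eS k) - mul (si k) (eC k))"
        unfolding S' C' mul_add[OF bc] mul_add[OF bs] mul_scaleR[OF bc] mul_scaleR[OF bs] by (simp add: scaleR_add_right)
      thus ?thesis using w unfolding one P_def by (simp add: scaleR_add_right)
    qed
    have "(\<lambda>k. mul (co k) (eS k)) \<longlonglongrightarrow> 0"
      by (rule LIMSEQ_zero_bound[OF nc tendsto_norm_zero[OF e(1)]])
    moreover have "(\<lambda>k. mul (si k) (eC k)) \<longlonglongrightarrow> 0"
      by (rule LIMSEQ_zero_bound[OF ns tendsto_norm_zero[OF e(2)]])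
    ultimately have "(\<lambda>k. E + (1 / w) *\<^sub>R (mul (co k) (eS k) - mul (si k) (eC k))) \<longlonglongrightarrow> E + (1 / w) *\<^sub>R (0 - 0)" by (intro tendsto_intros)
    thus ?thesis by (simp add: ext[of P, OF Peq])
  qed
  moreover have "norm (N k) \<le> 1 / w * (B + B)" for k
  proof -
    have "norm (mul (co k) (DS k) - mul (si k) (DC k)) \<le> B + B"
      using norm_triangle_ineq4[of "mul (co k) (DS k)" "mul (si k) (DC k)"] nc[of k "DS k"] ns[of k "DC k"] B[of k] by linarith
    thus ?thesis using w by (simp add: N_def divide_right_mono)
  qed
  moreover have "(\<lambda>k. mul \<phi> (N k) \<bullet> E) \<longlonglongrightarrow> 0" if \<phi>: "\<phi> \<in> Cc_inf Om" for \<phi>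
  proof -
    have p: "multiplier \<phi>" by (rule multiplier_Cc_inf[OF \<phi>])
    note bp = multiplier_bounded[OF p]
    obtain b where b: "\<And>x. \<bar>\<phi> x\<bar> \<le> b" using bp by (auto simp: bounded_multiplier_def)
    have nb: "norm (mul \<phi> (DS k)) \<le> b * B" "norm (mul \<phi> (DC k)) \<le> b * B" for k
      using mul_norm_le[OF bp b] mult_left_mono[OF B(1)[of k]] mult_left_mono[OF B(2)[of k]] order_trans[OF abs_ge_zero b] by (meson order_trans)+
    \<comment> \<open>Cosine and sine are moved onto \<open>E\<close>, and the modulated profiles
      are replaced by the gradients \<open>SS\<close> and \<open>CC\<close> minus their errors. The
      form at the profile thereby becomes a sum of defect pairings of gradients, to which
      \<open>defect_energy_tendsto_zero\<close> applies.\<close>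
    have "mul \<phi> (N k) \<bullet> E = 1 / w * (1 / w) * (mul \<phi> (DS k) \<bullet> SS k + mul \<phi> (DC k) \<bullet> CC k - mul \<phi> (DS k) \<bullet> eS k - mul \<phi> (DC k) \<bullet> eC k)" for k
    proof -
      have "mul \<phi> (mul (co k) (DS k)) \<bullet> E = mul \<phi> (DS k) \<bullet> mul (co k) E" "mul \<phi> (mul (si k) (DC k)) \<bullet> E = mul \<phi> (DC k) \<bullet> mul (si k) E"
        by (simp_all only: mul_commute[OF bp bc] mul_commute[OF bp bs] mul_inner[OF bc] mul_inner[OF bs])
      hence "w * (w * (mul \<phi> (N k) \<bullet> E)) = w * (mul \<phi> (DS k) \<bullet> mul (co k) E) - w * (mul \<phi> (DC k) \<bullet> mul (si k) E)"
        using w by (simp add: N_def mul_scaleR[OF bp] linear_diff[OF bounded_linear.linear[OF bounded_linear_mul[OF bp]]] inner_diff_left right_diff_distrib)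
      also have "\<dots> = mul \<phi> (DS k) \<bullet> SS k + mul \<phi> (DC k) \<bullet> CC k - mul \<phi> (DS k) \<bullet> eS k - mul \<phi> (DC k) \<bullet> eC k"
        by (simp add: S' C' inner_add_right inner_diff_right)
      finally show ?thesis using w by (simp add: field_simps)
    qed
    moreover have "(\<lambda>k. 1 / w * (1 / w) * (mul \<phi> (DS k) \<bullet> SS k + mul \<phi> (DC k) \<bullet> CC k - mul \<phi> (DS k) \<bullet> eS k - mul \<phi> (DC k) \<bullet> eC k))
        \<longlonglongrightarrow> 1 / w * (1 / w) * (0 + 0 - 0 - 0)"
      unfolding SS_def CC_def
      by (intro tendsto_mult_left tendsto_add tendsto_diff defect_energy_tendsto_zero[OF t(1) n(1) DS(2) B(1) p]
          defect_energy_tendsto_zero[OF t(2) n(2) DC(2) B(2) p] inner_tendsto_zero[OF nb(1) e(1)] inner_tendsto_zero[OF nb(2) e(2)])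
    ultimately show ?thesis by simp
  qed
  ultimately show ?thesis unfolding E_def by blast
qed

text \<open>The symmetric form vanishes on \<open>axis i 1\<close> and on \<open>axis i 1 + axis j 1\<close>, hence everywhere by polarisation.\<close>

lemma axis_profiles:
  obtains P N B where "\<And>j k. R (P j k) (N j k)" "\<And>j. P j \<longlonglongrightarrow> profile (axis j 1)" "\<And>j k. norm (N j k) \<le> B j"
    "\<And>i j \<phi>. \<phi> \<in> Cc_inf Om \<Longrightarrow> (\<lambda>k. mul \<phi> (N j k) \<bullet> profile (axis i 1)) \<longlonglongrightarrow> 0"
proof -
  have "\<forall>\<xi>. \<exists>P N B. \<xi> \<in> directions \<longrightarrow> (\<forall>k. R (P k) (N k)) \<and> P \<longlonglongrightarrow> profile \<xi> \<and> (\<forall>k. norm (N k) \<le> B) \<and>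
     (\<forall>\<phi>\<in>Cc_inf Om. (\<lambda>k. mul \<phi> (N k) \<bullet> profile \<xi>) \<longlonglongrightarrow> 0)"
    using oscillating_profile by blast
  then obtain P N B where PN: "\<And>\<xi>. \<xi> \<in> directions \<Longrightarrow> (\<forall>k. R (P \<xi> k) (N \<xi> k)) \<and> P \<xi> \<longlonglongrightarrow> profile \<xi> \<and> (\<forall>k. norm (N \<xi> k) \<le> B \<xi>) \<and>
     (\<forall>\<phi>\<in>Cc_inf Om. (\<lambda>k. mul \<phi> (N \<xi> k) \<bullet> profile \<xi>) \<longlonglongrightarrow> 0)" by metis
  have ax: "axis i 1 \<in> directions" for i by (auto simp: directions_def)
  have lim: "(\<lambda>k. mul \<phi> (N (axis j 1) k) \<bullet> profile (axis i 1)) \<longlonglongrightarrow> 0" if \<phi>: "\<phi> \<in> Cc_inf Om" for i j \<phi>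
  proof (cases "i = j")
    case True thus ?thesis using PN[OF ax[of j]] \<phi> by blast
  next
    case False
    define a b :: "real^'n" where "a = axis i 1" and "b = axis j 1"
    have d: "a \<in> directions" "b \<in> directions" "a + b \<in> directions" using False unfolding a_def b_def directions_def by blast+
    note A = PN[OF d(1)] and B' = PN[OF d(2)] and AB = PN[OF d(3)]
    have bp: "bounded_multiplier \<phi>" by (rule multiplier_bounded[OF multiplier_Cc_inf[OF \<phi>]])
    interpret m: bounded_linear "mul \<phi> :: (real^'n, real^'n) L2 \<Rightarrow> _" by (rule bounded_linear_mul[OF bp])
    \<comment> \<open>The three defects were chosen independently, so they need not add up. But
      \<open>Q\<close> is related to \<open>O'\<close> and tends to 0, and the local Lipschitz bound
      \<open>R_lip\<close> forces \<open>mul \<phi> (O' k)\<close> to 0: additivity holds in the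
      limit.\<close>
    define Q where "Q = (\<lambda>k. P (a + b) k - P a k - P b k)"
    define O' where "O' = (\<lambda>k. N (a + b) k - N a k - N b k)"
    have RQ: "R (Q k) (O' k)" for k unfolding Q_def O'_def using A B' AB by (intro R_diff) auto
    have "Q \<longlonglongrightarrow> profile (a + b) - profile a - profile b" unfolding Q_def using A B' AB by (intro tendsto_diff) auto
    hence "(\<lambda>k. mul \<phi> (Q k)) \<longlonglongrightarrow> mul \<phi> 0" by (intro m.tendsto) (simp add: profile_add)
    hence "(\<lambda>k. Lam * norm (mul \<phi> (Q k))) \<longlonglongrightarrow> 0" by (simp add: m.zero tendsto_mult_right_zero tendsto_norm_zero)
    hence O0: "(\<lambda>k. mul \<phi> (O' k)) \<longlonglongrightarrow> 0" using R_lip[OF \<phi> RQ] by (rule LIMSEQ_zero_bound[rotated])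
    have s1: "(\<lambda>k. mul \<phi> (O' k) \<bullet> profile (a + b)) \<longlonglongrightarrow> 0" using tendsto_inner[OF O0 tendsto_const] by simp
    have s2: "(\<lambda>k. mul \<phi> (N (a + b) k) \<bullet> profile (a + b)) \<longlonglongrightarrow> 0" "(\<lambda>k. mul \<phi> (N a k) \<bullet> profile a) \<longlonglongrightarrow> 0" "(\<lambda>k. mul \<phi> (N b k) \<bullet> profile b) \<longlonglongrightarrow> 0"
      using A B' AB \<phi> by blast+
    have "(\<lambda>k. mul \<phi> (N (a + b) k) \<bullet> profile (a + b) - mul \<phi> (O' k) \<bullet> profile (a + b) - mul \<phi> (N a k) \<bullet> profile a - mul \<phi> (N b k) \<bullet> profile b)
        \<longlonglongrightarrow> 0 - 0 - 0 - 0" by (intro tendsto_diff s1 s2)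
    moreover have "mul \<phi> (N (a + b) k) \<bullet> profile (a + b) - mul \<phi> (O' k) \<bullet> profile (a + b) - mul \<phi> (N a k) \<bullet> profile a - mul \<phi> (N b k) \<bullet> profile b
        = mul \<phi> (N a k) \<bullet> profile b + mul \<phi> (N b k) \<bullet> profile a" for k
      by (simp add: O'_def m.diff inner_diff_left profile_add inner_add_right)
    ultimately have sum0: "(\<lambda>k. mul \<phi> (N a k) \<bullet> profile b + mul \<phi> (N b k) \<bullet> profile a) \<longlonglongrightarrow> 0" by simp
    obtain c where c: "\<And>x. \<bar>\<phi> x\<bar> \<le> c" using bp by (auto simp: bounded_multiplier_def)
    have c0: "c \<ge> 0" using order_trans[OF abs_ge_zero c] .
    have nb: "norm (mul \<phi> (N a k)) \<le> c * B a" "norm (mul \<phi> (N b k)) \<le> c * B b" for k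
      using A B' c0 by (auto intro!: order_trans[OF mul_norm_le[OF bp c]] mult_left_mono)
    have p: "(\<lambda>k. P a k - profile a) \<longlonglongrightarrow> 0" "(\<lambda>k. P b k - profile b) \<longlonglongrightarrow> 0" using A B' LIM_zero by blast+
    have "(\<lambda>k. mul \<phi> (N b k) \<bullet> (P a k - profile a) - mul \<phi> (N a k) \<bullet> (P b k - profile b)) \<longlonglongrightarrow> 0 - 0"
      by (intro tendsto_diff inner_tendsto_zero[OF nb(2) p(1)] inner_tendsto_zero[OF nb(1) p(2)])
    \<comment> \<open>Symmetry of the form. As \<open>P\<close> converges strongly, it shows that
      the two mixed terms have difference tending to 0, while \<open>sum0\<close> treats their
      sum.\<close>
    moreover have "mul \<phi> (N b k) \<bullet> P a k = mul \<phi> (N a k) \<bullet> P b k" for k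
      using R_sym[OF \<phi>, of "P a k" "N a k" "P b k" "N b k"] A B' mul_inner[OF bp, of "N b k" "P a k"]
      by (simp add: inner_commute)
    ultimately have dif0: "(\<lambda>k. mul \<phi> (N a k) \<bullet> profile b - mul \<phi> (N b k) \<bullet> profile a) \<longlonglongrightarrow> 0"
      by (simp add: inner_diff_right)
    have "(\<lambda>k. ((mul \<phi> (N a k) \<bullet> profile b + mul \<phi> (N b k) \<bullet> profile a) - (mul \<phi> (N a k) \<bullet> profile b - mul \<phi> (N b k) \<bullet> profile a)) / 2) \<longlonglongrightarrow> (0 - 0) / 2"
      by (intro tendsto_divide tendsto_diff sum0 dif0 tendsto_const) simp
    thus ?thesis by (simp add: a_def b_def)
  qed
  show ?thesis
    by (rule that[of "\<lambda>j. P (axis j 1)" "\<lambda>j. N (axis j 1)" "\<lambda>j. B (axis j 1)"]) (use PN[OF ax] lim in auto)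
qed

text \<open>By symmetry, pairing \<open>D\<close> with the fields \<open>P\<close> equals pairing
  their defects \<open>N\<close> with \<open>U\<close>. The \<open>P\<close> converge strongly to
  axis profiles and \<open>mul \<eta> (N j k)\<close> weakly to 0, so the square of
  \<open>\<eta>\<close> times \<open>D\<close> is orthogonal to all test fields; a zero of
  \<open>\<eta>\<^sup>2 d\<close> is a zero of \<open>\<eta> d\<close>.\<close>

lemma defect_eq_zero:
  assumes U: "R U D" shows "mul \<eta> D = 0"
proof -
  obtain P N B where PN: "\<And>j k. R (P j k) (N j k)" "\<And>j. P j \<longlonglongrightarrow> profile (axis j 1)" "\<And>j k. norm (N j k) \<le> B j"
    and lim: "\<And>i j \<phi>. \<phi> \<in> Cc_inf Om \<Longrightarrow> (\<lambda>k. mul \<phi> (N j k) \<bullet> profile (axis i 1)) \<longlonglongrightarrow> 0"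
    using axis_profiles by blast
  note e2 = frac_grad_Cc_inf(3)[OF eta]
  have be: "bounded_multiplier \<eta>" by (rule multiplier_bounded[OF multiplier_Cc_inf[OF eta]])
  obtain c where c: "\<And>x. \<bar>\<eta> x\<bar> \<le> c" using be by (auto simp: bounded_multiplier_def)
  have c0: "c \<ge> 0" using order_trans[OF abs_ge_zero c] .
  have weak: "(\<lambda>k. mul \<eta> (N j k) \<bullet> X) \<longlonglongrightarrow> 0" for j X
  proof -
    define Z where "Z = {g. (\<lambda>k. mul \<eta> (N j k) \<bullet> g) \<longlonglongrightarrow> 0}"
    have "norm (mul \<eta> (N j k)) \<le> c * B j" for k using PN(3)[of j k] c0 by (intro order_trans[OF mul_norm_le[OF be c]] mult_left_mono)
    note Z = weak_null_subspace[of "\<lambda>k. mul \<eta> (N j k)", OF this, folded Z_def]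
    \<comment> \<open>All test fields in \<open>Om\<close> lie in \<open>Z\<close>, so the remainder
      \<open>X - p\<close> vanishes on \<open>Om\<close> and \<open>\<eta>\<close> annihilates it.
      It is then itself in \<open>Z\<close>, hence 0.\<close>
    obtain p where p: "p \<in> Z" "\<And>v. v \<in> Z \<Longrightarrow> (X - p) \<bullet> v = 0" using closed_subspace_projection[OF Z] by blast
    obtain q where q: "q \<in> Ltwo" "X - p = cls q" using cls_cases by metis
    have "AE x in lebesgue. x \<in> Om \<longrightarrow> q x \<bullet> axis i 1 = 0" for i
    proof (rule Cc_inf_orthogonal_imp_zero[OF Ltwo_inner_const[OF q(1)] open_Om])
      fix \<phi> :: "real^'n \<Rightarrow> real" assume \<phi>: "\<phi> \<in> Cc_inf Om"
      note bp = multiplier_bounded[OF multiplier_Cc_inf[OF \<phi>]] and p2 = frac_grad_Cc_inf(3)[OF \<phi>]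
      have sw: "mul \<eta> (cls (\<lambda>x. \<phi> x *\<^sub>R axis i 1)) = mul \<phi> (profile (axis i 1))"
        unfolding profile_def mul_cls[OF be Ltwo_scale_const[OF p2]] mul_cls[OF bp Ltwo_scale_const[OF e2]] by (simp add: mult.commute)
      have "mul \<eta> (N j k) \<bullet> cls (\<lambda>x. \<phi> x *\<^sub>R axis i 1) = mul \<phi> (N j k) \<bullet> profile (axis i 1)" for k
        by (simp only: mul_inner[OF be] mul_inner[OF bp] sw)
      hence "cls (\<lambda>x. \<phi> x *\<^sub>R axis i 1) \<in> Z" using lim[OF \<phi>, of j i] by (simp add: Z_def)
      hence "cls q \<bullet> cls (\<lambda>x. \<phi> x *\<^sub>R axis i 1) = 0" using p(2) q(2) by simp
      thus "(LINT x|lebesgue. \<phi> x * (q x \<bullet> axis i 1)) = 0" by (simp add: inner_cls[OF q(1) Ltwo_scale_const[OF p2]])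
    qed
    hence "AE x in lebesgue. x \<in> Om \<longrightarrow> q x = 0" by (rule vector_zero_of_components)
    hence "AE x in lebesgue. \<eta> x *\<^sub>R q x = 0"
      by eventually_elim (use Cc_inf_D[OF eta] in \<open>metis scaleR_eq_0_iff subsetD\<close>)
    hence "mul \<eta> (X - p) = 0"
      unfolding q(2) mul_cls[OF be q(1)] cls_zero[symmetric] by (intro cls_eqI bounded_multiplier_Ltwo[OF be q(1)] Ltwo_zero)
    hence "X - p \<in> Z" by (simp add: Z_def mul_inner[OF be])
    hence "X - p = 0" using p(2)[of "X - p"] by simp
    thus ?thesis using p(1) by (simp add: Z_def)
  qed
  obtain d where d: "d \<in> Ltwo" "D = cls d" using cls_cases by metis
  have "AE x in lebesgue. x \<in> Om \<longrightarrow> (\<eta> x *\<^sub>R (\<eta> x *\<^sub>R d x)) \<bullet> axis j 1 = 0" for j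
  proof (rule Cc_inf_orthogonal_imp_zero[OF Ltwo_inner_const[OF bounded_multiplier_Ltwo[OF be bounded_multiplier_Ltwo[OF be d(1)]]] open_Om])
    fix \<phi> :: "real^'n \<Rightarrow> real" assume \<phi>: "\<phi> \<in> Cc_inf Om"
    note bp = multiplier_bounded[OF multiplier_Cc_inf[OF \<phi>]] and p2 = frac_grad_Cc_inf(3)[OF \<phi>]
    have pe: "(\<lambda>x. \<phi> x * \<eta> x) \<in> Cc_inf Om" by (rule multiplier_mult_Cc_inf[OF multiplier_Cc_inf[OF \<phi>] eta])
    have bpe: "bounded_multiplier (\<lambda>x. \<phi> x * \<eta> x)" by (rule multiplier_bounded[OF multiplier_Cc_inf[OF pe]])
    have "(\<lambda>k. mul (\<lambda>x. \<phi> x * \<eta> x) D \<bullet> P j k) \<longlonglongrightarrow> mul (\<lambda>x. \<phi> x * \<eta> x) D \<bullet> profile (axis j 1)"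
      by (intro tendsto_inner tendsto_const PN(2))
    moreover have "mul (\<lambda>x. \<phi> x * \<eta> x) D \<bullet> P j k = mul \<eta> (N j k) \<bullet> mul \<phi> U" for k
      using R_sym[OF pe U PN(1)[of j k]] mul_inner[OF be, of "N j k" "mul \<phi> U"]
      by (simp add: mul_mul(1)[OF bp be, symmetric] mul_commute[OF bp be] inner_commute)
    ultimately have "mul (\<lambda>x. \<phi> x * \<eta> x) D \<bullet> profile (axis j 1) = 0" using weak[of j "mul \<phi> U"] LIMSEQ_unique by simp
    thus "(LINT x|lebesgue. \<phi> x * ((\<eta> x *\<^sub>R (\<eta> x *\<^sub>R d x)) \<bullet> axis j 1)) = 0"
      unfolding d(2) profile_def mul_cls[OF bpe d(1)] inner_cls[OF bounded_multiplier_Ltwo[OF bpe d(1)] Ltwo_scale_const[OF e2]]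
      by (simp add: mult_ac)
  qed
  hence "AE x in lebesgue. x \<in> Om \<longrightarrow> \<eta> x *\<^sub>R (\<eta> x *\<^sub>R d x) = 0" by (rule vector_zero_of_components)
  hence "AE x in lebesgue. \<eta> x *\<^sub>R d x = 0"
    by eventually_elim (use Cc_inf_D[OF eta] in \<open>metis scaleR_eq_0_iff subsetD\<close>)
  thus ?thesis
    unfolding d(2) mul_cls[OF be d(1)] cls_zero[symmetric] by (intro cls_eqI bounded_multiplier_Ltwo[OF be d(1)] Ltwo_zero)
qed

end

section \<open>Convergence of the fluxes\<close>

text \<open>Positivity at \<open>X - (1 / L) *\<^sub>R A X\<close>. For symmetric operators this
  recovers, from the norm bound in \<open>elliptic\<close>, the second inequality of the matrix
  class, which is the form that survives weak limits.\<close>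

lemma elliptic_norm_sq_le:
  assumes A: "elliptic l L A" and l: "l > 0" and L: "L > 0"
  shows "(norm (A X))\<^sup>2 \<le> L * (A X \<bullet> X)"
proof -
  interpret bounded_linear A by (rule elliptic_linear[OF A])
  define Y where "Y = X - (1 / L) *\<^sub>R A X"
  have "0 \<le> l * (norm Y)\<^sup>2" using l by simp
  also have "\<dots> \<le> A Y \<bullet> Y" by (rule elliptic_lower[OF A])
  also have "A Y \<bullet> Y = A X \<bullet> X - 2 / L * (A X \<bullet> A X) + (1 / L)\<^sup>2 * (A (A X) \<bullet> A X)"
    using elliptic_sym[OF A, of "A X" X]
    by (simp add: Y_def diff scaleR inner_diff_left inner_diff_right power2_eq_square algebra_simps)
  also have "A (A X) \<bullet> A X \<le> L * (A X \<bullet> A X)"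
    using norm_cauchy_schwarz[of "A (A X)" "A X"] mult_right_mono[OF elliptic_upper[OF A, of "A X"], of "norm (A X)"]
    by (simp add: dot_square_norm power2_eq_square)
  hence "(1 / L)\<^sup>2 * (A (A X) \<bullet> A X) \<le> (1 / L)\<^sup>2 * (L * (A X \<bullet> A X))" by (intro mult_left_mono) auto
  hence "A X \<bullet> X - 2 / L * (A X \<bullet> A X) + (1 / L)\<^sup>2 * (A (A X) \<bullet> A X) \<le> A X \<bullet> X - (A X \<bullet> A X) / L"
    using L by (simp add: power2_eq_square)
  finally show ?thesis using L by (simp add: power2_norm_eq_inner field_simps)
qed

lemma weak_limit_norm_le:
  assumes "weakly x y" "\<And>h. norm (x h) \<le> B" shows "norm y \<le> B"
proof -
  have "y \<bullet> y \<le> B * norm y"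
  proof (rule LIMSEQ_le_const2[OF weaklyD[OF assms(1), of y]])
    have "x h \<bullet> y \<le> B * norm y" for h
      using norm_cauchy_schwarz[of "x h" y] mult_right_mono[OF assms(2)[of h] norm_ge_zero[of y]] by linarith
    thus "\<exists>N. \<forall>n\<ge>N. x n \<bullet> y \<le> B * norm y" by blast
  qed
  moreover have "B \<ge> 0" using order_trans[OF norm_ge_zero assms(2)[of 0]] .
  ultimately show ?thesis by (cases "y = 0") (auto simp: dot_square_norm power2_eq_square)
qed

section \<open>Resolvent sequences and subsequences\<close>

context energy_graph
begin

definition resolvent_sequence :: "(nat \<Rightarrow> 'h \<Rightarrow> 'h) \<Rightarrow> ('h \<Rightarrow> 'h) \<Rightarrow> (nat \<Rightarrow> 'h) \<Rightarrow> 'h \<Rightarrow> bool" where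
  "resolvent_sequence A Ainf W U \<longleftrightarrow> U \<in> K \<and> (\<forall>h. W h \<in> K \<and> (\<forall>V\<in>K. A h (W h) \<bullet> V = Ainf U \<bullet> V))"

lemma resolvents_convergeD: "resolvents_converge A Ainf \<Longrightarrow> resolvent_sequence A Ainf W U \<Longrightarrow> weakly W U"
  by (simp add: resolvents_converge_def resolvent_sequence_def)

text \<open>The hypothesis concerns full sequences, so the gaps of the subsequence are filled with
  genuine resolvents.\<close>

lemma resolvents_converge_subseq:
  assumes A: "\<And>h. elliptic l L (A h)" and B: "elliptic l L B" and l: "l > 0"
    and R: "resolvents_converge A B" and r: "strict_mono (r :: nat \<Rightarrow> nat)"
  shows "resolvents_converge (\<lambda>h. A (r h)) B"
  unfolding resolvents_converge_def
proof (intro ballI allI impI)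
  fix U W assume U: "U \<in> K" and W: "\<forall>h. W h \<in> K \<and> (\<forall>V\<in>K. A (r h) (W h) \<bullet> V = B U \<bullet> V)"
  have "\<forall>h. \<exists>Z\<in>K. \<forall>V\<in>K. A h Z \<bullet> V = B U \<bullet> V" using resolvent_exists[OF A B l] by metis
  then obtain Z where Z: "\<And>h. Z h \<in> K" "\<And>h V. V \<in> K \<Longrightarrow> A h (Z h) \<bullet> V = B U \<bullet> V" by metis
  define X where "X = (\<lambda>h. if h \<in> range r then W (inv r h) else Z h)"
  have inj: "inj r" using r by (rule strict_mono_imp_inj_on)
  have Xr: "X (r n) = W n" for n using inj by (simp add: X_def)
  have "X h \<in> K \<and> (\<forall>V\<in>K. A h (X h) \<bullet> V = B U \<bullet> V)" for h
  proof (cases "h \<in> range r")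
    case True
    then obtain n where "h = r n" by blast
    thus ?thesis using W Xr by simp
  qed (use Z in \<open>simp add: X_def\<close>)
  hence "weakly X U" using R U unfolding resolvents_converge_def by blast
  from weakly_subseq[OF this r] show "weakly W U" by (simp add: Xr)
qed

end

context fractional_kernel
begin

text \<open>Gives the sublocale below a term for its constant.\<close>

definition poincare_const :: "(real ^ 'n) set \<Rightarrow> real" where
  "poincare_const U = (SOME C. energy_graph (grad_graph U) C)"

lemma energy_graph_poincare_const: "bounded U \<Longrightarrow> energy_graph (grad_graph U) (poincare_const U)"
  unfolding poincare_const_def by (rule someI_ex) (use energy_graph_grad_graph in blast)

end

section \<open>Flux limits for a sequence of coefficients\<close>

locale coefficient_sequence = fractional_kernel s dimension
  for s :: real and dimension :: "'n::finite itself" +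
  fixes Om :: "(real ^ 'n) set" and l L :: real and A0 Ainf :: "real ^ 'n \<Rightarrow> real ^ 'n ^ 'n"
    and A :: "nat \<Rightarrow> real ^ 'n \<Rightarrow> real ^ 'n ^ 'n"
  assumes l: "0 < l" and L: "0 < L" and bounded_Om: "bounded Om" and open_Om: "open Om"
    and A: "\<And>h. A h \<in> Msym_ext l L Om A0" and Ainf: "Ainf \<in> Msym_ext l L Om A0"

sublocale coefficient_sequence \<subseteq> energy_graph "grad_graph Om" "poincare_const Om"
  by (rule energy_graph_poincare_const[OF bounded_Om])

context coefficient_sequence
begin

definition a :: "nat \<Rightarrow> (real ^ 'n, real ^ 'n) L2 \<Rightarrow> (real ^ 'n, real ^ 'n) L2" where "a h = matop (A h)"
definition b :: "(real ^ 'n, real ^ 'n) L2 \<Rightarrow> (real ^ 'n, real ^ 'n) L2" where "b = matop Ainf"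

lemma A_Msym: "A h \<in> Msym l L UNIV" "Ainf \<in> Msym l L UNIV" using A[of h] Ainf by (auto simp: Msym_ext_def)
lemma A_Mclass: "A h \<in> Mclass l L UNIV" "Ainf \<in> Mclass l L UNIV" using A_Msym(1)[of h] A_Msym(2) by (auto simp: Msym_def)

lemma a_elliptic: "elliptic l L (a h)" and b_elliptic: "elliptic l L b"
  unfolding a_def b_def by (intro matop_elliptic A_Msym L)+

lemma a_mul: "bounded_multiplier \<phi> \<Longrightarrow> a h (mul \<phi> X) = mul \<phi> (a h X)" and b_mul: "bounded_multiplier \<phi> \<Longrightarrow> b (mul \<phi> X) = mul \<phi> (b X)"
  unfolding a_def b_def by (intro matop_mul[OF A_Mclass(1) L] matop_mul[OF A_Mclass(2) L]; assumption)+

lemma a_b_outside: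
  assumes "\<And>x. x \<in> Om \<Longrightarrow> \<theta> x = 0" "bounded_multiplier \<theta>"
  shows "mul \<theta> (a h X) = mul \<theta> (b X)"
proof -
  obtain f where f: "f \<in> Ltwo" "X = cls f" using cls_cases by metis
  have F: "(\<lambda>x. A h x *v f x) \<in> Ltwo" "(\<lambda>x. Ainf x *v f x) \<in> Ltwo" by (intro matop_Ltwo[OF A_Mclass(1) L] matop_Ltwo[OF A_Mclass(2) L] f)+
  have "AE x in lebesgue. x \<notin> Om \<longrightarrow> A h x = A0 x" "AE x in lebesgue. x \<notin> Om \<longrightarrow> Ainf x = A0 x"
    using A[of h] Ainf by (auto simp: Msym_ext_def)
  hence "AE x in lebesgue. \<theta> x *\<^sub>R (A h x *v f x) = \<theta> x *\<^sub>R (Ainf x *v f x)"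
    by eventually_elim (use assms(1) in auto)
  thus ?thesis
    unfolding a_def b_def f(2) matop_cls[OF A_Mclass(1) L f(1)] matop_cls[OF A_Mclass(2) L f(1)] mul_cls[OF assms(2) F(1)] mul_cls[OF assms(2) F(2)]
    by (intro cls_eqI bounded_multiplier_Ltwo[OF assms(2)] F)
qed

text \<open>Fields generated from resolvent sequences, with the weak limits of the fields and of
  their fluxes. The closure under sums and multipliers makes demodulated gradients available, and
  the inductive form lets the div-curl lemma spread from resolvents to all of them. That
  \<open>m\<close> depends only on \<open>U\<close> is not built in.\<close>

inductive flux_limit :: "(nat \<Rightarrow> (real ^ 'n, real ^ 'n) L2) \<Rightarrow> (real ^ 'n, real ^ 'n) L2 \<Rightarrow> (real ^ 'n, real ^ 'n) L2 \<Rightarrow> bool" where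
  resolvent: "resolvent_sequence a b W U \<Longrightarrow> weakly W U \<Longrightarrow> weakly (\<lambda>h. a h (W h)) m \<Longrightarrow> flux_limit W U m"
| add: "flux_limit W U m \<Longrightarrow> flux_limit W' U' m' \<Longrightarrow> flux_limit (\<lambda>h. W h + W' h) (U + U') (m + m')"
| mul: "multiplier \<phi> \<Longrightarrow> flux_limit W U m \<Longrightarrow> flux_limit (\<lambda>h. mul \<phi> (W h)) (mul \<phi> U) (mul \<phi> m)"

lemma resolvent_sequence_bounded:
  assumes "resolvent_sequence a b W U" shows "norm (W h) \<le> L / l * norm U"
  using assms by (intro resolvent_bounded[OF a_elliptic[of h] b_elliptic l]) (auto simp: resolvent_sequence_def)

lemma a_add: "a h (X + Y) = a h X + a h Y"
  by (rule linear_add[OF bounded_linear.linear[OF elliptic_linear[OF a_elliptic]]])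

lemma flux_limit_weakly:
  assumes "flux_limit W U m"
  shows "weakly W U \<and> weakly (\<lambda>h. a h (W h)) m"
  using assms
proof (induction rule: flux_limit.induct)
  case (add W U m W' U' m') thus ?case by (simp add: weakly_add a_add)
next
  case (mul \<phi> W U m)
  note bp = multiplier_bounded[OF mul(1)]
  show ?case using mul(3) by (simp add: a_mul[OF bp] weakly_linear_image[OF bounded_linear_mul[OF bp]])
qed simp

text \<open>For \<open>Z h - Z\<close> the product with \<open>\<phi>\<close> is a gradient up to a commutator that vanishes strongly by
  compactness, and the flux of a resolvent sequence does not change when tested against gradients.\<close>

lemma div_curl_resolvent:
  assumes Y: "resolvent_sequence a b Y Y0" "weakly (\<lambda>h. a h (Y h)) m"
    and Z: "resolvent_sequence a b Z Z0" "weakly Z Z0" and \<phi>: "\<phi> \<in> Cc_inf Om"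
  shows "(\<lambda>h. mul \<phi> (a h (Y h)) \<bullet> Z h) \<longlonglongrightarrow> mul \<phi> m \<bullet> Z0"
proof -
  have p: "multiplier \<phi>" by (rule multiplier_Cc_inf[OF \<phi>])
  note bp = multiplier_bounded[OF p]
  interpret mp: bounded_linear "mul \<phi> :: (real^'n, real^'n) L2 \<Rightarrow> _" by (rule bounded_linear_mul[OF bp])
  obtain C where C: "C \<ge> 0" "\<And>x Y U. (x, Y) \<in> grad_graph U \<Longrightarrow> \<exists>Z. (mul \<phi> x, Z) \<in> grad_graph U \<and> norm (Z - mul \<phi> Y) \<le> C * norm x"
    using grad_graph_mult[OF p] by metis
  have "\<forall>h. \<exists>z. (z, Z h) \<in> grad_graph Om" using Z(1) by (force simp: resolvent_sequence_def K_def)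
  then obtain z where z: "\<And>h. (z h, Z h) \<in> grad_graph Om" by metis
  obtain z0 where z0: "(z0, Z0) \<in> grad_graph Om" using Z(1) by (force simp: resolvent_sequence_def K_def)
  have zlim: "z \<longlonglongrightarrow> z0" by (rule strong_limit[OF z resolvent_sequence_bounded[OF Z(1)] Z(2) z0])
  have "\<forall>h. \<exists>D. (mul \<phi> (z h - z0), D) \<in> grad_graph Om \<and> norm (D - mul \<phi> (Z h - Z0)) \<le> C * norm (z h - z0)"
    using C(2)[OF G_diff[OF z z0]] by blast
  then obtain D where D: "\<And>h. (mul \<phi> (z h - z0), D h) \<in> grad_graph Om" "\<And>h. norm (D h - mul \<phi> (Z h - Z0)) \<le> C * norm (z h - z0)" by metis
  have DK: "D h \<in> K" for h using D(1)[of h] by (force simp: K_def)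
  have "(\<lambda>h. C * norm (z h - z0)) \<longlonglongrightarrow> 0" using LIM_zero[OF zlim] by (intro tendsto_mult_right_zero tendsto_norm_zero)
  hence e: "(\<lambda>h. D h - mul \<phi> (Z h - Z0)) \<longlonglongrightarrow> 0" by (rule LIMSEQ_zero_bound[OF D(2)])
  have "weakly (\<lambda>h. mul \<phi> (Z h - Z0)) (mul \<phi> (Z0 - Z0))"
    by (intro weakly_linear_image[OF bounded_linear_mul[OF bp]] weakly_diff Z(2) tendsto_imp_weakly tendsto_const)
  from weakly_add[OF tendsto_imp_weakly[OF e] this] have Dw: "weakly D 0" by (simp add: mp.zero)
  have nb: "norm (a h (Y h)) \<le> L * (L / l * norm Y0)" for h
    using elliptic_upper[OF a_elliptic, of h "Y h"] mult_left_mono[OF resolvent_sequence_bounded[OF Y(1), of h], of L] L by linarith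
  have "mul \<phi> (a h (Y h)) \<bullet> Z h = b Y0 \<bullet> D h - a h (Y h) \<bullet> (D h - mul \<phi> (Z h - Z0)) + a h (Y h) \<bullet> mul \<phi> Z0" for h
  proof -
    have "a h (Y h) \<bullet> D h = b Y0 \<bullet> D h" using Y(1) DK by (simp add: resolvent_sequence_def)
    thus ?thesis by (simp add: mul_inner[OF bp] inner_diff_right mp.diff)
  qed
  moreover have "(\<lambda>h. b Y0 \<bullet> D h - a h (Y h) \<bullet> (D h - mul \<phi> (Z h - Z0)) + a h (Y h) \<bullet> mul \<phi> Z0) \<longlonglongrightarrow> b Y0 \<bullet> 0 - 0 + m \<bullet> mul \<phi> Z0"
    by (intro tendsto_add tendsto_diff weaklyD'[OF Dw] inner_tendsto_zero[OF nb e] weaklyD[OF Y(2)])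
  ultimately show ?thesis by (simp add: mul_inner[OF bp])
qed

text \<open>Induction on the second field: a multiplier acting on it is absorbed into
  \<open>\<phi>\<close>, which stays a test function.\<close>

lemma div_curl_resolvent_left:
  assumes Y: "resolvent_sequence a b Y Y0" "weakly (\<lambda>h. a h (Y h)) m"
    and Z: "flux_limit Z Z0 m'" and \<phi>: "\<phi> \<in> Cc_inf Om"
  shows "(\<lambda>h. mul \<phi> (a h (Y h)) \<bullet> Z h) \<longlonglongrightarrow> mul \<phi> m \<bullet> Z0"
  using Z \<phi>
proof (induction arbitrary: \<phi> rule: flux_limit.induct)
  case (resolvent W U m')
  show ?case by (rule div_curl_resolvent[OF Y resolvent(1,2,4)])
next
  case (add W U m W' U' m') thus ?case by (simp add: inner_add_right tendsto_add)
next
  case (mul \<psi> W U m')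
  note bp = multiplier_bounded[OF multiplier_Cc_inf[OF mul(4)]] and bq = multiplier_bounded[OF mul(1)]
  have eq: "mul \<phi> X \<bullet> mul \<psi> Z = mul (\<lambda>x. \<psi> x * \<phi> x) X \<bullet> Z" for X Z
    by (simp only: mul_inner[OF bq, symmetric] mul_mul(1)[OF bq bp])
  show ?case unfolding eq by (rule mul(3)[OF multiplier_mult_Cc_inf[OF mul(1,4)]])
qed

text \<open>The same for the first field; its multiplier reaches \<open>\<phi>\<close> because the
  coefficients act pointwise and commute with it.\<close>

lemma div_curl:
  assumes Y: "flux_limit Y Y0 m" and Z: "flux_limit Z Z0 m'" and \<phi>: "\<phi> \<in> Cc_inf Om"
  shows "(\<lambda>h. mul \<phi> (a h (Y h)) \<bullet> Z h) \<longlonglongrightarrow> mul \<phi> m \<bullet> Z0"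
  using Y \<phi>
proof (induction arbitrary: \<phi> rule: flux_limit.induct)
  case (resolvent W U m)
  show ?case by (rule div_curl_resolvent_left[OF resolvent(1,3) Z resolvent(4)])
next
  case (add W U m W' U' m')
  have bp: "bounded_multiplier \<phi>" by (rule multiplier_bounded[OF multiplier_Cc_inf[OF add(5)]])
  show ?case unfolding a_add mul_add[OF bp] inner_add_left by (intro tendsto_add add)
next
  case (mul \<psi> W U m)
  note bp = multiplier_bounded[OF multiplier_Cc_inf[OF mul(4)]] and bq = multiplier_bounded[OF mul(1)]
  show ?case unfolding a_mul[OF bq] mul_commute[OF bp bq] mul_mul(1)[OF bq bp] by (rule mul(3)[OF multiplier_mult_Cc_inf[OF mul(1,4)]])
qed

text \<open>For each \<open>h\<close> both pairings agree, since \<open>a h\<close> is symmetric and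
  commutes with \<open>mul \<phi>\<close>; the div-curl lemma identifies their limits.\<close>

lemma flux_limit_sym:
  assumes Y: "flux_limit Y Y0 m" and Z: "flux_limit Z Z0 m'" and \<phi>: "\<phi> \<in> Cc_inf Om"
  shows "mul \<phi> m \<bullet> Z0 = mul \<phi> Y0 \<bullet> m'"
proof -
  have bp: "bounded_multiplier \<phi>" by (rule multiplier_bounded[OF multiplier_Cc_inf[OF \<phi>]])
  have "mul \<phi> (a h (Z h)) \<bullet> Y h = mul \<phi> (a h (Y h)) \<bullet> Z h" for h
  proof -
    have "mul \<phi> (a h (Z h)) \<bullet> Y h = a h (mul \<phi> (Z h)) \<bullet> Y h" by (simp add: a_mul[OF bp])
    also have "\<dots> = mul \<phi> (Z h) \<bullet> a h (Y h)" by (rule elliptic_sym[OF a_elliptic])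
    also have "\<dots> = mul \<phi> (a h (Y h)) \<bullet> Z h" by (simp add: mul_inner[OF bp] inner_commute)
    finally show ?thesis .
  qed
  hence "mul \<phi> m \<bullet> Z0 = mul \<phi> m' \<bullet> Y0" using LIMSEQ_unique[OF div_curl[OF Y Z \<phi>]] div_curl[OF Z Y \<phi>] by simp
  thus ?thesis using mul_inner[OF bp, of m' Y0] by (simp add: inner_commute)
qed

text \<open>The squared norm of the fluxes is only weakly lower semicontinuous, so it is replaced by
  its linear minorant at \<open>mul \<phi> m\<close>. The energy on the other side converges by the
  div-curl lemma with the test function \<open>\<phi>\<^sup>2\<close>.\<close>

lemma flux_limit_lipschitz:
  assumes Y: "flux_limit Y Y0 m" and \<phi>: "\<phi> \<in> Cc_inf Om"
  shows "norm (mul \<phi> m) \<le> L * norm (mul \<phi> Y0)"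
proof -
  have bp: "bounded_multiplier \<phi>" by (rule multiplier_bounded[OF multiplier_Cc_inf[OF \<phi>]])
  have pp: "(\<lambda>x. \<phi> x * \<phi> x) \<in> Cc_inf Om" by (rule multiplier_mult_Cc_inf[OF multiplier_Cc_inf[OF \<phi>] \<phi>])
  have sq: "mul (\<lambda>x. \<phi> x * \<phi> x) X \<bullet> Z = mul \<phi> X \<bullet> mul \<phi> Z" for X Z
    by (simp only: mul_mul(1)[OF bp bp, symmetric] mul_inner[OF bp])
  have le: "2 * (mul \<phi> (a h (Y h)) \<bullet> mul \<phi> m) - mul \<phi> m \<bullet> mul \<phi> m \<le> L * (mul \<phi> (a h (Y h)) \<bullet> mul \<phi> (Y h))" for h
  proof -
    have "0 \<le> (mul \<phi> (a h (Y h)) - mul \<phi> m) \<bullet> (mul \<phi> (a h (Y h)) - mul \<phi> m)" by simp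
    moreover have "mul \<phi> (a h (Y h)) \<bullet> mul \<phi> (a h (Y h)) \<le> L * (mul \<phi> (a h (Y h)) \<bullet> mul \<phi> (Y h))"
      using elliptic_norm_sq_le[OF a_elliptic l L, of h "mul \<phi> (Y h)"] by (simp add: a_mul[OF bp] power2_norm_eq_inner)
    ultimately show ?thesis by (simp add: inner_diff_left inner_diff_right inner_commute)
  qed
  have w: "weakly (\<lambda>h. mul \<phi> (a h (Y h))) (mul \<phi> m)"
    using flux_limit_weakly[OF Y] by (intro weakly_linear_image[OF bounded_linear_mul[OF bp]]) auto
  have "2 * (mul \<phi> m \<bullet> mul \<phi> m) - mul \<phi> m \<bullet> mul \<phi> m \<le> L * (mul \<phi> m \<bullet> mul \<phi> Y0)"
  proof (rule LIMSEQ_le)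
    show "(\<lambda>h. 2 * (mul \<phi> (a h (Y h)) \<bullet> mul \<phi> m) - mul \<phi> m \<bullet> mul \<phi> m) \<longlonglongrightarrow> 2 * (mul \<phi> m \<bullet> mul \<phi> m) - mul \<phi> m \<bullet> mul \<phi> m"
      by (intro tendsto_diff tendsto_mult_left weaklyD[OF w] tendsto_const)
    show "(\<lambda>h. L * (mul \<phi> (a h (Y h)) \<bullet> mul \<phi> (Y h))) \<longlonglongrightarrow> L * (mul \<phi> m \<bullet> mul \<phi> Y0)"
      using tendsto_mult_left[OF div_curl[OF Y Y pp], of L] by (simp add: sq)
  qed (use le in blast)
  hence "norm (mul \<phi> m) * norm (mul \<phi> m) \<le> L * (mul \<phi> m \<bullet> mul \<phi> Y0)" by (simp add: dot_square_norm power2_eq_square)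
  also have "\<dots> \<le> L * (norm (mul \<phi> m) * norm (mul \<phi> Y0))" using L by (intro mult_left_mono norm_cauchy_schwarz) auto
  finally have "norm (mul \<phi> m) * norm (mul \<phi> m) \<le> norm (mul \<phi> m) * (L * norm (mul \<phi> Y0))" by (simp add: mult_ac)
  thus ?thesis using L by (cases "mul \<phi> m = 0") auto
qed

text \<open>Feeds the flux limits into \<open>flux_relation\<close>, under the assumption that the
  fluxes for all oscillations converge weakly; \<open>flux_limit_inside\<close> secures this by
  passing to a subsequence.\<close>

lemma flux_limit_inside_aux:
  assumes RC: "resolvents_converge a b" and \<eta>: "\<eta> \<in> Cc_inf Om"
    and osc: "\<And>f. f \<in> oscillations \<eta> \<Longrightarrow> \<exists>W m. resolvent_sequence a b W (cls (frac_grad s f)) \<and> weakly (\<lambda>h. a h (W h)) m"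
    and U: "flux_limit W U m"
  shows "mul \<eta> (m - b U) = 0"
proof -
  interpret bl: bounded_linear b by (rule elliptic_linear[OF b_elliptic])
  define R where "R = (\<lambda>Y D. \<exists>W m. flux_limit W Y m \<and> D = m - b Y)"
  \<comment> \<open>One constant for two bounds: \<open>2 * L\<close> for localised defects, and
    \<open>L + L * (L / l)\<close> for those of the oscillations, the latter through the resolvent
    bound.\<close>
  interpret flux_relation s dimension Om \<eta> R "2 * L + L * (L / l)"
  proof
    show "R (Y + Z) (D + E)" if hyp: "R Y D" "R Z E" for Y D Z E
    proof -
      obtain W m where "flux_limit W Y m" "D = m - b Y" using hyp(1) unfolding R_def by blast
      moreover obtain W' m' where "flux_limit W' Z m'" "E = m' - b Z" using hyp(2) unfolding R_def by blast
      ultimately have "flux_limit (\<lambda>h. W h + W' h) (Y + Z) (m + m') \<and> D + E = m + m' - b (Y + Z)"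
        using flux_limit.add by (simp add: bl.add)
      thus ?thesis unfolding R_def by blast
    qed
    show "R (mul \<phi> Y) (mul \<phi> D)" if hyp: "multiplier \<phi>" "R Y D" for \<phi> Y D
    proof -
      note bp = multiplier_bounded[OF hyp(1)]
      obtain W m where "flux_limit W Y m" "D = m - b Y" using hyp unfolding R_def by blast
      hence "flux_limit (\<lambda>h. mul \<phi> (W h)) (mul \<phi> Y) (mul \<phi> m) \<and> mul \<phi> D = mul \<phi> m - b (mul \<phi> Y)"
        using flux_limit.mul[OF hyp(1), of W Y m]
        by (simp add: b_mul[OF bp] linear_diff[OF bounded_linear.linear[OF bounded_linear_mul[OF bp]]])
      thus ?thesis unfolding R_def by blast
    qed
    show "mul \<phi> D \<bullet> Z = mul \<phi> Y \<bullet> E" if \<phi>: "\<phi> \<in> Cc_inf Om" and hyp: "R Y D" "R Z E" for \<phi> Y D Z E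
    proof -
      have bp: "bounded_multiplier \<phi>" by (rule multiplier_bounded[OF multiplier_Cc_inf[OF \<phi>]])
      obtain W m where w: "flux_limit W Y m" "D = m - b Y" using hyp(1) unfolding R_def by blast
      obtain W' m' where w': "flux_limit W' Z m'" "E = m' - b Z" using hyp(2) unfolding R_def by blast
      have "mul \<phi> (b Y) \<bullet> Z = mul \<phi> Y \<bullet> b Z" by (simp only: b_mul[OF bp, symmetric] elliptic_sym[OF b_elliptic])
      thus ?thesis using flux_limit_sym[OF w(1) w'(1) \<phi>]
        by (simp add: w w' linear_diff[OF bounded_linear.linear[OF bounded_linear_mul[OF bp]]] inner_diff_left inner_diff_right)
    qed
    show "norm (mul \<phi> D) \<le> (2 * L + L * (L / l)) * norm (mul \<phi> Y)" if \<phi>: "\<phi> \<in> Cc_inf Om" and hyp: "R Y D" for \<phi> Y D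
    proof -
      have bp: "bounded_multiplier \<phi>" by (rule multiplier_bounded[OF multiplier_Cc_inf[OF \<phi>]])
      obtain W m where w: "flux_limit W Y m" "D = m - b Y" using hyp unfolding R_def by blast
      have "norm (mul \<phi> D) \<le> norm (mul \<phi> m) + norm (b (mul \<phi> Y))"
        by (simp add: w b_mul[OF bp] linear_diff[OF bounded_linear.linear[OF bounded_linear_mul[OF bp]]] norm_triangle_ineq4)
      also have "\<dots> \<le> L * norm (mul \<phi> Y) + L * norm (mul \<phi> Y)"
        by (intro add_mono flux_limit_lipschitz[OF w(1) \<phi>] elliptic_upper[OF b_elliptic])
      also have "\<dots> = (2 * L) * norm (mul \<phi> Y)" by simp
      also have "\<dots> \<le> (2 * L + L * (L / l)) * norm (mul \<phi> Y)" using l L by (intro mult_right_mono) auto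
      finally show ?thesis .
    qed
    fix f assume "f \<in> oscillations \<eta>"
    then obtain W m where w: "resolvent_sequence a b W (cls (frac_grad s f))" "weakly (\<lambda>h. a h (W h)) m" using osc by blast
    define Y where "Y = cls (frac_grad s f)"
    have "weakly W Y" using resolvents_convergeD[OF RC w(1)] unfolding Y_def .
    hence "flux_limit W Y m" using w unfolding Y_def by (intro flux_limit.resolvent)
    hence "R Y (m - b Y)" unfolding R_def by blast
    moreover have "(m - b Y) \<bullet> V = 0" if V: "V \<in> snd ` grad_graph Om" for V
    proof -
      have "a h (W h) \<bullet> V = b Y \<bullet> V" for h using w(1) V by (auto simp: resolvent_sequence_def Y_def K_def)
      hence "m \<bullet> V = b Y \<bullet> V" using LIMSEQ_unique[OF weaklyD[OF w(2), of V]] by simp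
      thus ?thesis by (simp add: inner_diff_left)
    qed
    moreover have "norm (m - b Y) \<le> (2 * L + L * (L / l)) * norm Y"
    proof -
      have "norm (a h (W h)) \<le> L * (L / l * norm Y)" for h
        using elliptic_upper[OF a_elliptic, of h "W h"] mult_left_mono[OF resolvent_sequence_bounded[OF w(1), of h], of L] L unfolding Y_def by linarith
      hence "norm m \<le> L * (L / l * norm Y)" by (rule weak_limit_norm_le[OF w(2)])
      hence "norm (m - b Y) \<le> L * (L / l * norm Y) + L * norm Y"
        using norm_triangle_ineq4[of m "b Y"] elliptic_upper[OF b_elliptic, of Y] by linarith
      also have "\<dots> = (L + L * (L / l)) * norm Y" by (simp add: algebra_simps)
      also have "\<dots> \<le> (2 * L + L * (L / l)) * norm Y" using L by (intro mult_right_mono) auto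
      finally show ?thesis .
    qed
    ultimately show "\<exists>D. R (cls (frac_grad s f)) D \<and> (\<forall>V \<in> snd ` grad_graph Om. D \<bullet> V = 0) \<and>
        norm D \<le> (2 * L + L * (L / l)) * norm (cls (frac_grad s f))" unfolding Y_def by blast
  qed (rule open_Om \<eta>)+
  show ?thesis by (rule defect_eq_zero) (use U in \<open>auto simp: R_def\<close>)
qed

lemma subsequence: "coefficient_sequence s Om l L A0 Ainf (\<lambda>h. A (r h))"
  by unfold_locales (rule l L bounded_Om open_Om A Ainf)+

text \<open>The fluxes for oscillating data are merely bounded. Along one subsequence all of these
  countably many sequences converge weakly, and both the convergence of the resolvents and the given
  limit \<open>m\<close> persist there.\<close>

lemma flux_limit_inside:
  assumes RC: "resolvents_converge a b" and \<eta>: "\<eta> \<in> Cc_inf Om"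
    and W: "resolvent_sequence a b W U" "weakly (\<lambda>h. a h (W h)) m"
  shows "mul \<eta> (m - b U) = 0"
proof -
  have ne: "oscillations \<eta> \<noteq> {}" by (auto simp: oscillations_def directions_def)
  define f where "f = from_nat_into (oscillations \<eta>)"
  have fr: "range f = oscillations \<eta>" unfolding f_def by (rule range_from_nat_into[OF ne countable_oscillations])
  have osc: "osc_cos \<eta> \<xi> k \<in> Cc_inf Om" "osc_sin \<eta> \<xi> k \<in> Cc_inf Om" for \<xi> k
    unfolding osc_cos_def osc_sin_def by (intro Cc_inf_scale multiplier_mult_Cc_inf multiplier_cos multiplier_sin \<eta>)+
  have test: "f i \<in> Cc_inf Om" for i
  proof -
    have "f i \<in> oscillations \<eta>" using fr by blast
    thus ?thesis
      using osc unfolding oscillations_def by auto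
  qed
  have inK: "cls (frac_grad s (f i)) \<in> K" for i
  proof -
    have "(cls (f i), cls (frac_grad s (f i))) \<in> grad_graph Om" by (rule grad_graph_I[of "\<lambda>_. f i"]) (use test in auto)
    thus ?thesis by (force simp: K_def)
  qed
  have "\<forall>i h. \<exists>X\<in>K. \<forall>V\<in>K. a h X \<bullet> V = b (cls (frac_grad s (f i))) \<bullet> V"
  proof (intro allI)
    fix i h
    show "\<exists>X\<in>K. \<forall>V\<in>K. a h X \<bullet> V = b (cls (frac_grad s (f i))) \<bullet> V"
      by (rule resolvent_exists[OF a_elliptic[of h] b_elliptic l, of "cls (frac_grad s (f i))"]) blast
  qed
  then obtain X where X: "\<And>i h. X i h \<in> K" "\<And>i h V. V \<in> K \<Longrightarrow> a h (X i h) \<bullet> V = b (cls (frac_grad s (f i))) \<bullet> V" by metis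
  have rX: "resolvent_sequence a b (X i) (cls (frac_grad s (f i)))" for i using X inK by (simp add: resolvent_sequence_def)
  have bX: "norm (a h (X i h)) \<le> L * (L / l * norm (cls (frac_grad s (f i))))" for i h
    using elliptic_upper[OF a_elliptic, of h "X i h"] mult_left_mono[OF resolvent_sequence_bounded[OF rX[of i], of h], of L] L by linarith
  obtain r where r: "strict_mono (r :: nat \<Rightarrow> nat)" "\<And>i. \<exists>y. weakly (\<lambda>h. a (r h) (X i (r h))) y"
    using weakly_compact_family[of "\<lambda>i h. a h (X i h)", OF bX] by blast
  interpret sub: coefficient_sequence s dimension Om l L A0 Ainf "\<lambda>h. A (r h)" by (rule subsequence)
  have sa: "sub.a = (\<lambda>h. a (r h))" by (simp add: sub.a_def a_def fun_eq_iff)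
  have RC': "resolvents_converge sub.a sub.b" unfolding sa by (rule resolvents_converge_subseq[where A=a, OF a_elliptic b_elliptic l RC r(1)])
  have "mul \<eta> (m - sub.b U) = 0"
  proof (rule sub.flux_limit_inside_aux[OF RC' \<eta>])
    fix g assume "g \<in> oscillations \<eta>"
    then obtain i where i: "g = f i" using fr by blast
    obtain y where "weakly (\<lambda>h. a (r h) (X i (r h))) y" using r(2) by blast
    moreover have "resolvent_sequence sub.a sub.b (\<lambda>h. X i (r h)) (cls (frac_grad s g))"
      using rX[of i] unfolding sa i by (simp add: resolvent_sequence_def)
    ultimately show "\<exists>W m. resolvent_sequence sub.a sub.b W (cls (frac_grad s g)) \<and> weakly (\<lambda>h. sub.a h (W h)) m"
      unfolding sa by blast
  next
    have rs: "resolvent_sequence sub.a sub.b (\<lambda>h. W (r h)) U" using W(1) unfolding sa by (simp add: resolvent_sequence_def)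
    moreover have "weakly (\<lambda>h. W (r h)) U" by (rule resolvents_convergeD[OF RC' rs])
    moreover have "weakly (\<lambda>h. sub.a h (W (r h))) m" unfolding sa by (rule weakly_subseq[OF W(2) r(1)])
    ultimately show "sub.flux_limit (\<lambda>h. W (r h)) U m" by (rule sub.flux_limit.resolvent)
  qed
  thus ?thesis .
qed

lemma flux_limit_unique:
  assumes RC: "resolvents_converge a b"
    and W: "resolvent_sequence a b W U" "weakly (\<lambda>h. a h (W h)) m"
  shows "m = b U"
proof -
  obtain d where d: "d \<in> Ltwo" "m - b U = cls d" using cls_cases by metis
  have "AE x in lebesgue. x \<in> Om \<longrightarrow> d x \<bullet> axis j 1 = 0" for j
  proof (rule Cc_inf_orthogonal_imp_zero[OF Ltwo_inner_const[OF d(1)] open_Om])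
    fix \<eta> assume \<eta>: "\<eta> \<in> Cc_inf Om"
    have be: "bounded_multiplier \<eta>" by (rule multiplier_bounded[OF multiplier_Cc_inf[OF \<eta>]])
    have "cls (\<lambda>x. \<eta> x *\<^sub>R d x) = cls (\<lambda>x. 0)"
      using flux_limit_inside[OF RC \<eta> W] unfolding d(2) mul_cls[OF be d(1)] cls_zero .
    hence "AE x in lebesgue. \<eta> x *\<^sub>R d x = 0" using cls_eq_iff[OF bounded_multiplier_Ltwo[OF be d(1)] Ltwo_zero] by blast
    hence "AE x in lebesgue. \<eta> x * (d x \<bullet> axis j 1) = 0" by eventually_elim auto
    thus "(LINT x|lebesgue. \<eta> x * (d x \<bullet> axis j 1)) = 0" by (rule integral_eq_zero_AE)
  qed
  hence inside: "AE x in lebesgue. x \<in> Om \<longrightarrow> d x = 0" by (rule vector_zero_of_components)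
  \<comment> \<open>A discontinuous multiplier suffices outside, because it only has to commute with
    the coefficients and preserve weak limits; there \<open>a h\<close> agrees with the fixed
    operator \<open>b\<close>, which is weakly continuous.\<close>
  define \<theta> :: "real^'n \<Rightarrow> real" where "\<theta> = indicator (- Om)"
  have bc: "bounded_multiplier \<theta>"
    unfolding bounded_multiplier_def \<theta>_def using open_Om by (auto intro!: borel_measurable_indicator exI[of _ 1] simp: indicator_def)
  have w: "weakly (\<lambda>h. mul \<theta> (a h (W h))) (mul \<theta> m)" by (rule weakly_linear_image[OF bounded_linear_mul[OF bc] W(2)])
  have "weakly W U" by (rule resolvents_convergeD[OF RC W(1)])
  hence "weakly (\<lambda>h. mul \<theta> (b (W h))) (mul \<theta> (b U))"
    by (intro weakly_linear_image[OF bounded_linear_mul[OF bc]] weakly_linear_image[OF elliptic_linear[OF b_elliptic]])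
  moreover have "mul \<theta> (a h (W h)) = mul \<theta> (b (W h))" for h by (rule a_b_outside[OF _ bc]) (simp add: \<theta>_def)
  ultimately have "mul \<theta> m = mul \<theta> (b U)" using w weakly_unique by simp
  hence "mul \<theta> (cls d) = cls (\<lambda>x. 0)"
    unfolding d(2)[symmetric] by (simp add: linear_diff[OF bounded_linear.linear[OF bounded_linear_mul[OF bc]]] cls_zero)
  hence "AE x in lebesgue. \<theta> x *\<^sub>R d x = 0"
    unfolding mul_cls[OF bc d(1)] cls_eq_iff[OF bounded_multiplier_Ltwo[OF bc d(1)] Ltwo_zero] .
  with inside have "AE x in lebesgue. d x = 0"
    by eventually_elim (auto simp: \<theta>_def indicator_def split: if_splits)
  hence "cls d = 0" unfolding cls_zero[symmetric] by (intro cls_eqI d Ltwo_zero)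
  thus ?thesis using d(2) by simp
qed

text \<open>The fluxes are bounded, and \<open>flux_limit_unique\<close>, used for the coefficients
  of a subsequence, identifies every weak cluster point with \<open>b U\<close>.\<close>

lemma fluxes_converge:
  assumes RC: "resolvents_converge a b" and W: "resolvent_sequence a b W U"
  shows "weakly (\<lambda>h. a h (W h)) (b U)"
  unfolding weakly_def
proof
  fix g
  show "(\<lambda>h. a h (W h) \<bullet> g) \<longlonglongrightarrow> b U \<bullet> g"
  proof (rule LIMSEQ_by_subsequences)
    fix r :: "nat \<Rightarrow> nat" assume r: "strict_mono r"
    have "norm (a (r h) (W (r h))) \<le> L * (L / l * norm U)" for h
      using elliptic_upper[OF a_elliptic, of "r h" "W (r h)"] mult_left_mono[OF resolvent_sequence_bounded[OF W, of "r h"], of L] L by linarith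
    then obtain q m where q: "strict_mono (q :: nat \<Rightarrow> nat)" "weakly (\<lambda>h. a (r (q h)) (W (r (q h)))) m"
      using weakly_compact[of "\<lambda>h. a (r h) (W (r h))"] by blast
    interpret sub: coefficient_sequence s dimension Om l L A0 Ainf "\<lambda>h. A (r (q h))" by (rule subsequence)
    have sa: "sub.a = (\<lambda>h. a (r (q h)))" by (simp add: sub.a_def a_def fun_eq_iff)
    have "m = sub.b U"
    proof (rule sub.flux_limit_unique)
      show "resolvents_converge sub.a sub.b"
        unfolding sa using resolvents_converge_subseq[where A=a, OF a_elliptic b_elliptic l RC strict_mono_o[OF r q(1)]] by (simp add: o_def)
      show "resolvent_sequence sub.a sub.b (\<lambda>h. W (r (q h))) U" using W unfolding sa by (simp add: resolvent_sequence_def)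
      show "weakly (\<lambda>h. sub.a h (W (r (q h)))) m" unfolding sa by (rule q(2))
    qed
    thus "\<exists>q::nat\<Rightarrow>nat. strict_mono q \<and> (\<lambda>n. a (r (q n)) (W (r (q n))) \<bullet> g) \<longlonglongrightarrow> b U \<bullet> g"
      using q(1) weaklyD[OF q(2), of g] by blast
  qed
qed

end

section \<open>H-convergence and Gamma-convergence\<close>

lemma fdual_Ltwo_inner:
  fixes g :: "('a::euclidean_space, 'b::euclidean_space) L2"
  shows "(\<lambda>u. g \<bullet> cls u) \<in> fdual Ltwo Ltwo_norm"
proof -
  have "\<bar>g \<bullet> cls u\<bar> \<le> norm g * Ltwo_norm u" if "u \<in> Ltwo" for u
    using Cauchy_Schwarz_ineq2[of g "cls u"] norm_cls[OF that] by simp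
  hence "\<exists>C. \<forall>u\<in>Ltwo. \<bar>g \<bullet> cls u\<bar> \<le> C * Ltwo_norm u" by blast
  thus ?thesis unfolding fdual_def by (simp add: cls_add cls_scaleR inner_add_right)
qed

text \<open>Linearity and boundedness make \<open>f\<close> constant on each class, so it descends
  to the quotient, where Riesz applies.\<close>

lemma fdual_Ltwo_representation:
  fixes f :: "('a::euclidean_space \<Rightarrow> 'b::euclidean_space) \<Rightarrow> real"
  assumes "f \<in> fdual Ltwo Ltwo_norm"
  obtains g where "\<And>u. u \<in> Ltwo \<Longrightarrow> f u = g \<bullet> cls u"
proof -
  obtain C where fa: "\<And>u v. u \<in> Ltwo \<Longrightarrow> v \<in> Ltwo \<Longrightarrow> f (\<lambda>x. u x + v x) = f u + f v"
    and fs: "\<And>c u. u \<in> Ltwo \<Longrightarrow> f (\<lambda>x. c *\<^sub>R u x) = c * f u" and fb: "\<And>u. u \<in> Ltwo \<Longrightarrow> \<bar>f u\<bar> \<le> C * Ltwo_norm u"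
    using assms unfolding fdual_def by blast
  have eq: "f u = f v" if "u \<in> Ltwo" "v \<in> Ltwo" "cls u = cls v" for u v
  proof -
    have v: "(\<lambda>x. (-1) *\<^sub>R v x) \<in> Ltwo" by (rule Ltwo_scaleR[OF that(2)])
    have "cls (\<lambda>x. u x + (-1) *\<^sub>R v x) = 0" unfolding cls_add[OF that(1) v] cls_scaleR[OF that(2)] using that(3) by simp
    hence "Ltwo_norm (\<lambda>x. u x + (-1) *\<^sub>R v x) = 0" using norm_cls[OF Ltwo_add[OF that(1) v]] by simp
    thus ?thesis using fb[OF Ltwo_add[OF that(1) v]] fa[OF that(1) v] fs[OF that(2), of "-1"] by simp
  qed
  define F where "F = (\<lambda>X. f (rep_L2 X))"
  have F: "F (cls u) = f u" if "u \<in> Ltwo" for u unfolding F_def by (rule eq[OF rep_L2_Ltwo that cls_rep])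
  have "\<exists>g\<in>UNIV. \<forall>X\<in>UNIV. g \<bullet> X = F X"
  proof (rule riesz_representation)
    fix X Y :: "('a, 'b) L2" and c :: real
    obtain u v where uv: "u \<in> Ltwo" "X = cls u" "v \<in> Ltwo" "Y = cls v" using cls_cases by metis
    show "F (X + Y) = F X + F Y" unfolding uv cls_add[OF uv(1,3), symmetric] using uv by (simp add: F Ltwo_add fa)
    show "F (c *\<^sub>R X) = c * F X" unfolding uv cls_scaleR[OF uv(1), symmetric] using uv by (simp add: F Ltwo_scaleR fs)
    show "\<bar>F X\<bar> \<le> C * norm X" unfolding uv using uv by (simp add: F fb norm_cls)
  qed auto
  then obtain g where "\<And>X. g \<bullet> X = F X" by blast
  hence "f u = g \<bullet> cls u" if "u \<in> Ltwo" for u using F[OF that] by simp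
  thus ?thesis by (rule that)
qed

lemma fweakconv_Ltwo_iff:
  fixes u :: "nat \<Rightarrow> 'a::euclidean_space \<Rightarrow> 'b::euclidean_space"
  shows "fweakconv Ltwo Ltwo_norm u v \<longleftrightarrow> (\<forall>k. u k \<in> Ltwo) \<and> v \<in> Ltwo \<and> weakly (\<lambda>k. cls (u k)) (cls v)"
proof
  assume w: "fweakconv Ltwo Ltwo_norm u v"
  have "(\<lambda>k. g \<bullet> cls (u k)) \<longlonglongrightarrow> g \<bullet> cls v" for g
    using w bspec[OF _ fdual_Ltwo_inner[of g], of "\<lambda>f. (\<lambda>k. f (u k)) \<longlonglongrightarrow> f v"] unfolding fweakconv_def by simp
  thus "(\<forall>k. u k \<in> Ltwo) \<and> v \<in> Ltwo \<and> weakly (\<lambda>k. cls (u k)) (cls v)"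
    using w unfolding fweakconv_def weakly_def by (simp add: inner_commute)
next
  assume w: "(\<forall>k. u k \<in> Ltwo) \<and> v \<in> Ltwo \<and> weakly (\<lambda>k. cls (u k)) (cls v)"
  have "(\<lambda>k. f (u k)) \<longlonglongrightarrow> f v" if f: "f \<in> fdual Ltwo Ltwo_norm" for f
  proof -
    obtain g where "\<And>u. u \<in> Ltwo \<Longrightarrow> f u = g \<bullet> cls u" using fdual_Ltwo_representation[OF f] by blast
    thus ?thesis using w weaklyD'[of "\<lambda>k. cls (u k)" "cls v" g] by simp
  qed
  thus "fweakconv Ltwo Ltwo_norm u v" using w unfolding fweakconv_def by blast
qed

section \<open>Translation of the two notions of convergence\<close>

context coefficient_sequence
begin

definition gr :: "(real ^ 'n \<Rightarrow> real) \<Rightarrow> (real ^ 'n, real ^ 'n) L2" where "gr u = cls (Hs_grad s Om u)"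

lemma Hs0_D:
  assumes "u \<in> Hs0 s Om"
  shows "u \<in> Ltwo" "Hs_grad s Om u \<in> Ltwo" "(cls u, gr u) \<in> grad_graph Om" "gr u \<in> K"
proof -
  have "has_Hs_grad s Om u (Hs_grad s Om u)" using assms unfolding Hs_grad_def Hs0_def by (auto intro: someI_ex[of "has_Hs_grad s Om u"])
  thus "u \<in> Ltwo" "Hs_grad s Om u \<in> Ltwo" and g: "(cls u, gr u) \<in> grad_graph Om" unfolding has_Hs_grad_iff gr_def by auto
  show "gr u \<in> K" using g by (force simp: K_def)
qed

text \<open>Closability makes the choice in \<open>Hs_grad\<close> immaterial: any gradient found in
  the graph is the class of the chosen one.\<close>

lemma Hs0_I:
  assumes "u \<in> Ltwo" "(cls u, U) \<in> grad_graph Om" shows "u \<in> Hs0 s Om" "gr u = U"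
proof -
  obtain f where "f \<in> Ltwo" "U = cls f" using cls_cases by metis
  thus u: "u \<in> Hs0 s Om" using assms unfolding Hs0_def has_Hs_grad_iff by blast
  show "gr u = U" by (rule G_functional[OF Hs0_D(3)[OF u] assms(2)])
qed

lemma Hs0_of_gradient: assumes "U \<in> K" obtains u where "u \<in> Hs0 s Om" "gr u = U"
proof -
  obtain x where x: "(x, U) \<in> grad_graph Om" using assms by (force simp: K_def)
  obtain u where "u \<in> Ltwo" "x = cls u" using cls_cases by metis
  thus ?thesis using Hs0_I that x by blast
qed

lemma gr_add:
  assumes "u \<in> Hs0 s Om" "v \<in> Hs0 s Om"
  shows "(\<lambda>x. u x + v x) \<in> Hs0 s Om" "gr (\<lambda>x. u x + v x) = gr u + gr v"
proof -
  have 1: "(\<lambda>x. u x + v x) \<in> Ltwo" using assms by (intro Ltwo_add Hs0_D)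
  have 2: "(cls (\<lambda>x. u x + v x), gr u + gr v) \<in> grad_graph Om"
    using subspace_add[OF subspace_grad_graph Hs0_D(3)[OF assms(1)] Hs0_D(3)[OF assms(2)]] assms
    by (simp add: cls_add Hs0_D(1))
  show "(\<lambda>x. u x + v x) \<in> Hs0 s Om" "gr (\<lambda>x. u x + v x) = gr u + gr v" by (rule Hs0_I[OF 1 2])+
qed

lemma gr_scaleR:
  assumes "u \<in> Hs0 s Om"
  shows "(\<lambda>x. c *\<^sub>R u x) \<in> Hs0 s Om" "gr (\<lambda>x. c *\<^sub>R u x) = c *\<^sub>R gr u"
proof -
  have 1: "(\<lambda>x. c *\<^sub>R u x) \<in> Ltwo" using assms by (intro Ltwo_scaleR Hs0_D)
  have 2: "(cls (\<lambda>x. c *\<^sub>R u x), c *\<^sub>R gr u) \<in> grad_graph Om"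
    using subspace_scale[OF subspace_grad_graph Hs0_D(3)[OF assms], of c] unfolding cls_scaleR[OF Hs0_D(1)[OF assms]] by simp
  show "(\<lambda>x. c *\<^sub>R u x) \<in> Hs0 s Om" "gr (\<lambda>x. c *\<^sub>R u x) = c *\<^sub>R gr u" by (rule Hs0_I[OF 1 2])+
qed

text \<open>By Poincare the norm is equivalent to that of the gradient, so functionals and weak
  convergence on \<open>Hs0\<close> can be read off in \<open>K\<close>.\<close>

lemma Hs_norm_bounds:
  assumes u: "u \<in> Hs0 s Om"
  shows "norm (gr u) \<le> Hs_norm s Om u" "Hs_norm s Om u \<le> (\<bar>poincare_const Om\<bar> + 1) * norm (gr u)"
proof -
  have n: "Hs_norm s Om u = sqrt ((norm (cls u))\<^sup>2 + (norm (gr u))\<^sup>2)"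
    unfolding Hs_norm_def gr_def by (simp add: norm_cls Hs0_D[OF u])
  show "norm (gr u) \<le> Hs_norm s Om u" unfolding n by (rule real_le_rsqrt) simp
  have "Hs_norm s Om u \<le> norm (cls u) + norm (gr u)" unfolding n by (rule sqrt_sum_squares_le_sum) auto
  also have "norm (cls u) \<le> \<bar>poincare_const Om\<bar> * norm (gr u)"
    using poincare[OF Hs0_D(3)[OF u]] mult_right_mono[OF abs_ge_self norm_ge_zero, of "poincare_const Om" "gr u"] by linarith
  finally show "Hs_norm s Om u \<le> (\<bar>poincare_const Om\<bar> + 1) * norm (gr u)" by (simp add: algebra_simps)
qed

lemma Hs_dual_inner: "(\<lambda>u. g \<bullet> gr u) \<in> Hs_dual s Om"
proof -
  have "\<bar>g \<bullet> gr u\<bar> \<le> norm g * Hs_norm s Om u" if "u \<in> Hs0 s Om" for u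
    using Cauchy_Schwarz_ineq2[of g "gr u"] mult_left_mono[OF Hs_norm_bounds(1)[OF that] norm_ge_zero[of g]] by linarith
  hence "\<exists>C. \<forall>u\<in>Hs0 s Om. \<bar>g \<bullet> gr u\<bar> \<le> C * Hs_norm s Om u" by blast
  thus ?thesis unfolding fdual_def using gr_add gr_scaleR by (simp add: inner_add_right)
qed

text \<open>The equivalence of norms makes \<open>f\<close> depend on \<open>gr u\<close> alone, so
  it factors through \<open>K\<close>, where Riesz applies.\<close>

lemma Hs_dual_representation:
  assumes "f \<in> Hs_dual s Om"
  obtains g where "g \<in> K" "\<And>u. u \<in> Hs0 s Om \<Longrightarrow> f u = g \<bullet> gr u"
proof -
  obtain C where fa: "\<And>u v. u \<in> Hs0 s Om \<Longrightarrow> v \<in> Hs0 s Om \<Longrightarrow> f (\<lambda>x. u x + v x) = f u + f v"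
    and fs: "\<And>c u. u \<in> Hs0 s Om \<Longrightarrow> f (\<lambda>x. c *\<^sub>R u x) = c * f u" and fb: "\<And>u. u \<in> Hs0 s Om \<Longrightarrow> \<bar>f u\<bar> \<le> C * Hs_norm s Om u"
    using assms unfolding fdual_def by blast
  define P where "P = \<bar>poincare_const Om\<bar> + 1"
  have fb': "\<bar>f u\<bar> \<le> \<bar>C\<bar> * P * norm (gr u)" if "u \<in> Hs0 s Om" for u
  proof -
    have "C * Hs_norm s Om u \<le> \<bar>C\<bar> * (P * norm (gr u))"
      using Hs_norm_bounds[OF that] order_trans[OF norm_ge_zero Hs_norm_bounds(1)[OF that]] unfolding P_def by (intro mult_mono) auto
    thus ?thesis using fb[OF that] by (simp add: mult.assoc)
  qed
  have eq: "f u = f v" if uv: "u \<in> Hs0 s Om" "v \<in> Hs0 s Om" "gr u = gr v" for u v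
  proof -
    note v = gr_scaleR[OF uv(2), of "-1"]
    show ?thesis using fb'[OF gr_add(1)[OF uv(1) v(1)]] fa[OF uv(1) v(1)] fs[OF uv(2), of "-1"]
      unfolding gr_add(2)[OF uv(1) v(1)] v(2) using uv(3) by simp
  qed
  define F where "F = (\<lambda>U. f (SOME u. u \<in> Hs0 s Om \<and> gr u = U))"
  have F: "F (gr u) = f u" if "u \<in> Hs0 s Om" for u
  proof -
    have "(SOME v. v \<in> Hs0 s Om \<and> gr v = gr u) \<in> Hs0 s Om \<and> gr (SOME v. v \<in> Hs0 s Om \<and> gr v = gr u) = gr u"
      by (rule someI[of "\<lambda>v. v \<in> Hs0 s Om \<and> gr v = gr u" u]) (use that in simp)
    thus ?thesis unfolding F_def using eq that by blast
  qed
  have "\<exists>g\<in>K. \<forall>U\<in>K. g \<bullet> U = F U"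
  proof (rule riesz_representation[OF subspace_K closed_K])
    show "F (U + V) = F U + F V" if UV: "U \<in> K" "V \<in> K" for U V
    proof -
      obtain u v where u: "u \<in> Hs0 s Om" "gr u = U" and v: "v \<in> Hs0 s Om" "gr v = V" using Hs0_of_gradient UV by metis
      show ?thesis using F[OF gr_add(1)[OF u(1) v(1)]] F[OF u(1)] F[OF v(1)] fa[OF u(1) v(1)] by (simp add: gr_add(2)[OF u(1) v(1)] u v)
    qed
    show "F (c *\<^sub>R U) = c * F U" if "U \<in> K" for c U
    proof -
      obtain u where u: "u \<in> Hs0 s Om" "gr u = U" using Hs0_of_gradient \<open>U \<in> K\<close> by metis
      show ?thesis using F[OF gr_scaleR(1)[OF u(1), of c]] F[OF u(1)] fs[OF u(1), of c] unfolding gr_scaleR(2)[OF u(1)] u(2) by simp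
    qed
    show "\<bar>F U\<bar> \<le> \<bar>C\<bar> * P * norm U" if "U \<in> K" for U
    proof -
      obtain u where u: "u \<in> Hs0 s Om" "gr u = U" using Hs0_of_gradient \<open>U \<in> K\<close> by metis
      show ?thesis using F[OF u(1)] fb'[OF u(1)] by (simp add: u)
    qed
  qed
  then obtain g where "g \<in> K" "\<And>U. U \<in> K \<Longrightarrow> g \<bullet> U = F U" by blast
  thus ?thesis using that[of g] F Hs0_D(4) by simp
qed

lemma fweakconv_Hs0_iff:
  "fweakconv (Hs0 s Om) (Hs_norm s Om) u v \<longleftrightarrow> (\<forall>k. u k \<in> Hs0 s Om) \<and> v \<in> Hs0 s Om \<and> weakly (\<lambda>k. gr (u k)) (gr v)"
proof
  assume w: "fweakconv (Hs0 s Om) (Hs_norm s Om) u v"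
  have "(\<lambda>k. g \<bullet> gr (u k)) \<longlonglongrightarrow> g \<bullet> gr v" for g
    using w bspec[OF _ Hs_dual_inner[of g], of "\<lambda>f. (\<lambda>k. f (u k)) \<longlonglongrightarrow> f v"] unfolding fweakconv_def by simp
  thus "(\<forall>k. u k \<in> Hs0 s Om) \<and> v \<in> Hs0 s Om \<and> weakly (\<lambda>k. gr (u k)) (gr v)"
    using w unfolding fweakconv_def weakly_def by (simp add: inner_commute)
next
  assume w: "(\<forall>k. u k \<in> Hs0 s Om) \<and> v \<in> Hs0 s Om \<and> weakly (\<lambda>k. gr (u k)) (gr v)"
  have "(\<lambda>k. f (u k)) \<longlonglongrightarrow> f v" if f: "f \<in> Hs_dual s Om" for f
  proof -
    obtain g where "\<And>u. u \<in> Hs0 s Om \<Longrightarrow> f u = g \<bullet> gr u" using Hs_dual_representation[OF f] by blast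
    thus ?thesis using w weaklyD'[of "\<lambda>k. gr (u k)" "gr v" g] by simp
  qed
  thus "fweakconv (Hs0 s Om) (Hs_norm s Om) u v" using w unfolding fweakconv_def by blast
qed

lemma coefficient_gr:
  assumes B: "B \<in> Mclass l L UNIV" and u: "u \<in> Hs0 s Om"
  shows "(\<lambda>x. B x *v Hs_grad s Om u x) \<in> Ltwo" "cls (\<lambda>x. B x *v Hs_grad s Om u x) = matop B (gr u)"
    "v \<in> Hs0 s Om \<Longrightarrow> (LINT x|lebesgue. (B x *v Hs_grad s Om u x) \<bullet> Hs_grad s Om v x) = matop B (gr u) \<bullet> gr v"
proof -
  show m: "(\<lambda>x. B x *v Hs_grad s Om u x) \<in> Ltwo" by (rule matop_Ltwo[OF B L Hs0_D(2)[OF u]])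
  show c: "cls (\<lambda>x. B x *v Hs_grad s Om u x) = matop B (gr u)" unfolding gr_def by (rule matop_cls[OF B L Hs0_D(2)[OF u], symmetric])
  show "(LINT x|lebesgue. (B x *v Hs_grad s Om u x) \<bullet> Hs_grad s Om v x) = matop B (gr u) \<bullet> gr v" if v: "v \<in> Hs0 s Om"
    unfolding c[symmetric] gr_def[of v] by (rule inner_cls[OF m Hs0_D(2)[OF v], symmetric])
qed

lemma weak_solution_iff:
  assumes B: "B \<in> Mclass l L UNIV" and f: "\<And>u. u \<in> Hs0 s Om \<Longrightarrow> f u = g \<bullet> gr u"
  shows "weak_solution s Om B f u \<longleftrightarrow> u \<in> Hs0 s Om \<and> (\<forall>V\<in>K. matop B (gr u) \<bullet> V = g \<bullet> V)"
proof -
  have "(\<forall>v\<in>Hs0 s Om. matop B (gr u) \<bullet> gr v = g \<bullet> gr v) \<longleftrightarrow> (\<forall>V\<in>K. matop B (gr u) \<bullet> V = g \<bullet> V)"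
    using Hs0_D(4) Hs0_of_gradient by metis
  thus ?thesis unfolding weak_solution_def using coefficient_gr(3)[OF B] f by (metis (no_types, lifting))
qed

text \<open>From left to right the convergence of the solutions is taken for the functional
  \<open>b U\<close>. Conversely, a functional given by \<open>g\<close> satisfies
  \<open>g \<bullet> V = b (gr u) \<bullet> V\<close> on \<open>K\<close> for the limit solution
  \<open>u\<close>, so the solutions form a resolvent sequence, and \<open>fluxes_converge\<close>
  adds the fluxes.\<close>

lemma H_converges_iff: "H_converges s Om A Ainf \<longleftrightarrow> resolvents_converge a b"
proof
  assume H: "H_converges s Om A Ainf"
  show "resolvents_converge a b"
    unfolding resolvents_converge_def
  proof (intro ballI allI impI)
    fix U W assume U: "U \<in> K" and W: "\<forall>h. W h \<in> K \<and> (\<forall>V\<in>K. a h (W h) \<bullet> V = b U \<bullet> V)"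
    obtain u where u: "u \<in> Hs0 s Om" "gr u = U" using Hs0_of_gradient[OF U] by blast
    have "\<forall>h. \<exists>w. w \<in> Hs0 s Om \<and> gr w = W h" using W Hs0_of_gradient by metis
    then obtain w where w: "\<And>h. w h \<in> Hs0 s Om" "\<And>h. gr (w h) = W h" by metis
    define f where "f = (\<lambda>u. b U \<bullet> gr u)"
    have "weak_solution s Om (A h) f (w h)" for h
      using weak_solution_iff[OF A_Mclass(1)[of h], of f "b U" "w h"] W w by (simp add: f_def a_def)
    moreover have "weak_solution s Om Ainf f u"
      using weak_solution_iff[OF A_Mclass(2), of f "b U" u] u by (simp add: f_def b_def)
    moreover have "f \<in> Hs_dual s Om" unfolding f_def by (rule Hs_dual_inner)
    ultimately have "fweakconv (Hs0 s Om) (Hs_norm s Om) w u" using H unfolding H_converges_def by blast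
    thus "weakly W U" unfolding fweakconv_Hs0_iff using w u by simp
  qed
next
  assume RC: "resolvents_converge a b"
  show "H_converges s Om A Ainf"
    unfolding H_converges_def
  proof (intro ballI allI impI, elim conjE)
    fix f w u assume f: "f \<in> Hs_dual s Om" and w: "\<forall>h. weak_solution s Om (A h) f (w h)" and u: "weak_solution s Om Ainf f u"
    obtain g where g: "g \<in> K" "\<And>u. u \<in> Hs0 s Om \<Longrightarrow> f u = g \<bullet> gr u" using Hs_dual_representation[OF f] by blast
    have w': "w h \<in> Hs0 s Om" "\<And>V. V \<in> K \<Longrightarrow> a h (gr (w h)) \<bullet> V = g \<bullet> V" for h
      using w weak_solution_iff[OF A_Mclass(1)[of h] g(2), of "w h"] by (auto simp: a_def)
    have u': "u \<in> Hs0 s Om" "\<And>V. V \<in> K \<Longrightarrow> b (gr u) \<bullet> V = g \<bullet> V"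
      using u weak_solution_iff[OF A_Mclass(2) g(2), of u] by (auto simp: b_def)
    have rs: "resolvent_sequence a b (\<lambda>h. gr (w h)) (gr u)"
      unfolding resolvent_sequence_def using w' u' Hs0_D(4) by simp
    have "fweakconv (Hs0 s Om) (Hs_norm s Om) w u"
      unfolding fweakconv_Hs0_iff using w' u' resolvents_convergeD[OF RC rs] by blast
    moreover have "fweakconv Ltwo Ltwo_norm (\<lambda>h x. A h x *v Hs_grad s Om (w h) x) (\<lambda>x. Ainf x *v Hs_grad s Om u x)"
      unfolding fweakconv_Ltwo_iff coefficient_gr(2)[OF A_Mclass(1) w'(1)] coefficient_gr(2)[OF A_Mclass(2) u'(1)]
      using fluxes_converge[OF RC rs] coefficient_gr(1)[OF A_Mclass(1) w'(1)] coefficient_gr(1)[OF A_Mclass(2) u'(1)]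
      by (simp add: a_def b_def)
    ultimately show "fweakconv (Hs0 s Om) (Hs_norm s Om) w u \<and>
        fweakconv Ltwo Ltwo_norm (\<lambda>h x. A h x *v Hs_grad s Om (w h) x) (\<lambda>x. Ainf x *v Hs_grad s Om u x)" by blast
  qed
qed

lemma energy_eq:
  assumes B: "B \<in> Mclass l L UNIV" and u: "u \<in> Ltwo"
  shows "energy s Om B u = energy_on (matop B) (cls u)"
proof (cases "u \<in> Hs0 s Om")
  case True
  thus ?thesis by (simp add: energy_def coefficient_gr(3)[OF B True True] energy_on_G[OF Hs0_D(3)[OF True]])
next
  case False
  hence "\<not> (\<exists>U. (cls u, U) \<in> grad_graph Om)" using Hs0_I(1)[OF u] by blast
  thus ?thesis using False by (simp add: energy_def energy_on_def)
qed

lemma Gamma_converges_iff: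
  "Gamma_converges Ltwo Ltwo_norm (\<lambda>h. energy s Om (A h)) (energy s Om Ainf) \<longleftrightarrow> energies_Gamma_converge a b"
proof -
  have e: "energy s Om (A h) u = energy_on (a h) (cls u)" "energy s Om Ainf u = energy_on b (cls u)" if "u \<in> Ltwo" for h u
    unfolding a_def b_def by (intro energy_eq A_Mclass that)+
  show ?thesis
  proof
    assume Gm: "Gamma_converges Ltwo Ltwo_norm (\<lambda>h. energy s Om (A h)) (energy s Om Ainf)"
    show "energies_Gamma_converge a b"
      unfolding energies_Gamma_converge_def
    proof (intro conjI allI impI)
      fix x :: "(real ^ 'n, real) L2" and w assume w: "w \<longlonglongrightarrow> x"
      have "fconv Ltwo Ltwo_norm (\<lambda>h. rep_L2 (w h)) (rep_L2 x)" unfolding fconv_Ltwo_iff using w by (simp add: rep_L2_Ltwo cls_rep)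
      hence "energy s Om Ainf (rep_L2 x) \<le> liminf (\<lambda>h. energy s Om (A h) (rep_L2 (w h)))"
        using Gm rep_L2_Ltwo[of x] unfolding Gamma_converges_def by blast
      thus "energy_on b x \<le> liminf (\<lambda>h. energy_on (a h) (w h))" by (simp add: e rep_L2_Ltwo cls_rep)
    next
      fix x :: "(real ^ 'n, real) L2"
      obtain w where w: "fconv Ltwo Ltwo_norm w (rep_L2 x)" "limsup (\<lambda>h. energy s Om (A h) (w h)) \<le> energy s Om Ainf (rep_L2 x)"
        using Gm rep_L2_Ltwo[of x] unfolding Gamma_converges_def by blast
      have w': "w h \<in> Ltwo" for h using w(1) by (simp add: fconv_Ltwo_iff)
      have "(\<lambda>h. cls (w h)) \<longlonglongrightarrow> x" using w(1) by (simp add: fconv_Ltwo_iff cls_rep)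
      moreover have "limsup (\<lambda>h. energy_on (a h) (cls (w h))) \<le> energy_on b x" using w(2) by (simp add: e w' rep_L2_Ltwo cls_rep)
      ultimately show "\<exists>w. w \<longlonglongrightarrow> x \<and> limsup (\<lambda>h. energy_on (a h) (w h)) \<le> energy_on b x" by blast
    qed
  next
    assume Gm: "energies_Gamma_converge a b"
    show "Gamma_converges Ltwo Ltwo_norm (\<lambda>h. energy s Om (A h)) (energy s Om Ainf)"
      unfolding Gamma_converges_def
    proof (intro conjI ballI allI impI)
      fix u :: "real ^ 'n \<Rightarrow> real" and w assume u: "u \<in> Ltwo" and w: "fconv Ltwo Ltwo_norm w u"
      have w': "w h \<in> Ltwo" for h using w by (simp add: fconv_Ltwo_iff)
      have "(\<lambda>h. cls (w h)) \<longlonglongrightarrow> cls u" using w by (simp add: fconv_Ltwo_iff)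
      hence "energy_on b (cls u) \<le> liminf (\<lambda>h. energy_on (a h) (cls (w h)))" using Gm unfolding energies_Gamma_converge_def by blast
      thus "energy s Om Ainf u \<le> liminf (\<lambda>h. energy s Om (A h) (w h))" by (simp add: e u w')
    next
      fix u :: "real ^ 'n \<Rightarrow> real" assume u: "u \<in> Ltwo"
      obtain w where w: "w \<longlonglongrightarrow> cls u" "limsup (\<lambda>h. energy_on (a h) (w h)) \<le> energy_on b (cls u)"
        using Gm unfolding energies_Gamma_converge_def by blast
      have "fconv Ltwo Ltwo_norm (\<lambda>h. rep_L2 (w h)) u" unfolding fconv_Ltwo_iff using w u by (simp add: rep_L2_Ltwo cls_rep)
      moreover have "limsup (\<lambda>h. energy s Om (A h) (rep_L2 (w h))) \<le> energy s Om Ainf u" using w(2) by (simp add: e u rep_L2_Ltwo cls_rep)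
      ultimately show "\<exists>w. fconv Ltwo Ltwo_norm w u \<and> limsup (\<lambda>h. energy s Om (A h) (w h)) \<le> energy s Om Ainf u" by blast
    qed
  qed
qed

theorem H_converges_iff_Gamma_converges:
  "H_converges s Om A Ainf \<longleftrightarrow> Gamma_converges Ltwo Ltwo_norm (\<lambda>h. energy s Om (A h)) (energy s Om Ainf)"
  unfolding H_converges_iff Gamma_converges_iff Gamma_iff_resolvents[OF l a_elliptic b_elliptic] ..

end

theorem theorem5p1:
  fixes s l L :: real
    and \<Omega> :: "(real ^ 'n) set"
    and A0 Ainf :: "real ^ 'n \<Rightarrow> real ^ 'n ^ 'n"
    and A :: "nat \<Rightarrow> real ^ 'n \<Rightarrow> real ^ 'n ^ 'n"
  assumes "CARD('n) \<ge> 2"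
    and "0 < s" "s < 1"
    and "0 < l" "l \<le> L"
    and "bounded \<Omega>" "open \<Omega>"
    and "A0 \<in> Msym l L UNIV"
    and "\<And>h. A h \<in> Msym_ext l L \<Omega> A0"
    and "Ainf \<in> Msym_ext l L \<Omega> A0"
  shows "H_converges s \<Omega> A Ainf \<longleftrightarrow>
    Gamma_converges Ltwo Ltwo_norm (\<lambda>h. energy s \<Omega> (A h)) (energy s \<Omega> Ainf)"
proof -
  interpret coefficient_sequence s "TYPE('n)" \<Omega> l L A0 Ainf A
    by unfold_locales (use assms in auto)
  show ?thesis by (rule H_converges_iff_Gamma_converges)
qed

end
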